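(* Let $P$ be a submonoid of a group $G$ and let $\rho$ be a representation of $\mathcal T_u(P)$ in a $\mathrm C^*$-algebra $B$. Let $\alpha\in\mathcal W$ be a neutral word and let $A\subset\mathcal W$ be a finite (possibly empty) collection of neutral words such that $K(\beta)\subset K(\alpha)$ for all $\beta\in A$. If $\{K(\beta):\beta\in A\}$ is not a foundation set for $K(\alpha)$ and $$\rho\Big(\prod_{\beta\in A}(\dot t_\alpha-\dot t_\beta)\Big)=0,$$ then $\rho\equiv0$. As a consequence, the restriction of $q_u\colon\mathcal T_u(P)\to\mathbb C\times_{\mathbb C^P}P$ to $D_u$ induces an embedding of $D_u/D_u^{\mathrm o}$ in $\mathbb C\times_{\mathbb C^P}P$, and a $*$-homomorphism $\hat\rho\colon\mathbb C\times_{\mathbb C^P}P\to B$ is faithful on $D_u/D_u^{\mathrm o}$ if and only if $\hat\rho\neq0$.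
   Context: $e$ is the identity of $G$. A representation is a $*$-homomorphism. A word is a finite sequence $\alpha=(p_1,p_2,\ldots,p_{2k-1},p_{2k})$ of even length $2k\ge 0$ with entries in $P$; $\mathcal W$ is the set of all words (including the empty word). Put $\dot\alpha:=p_1^{-1}p_2\cdots p_{2k-1}^{-1}p_{2k}\in G$ (equal to $e$ for the empty word); $\alpha$ is neutral if $\dot\alpha=e$. Put $K(\alpha):=P\cap p_{2k}^{-1}p_{2k-1}P\cap p_{2k}^{-1}p_{2k-1}p_{2k-2}^{-1}p_{2k-3}P\cap\cdots\cap p_{2k}^{-1}p_{2k-1}\cdots p_2^{-1}p_1P$ (equal to $P$ for the empty word), and $\mathfrak J:=\{K(\alpha):\alpha\in\mathcal W\}$, the constructible right ideals. For a map $w\colon P\to B$ into a unital $\mathrm C^*$-algebra, $\dot w_\alpha:=w_{p_1}^*w_{p_2}\cdots w_{p_{2k-1}}^*w_{p_{2k}}$ ($=1$ for the empty word). $\mathcal T_u(P)$ is the universal $\mathrm C^*$-algebra with generators $\{t_p:p\in P\}$ subject to: (T1) $t_e=1$; (T2) $\dot t_\alpha=0$ if $\alpha$ is neutral and $K(\alpha)=\emptyset$; (T3) $\dot t_\alpha=\dot t_\beta$ if $\alpha,\beta$ are neutral and $K(\alpha)=K(\beta)$; (T4) $\prod_{\beta\in F}(\dot t_\alpha-\dot t_\beta)=0$ if $\alpha$ is neutral and $F$ is a finite set of neutral words with $K(\alpha)=\bigcup_{\beta\in F}K(\beta)$. An empty product $\prod_{\beta\in\emptyset}(\dot t_\alpha-\dot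 t_\beta)$ is interpreted as $\dot t_\alpha$. $D_u:=\overline{\mathrm{span}}\{\dot t_\alpha:\dot\alpha=e\}$. For $S\in\mathfrak J$, a finite collection $\mathcal C\subset\mathfrak J$ is a foundation set for $S$ if $R\subset S$ for all $R\in\mathcal C$ and $pP\cap\bigcup_{R\in\mathcal C}R\neq\emptyset$ for all $p\in S$. $L_p\delta_q=\delta_{pq}$ is the left regular representation on $\ell^2(P)$; for neutral $\alpha$, $\dot L_\alpha$ is multiplication by $\mathbb 1_{K(\alpha)}$; $D_r:=\overline{\mathrm{span}}\{\mathbb 1_S:S\in\mathfrak J\}$. The map $\lambda^+\colon\mathcal T_u(P)\to\mathrm C^*(L_p:p\in P)$, $t_p\mapsto L_p$, restricts to an isomorphism $D_u\cong D_r$. For finite $F\subseteq G$, $\Delta_F:=\{p\in P:\forall g\in F,\ pP\cap gP=\emptyset\text{ or }pP\cap gP=pP\}$; $D_r^{\mathrm o}:=\{b\in D_r:\lim_F\|b|_{\ell^2(\Delta_F)}\|=0\}$ (limit over finite $F\subseteq G$ directed by inclusion), an ideal of $D_r$; $D_u^{\mathrm o}\subseteq D_u$ is the ideal corresponding to $D_r^{\mathrm o}$ under $\lambda^+|_{D_u}$. An isometric representation $w\colon P\to B$ is strongly covariant if $\dot L_\alpha\mapsto\dot w_\alpha$ ($\alpha$ neutral) extends to a well-defined $*$-homomorphism $D_r\to B$ that factors through $D_r/D_r^{\mathrm o}$; the covariance algebra $\mathbb C\times_{\mathbb C^P}P$ is the universal $\mathrm C^*$-algebra for strongly covariant isometric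 representations, with canonical generators $j_p$, and $q_u\colon\mathcal T_u(P)\to\mathbb C\times_{\mathbb C^P}P$ is the canonical surjective $*$-homomorphism with $q_u(t_p)=j_p$ (it vanishes on $D_u^{\mathrm o}$). "Faithful on $D_u/D_u^{\mathrm o}$" refers to the image $q_u(D_u)$ of this embedding. *)

theory Defs
  imports "HOL-Analysis.Analysis" "HOL-Algebra.QuotRing" "HOL-Algebra.Module"
begin

section \<open>C*-algebras\<close>

record 'a cstar_struct = "(complex, 'a) module" +
  adj :: "'a \<Rightarrow> 'a"
  nrm :: "'a \<Rightarrow> real"

text \<open>C*-algebras need not be unital: the field \<^const>\<open>one\<close> is constrained only in
  the unital case. The zero algebra is allowed.\<close>

locale cstar_algebra = abelian_group A for A :: "('a, 'm) cstar_struct_scheme" (structure) +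
  assumes smult_closed: "x \<in> carrier A \<Longrightarrow> c \<odot> x \<in> carrier A"
    and smult_l_distr: "x \<in> carrier A \<Longrightarrow> (c + d) \<odot> x = c \<odot> x \<oplus> d \<odot> x"
    and smult_r_distr: "\<lbrakk>x \<in> carrier A; y \<in> carrier A\<rbrakk> \<Longrightarrow> c \<odot> (x \<oplus> y) = c \<odot> x \<oplus> c \<odot> y"
    and smult_assoc: "x \<in> carrier A \<Longrightarrow> (c * d) \<odot> x = c \<odot> (d \<odot> x)"
    and smult_one: "x \<in> carrier A \<Longrightarrow> 1 \<odot> x = x"
    and mult_closed: "\<lbrakk>x \<in> carrier A; y \<in> carrier A\<rbrakk> \<Longrightarrow> x \<otimes> y \<in> carrier A"
    and mult_assoc: "\<lbrakk>x \<in> carrier A; y \<in> carrier A; z \<in> carrier A\<rbrakk> \<Longrightarrow>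
      (x \<otimes> y) \<otimes> z = x \<otimes> (y \<otimes> z)"
    and l_distr: "\<lbrakk>x \<in> carrier A; y \<in> carrier A; z \<in> carrier A\<rbrakk> \<Longrightarrow>
      (x \<oplus> y) \<otimes> z = x \<otimes> z \<oplus> y \<otimes> z"
    and r_distr: "\<lbrakk>x \<in> carrier A; y \<in> carrier A; z \<in> carrier A\<rbrakk> \<Longrightarrow>
      z \<otimes> (x \<oplus> y) = z \<otimes> x \<oplus> z \<otimes> y"
    and smult_mult_l: "\<lbrakk>x \<in> carrier A; y \<in> carrier A\<rbrakk> \<Longrightarrow> (c \<odot> x) \<otimes> y = c \<odot> (x \<otimes> y)"
    and smult_mult_r: "\<lbrakk>x \<in> carrier A; y \<in> carrier A\<rbrakk> \<Longrightarrow> x \<otimes> (c \<odot> y) = c \<odot> (x \<otimes> y)"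
    and adj_closed: "x \<in> carrier A \<Longrightarrow> adj A x \<in> carrier A"
    and adj_adj: "x \<in> carrier A \<Longrightarrow> adj A (adj A x) = x"
    and adj_add: "\<lbrakk>x \<in> carrier A; y \<in> carrier A\<rbrakk> \<Longrightarrow> adj A (x \<oplus> y) = adj A x \<oplus> adj A y"
    and adj_smult: "x \<in> carrier A \<Longrightarrow> adj A (c \<odot> x) = cnj c \<odot> adj A x"
    and adj_mult: "\<lbrakk>x \<in> carrier A; y \<in> carrier A\<rbrakk> \<Longrightarrow> adj A (x \<otimes> y) = adj A y \<otimes> adj A x"
    and nrm_nonneg: "x \<in> carrier A \<Longrightarrow> 0 \<le> nrm A x"
    and nrm_eq_0: "x \<in> carrier A \<Longrightarrow> nrm A x = 0 \<longleftrightarrow> x = \<zero>"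
    and nrm_triangle: "\<lbrakk>x \<in> carrier A; y \<in> carrier A\<rbrakk> \<Longrightarrow> nrm A (x \<oplus> y) \<le> nrm A x + nrm A y"
    and nrm_smult: "x \<in> carrier A \<Longrightarrow> nrm A (c \<odot> x) = cmod c * nrm A x"
    and nrm_mult: "\<lbrakk>x \<in> carrier A; y \<in> carrier A\<rbrakk> \<Longrightarrow> nrm A (x \<otimes> y) \<le> nrm A x * nrm A y"
    and cstar_identity: "x \<in> carrier A \<Longrightarrow> nrm A (adj A x \<otimes> x) = (nrm A x)\<^sup>2"
    and complete: "\<lbrakk>\<And>n. X n \<in> carrier A;
        \<And>e. e > 0 \<Longrightarrow> \<exists>N. \<forall>m\<ge>N. \<forall>n\<ge>N. nrm A (X m \<ominus> X n) < e\<rbrakk> \<Longrightarrow>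
      \<exists>x\<in>carrier A. (\<lambda>n::nat. nrm A (X n \<ominus> x)) \<longlonglongrightarrow> 0"

locale unital_cstar_algebra = cstar_algebra +
  assumes one_closed: "\<one> \<in> carrier A"
    and l_one: "x \<in> carrier A \<Longrightarrow> \<one> \<otimes> x = x"
    and r_one: "x \<in> carrier A \<Longrightarrow> x \<otimes> \<one> = x"

text \<open>Units are not required to be preserved.\<close>

definition star_hom ::
  "('a, 'm) cstar_struct_scheme \<Rightarrow> ('b, 'n) cstar_struct_scheme \<Rightarrow> ('a \<Rightarrow> 'b) \<Rightarrow> bool" where
  "star_hom A B h \<longleftrightarrow>
     h \<in> carrier A \<rightarrow> carrier B \<and>
     (\<forall>x\<in>carrier A. \<forall>y\<in>carrier A. h (x \<oplus>\<^bsub>A\<^esub> y) = h x \<oplus>\<^bsub>B\<^esub> h y) \<and>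
     (\<forall>c. \<forall>x\<in>carrier A. h (c \<odot>\<^bsub>A\<^esub> x) = c \<odot>\<^bsub>B\<^esub> h x) \<and>
     (\<forall>x\<in>carrier A. \<forall>y\<in>carrier A. h (x \<otimes>\<^bsub>A\<^esub> y) = h x \<otimes>\<^bsub>B\<^esub> h y) \<and>
     (\<forall>x\<in>carrier A. h (adj A x) = adj B (h x))"

definition closed_subspace :: "('a, 'm) cstar_struct_scheme \<Rightarrow> 'a set \<Rightarrow> bool" where
  "closed_subspace A S \<longleftrightarrow>
     S \<subseteq> carrier A \<and> \<zero>\<^bsub>A\<^esub> \<in> S \<and>
     (\<forall>x\<in>S. \<forall>y\<in>S. x \<oplus>\<^bsub>A\<^esub> y \<in> S) \<and>
     (\<forall>c. \<forall>x\<in>S. c \<odot>\<^bsub>A\<^esub> x \<in> S) \<and>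
     (\<forall>X. \<forall>x\<in>carrier A. (\<forall>n. X n \<in> S) \<longrightarrow> (\<lambda>n::nat. nrm A (X n \<ominus>\<^bsub>A\<^esub> x)) \<longlonglongrightarrow> 0 \<longrightarrow> x \<in> S)"

definition closed_span :: "('a, 'm) cstar_struct_scheme \<Rightarrow> 'a set \<Rightarrow> 'a set" where
  "closed_span A X = \<Inter>{S. closed_subspace A S \<and> X \<subseteq> S}"

definition cstar_subalgebra :: "('a, 'm) cstar_struct_scheme \<Rightarrow> 'a set \<Rightarrow> bool" where
  "cstar_subalgebra A S \<longleftrightarrow>
     closed_subspace A S \<and> (\<forall>x\<in>S. \<forall>y\<in>S. x \<otimes>\<^bsub>A\<^esub> y \<in> S) \<and> (\<forall>x\<in>S. adj A x \<in> S)"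

definition cstar_generated ::
  "('a, 'm) cstar_struct_scheme \<Rightarrow> 'a set \<Rightarrow> ('a, 'm) cstar_struct_scheme" where
  "cstar_generated A X = A\<lparr>carrier := \<Inter>{S. cstar_subalgebra A S \<and> X \<subseteq> S}\<rparr>"

definition cstar_quotient ::
  "('a, 'm) cstar_struct_scheme \<Rightarrow> 'a set \<Rightarrow> 'a set cstar_struct" where
  "cstar_quotient A J = \<lparr>
     carrier = a_rcosets\<^bsub>A\<^esub> J,
     mult = rcoset_mult A J,
     one = J +>\<^bsub>A\<^esub> \<one>\<^bsub>A\<^esub>,
     zero = J,
     add = set_add A,
     smult = (\<lambda>c U. \<Union>x\<in>U. J +>\<^bsub>A\<^esub> (c \<odot>\<^bsub>A\<^esub> x)),
     adj = (\<lambda>U. adj A ` U),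
     nrm = (\<lambda>U. Inf (nrm A ` U))\<rparr>"

text \<open>The bounded families in a product of C*-algebras, with the supremum norm.\<close>

definition cstar_product :: "'i set \<Rightarrow> ('i \<Rightarrow> 'a cstar_struct) \<Rightarrow> ('i \<Rightarrow> 'a) cstar_struct" where
  "cstar_product I A = \<lparr>
     carrier = {x \<in> \<Pi>\<^sub>E i\<in>I. carrier (A i). bdd_above ((\<lambda>i. nrm (A i) (x i)) ` I)},
     mult = (\<lambda>x y. \<lambda>i\<in>I. x i \<otimes>\<^bsub>A i\<^esub> y i),
     one = (\<lambda>i\<in>I. \<one>\<^bsub>A i\<^esub>),
     zero = (\<lambda>i\<in>I. \<zero>\<^bsub>A i\<^esub>),
     add = (\<lambda>x y. \<lambda>i\<in>I. x i \<oplus>\<^bsub>A i\<^esub> y i),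
     smult = (\<lambda>c x. \<lambda>i\<in>I. c \<odot>\<^bsub>A i\<^esub> x i),
     adj = (\<lambda>x. \<lambda>i\<in>I. adj (A i) (x i)),
     nrm = (\<lambda>x. Sup (insert 0 ((\<lambda>i. nrm (A i) (x i)) ` I)))\<rparr>"


section \<open>Universal C*-algebras\<close>

text \<open>
  Let \<open>\<Phi>\<close> be a property of families \<open>w\<close>, indexed by \<open>P\<close>, of elements of unital
  C*-algebras \<open>B\<close>; assume that \<open>\<Phi>\<close> bounds the norms of the \<open>w p\<close> and depends only on the unital
  C*-algebra generated by the family, up to isomorphism.
  The universal C*-algebra for \<open>\<Phi>\<close> is the C*-algebra generated by the unit and the families
  \<open>(w p)\<close>, where \<open>(B, w)\<close> runs over all pairs with \<open>\<Phi> B w\<close>, inside the product of all the \<open>B\<close>;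
  its universal homomorphisms are the coordinate projections.

  HOL cannot quantify over all types, so the underlying type of \<open>B\<close> has to be fixed. The type below
  is large enough: every element of a unital C*-algebra generated by a family \<open>w\<close> is the limit of a
  sequence of *-polynomials in the \<open>w p\<close>, so choosing such sequences transports the
  algebra, with all its structure, to this type. In a *-polynomial,
  \<open>(c, [(p, s), \<dots>])\<close> stands for a scalar multiple of a monomial, where \<open>s\<close> tells
  whether a factor is adjoined.
\<close>

type_synonym 'g star_poly = "(complex \<times> ('g \<times> bool) list) list"
type_synonym 'g univ = "nat \<Rightarrow> 'g star_poly"
type_synonym 'g univ_index = "'g univ cstar_struct \<times> ('g \<Rightarrow> 'g univ)"
type_synonym 'g univ_elem = "'g univ_index \<Rightarrow> 'g univ"

definition univ_index ::
  "'g set \<Rightarrow> ('g univ cstar_struct \<Rightarrow> ('g \<Rightarrow> 'g univ) \<Rightarrow> bool) \<Rightarrow> 'g univ_index set" where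
  "univ_index P \<Phi> = {(B, w). unital_cstar_algebra B \<and> w \<in> P \<rightarrow> carrier B \<and> \<Phi> B w}"

definition univ_gen ::
  "'g set \<Rightarrow> ('g univ cstar_struct \<Rightarrow> ('g \<Rightarrow> 'g univ) \<Rightarrow> bool) \<Rightarrow> 'g \<Rightarrow> 'g univ_elem" where
  "univ_gen P \<Phi> p = (\<lambda>(B, w)\<in>univ_index P \<Phi>. w p)"

definition univ_cstar ::
  "'g set \<Rightarrow> ('g univ cstar_struct \<Rightarrow> ('g \<Rightarrow> 'g univ) \<Rightarrow> bool) \<Rightarrow> 'g univ_elem cstar_struct" where
  "univ_cstar P \<Phi> =
     (let A = cstar_product (univ_index P \<Phi>) fst
      in cstar_generated A (insert \<one>\<^bsub>A\<^esub> (univ_gen P \<Phi> ` P)))"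


section \<open>Words and constructible right ideals\<close>

definition words :: "'g set \<Rightarrow> 'g list set" where
  "words P = {\<alpha>. set \<alpha> \<subseteq> P \<and> even (length \<alpha>)}"

fun word_elt :: "('g, 'm) monoid_scheme \<Rightarrow> 'g list \<Rightarrow> 'g" where
  "word_elt G [] = \<one>\<^bsub>G\<^esub>"
| "word_elt G [p] = undefined"
| "word_elt G (p # q # \<alpha>) = inv\<^bsub>G\<^esub> p \<otimes>\<^bsub>G\<^esub> q \<otimes>\<^bsub>G\<^esub> word_elt G \<alpha>"

definition neutral_words :: "('g, 'm) monoid_scheme \<Rightarrow> 'g set \<Rightarrow> 'g list set" where
  "neutral_words G P = {\<alpha> \<in> words P. word_elt G \<alpha> = \<one>\<^bsub>G\<^esub>}"

text \<open>For \<open>m \<le> k\<close> the reversal of the suffix \<open>(p\<^sub>2\<^sub>m\<^sub>+\<^sub>1, \<dots>, p\<^sub>2\<^sub>k)\<close> evaluates to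
  the product of \<open>p\<^sub>2\<^sub>k\<^sup>-\<^sup>1 p\<^sub>2\<^sub>k\<^sub>-\<^sub>1\<close> down to
  \<open>p\<^sub>2\<^sub>m\<^sub>+\<^sub>2\<^sup>-\<^sup>1 p\<^sub>2\<^sub>m\<^sub>+\<^sub>1\<close>; the case \<open>m = k\<close> contributes \<open>P\<close>.\<close>

definition K :: "('g, 'm) monoid_scheme \<Rightarrow> 'g set \<Rightarrow> 'g list \<Rightarrow> 'g set" where
  "K G P \<alpha> = (\<Inter>m\<le>length \<alpha> div 2. word_elt G (rev (drop (2 * m) \<alpha>)) <#\<^bsub>G\<^esub> P)"

definition constructible :: "('g, 'm) monoid_scheme \<Rightarrow> 'g set \<Rightarrow> 'g set set" where
  "constructible G P = K G P ` words P"

definition foundation_set ::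
  "('g, 'm) monoid_scheme \<Rightarrow> 'g set \<Rightarrow> 'g set set \<Rightarrow> 'g set \<Rightarrow> bool" where
  "foundation_set G P \<C> S \<longleftrightarrow>
     S \<in> constructible G P \<and> finite \<C> \<and> \<C> \<subseteq> constructible G P \<and> (\<forall>R\<in>\<C>. R \<subseteq> S) \<and>
     (\<forall>p\<in>S. (p <#\<^bsub>G\<^esub> P) \<inter> \<Union>\<C> \<noteq> {})"

fun word_op :: "('a, 'm) cstar_struct_scheme \<Rightarrow> ('g \<Rightarrow> 'a) \<Rightarrow> 'g list \<Rightarrow> 'a" where
  "word_op B w [] = \<one>\<^bsub>B\<^esub>"
| "word_op B w [p] = undefined"
| "word_op B w (p # q # \<alpha>) = adj B (w p) \<otimes>\<^bsub>B\<^esub> w q \<otimes>\<^bsub>B\<^esub> word_op B w \<alpha>"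

text \<open>The product of the differences, taken along some enumeration of the finite set \<open>F\<close>. For
  neutral words the enumeration is immaterial as soon as \<open>word_op B w\<close> depends only on the
  ideals \<open>K G P \<alpha>\<close>: products correspond to concatenation of words and thus to
  intersection of ideals, so all the factors commute.\<close>

definition diff_prod ::
  "('a, 'm) cstar_struct_scheme \<Rightarrow> ('g \<Rightarrow> 'a) \<Rightarrow> 'g list \<Rightarrow> 'g list set \<Rightarrow> 'a" where
  "diff_prod B w \<alpha> F =
     (if F = {} then word_op B w \<alpha>
      else foldr (\<lambda>\<beta> x. (word_op B w \<alpha> \<ominus>\<^bsub>B\<^esub> word_op B w \<beta>) \<otimes>\<^bsub>B\<^esub> x)
             (SOME \<beta>s. set \<beta>s = F \<and> distinct \<beta>s) \<one>\<^bsub>B\<^esub>)"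


section \<open>The universal Toeplitz algebra\<close>

definition toeplitz_family ::
  "('g, 'm) monoid_scheme \<Rightarrow> 'g set \<Rightarrow> ('a, 'n) cstar_struct_scheme \<Rightarrow> ('g \<Rightarrow> 'a) \<Rightarrow> bool" where
  "toeplitz_family G P B w \<longleftrightarrow>
     w \<one>\<^bsub>G\<^esub> = \<one>\<^bsub>B\<^esub> \<and>
     (\<forall>\<alpha>\<in>neutral_words G P. K G P \<alpha> = {} \<longrightarrow> word_op B w \<alpha> = \<zero>\<^bsub>B\<^esub>) \<and>
     (\<forall>\<alpha>\<in>neutral_words G P. \<forall>\<beta>\<in>neutral_words G P.
        K G P \<alpha> = K G P \<beta> \<longrightarrow> word_op B w \<alpha> = word_op B w \<beta>) \<and>
     (\<forall>\<alpha>\<in>neutral_words G P. \<forall>F. finite F \<and> F \<subseteq> neutral_words G P \<and>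
        K G P \<alpha> = (\<Union>\<beta>\<in>F. K G P \<beta>) \<longrightarrow> diff_prod B w \<alpha> F = \<zero>\<^bsub>B\<^esub>)"

definition T_univ :: "('g, 'm) monoid_scheme \<Rightarrow> 'g set \<Rightarrow> 'g univ_elem cstar_struct" where
  "T_univ G P = univ_cstar P (toeplitz_family G P)"

definition t_gen :: "('g, 'm) monoid_scheme \<Rightarrow> 'g set \<Rightarrow> 'g \<Rightarrow> 'g univ_elem" where
  "t_gen G P = univ_gen P (toeplitz_family G P)"

definition D_univ :: "('g, 'm) monoid_scheme \<Rightarrow> 'g set \<Rightarrow> 'g univ_elem cstar_struct" where
  "D_univ G P = (T_univ G P)\<lparr>carrier :=
     closed_span (T_univ G P) (word_op (T_univ G P) (t_gen G P) ` neutral_words G P)\<rparr>"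


section \<open>The regular representation\<close>

definition l2 :: "'i set \<Rightarrow> ('i \<Rightarrow> complex) set" where
  "l2 I = {f. (\<forall>x. x \<notin> I \<longrightarrow> f x = 0) \<and> (\<lambda>x. (cmod (f x))\<^sup>2) summable_on UNIV}"

definition l2_inner :: "('i \<Rightarrow> complex) \<Rightarrow> ('i \<Rightarrow> complex) \<Rightarrow> complex" where
  "l2_inner f g = (\<Sum>\<^sub>\<infinity>x. cnj (f x) * g x)"

definition l2_norm :: "('i \<Rightarrow> complex) \<Rightarrow> real" where
  "l2_norm f = sqrt (\<Sum>\<^sub>\<infinity>x. (cmod (f x))\<^sup>2)"

definition op_norm_on ::
  "'i set \<Rightarrow> (('i \<Rightarrow> complex) \<Rightarrow> ('i \<Rightarrow> complex)) \<Rightarrow> real" where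
  "op_norm_on I T = Sup {l2_norm (T f) |f. f \<in> l2 I \<and> l2_norm f \<le> 1}"

text \<open>The C*-algebra of bounded linear operators on \<open>\<ell>\<^sup>2(I)\<close>.\<close>

definition l2_ops :: "'i set \<Rightarrow> (('i \<Rightarrow> complex) \<Rightarrow> ('i \<Rightarrow> complex)) cstar_struct" where
  "l2_ops I = (let ops = {T \<in> l2 I \<rightarrow>\<^sub>E l2 I.
         (\<forall>f\<in>l2 I. \<forall>g\<in>l2 I. T (\<lambda>x. f x + g x) = (\<lambda>x. T f x + T g x)) \<and>
         (\<forall>c. \<forall>f\<in>l2 I. T (\<lambda>x. c * f x) = (\<lambda>x. c * T f x)) \<and>
         (\<exists>C. \<forall>f\<in>l2 I. l2_norm (T f) \<le> C * l2_norm f)}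
     in \<lparr>
       carrier = ops,
       mult = (\<lambda>S T. \<lambda>f\<in>l2 I. S (T f)),
       one = (\<lambda>f\<in>l2 I. f),
       zero = (\<lambda>f\<in>l2 I. \<lambda>x. 0),
       add = (\<lambda>S T. \<lambda>f\<in>l2 I. \<lambda>x. S f x + T f x),
       smult = (\<lambda>c T. \<lambda>f\<in>l2 I. \<lambda>x. c * T f x),
       adj = (\<lambda>T. THE S. S \<in> ops \<and> (\<forall>f\<in>l2 I. \<forall>g\<in>l2 I. l2_inner (T f) g = l2_inner f (S g))),
       nrm = op_norm_on I\<rparr>)"

definition mult_op :: "'i set \<Rightarrow> ('i \<Rightarrow> complex) \<Rightarrow> ('i \<Rightarrow> complex) \<Rightarrow> ('i \<Rightarrow> complex)" where
  "mult_op I \<phi> = (\<lambda>f\<in>l2 I. \<lambda>x. \<phi> x * f x)"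

text \<open>On functions, the rule \<open>L\<^sub>p \<delta>\<^sub>q = \<delta>\<^sub>p\<^sub>q\<close> says that
  \<open>L\<^sub>p f\<close> lives on \<open>pP\<close> and takes the value \<open>f q\<close> at \<open>pq\<close>.\<close>

definition left_reg ::
  "('g, 'm) monoid_scheme \<Rightarrow> 'g set \<Rightarrow> 'g \<Rightarrow> ('g \<Rightarrow> complex) \<Rightarrow> ('g \<Rightarrow> complex)" where
  "left_reg G P p =
     (\<lambda>f\<in>l2 P. \<lambda>x. if x \<in> p <#\<^bsub>G\<^esub> P then f (inv\<^bsub>G\<^esub> p \<otimes>\<^bsub>G\<^esub> x) else 0)"

definition T_red ::
  "('g, 'm) monoid_scheme \<Rightarrow> 'g set \<Rightarrow> (('g \<Rightarrow> complex) \<Rightarrow> ('g \<Rightarrow> complex)) cstar_struct" where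
  "T_red G P = cstar_generated (l2_ops P) (left_reg G P ` P)"

text \<open>Homomorphisms that are unique on the carrier are made unique as HOL functions by requiring
  them to be extensional.\<close>

definition lambda_plus ::
  "('g, 'm) monoid_scheme \<Rightarrow> 'g set \<Rightarrow> 'g univ_elem \<Rightarrow> (('g \<Rightarrow> complex) \<Rightarrow> ('g \<Rightarrow> complex))" where
  "lambda_plus G P = (THE h. h \<in> extensional (carrier (T_univ G P)) \<and>
     star_hom (T_univ G P) (T_red G P) h \<and> (\<forall>p\<in>P. h (t_gen G P p) = left_reg G P p))"

text \<open>The operator algebra spanned by the \<open>indicator S\<close>: functions on \<open>P\<close> act on \<open>\<ell>\<^sup>2(P)\<close> as multiplication operators.\<close>

definition D_red ::
  "('g, 'm) monoid_scheme \<Rightarrow> 'g set \<Rightarrow> (('g \<Rightarrow> complex) \<Rightarrow> ('g \<Rightarrow> complex)) cstar_struct" where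
  "D_red G P = (l2_ops P)\<lparr>carrier :=
     closed_span (l2_ops P) ((\<lambda>S. mult_op P (indicator S)) ` constructible G P)\<rparr>"

definition Delta :: "('g, 'm) monoid_scheme \<Rightarrow> 'g set \<Rightarrow> 'g set \<Rightarrow> 'g set" where
  "Delta G P F = {p \<in> P. \<forall>g\<in>F. (p <#\<^bsub>G\<^esub> P) \<inter> (g <#\<^bsub>G\<^esub> P) = {} \<or>
     (p <#\<^bsub>G\<^esub> P) \<inter> (g <#\<^bsub>G\<^esub> P) = p <#\<^bsub>G\<^esub> P}"

definition D_red_o ::
  "('g, 'm) monoid_scheme \<Rightarrow> 'g set \<Rightarrow> (('g \<Rightarrow> complex) \<Rightarrow> ('g \<Rightarrow> complex)) set" where
  "D_red_o G P = {b \<in> carrier (D_red G P).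
     ((\<lambda>F. op_norm_on (Delta G P F) b) \<longlongrightarrow> 0) (finite_subsets_at_top (carrier G))}"

definition D_univ_o :: "('g, 'm) monoid_scheme \<Rightarrow> 'g set \<Rightarrow> 'g univ_elem set" where
  "D_univ_o G P = {x \<in> carrier (D_univ G P). lambda_plus G P x \<in> D_red_o G P}"


section \<open>The covariance algebra\<close>

definition isometric_rep ::
  "('g, 'm) monoid_scheme \<Rightarrow> 'g set \<Rightarrow> ('a, 'n) cstar_struct_scheme \<Rightarrow> ('g \<Rightarrow> 'a) \<Rightarrow> bool" where
  "isometric_rep G P B w \<longleftrightarrow>
     w \<one>\<^bsub>G\<^esub> = \<one>\<^bsub>B\<^esub> \<and>
     (\<forall>p\<in>P. w p \<in> carrier B \<and> adj B (w p) \<otimes>\<^bsub>B\<^esub> w p = \<one>\<^bsub>B\<^esub>) \<and>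
     (\<forall>p\<in>P. \<forall>q\<in>P. w (p \<otimes>\<^bsub>G\<^esub> q) = w p \<otimes>\<^bsub>B\<^esub> w q)"

definition strongly_covariant ::
  "('g, 'm) monoid_scheme \<Rightarrow> 'g set \<Rightarrow> ('a, 'n) cstar_struct_scheme \<Rightarrow> ('g \<Rightarrow> 'a) \<Rightarrow> bool" where
  "strongly_covariant G P B w \<longleftrightarrow> isometric_rep G P B w \<and>
     (\<exists>\<pi>. star_hom (D_red G P) B \<pi> \<and>
       (\<forall>\<alpha>\<in>neutral_words G P. \<pi> (word_op (l2_ops P) (left_reg G P) \<alpha>) = word_op B w \<alpha>) \<and>
       (\<forall>b\<in>D_red_o G P. \<pi> b = \<zero>\<^bsub>B\<^esub>))"

definition Cov :: "('g, 'm) monoid_scheme \<Rightarrow> 'g set \<Rightarrow> 'g univ_elem cstar_struct" where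
  "Cov G P = univ_cstar P (strongly_covariant G P)"

definition j_gen :: "('g, 'm) monoid_scheme \<Rightarrow> 'g set \<Rightarrow> 'g \<Rightarrow> 'g univ_elem" where
  "j_gen G P = univ_gen P (strongly_covariant G P)"

definition q_univ :: "('g, 'm) monoid_scheme \<Rightarrow> 'g set \<Rightarrow> 'g univ_elem \<Rightarrow> 'g univ_elem" where
  "q_univ G P = (THE h. h \<in> extensional (carrier (T_univ G P)) \<and>
     star_hom (T_univ G P) (Cov G P) h \<and> (\<forall>p\<in>P. h (t_gen G P p) = j_gen G P p))"

end

theory Submission
  imports Defs
begin

text \<open>
  If \<open>p\<close> lies in \<open>K(\<alpha>)\<close> and \<open>pP\<close> misses all the \<open>K(\<beta>)\<close>, then the product \<open>D\<close> of the differences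
  satisfies \<open>D t\<^sub>p = t\<^sub>p\<close>, so a representation that kills \<open>D\<close> kills the isometry \<open>t\<^sub>p\<close> and hence everything.

  The same idea works for an arbitrary \<open>x\<close> in \<open>D\<^sub>u\<close>. Let \<open>f = \<lambda>\<^sup>+(x)\<close>. Every constructible ideal either
  contains or misses \<open>qP\<close> when \<open>q\<close> lies in \<open>\<Delta>\<^sub>F\<close> for a suitable \<open>F\<close>; approximating \<open>x\<close> by words, the
  compression \<open>t\<^sub>q\<^sup>* x t\<^sub>q\<close> is therefore uniformly close to the scalar \<open>f(q)\<close> on some \<open>\<Delta>\<^sub>F\<close>. If \<open>f\<close> is not
  in \<open>D\<^sub>r\<^sup>o\<close>, these scalars do not tend to \<open>0\<close>, and a representation with \<open>\<rho>(x) = 0\<close> satisfies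
  \<open>\<rho>(1) = 0\<close>. So the kernel of a nonzero representation meets \<open>D\<^sub>u\<close> inside \<open>D\<^sub>u\<^sup>o\<close>, and both consequences
  follow as soon as the covariance algebra is nonzero.

  A nonzero strongly covariant representation comes from an ultrafilter on \<open>P\<close> that contains all the \<open>\<Delta>\<^sub>F\<close>.
  The set \<open>X\<close> of all \<open>g\<close> in \<open>G\<close> with \<open>gq \<in> P\<close> for almost all \<open>q\<close> satisfies \<open>P X \<subseteq> X\<close>, so \<open>P\<close> acts on
  \<open>\<ell>\<^sup>2(X)\<close> by shifts, and \<open>f \<mapsto> (g \<mapsto> lim\<^sub>q f(gq))\<close> vanishes on \<open>D\<^sub>r\<^sup>o\<close> because
  \<open>g \<Delta>\<^sub>F \<inter> P \<subseteq> \<Delta>\<^sub>g\<^sub>F\<close>.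

  Uniqueness of the canonical maps needs that *-homomorphisms are contractive. This is elementary: a
  self-adjoint \<open>a\<close> of norm less than \<open>1\<close> is \<open>(v + v\<^sup>*)/2\<close> with \<open>v\<^sup>* v = 1\<close>.
\<close>

section \<open>Elementary facts on C*-algebras\<close>

text \<open>The universal algebras sit in products over families with values in the single type
  \<open>'g univ\<close>, so a concrete representation on a Hilbert space is not itself a
  coordinate. It becomes one after passing to the subalgebra generated by the family and the unit
  and moving that algebra along an injection; the relations must then be re-established there. The
  canonical maps are definite descriptions, so existence and uniqueness both come before any use of
  them. Every strongly covariant family satisfies (T1)-(T4), and therefore the map onto the
  covariance algebra turns out to be the restriction of coordinates to fewer indices.

  Limits along an ultrafilter exist for all bounded symbols at once, which makes the boundary
  representation a homomorphism on all of D_r; it is nonzero because e lies in \<open>X\<close>.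
  Replacing a compression by a scalar costs at most twice the norm of x, uniformly in the
  compressing generator, and this lets the exact result for words pass to the closed span. The image
  of the unit is a self-adjoint idempotent, whose norm is 0 or 1, so a bound by 1/2 already makes it
  vanish.\<close>

lemma cstar_algebraI:
  fixes A (structure)
  assumes add_closed: "\<And>x y. \<lbrakk>x \<in> carrier A; y \<in> carrier A\<rbrakk> \<Longrightarrow> x \<oplus> y \<in> carrier A"
    and zero_closed: "\<zero> \<in> carrier A"
    and a_assoc: "\<And>x y z. \<lbrakk>x \<in> carrier A; y \<in> carrier A; z \<in> carrier A\<rbrakk> \<Longrightarrow> (x \<oplus> y) \<oplus> z = x \<oplus> (y \<oplus> z)"
    and a_comm: "\<And>x y. \<lbrakk>x \<in> carrier A; y \<in> carrier A\<rbrakk> \<Longrightarrow> x \<oplus> y = y \<oplus> x"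
    and l_zero: "\<And>x. x \<in> carrier A \<Longrightarrow> \<zero> \<oplus> x = x"
    and smult_closed: "\<And>x c. x \<in> carrier A \<Longrightarrow> c \<odot> x \<in> carrier A"
    and smult_l_distr: "\<And>x c d. x \<in> carrier A \<Longrightarrow> (c + d) \<odot> x = c \<odot> x \<oplus> d \<odot> x"
    and smult_r_distr: "\<And>x y c. \<lbrakk>x \<in> carrier A; y \<in> carrier A\<rbrakk> \<Longrightarrow> c \<odot> (x \<oplus> y) = c \<odot> x \<oplus> c \<odot> y"
    and smult_assoc: "\<And>x c d. x \<in> carrier A \<Longrightarrow> (c * d) \<odot> x = c \<odot> (d \<odot> x)"
    and smult_one: "\<And>x. x \<in> carrier A \<Longrightarrow> 1 \<odot> x = x"
    and mult_closed: "\<And>x y. \<lbrakk>x \<in> carrier A; y \<in> carrier A\<rbrakk> \<Longrightarrow> x \<otimes> y \<in> carrier A"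
    and mult_assoc: "\<And>x y z. \<lbrakk>x \<in> carrier A; y \<in> carrier A; z \<in> carrier A\<rbrakk> \<Longrightarrow>
      (x \<otimes> y) \<otimes> z = x \<otimes> (y \<otimes> z)"
    and l_distr: "\<And>x y z. \<lbrakk>x \<in> carrier A; y \<in> carrier A; z \<in> carrier A\<rbrakk> \<Longrightarrow>
      (x \<oplus> y) \<otimes> z = x \<otimes> z \<oplus> y \<otimes> z"
    and r_distr: "\<And>x y z. \<lbrakk>x \<in> carrier A; y \<in> carrier A; z \<in> carrier A\<rbrakk> \<Longrightarrow>
      z \<otimes> (x \<oplus> y) = z \<otimes> x \<oplus> z \<otimes> y"
    and smult_mult_l: "\<And>x y c. \<lbrakk>x \<in> carrier A; y \<in> carrier A\<rbrakk> \<Longrightarrow> (c \<odot> x) \<otimes> y = c \<odot> (x \<otimes> y)"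
    and smult_mult_r: "\<And>x y c. \<lbrakk>x \<in> carrier A; y \<in> carrier A\<rbrakk> \<Longrightarrow> x \<otimes> (c \<odot> y) = c \<odot> (x \<otimes> y)"
    and adj_closed: "\<And>x. x \<in> carrier A \<Longrightarrow> adj A x \<in> carrier A"
    and adj_adj: "\<And>x. x \<in> carrier A \<Longrightarrow> adj A (adj A x) = x"
    and adj_add: "\<And>x y. \<lbrakk>x \<in> carrier A; y \<in> carrier A\<rbrakk> \<Longrightarrow> adj A (x \<oplus> y) = adj A x \<oplus> adj A y"
    and adj_smult: "\<And>x c. x \<in> carrier A \<Longrightarrow> adj A (c \<odot> x) = cnj c \<odot> adj A x"
    and adj_mult: "\<And>x y. \<lbrakk>x \<in> carrier A; y \<in> carrier A\<rbrakk> \<Longrightarrow> adj A (x \<otimes> y) = adj A y \<otimes> adj A x"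
    and nrm_nonneg: "\<And>x. x \<in> carrier A \<Longrightarrow> 0 \<le> nrm A x"
    and nrm_eq_0: "\<And>x. x \<in> carrier A \<Longrightarrow> nrm A x = 0 \<longleftrightarrow> x = \<zero>"
    and nrm_triangle: "\<And>x y. \<lbrakk>x \<in> carrier A; y \<in> carrier A\<rbrakk> \<Longrightarrow> nrm A (x \<oplus> y) \<le> nrm A x + nrm A y"
    and nrm_smult: "\<And>x c. x \<in> carrier A \<Longrightarrow> nrm A (c \<odot> x) = cmod c * nrm A x"
    and nrm_mult: "\<And>x y. \<lbrakk>x \<in> carrier A; y \<in> carrier A\<rbrakk> \<Longrightarrow> nrm A (x \<otimes> y) \<le> nrm A x * nrm A y"
    and cstar_identity: "\<And>x. x \<in> carrier A \<Longrightarrow> nrm A (adj A x \<otimes> x) = (nrm A x)\<^sup>2"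
    and complete: "\<And>X. \<lbrakk>\<And>n. X n \<in> carrier A;
        \<And>e. e > 0 \<Longrightarrow> \<exists>N. \<forall>m\<ge>N. \<forall>n\<ge>N. nrm A (X m \<oplus> (-1) \<odot> X n) < e\<rbrakk> \<Longrightarrow>
      \<exists>x\<in>carrier A. (\<lambda>n::nat. nrm A (X n \<oplus> (-1) \<odot> x)) \<longlonglongrightarrow> 0"
  shows "cstar_algebra A"
proof -
  \<comment> \<open>Subtraction refers to an additive inverse described relative to the carrier, so
    the hypotheses use \<open>(-1) \<odot> y\<close>, which unfolds in every concrete algebra. It is
    an additive inverse because homogeneity of the norm makes \<open>0 \<odot> x\<close>
    vanish.\<close>
  have neg: "(-1) \<odot> x \<oplus> x = \<zero>" if "x \<in> carrier A" for x
  proof -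
    have "nrm A (0 \<odot> x) = 0" using nrm_smult[OF that, of 0] by simp
    then have "0 \<odot> x = \<zero>" using nrm_eq_0 smult_closed that by blast
    then show ?thesis using smult_l_distr[OF that, of "-1" 1] smult_one[OF that] by simp
  qed
  interpret abelian_group A
    by (rule abelian_groupI[OF add_closed zero_closed a_assoc a_comm l_zero])
      (auto intro: neg smult_closed)
  have minus: "x \<ominus> y = x \<oplus> (-1) \<odot> y" if "x \<in> carrier A" "y \<in> carrier A" for x y
    using minus_equality[OF neg[OF that(2)]] smult_closed that by (simp add: a_minus_def)
  show ?thesis
  proof (unfold_locales, goal_cases)
    case (23 X)
    have "\<And>e. e > 0 \<Longrightarrow> \<exists>N. \<forall>m\<ge>N. \<forall>n\<ge>N. nrm A (X m \<oplus> (-1) \<odot> X n) < e"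
      using 23 minus by metis
    from complete[OF 23(1) this] obtain x where
      x: "x \<in> carrier A" "(\<lambda>n::nat. nrm A (X n \<oplus> (-1) \<odot> x)) \<longlonglongrightarrow> 0" by blast
    then show ?case using minus 23(1) by (intro bexI[of _ x]) simp_all
  qed (rule assms; assumption)+
qed

text \<open>Membership of all the terms and of the limit is built in, so the limit laws carry no
  side conditions.\<close>

definition cstar_lim :: "('a, 'm) cstar_struct_scheme \<Rightarrow> (nat \<Rightarrow> 'a) \<Rightarrow> 'a \<Rightarrow> bool" where
  "cstar_lim A X x \<longleftrightarrow> (\<forall>n. X n \<in> carrier A) \<and> x \<in> carrier A \<and>
     (\<lambda>n. nrm A (X n \<ominus>\<^bsub>A\<^esub> x)) \<longlonglongrightarrow> 0"

context cstar_algebra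
begin

lemma zero_smult [simp]: "x \<in> carrier A \<Longrightarrow> 0 \<odot> x = \<zero>"
  using nrm_smult[of x 0] nrm_eq_0 smult_closed by simp

lemma smult_zero [simp]: "c \<odot> \<zero> = \<zero>"
  using nrm_smult[of \<zero> c] nrm_eq_0[of \<zero>] nrm_eq_0[of "c \<odot> \<zero>"] smult_closed by simp

lemma nrm_zero [simp]: "nrm A \<zero> = 0"
  using nrm_eq_0 by simp

lemma mult_zero [simp]: "x \<in> carrier A \<Longrightarrow> x \<otimes> \<zero> = \<zero>"
  using nrm_mult[of x \<zero>] nrm_nonneg[of "x \<otimes> \<zero>"] nrm_eq_0[of "x \<otimes> \<zero>"] mult_closed by simp

lemma zero_mult [simp]: "x \<in> carrier A \<Longrightarrow> \<zero> \<otimes> x = \<zero>"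
  using nrm_mult[of \<zero> x] nrm_nonneg[of "\<zero> \<otimes> x"] nrm_eq_0[of "\<zero> \<otimes> x"] mult_closed by simp

lemma adj_zero [simp]: "adj A \<zero> = \<zero>"
  using adj_smult[of \<zero> 0] adj_closed[of \<zero>] by simp

lemma smult_neg1: "x \<in> carrier A \<Longrightarrow> (-1) \<odot> x = \<ominus> x"
  using minus_equality[of "(-1) \<odot> x" x] smult_l_distr[of x "-1" 1] smult_closed
  by (simp add: smult_one)

lemma minus_smult: "y \<in> carrier A \<Longrightarrow> x \<ominus> y = x \<oplus> (-1) \<odot> y"
  by (simp add: a_minus_def smult_neg1)

lemmas closed = smult_closed mult_closed adj_closed

text \<open>The C*-identity and submultiplicativity give
  \<open>nrm A y ^ 2 \<le> nrm A (adj A y) * nrm A y\<close>; one factor cancels, and applying this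
  to the adjoint gives the converse.\<close>

lemma nrm_adj [simp]:
  assumes "x \<in> carrier A"
  shows "nrm A (adj A x) = nrm A x"
proof -
  have le: "nrm A y \<le> nrm A (adj A y)" if "y \<in> carrier A" for y
  proof (cases "nrm A y = 0")
    case True
    then show ?thesis using nrm_nonneg that adj_closed by simp
  next
    case False
    have "nrm A y * nrm A y \<le> nrm A (adj A y) * nrm A y"
      using cstar_identity[OF that] nrm_mult[of "adj A y" y] that adj_closed
      by (simp add: power2_eq_square)
    then show ?thesis using False nrm_nonneg[OF that] by (simp add: mult_le_cancel_right)
  qed
  show ?thesis using le[OF assms] le[of "adj A x"] assms by (simp add: adj_adj adj_closed)
qed

lemma nrm_a_inv [simp]: "x \<in> carrier A \<Longrightarrow> nrm A (\<ominus> x) = nrm A x"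
  using nrm_smult[of x "-1"] by (simp add: smult_neg1)

lemma minus_self [simp]: "x \<in> carrier A \<Longrightarrow> x \<ominus> x = \<zero>"
  by (simp add: a_minus_def r_neg)

lemma nrm_minus_commute: "\<lbrakk>x \<in> carrier A; y \<in> carrier A\<rbrakk> \<Longrightarrow> nrm A (x \<ominus> y) = nrm A (y \<ominus> x)"
  using nrm_a_inv[of "x \<ominus> y"] by (simp add: a_minus_def minus_add a_comm)

lemma minus_zero_right [simp]: "x \<in> carrier A \<Longrightarrow> x \<ominus> \<zero> = x"
  by (simp add: minus_smult)

lemma minus_eq_0_iff: "\<lbrakk>x \<in> carrier A; y \<in> carrier A\<rbrakk> \<Longrightarrow> x \<ominus> y = \<zero> \<longleftrightarrow> x = y"
  using minus_equality[of x "\<ominus> y"] by (auto simp: a_minus_def r_neg)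

lemma nrm_minus_eq_0_iff: "\<lbrakk>x \<in> carrier A; y \<in> carrier A\<rbrakk> \<Longrightarrow> nrm A (x \<ominus> y) = 0 \<longleftrightarrow> x = y"
  by (simp add: nrm_eq_0 minus_eq_0_iff)

lemma minus_add_minus:
  "\<lbrakk>x \<in> carrier A; y \<in> carrier A; z \<in> carrier A\<rbrakk> \<Longrightarrow> (x \<ominus> y) \<oplus> (y \<ominus> z) = x \<ominus> z"
  by (simp add: a_minus_def a_assoc r_neg1)

lemma nrm_dist_triangle:
  "\<lbrakk>x \<in> carrier A; y \<in> carrier A; z \<in> carrier A\<rbrakk> \<Longrightarrow>
     nrm A (x \<ominus> z) \<le> nrm A (x \<ominus> y) + nrm A (y \<ominus> z)"
  using nrm_triangle[of "x \<ominus> y" "y \<ominus> z"] by (simp add: minus_add_minus)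

lemma nrm_le_minus: "\<lbrakk>x \<in> carrier A; y \<in> carrier A\<rbrakk> \<Longrightarrow> nrm A x \<le> nrm A (x \<ominus> y) + nrm A y"
  using nrm_dist_triangle[of x y \<zero>] by simp

lemma add_minus_add:
  "\<lbrakk>x \<in> carrier A; y \<in> carrier A; x' \<in> carrier A; y' \<in> carrier A\<rbrakk> \<Longrightarrow>
     (x \<oplus> y) \<ominus> (x' \<oplus> y') = (x \<ominus> x') \<oplus> (y \<ominus> y')"
  by (simp add: a_minus_def minus_add a_ac)

lemma nrm_add_minus_add:
  "\<lbrakk>x \<in> carrier A; y \<in> carrier A; x' \<in> carrier A; y' \<in> carrier A\<rbrakk> \<Longrightarrow>
     nrm A ((x \<oplus> y) \<ominus> (x' \<oplus> y')) \<le> nrm A (x \<ominus> x') + nrm A (y \<ominus> y')"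
  by (simp add: add_minus_add nrm_triangle)

lemma smult_minus:
  "\<lbrakk>x \<in> carrier A; y \<in> carrier A\<rbrakk> \<Longrightarrow> c \<odot> (x \<ominus> y) = c \<odot> x \<ominus> c \<odot> y"
  by (simp add: minus_smult smult_r_distr smult_closed flip: smult_assoc)

lemma adj_minus:
  "\<lbrakk>x \<in> carrier A; y \<in> carrier A\<rbrakk> \<Longrightarrow> adj A (x \<ominus> y) = adj A x \<ominus> adj A y"
  by (simp add: minus_smult adj_add adj_smult closed)

lemma mult_minus:
  "\<lbrakk>x \<in> carrier A; y \<in> carrier A; z \<in> carrier A\<rbrakk> \<Longrightarrow> z \<otimes> (x \<ominus> y) = z \<otimes> x \<ominus> z \<otimes> y"
  by (simp add: minus_smult closed r_distr smult_mult_r)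

lemma minus_mult:
  "\<lbrakk>x \<in> carrier A; y \<in> carrier A; z \<in> carrier A\<rbrakk> \<Longrightarrow> (x \<ominus> y) \<otimes> z = x \<otimes> z \<ominus> y \<otimes> z"
  by (simp add: minus_smult closed l_distr smult_mult_l)

lemma nrm_mult_minus_mult:
  assumes "x \<in> carrier A" "y \<in> carrier A" "x' \<in> carrier A" "y' \<in> carrier A"
  shows "nrm A (x \<otimes> y \<ominus> x' \<otimes> y') \<le> nrm A x * nrm A (y \<ominus> y') + nrm A (x \<ominus> x') * nrm A y'"
proof -
  have "nrm A (x \<otimes> y \<ominus> x' \<otimes> y') \<le> nrm A (x \<otimes> y \<ominus> x \<otimes> y') + nrm A (x \<otimes> y' \<ominus> x' \<otimes> y')"
    using assms by (intro nrm_dist_triangle closed)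
  also have "\<dots> = nrm A (x \<otimes> (y \<ominus> y')) + nrm A ((x \<ominus> x') \<otimes> y')"
    using assms by (simp add: mult_minus minus_mult)
  also have "\<dots> \<le> nrm A x * nrm A (y \<ominus> y') + nrm A (x \<ominus> x') * nrm A y'"
    using assms by (intro add_mono nrm_mult minus_closed)
  finally show ?thesis .
qed

lemma cstar_limD:
  "cstar_lim A X x \<Longrightarrow> X n \<in> carrier A" "cstar_lim A X x \<Longrightarrow> x \<in> carrier A"
  "cstar_lim A X x \<Longrightarrow> (\<lambda>n. nrm A (X n \<ominus> x)) \<longlonglongrightarrow> 0"
  by (auto simp: cstar_lim_def)

lemma cstar_limI:
  assumes "\<And>n. X n \<in> carrier A" "x \<in> carrier A" "f \<longlonglongrightarrow> 0" "\<And>n. nrm A (X n \<ominus> x) \<le> f n"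
  shows "cstar_lim A X x"
proof -
  have "(\<lambda>n. nrm A (X n \<ominus> x)) \<longlonglongrightarrow> 0"
    by (rule Lim_null_comparison[OF _ assms(3)])
      (use assms nrm_nonneg in \<open>auto intro!: always_eventually\<close>)
  then show ?thesis using assms by (auto simp: cstar_lim_def)
qed

lemma cstar_lim_unique:
  assumes "cstar_lim A X x" "cstar_lim A X y"
  shows "x = y"
proof -
  note c = cstar_limD[OF assms(1)] cstar_limD[OF assms(2)]
  have "(\<lambda>n. nrm A (X n \<ominus> x) + nrm A (X n \<ominus> y)) \<longlonglongrightarrow> 0 + 0"
    using c by (intro tendsto_add)
  moreover have "nrm A (x \<ominus> y) \<le> nrm A (X n \<ominus> x) + nrm A (X n \<ominus> y)" for n
    using nrm_dist_triangle[of x "X n" y] c nrm_minus_commute[of x "X n"] by simp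
  ultimately have "nrm A (x \<ominus> y) \<le> 0"
    by (intro tendsto_lowerbound[of _ 0 sequentially]) (auto intro!: always_eventually)
  then show ?thesis using nrm_nonneg[of "x \<ominus> y"] nrm_minus_eq_0_iff[of x y] c by simp
qed

lemma cstar_lim_const: "x \<in> carrier A \<Longrightarrow> cstar_lim A (\<lambda>_. x) x"
  by (simp add: cstar_lim_def)

lemma cstar_lim_add:
  assumes "cstar_lim A X x" "cstar_lim A Y y"
  shows "cstar_lim A (\<lambda>n. X n \<oplus> Y n) (x \<oplus> y)"
proof (rule cstar_limI)
  show "(\<lambda>n. nrm A (X n \<ominus> x) + nrm A (Y n \<ominus> y)) \<longlonglongrightarrow> 0"
    using tendsto_add[OF cstar_limD(3)[OF assms(1)] cstar_limD(3)[OF assms(2)]] by simp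
qed (use cstar_limD(1,2)[OF assms(1)] cstar_limD(1,2)[OF assms(2)] nrm_add_minus_add in auto)

lemma cstar_lim_smult:
  assumes "cstar_lim A X x"
  shows "cstar_lim A (\<lambda>n. c \<odot> X n) (c \<odot> x)"
proof (rule cstar_limI)
  show "(\<lambda>n. cmod c * nrm A (X n \<ominus> x)) \<longlonglongrightarrow> 0"
    using tendsto_mult_left[OF cstar_limD(3)[OF assms(1)], of "cmod c"] by simp
qed (use cstar_limD(1,2)[OF assms(1)] closed in \<open>auto simp: nrm_smult simp flip: smult_minus\<close>)

lemma cstar_lim_mult:
  assumes "cstar_lim A X x" "cstar_lim A Y y"
  shows "cstar_lim A (\<lambda>n. X n \<otimes> Y n) (x \<otimes> y)"
proof (rule cstar_limI)
  note c = cstar_limD[OF assms(1)] cstar_limD[OF assms(2)]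
  have "(\<lambda>n. (nrm A (X n \<ominus> x) + nrm A x) * nrm A (Y n \<ominus> y) + nrm A (X n \<ominus> x) * nrm A y)
    \<longlonglongrightarrow> (0 + nrm A x) * 0 + 0 * nrm A y"
    using c by (intro tendsto_intros)
  then show "(\<lambda>n. (nrm A (X n \<ominus> x) + nrm A x) * nrm A (Y n \<ominus> y) + nrm A (X n \<ominus> x) * nrm A y) \<longlonglongrightarrow> 0"
    by simp
  show "nrm A (X n \<otimes> Y n \<ominus> x \<otimes> y) \<le>
      (nrm A (X n \<ominus> x) + nrm A x) * nrm A (Y n \<ominus> y) + nrm A (X n \<ominus> x) * nrm A y" for n
    using nrm_mult_minus_mult[of "X n" "Y n" x y] c(1,2,4,5) nrm_nonneg[of "Y n \<ominus> y"]
      mult_right_mono[OF nrm_le_minus[of "X n" x], of "nrm A (Y n \<ominus> y)"]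
    by simp
qed (use cstar_limD(1,2)[OF assms(1)] cstar_limD(1,2)[OF assms(2)] closed in auto)

lemma cstar_lim_adj:
  assumes "cstar_lim A X x"
  shows "cstar_lim A (\<lambda>n. adj A (X n)) (adj A x)"
  using assms closed by (auto simp: cstar_lim_def simp flip: adj_minus)

lemma cstar_lim_Suc: "cstar_lim A X x \<Longrightarrow> cstar_lim A (\<lambda>n. X (Suc n)) x"
  unfolding cstar_lim_def using LIMSEQ_Suc by blast

lemma geometric_cstar_lim:
  assumes X: "\<And>n. X n \<in> carrier A" and r: "0 \<le> r" "r < 1"
    and le: "\<And>n. nrm A (X (Suc n) \<ominus> X n) \<le> C * r ^ n"
  shows "\<exists>x. cstar_lim A X x"
proof -
  have C: "0 \<le> C" using le[of 0] nrm_nonneg[of "X (Suc 0) \<ominus> X 0"] X by simp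
  \<comment> \<open>The bound is the exact partial sum of the geometric series, so that the
    induction step closes with an equality.\<close>
  have step: "nrm A (X (n + k) \<ominus> X n) \<le> C * (r ^ n - r ^ (n + k)) / (1 - r)" for n k
  proof (induction k)
    case 0
    then show ?case using X by simp
  next
    case (Suc k)
    have "nrm A (X (n + Suc k) \<ominus> X n) \<le> nrm A (X (Suc (n + k)) \<ominus> X (n + k)) + nrm A (X (n + k) \<ominus> X n)"
      using X nrm_dist_triangle by simp
    also have "\<dots> \<le> C * r ^ (n + k) + C * (r ^ n - r ^ (n + k)) / (1 - r)"
      by (intro add_mono le Suc)
    also have "\<dots> = C * (r ^ n - r ^ (n + Suc k)) / (1 - r)"
      using r by (simp add: field_simps)
    finally show ?case .
  qed
  have bound: "nrm A (X m \<ominus> X n) \<le> C * r ^ n / (1 - r)" if "n \<le> m" for m n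
  proof -
    have "nrm A (X m \<ominus> X n) \<le> C * (r ^ n - r ^ m) / (1 - r)"
      using step[of n "m - n"] that by simp
    also have "\<dots> \<le> C * r ^ n / (1 - r)"
      using r C by (intro divide_right_mono mult_left_mono) auto
    finally show ?thesis .
  qed
  have "(\<lambda>n. C * r ^ n / (1 - r)) \<longlonglongrightarrow> C * 0 / (1 - r)"
    using r by (intro tendsto_intros LIMSEQ_power_zero) auto
  then have lim: "(\<lambda>n. C * r ^ n / (1 - r)) \<longlonglongrightarrow> 0" by simp
  have "\<exists>N. \<forall>m\<ge>N. \<forall>n\<ge>N. nrm A (X m \<ominus> X n) < e" if e: "e > 0" for e
  proof -
    obtain N where N: "\<And>n. n \<ge> N \<Longrightarrow> C * r ^ n / (1 - r) < e"
      using order_tendstoD(2)[OF lim e] unfolding eventually_sequentially by blast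
    have "nrm A (X m \<ominus> X n) < e" if "m \<ge> N" "n \<ge> N" for m n
    proof (cases "n \<le> m")
      case True
      then show ?thesis using bound[of n m] N[of n] that by linarith
    next
      case False
      then show ?thesis using bound[of m n] N[of m] that X nrm_minus_commute[of "X m" "X n"] by simp
    qed
    then show ?thesis by blast
  qed
  from complete[OF X this] obtain x where "x \<in> carrier A" "(\<lambda>n. nrm A (X n \<ominus> x)) \<longlonglongrightarrow> 0"
    by blast
  then have "cstar_lim A X x" using X by (simp add: cstar_lim_def)
  then show ?thesis ..
qed

end


lemma (in unital_cstar_algebra) adj_one [simp]: "adj A \<one> = \<one>"
  using l_one r_one adj_mult[of "adj A \<one>" \<one>] adj_adj one_closed adj_closed by metis

text \<open>The norm of the unit equals its own square. Only an upper bound by 1 is claimed, since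
  in the zero algebra the norm is 0.\<close>

lemma (in unital_cstar_algebra) nrm_isometry_le_1:
  assumes "x \<in> carrier A" "adj A x \<otimes> x = \<one>"
  shows "nrm A x \<le> 1"
proof -
  have "nrm A \<one> = (nrm A \<one>)\<^sup>2" using cstar_identity[OF one_closed] l_one[OF one_closed] by simp
  then have "nrm A \<one> \<le> 1" by (auto simp: power2_eq_square)
  then have "(nrm A x)\<^sup>2 \<le> 1\<^sup>2" using cstar_identity[OF assms(1)] assms(2) by simp
  then show ?thesis by (rule power2_le_imp_le) simp
qed

section \<open>Contractivity of *-homomorphisms\<close>

text \<open>The unitary is \<open>a + i (1 - a\<^sup>2)\<^sup>1\<^sup>/\<^sup>2\<close>; the square root is \<open>1 - z\<close>, where \<open>z\<close> is the
  limit of the iteration of \<open>z \<mapsto> (a\<^sup>2 + z\<^sup>2)/2\<close> from \<open>0\<close>.\<close>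

lemma (in unital_cstar_algebra) self_adjoint_unitary_part:
  assumes a: "a \<in> carrier A" "adj A a = a" "nrm A a < 1"
  obtains v where "v \<in> carrier A" "adj A v \<otimes> v = \<one>" "v \<oplus> adj A v = 2 \<odot> a"
proof -
  define z where "z = rec_nat \<zero> (\<lambda>_ y. (1/2) \<odot> (a \<otimes> a \<oplus> y \<otimes> y))"
  have z0: "z 0 = \<zero>" and zS: "z (Suc n) = (1/2) \<odot> (a \<otimes> a \<oplus> z n \<otimes> z n)" for n
    by (simp_all add: z_def)
  have zc: "z n \<in> carrier A" for n by (induction n) (auto simp: z0 zS a closed)
  let ?r = "nrm A a"
  have r: "0 \<le> ?r" "?r < 1" using a nrm_nonneg by auto
  \<comment> \<open>The ball of radius \<open>?r\<close> is invariant: the iteration maps it into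
    the ball of radius \<open>?r * ?r\<close>, and \<open>?r < 1\<close>.\<close>
  have zn: "nrm A (z n) \<le> ?r" for n
  proof (induction n)
    case (Suc n)
    have "nrm A (z (Suc n)) = nrm A (a \<otimes> a \<oplus> z n \<otimes> z n) / 2"
      using zc a by (simp add: zS nrm_smult closed)
    also have "\<dots> \<le> (nrm A (a \<otimes> a) + nrm A (z n \<otimes> z n)) / 2"
      using zc a by (intro divide_right_mono nrm_triangle closed) auto
    also have "\<dots> \<le> (?r * ?r + nrm A (z n) * nrm A (z n)) / 2"
      using zc a by (intro divide_right_mono add_mono nrm_mult) auto
    also have "\<dots> \<le> (?r * ?r + ?r * ?r) / 2"
      using Suc zc nrm_nonneg r by (intro divide_right_mono add_mono mult_mono) auto
    also have "\<dots> \<le> ?r" using mult_left_mono[of ?r 1 ?r] r by simp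
    finally show ?case .
  qed (simp add: z0 r)
  \<comment> \<open>A difference of squares splits into two terms, each with a factor of norm at
    most \<open>?r\<close>. The factor 1/2 averages the two, so the increments shrink geometrically
    with ratio \<open>?r\<close>.\<close>
  have dz: "nrm A (z (Suc n) \<ominus> z n) \<le> ?r * ?r ^ n" for n
  proof (induction n)
    case 0
    show ?case using zn[of "Suc 0"] zc[of "Suc 0"] by (simp add: z0)
  next
    case (Suc n)
    define b where "b n = a \<otimes> a \<oplus> z n \<otimes> z n" for n
    have bc: "b n \<in> carrier A" for n using zc a by (simp add: b_def mult_closed)
    have zb: "z (Suc n) = (1/2) \<odot> b n" for n unfolding b_def by (rule zS)
    have "z (Suc (Suc n)) \<ominus> z (Suc n) = (1/2) \<odot> (b (Suc n) \<ominus> b n)"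
      unfolding zb smult_minus[OF bc bc] ..
    also have "\<dots> = (1/2) \<odot> (z (Suc n) \<otimes> z (Suc n) \<ominus> z n \<otimes> z n)"
      using zc a by (simp add: b_def add_minus_add mult_closed)
    finally have "nrm A (z (Suc (Suc n)) \<ominus> z (Suc n)) = nrm A (z (Suc n) \<otimes> z (Suc n) \<ominus> z n \<otimes> z n) / 2"
      using zc by (simp add: nrm_smult closed)
    also have "\<dots> \<le> (nrm A (z (Suc n)) * nrm A (z (Suc n) \<ominus> z n) + nrm A (z (Suc n) \<ominus> z n) * nrm A (z n)) / 2"
      using zc by (intro divide_right_mono nrm_mult_minus_mult) auto
    also have "\<dots> \<le> (?r * (?r * ?r ^ n) + (?r * ?r ^ n) * ?r) / 2"
      using Suc zn zc nrm_nonneg r by (intro divide_right_mono add_mono mult_mono) auto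
    finally show ?case by (simp add: mult_ac)
  qed
  obtain w where w: "cstar_lim A z w" using geometric_cstar_lim[OF zc r dz] by blast
  have wc: "w \<in> carrier A" using cstar_limD(2)[OF w] .
  have "cstar_lim A (\<lambda>n. (1/2) \<odot> (a \<otimes> a \<oplus> z n \<otimes> z n)) ((1/2) \<odot> (a \<otimes> a \<oplus> w \<otimes> w))"
    using a w by (intro cstar_lim_smult cstar_lim_add cstar_lim_mult cstar_lim_const)
  then have weq: "w = (1/2) \<odot> (a \<otimes> a \<oplus> w \<otimes> w)"
    using cstar_lim_unique cstar_lim_Suc[OF w] by (simp add: zS)
  have "adj A (z n) = z n" for n
    by (induction n) (auto simp: z0 zS a adj_smult adj_add adj_mult closed zc)
  then have wadj: "adj A w = w" using cstar_lim_unique[OF cstar_lim_adj[OF w]] w by simp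
  \<comment> \<open>Commutation with \<open>a\<close> passes to the limit and is what cancels the
    mixed terms in the product of \<open>adj A v\<close> and \<open>v\<close> below.\<close>
  have "a \<otimes> z n = z n \<otimes> a" for n
  proof (induction n)
    case (Suc n)
    have "a \<otimes> (z n \<otimes> z n) = (z n \<otimes> a) \<otimes> z n" using Suc zc a by (simp add: mult_assoc[symmetric])
    also have "\<dots> = (z n \<otimes> z n) \<otimes> a" using Suc zc a by (simp add: mult_assoc)
    finally show ?case
      using zc a by (simp add: zS smult_mult_l smult_mult_r l_distr r_distr closed mult_assoc)
  qed (simp add: z0 a)
  then have waz: "a \<otimes> w = w \<otimes> a"
    using cstar_lim_unique[OF cstar_lim_mult[OF cstar_lim_const[OF a(1)] w]]
      cstar_lim_mult[OF w cstar_lim_const[OF a(1)]] by simp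
  \<comment> \<open>The square root of 1 - a^2: the fixed point equation 2w = a^2 + w^2 says exactly
    that a^2 + (1 - w)^2 = 1.\<close>
  define y where "y = \<one> \<ominus> w"
  have yc: "y \<in> carrier A" using wc one_closed by (simp add: y_def)
  have ya: "adj A y = y" by (simp add: y_def adj_minus one_closed wc wadj)
  have ay: "a \<otimes> y = y \<otimes> a" using a wc waz one_closed by (simp add: y_def mult_minus minus_mult l_one r_one)
  have two: "2 \<odot> w = a \<otimes> a \<oplus> w \<otimes> w"
  proof -
    have "2 \<odot> w = (2 * (1/2)) \<odot> (a \<otimes> a \<oplus> w \<otimes> w)"
      using a wc weq by (subst smult_assoc) (auto simp: closed)
    then show ?thesis using a wc by (simp add: smult_one closed)
  qed
  have two': "2 \<odot> w = w \<oplus> w" using smult_l_distr[OF wc, of 1 1] by (simp add: smult_one wc)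
  have "a \<otimes> a \<oplus> y \<otimes> y = a \<otimes> a \<oplus> ((\<one> \<ominus> w) \<ominus> (w \<ominus> w \<otimes> w))"
    using wc one_closed by (simp add: y_def mult_minus minus_mult l_one r_one)
  also have "\<dots> = \<one> \<oplus> ((a \<otimes> a \<oplus> w \<otimes> w) \<ominus> (w \<oplus> w))"
    using a wc one_closed by (simp add: a_minus_def minus_add closed a_ac)
  also have "\<dots> = \<one>" using two two' a wc one_closed by (simp add: closed)
  finally have yy: "a \<otimes> a \<oplus> y \<otimes> y = \<one>" .
  define v where "v = a \<oplus> \<i> \<odot> y"
  have vc: "v \<in> carrier A" by (simp add: v_def a yc closed)
  have va: "adj A v = a \<oplus> (-\<i>) \<odot> y" by (simp add: v_def adj_add adj_smult a yc closed ya)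
  have c: "\<i> \<odot> (y \<otimes> a) \<oplus> (-\<i>) \<odot> (y \<otimes> a) = \<zero>"
    using smult_l_distr[of "y \<otimes> a" "\<i>" "-\<i>"] yc a by (simp add: closed)
  have "adj A v \<otimes> v = (a \<otimes> a \<oplus> \<i> \<odot> (y \<otimes> a)) \<oplus> ((-\<i>) \<odot> (y \<otimes> a) \<oplus> y \<otimes> y)"
    unfolding va unfolding v_def using a yc ay
    by (simp add: l_distr r_distr closed smult_mult_l smult_mult_r smult_one smult_r_distr a_ac
        flip: smult_assoc)
  also have "\<dots> = (a \<otimes> a \<oplus> y \<otimes> y) \<oplus> (\<i> \<odot> (y \<otimes> a) \<oplus> (-\<i>) \<odot> (y \<otimes> a))"
    using a yc by (simp add: closed a_ac)
  also have "\<dots> = \<one>" using c yy one_closed by simp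
  finally have vv: "adj A v \<otimes> v = \<one>" .
  have "v \<oplus> adj A v = (a \<oplus> a) \<oplus> (\<i> \<odot> y \<oplus> (-\<i>) \<odot> y)"
    unfolding va unfolding v_def using a yc by (simp add: closed a_ac)
  also have "\<dots> = 2 \<odot> a"
    using smult_l_distr[OF yc, of "\<i>" "-\<i>", symmetric] smult_l_distr[OF a(1), of 1 1] a yc
    by (simp add: smult_one)
  finally show ?thesis using that vc vv by blast
qed

lemma star_homD:
  assumes "star_hom A B h"
  shows "x \<in> carrier A \<Longrightarrow> h x \<in> carrier B"
    and "\<lbrakk>x \<in> carrier A; y \<in> carrier A\<rbrakk> \<Longrightarrow> h (x \<oplus>\<^bsub>A\<^esub> y) = h x \<oplus>\<^bsub>B\<^esub> h y"
    and "x \<in> carrier A \<Longrightarrow> h (c \<odot>\<^bsub>A\<^esub> x) = c \<odot>\<^bsub>B\<^esub> h x"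
    and "\<lbrakk>x \<in> carrier A; y \<in> carrier A\<rbrakk> \<Longrightarrow> h (x \<otimes>\<^bsub>A\<^esub> y) = h x \<otimes>\<^bsub>B\<^esub> h y"
    and "x \<in> carrier A \<Longrightarrow> h (adj A x) = adj B (h x)"
  using assms by (auto simp: star_hom_def)

lemma star_hom_minus:
  assumes "cstar_algebra A" "cstar_algebra B" "star_hom A B h" "x \<in> carrier A" "y \<in> carrier A"
  shows "h (x \<ominus>\<^bsub>A\<^esub> y) = h x \<ominus>\<^bsub>B\<^esub> h y"
  using assms star_homD[OF assms(3)] cstar_algebra.smult_closed[OF assms(1)]
  by (simp add: cstar_algebra.minus_smult)

lemma star_hom_zero:
  assumes "cstar_algebra A" "cstar_algebra B" "star_hom A B h"
  shows "h \<zero>\<^bsub>A\<^esub> = \<zero>\<^bsub>B\<^esub>"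
proof -
  interpret A: cstar_algebra A by fact
  interpret B: cstar_algebra B by fact
  show ?thesis
    using star_homD(3)[OF assms(3), of "\<zero>\<^bsub>A\<^esub>" 0] star_homD(1)[OF assms(3), of "\<zero>\<^bsub>A\<^esub>"] by simp
qed

lemma star_hom_comp:
  assumes "star_hom A B h" "star_hom B C k"
  shows "star_hom A C (k \<circ> h)"
  using assms unfolding star_hom_def by (auto simp: Pi_iff)

definition contractive where
  "contractive A B h \<longleftrightarrow> (\<forall>x\<in>carrier A. nrm B (h x) \<le> nrm A x)"

text \<open>For self-adjoint a of norm below 1, the element h(v) has h(v)^* h(v) = h(1), a
  self-adjoint idempotent of norm at most 1. So h(a), the average of h(v) and its adjoint, has norm
  at most 1. The detour through h(1) is due to B possibly having no unit preserved by h.\<close>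

theorem star_hom_contractive:
  assumes "unital_cstar_algebra A" "cstar_algebra B" and h: "star_hom A B h"
  shows "contractive A B h"
proof -
  interpret A: unital_cstar_algebra A by fact
  interpret B: cstar_algebra B by fact
  note hD = star_homD[OF h]
  have sa1: "nrm B (h a) \<le> 1" if a: "a \<in> carrier A" "adj A a = a" "nrm A a < 1" for a
  proof -
    obtain v where v: "v \<in> carrier A" "adj A v \<otimes>\<^bsub>A\<^esub> v = \<one>\<^bsub>A\<^esub>" "v \<oplus>\<^bsub>A\<^esub> adj A v = 2 \<odot>\<^bsub>A\<^esub> a"
      using A.self_adjoint_unitary_part[OF a] by blast
    let ?p = "h \<one>\<^bsub>A\<^esub>"
    have p: "?p \<in> carrier B" using hD(1) A.one_closed by blast
    have adj1: "adj A \<one>\<^bsub>A\<^esub> = \<one>\<^bsub>A\<^esub>"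
      using v(1,2) A.adj_mult[of "adj A v" v] by (simp add: A.adj_closed A.adj_adj)
    have "adj B ?p \<otimes>\<^bsub>B\<^esub> ?p = ?p"
      using adj1 A.one_closed A.l_one hD(4)[of "\<one>\<^bsub>A\<^esub>" "\<one>\<^bsub>A\<^esub>"] hD(5)[of "\<one>\<^bsub>A\<^esub>"] by simp
    then have "nrm B ?p = (nrm B ?p)\<^sup>2" using B.cstar_identity[OF p] by simp
    then have p1: "nrm B ?p \<le> 1" by (auto simp: power2_eq_square)
    have hv: "h v \<in> carrier B" using hD(1) v(1) by blast
    have "(nrm B (h v))\<^sup>2 = nrm B ?p"
      using B.cstar_identity[OF hv] hD(4)[of "adj A v" v] hD(5)[OF v(1)] v by (simp add: A.adj_closed)
    then have "(nrm B (h v))\<^sup>2 \<le> 1\<^sup>2" using p1 by simp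
    then have hv1: "nrm B (h v) \<le> 1" by (rule power2_le_imp_le) simp
    have "2 \<odot>\<^bsub>B\<^esub> h a = h v \<oplus>\<^bsub>B\<^esub> adj B (h v)"
      using hD(2)[of v "adj A v"] hD(3)[of a 2] hD(5)[of v] v a by (simp add: A.adj_closed)
    then have "2 * nrm B (h a) \<le> nrm B (h v) + nrm B (adj B (h v))"
      using B.nrm_smult[of "h a" 2] B.nrm_triangle[of "h v" "adj B (h v)"] hv hD(1) a
      by (simp add: B.adj_closed)
    then show ?thesis using hv1 hv by simp
  qed
  have sa: "nrm B (h a) \<le> nrm A a" if a: "a \<in> carrier A" "adj A a = a" for a
  proof (rule field_le_epsilon)
    fix e :: real assume "e > 0"
    \<comment> \<open>Dividing by slightly more than the norm makes the norm of the multiple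
      strictly less than 1 and also covers a = 0.\<close>
    let ?s = "nrm A a + e"
    have s: "?s > 0" using A.nrm_nonneg[OF a(1)] \<open>e > 0\<close> by simp
    define c where "c = 1 / ?s"
    have c: "c > 0" using s by (simp add: c_def)
    have "c * nrm A a < 1" using s \<open>e > 0\<close> by (simp add: c_def)
    then have "nrm A (complex_of_real c \<odot>\<^bsub>A\<^esub> a) < 1" using c a by (simp add: A.nrm_smult)
    then have "nrm B (h (complex_of_real c \<odot>\<^bsub>A\<^esub> a)) \<le> 1"
      by (intro sa1) (auto simp: a A.adj_smult A.closed)
    then have "c * nrm B (h a) \<le> 1" using c a hD(1) by (simp add: hD(3) B.nrm_smult)
    then show "nrm B (h a) \<le> nrm A a + e" using s by (simp add: c_def field_simps)
  qed
  have "nrm B (h x) \<le> nrm A x" if x: "x \<in> carrier A" for x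
  proof (rule power2_le_imp_le)
    \<comment> \<open>The product of \<open>adj A x\<close> and \<open>x\<close> is self-adjoint, so
      the C*-identity on both sides reduces the general case to the self-adjoint one.\<close>
    have "(nrm B (h x))\<^sup>2 = nrm B (h (adj A x \<otimes>\<^bsub>A\<^esub> x))"
      using B.cstar_identity[of "h x"] hD x by (simp add: A.closed)
    also have "\<dots> \<le> nrm A (adj A x \<otimes>\<^bsub>A\<^esub> x)"
      using x by (intro sa) (auto simp: A.closed A.adj_mult A.adj_adj)
    finally show "(nrm B (h x))\<^sup>2 \<le> (nrm A x)\<^sup>2" using A.cstar_identity[OF x] by simp
  qed (use x A.nrm_nonneg in auto)
  then show ?thesis by (simp add: contractive_def)
qed

section \<open>Subalgebras, products and generated subalgebras\<close>

context cstar_algebra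
begin

lemma closed_subspaceI:
  assumes "S \<subseteq> carrier A" "\<zero> \<in> S" "\<And>x y. \<lbrakk>x \<in> S; y \<in> S\<rbrakk> \<Longrightarrow> x \<oplus> y \<in> S"
    and "\<And>c x. x \<in> S \<Longrightarrow> c \<odot> x \<in> S"
    and "\<And>X x. \<lbrakk>cstar_lim A X x; \<And>n. X n \<in> S\<rbrakk> \<Longrightarrow> x \<in> S"
  shows "closed_subspace A S"
  unfolding closed_subspace_def
proof (intro conjI allI ballI impI)
  show "x \<in> S" if "x \<in> carrier A" "\<forall>n. X n \<in> S" "(\<lambda>n. nrm A (X n \<ominus> x)) \<longlonglongrightarrow> 0" for X x
  proof (rule assms(5)[of X])
    show "X n \<in> S" for n using that(2) by blast
    then have "X n \<in> carrier A" for n using assms(1) by blast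
    then show "cstar_lim A X x" using that by (simp add: cstar_lim_def)
  qed
qed (use assms(1-4) in auto)

lemma closed_subspaceD:
  assumes "closed_subspace A S"
  shows "S \<subseteq> carrier A" "\<zero> \<in> S" "\<And>x y. \<lbrakk>x \<in> S; y \<in> S\<rbrakk> \<Longrightarrow> x \<oplus> y \<in> S"
    and "\<And>c x. x \<in> S \<Longrightarrow> c \<odot> x \<in> S"
    and "\<And>X x. \<lbrakk>cstar_lim A X x; \<And>n. X n \<in> S\<rbrakk> \<Longrightarrow> x \<in> S"
proof -
  show "x \<in> S" if "cstar_lim A X x" "\<And>n. X n \<in> S" for X x
    using assms that unfolding closed_subspace_def cstar_lim_def by blast
qed (use assms in \<open>simp_all add: closed_subspace_def\<close>)

lemma closed_subspace_minus:
  assumes "closed_subspace A S" "x \<in> S" "y \<in> S"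
  shows "x \<ominus> y \<in> S"
proof -
  have "y \<in> carrier A" using closed_subspaceD(1)[OF assms(1)] assms(3) by blast
  then show ?thesis
    using closed_subspaceD(3,4)[OF assms(1)] assms(2,3) by (simp add: minus_smult)
qed

lemma cstar_subalgebraD:
  assumes "cstar_subalgebra A S"
  shows "closed_subspace A S" "\<And>x y. \<lbrakk>x \<in> S; y \<in> S\<rbrakk> \<Longrightarrow> x \<otimes> y \<in> S" "\<And>x. x \<in> S \<Longrightarrow> adj A x \<in> S"
  using assms by (auto simp: cstar_subalgebra_def)

lemma cstar_subalgebra_carrier: "cstar_subalgebra A (carrier A)"
  unfolding cstar_subalgebra_def
  by (intro conjI closed_subspaceI) (auto simp: closed cstar_limD)

lemma cstar_algebra_subalgebra:
  assumes "cstar_subalgebra A S"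
  shows "cstar_algebra (A\<lparr>carrier := S\<rparr>)"
proof -
  note D = closed_subspaceD[OF cstar_subalgebraD(1)[OF assms]] cstar_subalgebraD(2,3)[OF assms]
  note [simp] = D(2,3,4,6,7)
  have [simp]: "x \<in> carrier A" if "x \<in> S" for x using D(1) that by blast
  show ?thesis
  proof (rule cstar_algebraI, goal_cases)
    case (28 X)
    then have X: "X n \<in> S" for n by simp
    have "\<exists>N. \<forall>m\<ge>N. \<forall>n\<ge>N. nrm A (X m \<ominus> X n) < e" if "e > 0" for e
      using 28(2)[OF that] X by (simp add: minus_smult)
    from complete[OF _ this] X obtain x where
      x: "x \<in> carrier A" "(\<lambda>n. nrm A (X n \<ominus> x)) \<longlonglongrightarrow> 0" by auto
    have "x \<in> S" using D(5)[of X x] x X by (simp add: cstar_lim_def)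
    then show ?case using x by (intro bexI[of _ x]) (simp_all add: minus_smult)
  qed (simp_all add: a_ac smult_l_distr smult_r_distr smult_assoc smult_one
      mult_assoc l_distr r_distr smult_mult_l smult_mult_r adj_adj adj_add adj_smult adj_mult
      nrm_nonneg nrm_eq_0 nrm_triangle nrm_smult nrm_mult cstar_identity)
qed

text \<open>The additive inverse depends on the carrier, so the two differences are a priori
  distinct terms; both equal \<open>x \<oplus> (-1) \<odot> y\<close>.\<close>

lemma minus_subalgebra:
  assumes "cstar_subalgebra A S" "x \<in> S" "y \<in> S"
  shows "x \<ominus>\<^bsub>A\<lparr>carrier := S\<rparr>\<^esub> y = x \<ominus> y"
  using cstar_algebra.minus_smult[OF cstar_algebra_subalgebra[OF assms(1)], of y x] assms
    closed_subspaceD(1)[OF cstar_subalgebraD(1)[OF assms(1)]] minus_smult[of y x] by auto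

lemma cstar_lim_subalgebra:
  assumes "cstar_subalgebra A S"
  shows "cstar_lim (A\<lparr>carrier := S\<rparr>) X x \<longleftrightarrow> (\<forall>n. X n \<in> S) \<and> x \<in> S \<and> cstar_lim A X x"
  using closed_subspaceD(1)[OF cstar_subalgebraD(1)[OF assms]]
  by (auto simp: cstar_lim_def minus_subalgebra[OF assms])

lemma closed_subspace_subalgebra:
  assumes S: "cstar_subalgebra A S" and E: "closed_subspace (A\<lparr>carrier := S\<rparr>) E"
  shows "closed_subspace A E"
proof -
  note D = closed_subspaceD[OF cstar_subalgebraD(1)[OF S]]
  note E' = cstar_algebra.closed_subspaceD[OF cstar_algebra_subalgebra[OF S] E]
  show ?thesis
  proof (rule closed_subspaceI)
    fix X x assume X: "cstar_lim A X x" "\<And>n. X n \<in> E"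
    have XS: "X n \<in> S" for n using X(2) E'(1) by auto
    have "x \<in> S" using D(5)[OF X(1)] XS by blast
    then show "x \<in> E" using E'(5)[of X x] XS X by (simp add: cstar_lim_subalgebra[OF S])
  qed (use D(1) E'(1-4) in auto)
qed

lemma cstar_subalgebra_subalgebra:
  assumes "cstar_subalgebra A S" "cstar_subalgebra (A\<lparr>carrier := S\<rparr>) E"
  shows "cstar_subalgebra A E"
  using closed_subspace_subalgebra[OF assms(1)] assms(2) by (simp add: cstar_subalgebra_def)

lemma closed_subspace_Inter:
  assumes "\<And>S. S \<in> \<S> \<Longrightarrow> closed_subspace A S" "\<S> \<noteq> {}"
  shows "closed_subspace A (\<Inter>\<S>)"
proof (rule closed_subspaceI)
  note D = closed_subspaceD[OF assms(1)]
  obtain S where S: "S \<in> \<S>" using assms(2) by blast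
  show "\<Inter>\<S> \<subseteq> carrier A" using D(1)[OF S] S by blast
  show "\<zero> \<in> \<Inter>\<S>" using D(2) by simp
  show "x \<oplus> y \<in> \<Inter>\<S>" if "x \<in> \<Inter>\<S>" "y \<in> \<Inter>\<S>" for x y using D(3) that by simp
  show "c \<odot> x \<in> \<Inter>\<S>" if "x \<in> \<Inter>\<S>" for c x using D(4) that by simp
  show "x \<in> \<Inter>\<S>" if "cstar_lim A X x" "\<And>n. X n \<in> \<Inter>\<S>" for X x
  proof (rule InterI)
    fix T assume T: "T \<in> \<S>"
    show "x \<in> T" by (rule D(5)[OF T that(1)]) (use that(2) T in blast)
  qed
qed

section \<open>Closed spans and generated subalgebras\<close>

lemma closed_span_closed:
  assumes "X \<subseteq> carrier A"
  shows "closed_subspace A (closed_span A X)"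
  unfolding closed_span_def
  by (rule closed_subspace_Inter) (use assms cstar_subalgebraD(1)[OF cstar_subalgebra_carrier] in auto)

lemma closed_span_superset: "X \<subseteq> closed_span A X"
  by (auto simp: closed_span_def)

lemma closed_span_minimal: "closed_subspace A S \<Longrightarrow> X \<subseteq> S \<Longrightarrow> closed_span A X \<subseteq> S"
  by (auto simp: closed_span_def)

text \<open>Products are handled one factor at a time: with one factor fixed, the elements whose
  product with it stays in the span form a closed subspace. First the left factor is taken from X,
  then it is freed.\<close>

lemma closed_span_subalgebra:
  assumes X: "X \<subseteq> carrier A"
    and mult: "\<And>x y. \<lbrakk>x \<in> X; y \<in> X\<rbrakk> \<Longrightarrow> x \<otimes> y \<in> X"
    and adj: "\<And>x. x \<in> X \<Longrightarrow> adj A x \<in> X"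
  shows "cstar_subalgebra A (closed_span A X)"
proof -
  let ?S = "closed_span A X"
  note D = closed_subspaceD[OF closed_span_closed[OF X]]
  have left: "closed_subspace A {y \<in> carrier A. x \<otimes> y \<in> ?S}" if "x \<in> carrier A" for x
  proof (rule closed_subspaceI, goal_cases)
    case (5 Y y)
    have "x \<otimes> y \<in> ?S"
      using D(5)[OF cstar_lim_mult[OF cstar_lim_const[OF that] 5(1)]] 5(2) by simp
    then show ?case using cstar_limD(2)[OF 5(1)] by simp
  qed (use that D(2,3,4) in \<open>auto simp: closed r_distr smult_mult_r\<close>)
  have right: "closed_subspace A {x \<in> carrier A. x \<otimes> y \<in> ?S}" if "y \<in> carrier A" for y
  proof (rule closed_subspaceI, goal_cases)
    case (5 Y x)
    have "x \<otimes> y \<in> ?S"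
      using D(5)[OF cstar_lim_mult[OF 5(1) cstar_lim_const[OF that]]] 5(2) by simp
    then show ?case using cstar_limD(2)[OF 5(1)] by simp
  qed (use that D(2,3,4) in \<open>auto simp: closed l_distr smult_mult_l\<close>)
  have "closed_subspace A {x \<in> carrier A. adj A x \<in> ?S}"
  proof (rule closed_subspaceI, goal_cases)
    case (5 Y x)
    have "adj A x \<in> ?S"
      using D(5)[OF cstar_lim_adj[OF 5(1)]] 5(2) by simp
    then show ?case using cstar_limD(2)[OF 5(1)] by simp
  qed (use D(2,3,4) in \<open>auto simp: closed adj_add adj_smult\<close>)
  from closed_span_minimal[OF this, of X] have adj': "adj A x \<in> ?S" if "x \<in> ?S" for x
    using that X adj closed_span_superset by blast
  have m1: "x \<otimes> y \<in> ?S" if "x \<in> X" "y \<in> ?S" for x y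
    using closed_span_minimal[OF left[of x], of X] that X mult closed_span_superset by blast
  have "x \<otimes> y \<in> ?S" if "x \<in> ?S" "y \<in> ?S" for x y
    using closed_span_minimal[OF right[of y], of X] that X D(1) m1 by blast
  then show ?thesis using adj' closed_span_closed[OF X] by (simp add: cstar_subalgebra_def)
qed

lemma cstar_generated_subalgebra:
  assumes "X \<subseteq> carrier A"
  shows "cstar_subalgebra A (carrier (cstar_generated A X))"
proof -
  let ?\<S> = "{S. cstar_subalgebra A S \<and> X \<subseteq> S}"
  have "closed_subspace A (\<Inter>?\<S>)"
    by (rule closed_subspace_Inter) (use assms cstar_subalgebra_carrier cstar_subalgebraD(1) in auto)
  then show ?thesis
    using cstar_subalgebraD(2,3) by (auto simp: cstar_subalgebra_def cstar_generated_def)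
qed

lemma cstar_generated_superset: "X \<subseteq> carrier (cstar_generated A X)"
  by (auto simp: cstar_generated_def)

lemma cstar_generated_minimal:
  "cstar_subalgebra A S \<Longrightarrow> X \<subseteq> S \<Longrightarrow> carrier (cstar_generated A X) \<subseteq> S"
  by (auto simp: cstar_generated_def)

lemma cstar_generated_eq: "cstar_generated A X = A\<lparr>carrier := carrier (cstar_generated A X)\<rparr>"
  by (simp add: cstar_generated_def)

lemma cstar_generated_subset:
  assumes "X \<subseteq> carrier A"
  shows "carrier (cstar_generated A X) \<subseteq> carrier A"
  using cstar_generated_minimal[OF cstar_subalgebra_carrier assms] .

lemma cstar_algebra_generated: "X \<subseteq> carrier A \<Longrightarrow> cstar_algebra (cstar_generated A X)"
  using cstar_algebra_subalgebra[OF cstar_generated_subalgebra] cstar_generated_eq by metis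

end

lemma (in unital_cstar_algebra) unital_cstar_algebra_subalgebra:
  assumes "cstar_subalgebra A S" "\<one> \<in> S"
  shows "unital_cstar_algebra (A\<lparr>carrier := S\<rparr>)"
  using cstar_algebra_subalgebra[OF assms(1)] assms(2)
    closed_subspaceD(1)[OF cstar_subalgebraD(1)[OF assms(1)]]
  by (auto simp: unital_cstar_algebra_def unital_cstar_algebra_axioms_def l_one r_one)

lemma (in unital_cstar_algebra) unital_cstar_algebra_generated:
  assumes "X \<subseteq> carrier A" "\<one> \<in> carrier (cstar_generated A X)"
  shows "unital_cstar_algebra (cstar_generated A X)"
  using unital_cstar_algebra_subalgebra[OF cstar_generated_subalgebra[OF assms(1)] assms(2)]
  by (simp flip: cstar_generated_eq)

lemma cstar_generated_simps [simp]:
  "mult (cstar_generated A X) = mult A" "one (cstar_generated A X) = one A"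
  "add (cstar_generated A X) = add A" "zero (cstar_generated A X) = zero A"
  "smult (cstar_generated A X) = smult A" "adj (cstar_generated A X) = adj A"
  "nrm (cstar_generated A X) = nrm A"
  by (simp_all add: cstar_generated_def)

lemma contractive_cstar_lim:
  assumes "cstar_algebra A" "cstar_algebra B" "star_hom A B h" "contractive A B h" "cstar_lim A X x"
  shows "cstar_lim B (\<lambda>n. h (X n)) (h x)"
proof -
  interpret A: cstar_algebra A by fact
  interpret B: cstar_algebra B by fact
  note X = A.cstar_limD[OF assms(5)]
  show ?thesis
  proof (rule B.cstar_limI[OF _ _ X(3)])
    show "nrm B (h (X n) \<ominus>\<^bsub>B\<^esub> h x) \<le> nrm A (X n \<ominus>\<^bsub>A\<^esub> x)" for n
      using assms(4) X(1,2) by (simp add: contractive_def flip: star_hom_minus[OF assms(1-3)])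
  qed (use X star_homD(1)[OF assms(3)] in auto)
qed

lemma closed_subspace_vimage:
  assumes "cstar_algebra A" "cstar_algebra B" "star_hom A B h" "contractive A B h" "closed_subspace B S"
  shows "closed_subspace A {x \<in> carrier A. h x \<in> S}"
proof -
  interpret A: cstar_algebra A by fact
  interpret B: cstar_algebra B by fact
  note D = B.closed_subspaceD[OF assms(5)] and h = star_homD[OF assms(3)]
  show ?thesis
  proof (rule A.closed_subspaceI, goal_cases)
    case (5 X x)
    then show ?case
      using D(5)[OF contractive_cstar_lim[OF assms(1-4) 5(1)]] A.cstar_limD(2) by blast
  qed (use D h star_hom_zero[OF assms(1-3)] in \<open>auto simp: A.closed\<close>)
qed

lemma cstar_subalgebra_vimage:
  assumes "cstar_algebra A" "cstar_algebra B" "star_hom A B h" "contractive A B h" "cstar_subalgebra B S"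
  shows "cstar_subalgebra A {x \<in> carrier A. h x \<in> S}"
  using closed_subspace_vimage[OF assms(1-4)] assms(5) star_homD[OF assms(3)]
    cstar_algebra.closed[OF assms(1)]
  by (simp add: cstar_subalgebra_def)

text \<open>Contractivity makes both maps preserve limits, and uniqueness of limits closes the set.
  This is the source of uniqueness for homomorphisms given on generators.\<close>

lemma cstar_subalgebra_equalizer:
  assumes "cstar_algebra A" "cstar_algebra B" and h: "star_hom A B h" "contractive A B h"
    and k: "star_hom A B k" "contractive A B k"
  shows "cstar_subalgebra A {x \<in> carrier A. h x = k x}"
proof -
  interpret A: cstar_algebra A by fact
  interpret B: cstar_algebra B by fact
  note hk = star_homD[OF h(1)] star_homD[OF k(1)]
  have "closed_subspace A {x \<in> carrier A. h x = k x}"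
  proof (rule A.closed_subspaceI, goal_cases)
    case (5 X x)
    then have "cstar_lim B (\<lambda>n. h (X n)) (h x)" "cstar_lim B (\<lambda>n. h (X n)) (k x)"
      using contractive_cstar_lim[OF assms(1,2) h 5(1)] contractive_cstar_lim[OF assms(1,2) k 5(1)]
      by simp_all
    then show ?case using B.cstar_lim_unique A.cstar_limD(2)[OF 5(1)] by simp
  qed (use hk star_hom_zero[OF assms(1,2) h(1)] star_hom_zero[OF assms(1,2) k(1)] in \<open>auto simp: A.closed\<close>)
  then show ?thesis using hk A.closed by (simp add: cstar_subalgebra_def)
qed

lemma (in cstar_algebra) star_hom_eq_on_generated:
  assumes X: "X \<subseteq> carrier A" and B: "cstar_algebra B"
    and h: "star_hom (cstar_generated A X) B h" "contractive (cstar_generated A X) B h"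
    and k: "star_hom (cstar_generated A X) B k" "contractive (cstar_generated A X) B k"
    and eq: "\<And>x. x \<in> X \<Longrightarrow> h x = k x" and x: "x \<in> carrier (cstar_generated A X)"
  shows "h x = k x"
proof -
  let ?E = "{x \<in> carrier (cstar_generated A X). h x = k x}"
  have "cstar_subalgebra (cstar_generated A X) ?E"
    by (rule cstar_subalgebra_equalizer[OF cstar_algebra_generated[OF X] B h k])
  then have "cstar_subalgebra A ?E"
    using cstar_subalgebra_subalgebra[OF cstar_generated_subalgebra[OF X], of ?E]
    by (simp flip: cstar_generated_eq)
  then have "carrier (cstar_generated A X) \<subseteq> ?E"
    by (rule cstar_generated_minimal) (use cstar_generated_superset[of X] eq in auto)
  then show ?thesis using x by blast
qed

lemma star_hom_image_generated:
  assumes "cstar_algebra A" "cstar_algebra B" "star_hom A B h" "contractive A B h"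
    and "X \<subseteq> carrier A" "Y \<subseteq> carrier B" "h ` X \<subseteq> carrier (cstar_generated B Y)"
  shows "h ` carrier (cstar_generated A X) \<subseteq> carrier (cstar_generated B Y)"
  using cstar_algebra.cstar_generated_minimal[OF assms(1)
      cstar_subalgebra_vimage[OF assms(1-4) cstar_algebra.cstar_generated_subalgebra[OF assms(2,6)]],
      of X] assms(5,7) by blast

subsection \<open>Products\<close>

lemma cstar_product_simps [simp]:
  "mult (cstar_product I A) x y = (\<lambda>i\<in>I. x i \<otimes>\<^bsub>A i\<^esub> y i)"
  "one (cstar_product I A) = (\<lambda>i\<in>I. \<one>\<^bsub>A i\<^esub>)"
  "zero (cstar_product I A) = (\<lambda>i\<in>I. \<zero>\<^bsub>A i\<^esub>)"
  "add (cstar_product I A) x y = (\<lambda>i\<in>I. x i \<oplus>\<^bsub>A i\<^esub> y i)"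
  "smult (cstar_product I A) c x = (\<lambda>i\<in>I. c \<odot>\<^bsub>A i\<^esub> x i)"
  "adj (cstar_product I A) x = (\<lambda>i\<in>I. adj (A i) (x i))"
  by (simp_all add: cstar_product_def)

context
  fixes I :: "'i set" and A :: "'i \<Rightarrow> 'a cstar_struct"
  assumes A: "\<And>i. i \<in> I \<Longrightarrow> cstar_algebra (A i)"
begin

private abbreviation "N \<equiv> nrm (cstar_product I A)"

lemma cstar_productI:
  assumes "\<And>i. i \<in> I \<Longrightarrow> x i \<in> carrier (A i)" "x \<in> extensional I"
    and "\<And>i. i \<in> I \<Longrightarrow> nrm (A i) (x i) \<le> C"
  shows "x \<in> carrier (cstar_product I A)"
  using assms by (auto simp: cstar_product_def PiE_def intro!: bdd_aboveI[of _ C])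

lemma cstar_productD:
  assumes "x \<in> carrier (cstar_product I A)"
  shows "i \<in> I \<Longrightarrow> x i \<in> carrier (A i)" "x \<in> extensional I"
  using assms by (auto simp: cstar_product_def PiE_def)

lemma nrm_cstar_product_ge:
  assumes "x \<in> carrier (cstar_product I A)" "i \<in> I"
  shows "nrm (A i) (x i) \<le> N x"
  using assms unfolding cstar_product_def by (auto intro!: cSup_upper)

lemma nrm_cstar_product_nonneg: "x \<in> carrier (cstar_product I A) \<Longrightarrow> 0 \<le> N x"
  unfolding cstar_product_def by (auto intro!: cSup_upper)

lemma nrm_cstar_product_le:
  assumes "0 \<le> C" "\<And>i. i \<in> I \<Longrightarrow> nrm (A i) (x i) \<le> C"
  shows "N x \<le> C"
  using assms unfolding cstar_product_def by (auto intro!: cSup_least)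

text \<open>Algebraic identities are checked in each coordinate; the work is in the supremum norm.
  The 0 inserted in the supremum covers the empty index set, for which the product is the zero
  algebra.\<close>

lemma cstar_algebra_product: "cstar_algebra (cstar_product I A)"
proof -
  note D = cstar_productD and ge = nrm_cstar_product_ge and nn = nrm_cstar_product_nonneg
    and le = nrm_cstar_product_le
  note [simp] = D(1) cstar_algebra.closed[OF A] 
  have ext: "x = y" if "x \<in> extensional I" "y \<in> extensional I" "\<And>i. i \<in> I \<Longrightarrow> x i = y i"
    for x y :: "'i \<Rightarrow> 'a"
    using that by (rule extensionalityI)
  have ag: "abelian_group (A i)" if "i \<in> I" for i using A[OF that] by (rule cstar_algebra.axioms)
  note [simp] = abelian_groupE(1,2)[OF ag]
  have smc: "c \<odot>\<^bsub>cstar_product I A\<^esub> x \<in> carrier (cstar_product I A)"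
    if x: "x \<in> carrier (cstar_product I A)" for c x
  proof (rule cstar_productI)
    show "nrm (A i) ((c \<odot>\<^bsub>cstar_product I A\<^esub> x) i) \<le> cmod c * N x" if "i \<in> I" for i
      using ge[OF x that] that x by (simp add: cstar_algebra.nrm_smult[OF A] mult_left_mono)
  qed (use x in simp_all)
  show ?thesis
  proof (rule cstar_algebraI, goal_cases)
    case (1 x y)
    show ?case
    proof (rule cstar_productI)
      show "nrm (A i) ((x \<oplus>\<^bsub>cstar_product I A\<^esub> y) i) \<le> N x + N y" if "i \<in> I" for i
        using cstar_algebra.nrm_triangle[OF A[OF that], of "x i" "y i"] ge[OF 1(1) that] ge[OF 1(2) that]
          1 that by simp
    qed (use 1 in simp_all)
  next
    case 2
    show ?case
      by (rule cstar_productI[where C = 0]) (use cstar_algebra.nrm_zero[OF A] in simp_all)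
  next
    case (6 x c)
    then show ?case by (rule smc)
  next
    case (11 x y)
    show ?case
    proof (rule cstar_productI)
      show "nrm (A i) ((x \<otimes>\<^bsub>cstar_product I A\<^esub> y) i) \<le> N x * N y" if "i \<in> I" for i
        using order_trans[OF cstar_algebra.nrm_mult[OF A[OF that], of "x i" "y i"]
            mult_mono[OF ge[OF 11(1) that] ge[OF 11(2) that]]] 11 that nn
          cstar_algebra.nrm_nonneg[OF A[OF that]] by simp
    qed (use 11 in simp_all)
  next
    case (17 x)
    show ?case
    proof (rule cstar_productI)
      show "nrm (A i) (adj (cstar_product I A) x i) \<le> N x" if "i \<in> I" for i
        using ge[OF 17 that] that 17 by (simp add: cstar_algebra.nrm_adj[OF A])
    qed (use 17 in simp_all)
  next
    case (22 x)
    then show ?case by (rule nn)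
  next
    case (23 x)
    have "N x = 0 \<longleftrightarrow> (\<forall>i\<in>I. nrm (A i) (x i) = 0)"
    proof
      assume "N x = 0"
      then show "\<forall>i\<in>I. nrm (A i) (x i) = 0"
        using ge[OF 23] 23 cstar_algebra.nrm_nonneg[OF A] by (force intro: antisym)
    next
      assume "\<forall>i\<in>I. nrm (A i) (x i) = 0"
      then show "N x = 0" using le[of 0 x] nn[OF 23] by force
    qed
    also have "\<dots> \<longleftrightarrow> (\<forall>i\<in>I. x i = \<zero>\<^bsub>A i\<^esub>)"
      using 23 by (simp add: cstar_algebra.nrm_eq_0[OF A])
    also have "\<dots> \<longleftrightarrow> x = \<zero>\<^bsub>cstar_product I A\<^esub>"
      using D(2)[OF 23] by (auto intro!: ext)
    finally show ?case .
  next
    case (24 x y)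
    show ?case
    proof (rule le)
      show "nrm (A i) ((x \<oplus>\<^bsub>cstar_product I A\<^esub> y) i) \<le> N x + N y" if "i \<in> I" for i
        using cstar_algebra.nrm_triangle[OF A[OF that], of "x i" "y i"] ge[OF 24(1) that] ge[OF 24(2) that]
          24 that by simp
    qed (use 24 nn in simp)
  next
    case (25 x c)
    have *: "N (c \<odot>\<^bsub>cstar_product I A\<^esub> x) \<le> cmod c * N x" if "x \<in> carrier (cstar_product I A)" for c x
      using ge[OF that] that nn[OF that]
      by (intro le) (simp_all add: cstar_algebra.nrm_smult[OF A] mult_left_mono)
    show ?case
    proof (cases "c = 0")
      case True
      then show ?thesis using *[OF 25, of c] nn[OF smc[OF 25, of c]] by simp
    next
      case False
      \<comment> \<open>The reverse inequality is the upper bound applied to the scalar 1/c.\<close>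
      have "(1 / c) \<odot>\<^bsub>cstar_product I A\<^esub> (c \<odot>\<^bsub>cstar_product I A\<^esub> x) = x"
        using D[OF 25] False
        by (intro ext) (simp_all add: cstar_algebra.smult_one[OF A] flip: cstar_algebra.smult_assoc[OF A])
      then have "N x \<le> cmod (1 / c) * N (c \<odot>\<^bsub>cstar_product I A\<^esub> x)"
        using *[OF smc[OF 25, of c], of "1 / c"] by metis
      then show ?thesis using *[OF 25, of c] False by (simp add: norm_divide field_simps)
    qed
  next
    case (26 x y)
    show ?case
    proof (rule le)
      show "nrm (A i) ((x \<otimes>\<^bsub>cstar_product I A\<^esub> y) i) \<le> N x * N y" if "i \<in> I" for i
        using order_trans[OF cstar_algebra.nrm_mult[OF A[OF that], of "x i" "y i"]
            mult_mono[OF ge[OF 26(1) that] ge[OF 26(2) that]]] 26 that nn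
          cstar_algebra.nrm_nonneg[OF A[OF that]] by simp
    qed (use 26 nn in simp)
  next
    case (27 x)
    let ?y = "adj (cstar_product I A) x \<otimes>\<^bsub>cstar_product I A\<^esub> x"
    have y: "nrm (A i) (?y i) = (nrm (A i) (x i))\<^sup>2" if "i \<in> I" for i
      using cstar_algebra.cstar_identity[OF A[OF that], of "x i"] 27 that by simp
    have yc: "?y \<in> carrier (cstar_product I A)"
    proof (rule cstar_productI)
      show "nrm (A i) (?y i) \<le> (N x)\<^sup>2" if "i \<in> I" for i
        unfolding y[OF that] using ge[OF 27 that] 27 that cstar_algebra.nrm_nonneg[OF A[OF that]]
        by (intro power_mono) auto
    qed (use 27 in simp_all)
    have "N ?y \<le> (N x)\<^sup>2"
    proof (rule le)
      show "nrm (A i) (?y i) \<le> (N x)\<^sup>2" if "i \<in> I" for i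
        unfolding y[OF that] using ge[OF 27 that] 27 that cstar_algebra.nrm_nonneg[OF A[OF that]]
        by (intro power_mono) auto
    qed simp
    \<comment> \<open>Taking square roots turns the lower bound for the supremum into a bound in
      each coordinate.\<close>
    moreover have "N x \<le> sqrt (N ?y)"
    proof (rule le)
      show "nrm (A i) (x i) \<le> sqrt (N ?y)" if "i \<in> I" for i
        using ge[OF yc that] unfolding y[OF that] by (rule real_le_rsqrt)
    qed (use nn[OF yc] in simp)
    then have "(N x)\<^sup>2 \<le> N ?y"
      using power_mono[of "N x" "sqrt (N ?y)" 2] nn[OF 27] nn[OF yc] by simp
    ultimately show ?case by simp
  next
    case (28 X)
    let ?M = "cstar_product I A"
    have dist: "nrm (A i) (X m i \<ominus>\<^bsub>A i\<^esub> X n i) \<le> N (X m \<oplus>\<^bsub>?M\<^esub> (-1) \<odot>\<^bsub>?M\<^esub> X n)" if "i \<in> I" for i m n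
    proof -
      have "X m \<oplus>\<^bsub>?M\<^esub> (-1) \<odot>\<^bsub>?M\<^esub> X n \<in> carrier ?M"
      proof (rule cstar_productI)
        show "nrm (A i) ((X m \<oplus>\<^bsub>?M\<^esub> (-1) \<odot>\<^bsub>?M\<^esub> X n) i) \<le> N (X m) + N (X n)" if "i \<in> I" for i
          using cstar_algebra.nrm_triangle[OF A[OF that], of "X m i" "(-1) \<odot>\<^bsub>A i\<^esub> X n i"]
            ge[OF 28(1) that, of m] ge[OF 28(1) that, of n] 28(1) that
          by (simp add: cstar_algebra.nrm_smult[OF A])
      qed (use 28(1) in simp_all)
      from ge[OF this that] show ?thesis
        using that 28(1) by (simp add: cstar_algebra.minus_smult[OF A])
    qed
    have "\<exists>x. cstar_lim (A i) (\<lambda>n. X n i) x" if i: "i \<in> I" for i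
    proof -
      have "\<exists>N. \<forall>m\<ge>N. \<forall>n\<ge>N. nrm (A i) (X m i \<ominus>\<^bsub>A i\<^esub> X n i) < e" if "e > 0" for e
        using 28(2)[OF that] dist[OF i] by (meson le_less_trans)
      from cstar_algebra.complete[OF A[OF i] _ this] show ?thesis
        using i 28(1) by (auto simp: cstar_lim_def)
    qed
    then obtain x' where x': "\<And>i. i \<in> I \<Longrightarrow> cstar_lim (A i) (\<lambda>n. X n i) (x' i)" by metis
    define x where "x = restrict x' I"
    have xl: "cstar_lim (A i) (\<lambda>n. X n i) (x i)" if "i \<in> I" for i
      using x'[OF that] that by (simp add: x_def)
    have xc: "x i \<in> carrier (A i)" if "i \<in> I" for i
      using cstar_algebra.cstar_limD(2)[OF A[OF that] xl[OF that]] .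
    \<comment> \<open>The coordinatewise limits are approached uniformly in the index: fix m and let
      n tend to infinity in the Cauchy estimate.\<close>
    have lim: "\<exists>M. \<forall>m\<ge>M. \<forall>i\<in>I. nrm (A i) (X m i \<ominus>\<^bsub>A i\<^esub> x i) \<le> e" if e: "e > 0" for e
    proof -
      obtain M where M: "\<And>m n. \<lbrakk>m \<ge> M; n \<ge> M\<rbrakk> \<Longrightarrow> N (X m \<oplus>\<^bsub>?M\<^esub> (-1) \<odot>\<^bsub>?M\<^esub> X n) < e"
        using 28(2)[OF e] by blast
      have "nrm (A i) (X m i \<ominus>\<^bsub>A i\<^esub> x i) \<le> e" if "m \<ge> M" "i \<in> I" for m i
      proof -
        interpret Ai: cstar_algebra "A i" using A[OF that(2)] .
        have "(\<lambda>n. e + nrm (A i) (X n i \<ominus>\<^bsub>A i\<^esub> x i)) \<longlonglongrightarrow> e + 0"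
          using Ai.cstar_limD(3)[OF xl[OF that(2)]] by (intro tendsto_intros)
        moreover have "eventually (\<lambda>n. nrm (A i) (X m i \<ominus>\<^bsub>A i\<^esub> x i) \<le> e + nrm (A i) (X n i \<ominus>\<^bsub>A i\<^esub> x i)) sequentially"
          using eventually_ge_at_top[of M]
        proof eventually_elim
          case (elim n)
          have "nrm (A i) (X m i \<ominus>\<^bsub>A i\<^esub> X n i) < e"
            using dist[OF that(2), of m n] M[OF that(1) elim] by simp
          then show ?case
            using Ai.nrm_dist_triangle[of "X m i" "X n i" "x i"] xc[OF that(2)] that(2) 28(1) by simp
        qed
        ultimately have "nrm (A i) (X m i \<ominus>\<^bsub>A i\<^esub> x i) \<le> e + 0"
          by (intro tendsto_lowerbound[of _ "e + 0" sequentially]) auto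
        then show ?thesis by simp
      qed
      then show ?thesis by blast
    qed
    obtain M where M: "\<And>i. i \<in> I \<Longrightarrow> nrm (A i) (X M i \<ominus>\<^bsub>A i\<^esub> x i) \<le> 1" using lim[of 1] by auto
    have xM: "x \<in> carrier ?M"
    proof (rule cstar_productI)
      show "nrm (A i) (x i) \<le> 1 + N (X M)" if "i \<in> I" for i
      proof -
        interpret Ai: cstar_algebra "A i" using A[OF that] .
        show ?thesis
          using Ai.nrm_le_minus[of "x i" "X M i"] Ai.nrm_minus_commute[of "x i" "X M i"]
            M[OF that] ge[OF 28(1) that, of M] xc[OF that] that 28(1) by simp
      qed
    qed (use xc in \<open>auto simp: x_def\<close>)
    have "(\<lambda>n. N (X n \<oplus>\<^bsub>?M\<^esub> (-1) \<odot>\<^bsub>?M\<^esub> x)) \<longlonglongrightarrow> 0"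
    proof (rule LIMSEQ_I)
      fix r :: real assume "r > 0"
      then obtain K where K: "\<And>m i. \<lbrakk>m \<ge> K; i \<in> I\<rbrakk> \<Longrightarrow> nrm (A i) (X m i \<ominus>\<^bsub>A i\<^esub> x i) \<le> r / 2"
        using lim[of "r / 2"] by auto
      have "norm (N (X m \<oplus>\<^bsub>?M\<^esub> (-1) \<odot>\<^bsub>?M\<^esub> x) - 0) < r" if "m \<ge> K" for m
      proof -
        have e: "nrm (A i) ((X m \<oplus>\<^bsub>?M\<^esub> (-1) \<odot>\<^bsub>?M\<^esub> x) i) \<le> r / 2" if "i \<in> I" for i
          using K[OF \<open>m \<ge> K\<close> that] that xc[OF that] 28(1)
          by (simp add: cstar_algebra.minus_smult[OF A])
        have "N (X m \<oplus>\<^bsub>?M\<^esub> (-1) \<odot>\<^bsub>?M\<^esub> x) \<le> r / 2"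
          using e \<open>r > 0\<close> by (intro le) auto
        moreover have "X m \<oplus>\<^bsub>?M\<^esub> (-1) \<odot>\<^bsub>?M\<^esub> x \<in> carrier ?M"
          by (rule cstar_productI[OF _ _ e]) (use 28(1) xc in \<open>simp_all add: extensional_def\<close>)
        ultimately show ?thesis using \<open>r > 0\<close> nn by simp
      qed
      then show "\<exists>no. \<forall>n\<ge>no. norm (N (X n \<oplus>\<^bsub>?M\<^esub> (-1) \<odot>\<^bsub>?M\<^esub> x) - 0) < r" by blast
    qed
    then show ?case using xM by blast
  qed (use D in \<open>auto intro!: ext simp: abelian_groupE(3-5)[OF ag]
      abelian_monoid.a_lcomm[OF abelian_group.axioms(1)[OF ag]]
      abelian_monoid.r_zero[OF abelian_group.axioms(1)[OF ag]] cstar_algebra.smult_l_distr[OF A]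
      cstar_algebra.smult_r_distr[OF A] cstar_algebra.smult_assoc[OF A] cstar_algebra.smult_one[OF A]
      cstar_algebra.mult_assoc[OF A] cstar_algebra.l_distr[OF A] cstar_algebra.r_distr[OF A]
      cstar_algebra.smult_mult_l[OF A] cstar_algebra.smult_mult_r[OF A] cstar_algebra.adj_adj[OF A]
      cstar_algebra.adj_add[OF A] cstar_algebra.adj_smult[OF A] cstar_algebra.adj_mult[OF A]\<close>)
qed

end

lemma unital_cstar_algebra_product:
  assumes "\<And>i. i \<in> I \<Longrightarrow> unital_cstar_algebra (A i)"
  shows "unital_cstar_algebra (cstar_product I A)"
proof -
  have A: "cstar_algebra (A i)" if "i \<in> I" for i
    using assms[OF that] by (rule unital_cstar_algebra.axioms)
  have "nrm (A i) \<one>\<^bsub>A i\<^esub> \<le> 1" if "i \<in> I" for i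
  proof -
    interpret Ai: unital_cstar_algebra "A i" using assms[OF that] .
    show ?thesis by (rule Ai.nrm_isometry_le_1) (simp_all add: Ai.one_closed Ai.l_one)
  qed
  then have one: "\<one>\<^bsub>cstar_product I A\<^esub> \<in> carrier (cstar_product I A)"
    using assms A by (intro cstar_productI[where C = 1])
      (auto simp: unital_cstar_algebra.one_closed)
  have "x = y" if "x \<in> extensional I" "y \<in> extensional I" "\<And>i. i \<in> I \<Longrightarrow> x i = y i"
    for x y :: "'a \<Rightarrow> 'b"
    using that by (rule extensionalityI)
  then show ?thesis
    unfolding unital_cstar_algebra_def unital_cstar_algebra_axioms_def
    using cstar_algebra_product[of I A] A one cstar_productD[of I A] assms
    by (auto simp: unital_cstar_algebra.l_one unital_cstar_algebra.r_one)
qed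

section \<open>Transport of structure and *-polynomials\<close>

text \<open>Operators on a Hilbert space do not live in the type over which the universal algebras
  are built; this copies an algebra along an injection into that type.\<close>

definition transport :: "('a \<Rightarrow> 'b) \<Rightarrow> ('a, 'm) cstar_struct_scheme \<Rightarrow> 'b cstar_struct" where
  "transport f A = (let g = inv_into (carrier A) f in \<lparr>
     carrier = f ` carrier A,
     mult = (\<lambda>x y. f (g x \<otimes>\<^bsub>A\<^esub> g y)),
     one = f \<one>\<^bsub>A\<^esub>,
     zero = f \<zero>\<^bsub>A\<^esub>,
     add = (\<lambda>x y. f (g x \<oplus>\<^bsub>A\<^esub> g y)),
     smult = (\<lambda>c x. f (c \<odot>\<^bsub>A\<^esub> g x)),
     adj = (\<lambda>x. f (adj A (g x))),
     nrm = (\<lambda>x. nrm A (g x))\<rparr>)"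

context
  fixes A :: "('a, 'm) cstar_struct_scheme" and f :: "'a \<Rightarrow> 'b"
  assumes A: "cstar_algebra A" and inj: "inj_on f (carrier A)"
begin

interpretation A: cstar_algebra A by (rule A)

lemma transport_simps:
  "carrier (transport f A) = f ` carrier A"
  "\<one>\<^bsub>transport f A\<^esub> = f \<one>\<^bsub>A\<^esub>" "\<zero>\<^bsub>transport f A\<^esub> = f \<zero>\<^bsub>A\<^esub>"
  "\<lbrakk>x \<in> carrier A; y \<in> carrier A\<rbrakk> \<Longrightarrow> f x \<otimes>\<^bsub>transport f A\<^esub> f y = f (x \<otimes>\<^bsub>A\<^esub> y)"
  "\<lbrakk>x \<in> carrier A; y \<in> carrier A\<rbrakk> \<Longrightarrow> f x \<oplus>\<^bsub>transport f A\<^esub> f y = f (x \<oplus>\<^bsub>A\<^esub> y)"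
  "x \<in> carrier A \<Longrightarrow> c \<odot>\<^bsub>transport f A\<^esub> f x = f (c \<odot>\<^bsub>A\<^esub> x)"
  "x \<in> carrier A \<Longrightarrow> adj (transport f A) (f x) = f (adj A x)"
  "x \<in> carrier A \<Longrightarrow> nrm (transport f A) (f x) = nrm A x"
  by (simp_all add: transport_def Let_def inv_into_f_f[OF inj])

lemma star_hom_transport: "star_hom A (transport f A) f"
  by (simp add: star_hom_def transport_simps)

lemma star_hom_transport_inv: "star_hom (transport f A) A (inv_into (carrier A) f)"
  by (auto simp: star_hom_def transport_simps inv_into_f_f[OF inj] A.closed)

lemma cstar_algebra_transport: "cstar_algebra (transport f A)"
proof (rule cstar_algebraI, goal_cases)
  case (23 x)
  then show ?case
    using inj by (auto simp: transport_simps A.nrm_eq_0 inj_on_eq_iff)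
next
  case (28 X)
  define Y where "Y n = inv_into (carrier A) f (X n)" for n
  have Y: "Y n \<in> carrier A" "X n = f (Y n)" for n
    using 28(1)[of n] inv_into_into[of "X n" f "carrier A"] f_inv_into_f[of "X n" f "carrier A"]
    by (auto simp: Y_def transport_simps)
  have "\<exists>N. \<forall>m\<ge>N. \<forall>n\<ge>N. nrm A (Y m \<ominus>\<^bsub>A\<^esub> Y n) < e" if "e > 0" for e
    using 28(2)[OF that] Y by (simp add: transport_simps A.minus_smult A.closed)
  from A.complete[OF Y(1) this] obtain y where
    y: "y \<in> carrier A" "(\<lambda>n. nrm A (Y n \<ominus>\<^bsub>A\<^esub> y)) \<longlonglongrightarrow> 0" by blast
  then show ?case using Y
    by (intro bexI[of _ "f y"]) (simp_all add: transport_simps A.minus_smult A.closed)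
qed (auto simp: transport_simps A.closed A.a_ac A.smult_l_distr A.smult_r_distr A.smult_assoc A.smult_one
    A.mult_assoc A.l_distr A.r_distr A.smult_mult_l A.smult_mult_r A.adj_adj A.adj_add A.adj_smult
    A.adj_mult A.nrm_nonneg A.nrm_triangle A.nrm_smult A.nrm_mult A.cstar_identity)

end

lemma unital_cstar_algebra_transport:
  assumes "unital_cstar_algebra A" "inj_on f (carrier A)"
  shows "unital_cstar_algebra (transport f A)"
proof -
  interpret A: unital_cstar_algebra A by fact
  note T = transport_simps[OF A.cstar_algebra_axioms assms(2)]
  show ?thesis
    using cstar_algebra_transport[OF A.cstar_algebra_axioms assms(2)]
    by (auto simp: unital_cstar_algebra_def unital_cstar_algebra_axioms_def T
        A.one_closed A.l_one A.r_one)
qed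

text \<open>One round of sequential limits suffices: in a convergent sequence of limits, the n-th
  term is replaced by an element of Q at distance below 1/(n+1).\<close>

lemma (in cstar_algebra) closure_subalgebra:
  assumes Q: "Q \<subseteq> carrier A" "\<zero> \<in> Q"
    and op: "\<And>x y. \<lbrakk>x \<in> Q; y \<in> Q\<rbrakk> \<Longrightarrow> x \<oplus> y \<in> Q" "\<And>c x. x \<in> Q \<Longrightarrow> c \<odot> x \<in> Q"
      "\<And>x y. \<lbrakk>x \<in> Q; y \<in> Q\<rbrakk> \<Longrightarrow> x \<otimes> y \<in> Q" "\<And>x. x \<in> Q \<Longrightarrow> adj A x \<in> Q"
  shows "cstar_subalgebra A {x. \<exists>X. (\<forall>n. X n \<in> Q) \<and> cstar_lim A X x}" (is "cstar_subalgebra A ?C")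
proof -
  have CI: "x \<in> ?C" if "\<And>n. X n \<in> Q" "cstar_lim A X x" for X x using that by blast
  have CE: "\<exists>X. (\<forall>n. X n \<in> Q) \<and> cstar_lim A X x" if "x \<in> ?C" for x using that by simp
  have "closed_subspace A ?C"
  proof (rule closed_subspaceI)
    show "?C \<subseteq> carrier A" using cstar_limD(2) by blast
    show "\<zero> \<in> ?C" by (rule CI[OF _ cstar_lim_const]) (use Q in auto)
  next
    fix x y assume xy: "x \<in> ?C" "y \<in> ?C"
    obtain X where "\<And>n. X n \<in> Q" "cstar_lim A X x" using CE[OF xy(1)] by blast
    moreover obtain Y where "\<And>n. Y n \<in> Q" "cstar_lim A Y y" using CE[OF xy(2)] by blast
    ultimately show "x \<oplus> y \<in> ?C" using op(1) by (intro CI[OF _ cstar_lim_add]) simp_all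
  next
    fix c x assume "x \<in> ?C"
    from CE[OF this] obtain X where "\<And>n. X n \<in> Q" "cstar_lim A X x" by blast
    then show "c \<odot> x \<in> ?C" using op(2) by (intro CI[OF _ cstar_lim_smult]) simp_all
  next
    fix Y x assume Y: "cstar_lim A Y x" "\<And>n. Y n \<in> ?C"
    have "\<exists>q. q \<in> Q \<and> nrm A (Y n \<ominus> q) < 1 / (Suc n)" for n
    proof -
      obtain X where X: "\<And>n. X n \<in> Q" "cstar_lim A X (Y n)" using CE[OF Y(2)[of n]] by blast
      have "eventually (\<lambda>k. nrm A (X k \<ominus> Y n) < 1 / (Suc n)) sequentially"
        by (rule order_tendstoD(2)[OF cstar_limD(3)[OF X(2)]]) simp
      then obtain k where "nrm A (X k \<ominus> Y n) < 1 / (Suc n)"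
        unfolding eventually_sequentially by blast
      then show ?thesis
        using X(1)[of k] nrm_minus_commute[of "X k" "Y n"] cstar_limD(1,2)[OF X(2)] by auto
    qed
    then obtain q where q: "\<And>n. q n \<in> Q" "\<And>n. nrm A (Y n \<ominus> q n) < 1 / (Suc n)" by metis
    have "cstar_lim A q x"
    proof (rule cstar_limI)
      have "(\<lambda>n. 1 / Suc n + nrm A (Y n \<ominus> x)) \<longlonglongrightarrow> 0 + 0"
        using tendsto_add[OF LIMSEQ_inverse_real_of_nat cstar_limD(3)[OF Y(1)]]
        by (simp add: inverse_eq_divide)
      then show "(\<lambda>n. 1 / Suc n + nrm A (Y n \<ominus> x)) \<longlonglongrightarrow> 0" by simp
      show "q n \<in> carrier A" for n using q(1) Q by blast
      then show "nrm A (q n \<ominus> x) \<le> 1 / Suc n + nrm A (Y n \<ominus> x)" for n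
        using nrm_dist_triangle[of "q n" "Y n" x] nrm_minus_commute[of "q n" "Y n"] q(2)[of n]
          cstar_limD(1,2)[OF Y(1)] by (simp add: less_imp_le)
    qed (rule cstar_limD(2)[OF Y(1)])
    then show "x \<in> ?C" using q(1) by blast
  qed
  moreover have "x \<otimes> y \<in> ?C" if xy: "x \<in> ?C" "y \<in> ?C" for x y
  proof -
    obtain X where "\<And>n. X n \<in> Q" "cstar_lim A X x" using CE[OF xy(1)] by blast
    moreover obtain Y where "\<And>n. Y n \<in> Q" "cstar_lim A Y y" using CE[OF xy(2)] by blast
    ultimately show "x \<otimes> y \<in> ?C" using op(3) by (intro CI[OF _ cstar_lim_mult]) simp_all
  qed
  moreover have "adj A x \<in> ?C" if x: "x \<in> ?C" for x
  proof -
    obtain X where "\<And>n. X n \<in> Q" "cstar_lim A X x" using CE[OF x] by blast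
    then show "adj A x \<in> ?C" using op(4) by (intro CI[OF _ cstar_lim_adj]) simp_all
  qed
  ultimately show ?thesis by (simp add: cstar_subalgebra_def)
qed

section \<open>Evaluation of *-polynomials in a family\<close>

definition mono_eval :: "('a, 'm) cstar_struct_scheme \<Rightarrow> ('g \<Rightarrow> 'a) \<Rightarrow> ('g \<times> bool) list \<Rightarrow> 'a" where
  "mono_eval A w l = foldr (\<lambda>(p, s) x. (if s then adj A (w p) else w p) \<otimes>\<^bsub>A\<^esub> x) l \<one>\<^bsub>A\<^esub>"

definition poly_eval :: "('a, 'm) cstar_struct_scheme \<Rightarrow> ('g \<Rightarrow> 'a) \<Rightarrow> 'g star_poly \<Rightarrow> 'a" where
  "poly_eval A w ps = foldr (\<lambda>(c, l) x. c \<odot>\<^bsub>A\<^esub> mono_eval A w l \<oplus>\<^bsub>A\<^esub> x) ps \<zero>\<^bsub>A\<^esub>"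

definition star_polys :: "'g set \<Rightarrow> 'g star_poly set" where
  "star_polys P = {ps. \<forall>(c, l)\<in>set ps. fst ` set l \<subseteq> P}"

context unital_cstar_algebra
begin

context
  fixes w :: "'g \<Rightarrow> 'a" and P :: "'g set"
  assumes w: "w \<in> P \<rightarrow> carrier A"
begin

lemma w_closed: "p \<in> P \<Longrightarrow> w p \<in> carrier A"
  using w by blast

lemma mono_eval_simps:
  "mono_eval A w [] = \<one>"
  "mono_eval A w ((p, s) # l) = (if s then adj A (w p) else w p) \<otimes> mono_eval A w l"
  by (simp_all add: mono_eval_def)

lemma poly_eval_simps:
  "poly_eval A w [] = \<zero>"
  "poly_eval A w ((c, l) # ps) = c \<odot> mono_eval A w l \<oplus> poly_eval A w ps"
  by (simp_all add: poly_eval_def)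

lemma star_polys_simps:
  "[] \<in> star_polys P" "(c, l) # ps \<in> star_polys P \<longleftrightarrow> fst ` set l \<subseteq> P \<and> ps \<in> star_polys P"
  "ps @ qs \<in> star_polys P \<longleftrightarrow> ps \<in> star_polys P \<and> qs \<in> star_polys P"
  by (simp_all add: star_polys_def ball_Un)

lemma mono_eval_closed: "fst ` set l \<subseteq> P \<Longrightarrow> mono_eval A w l \<in> carrier A"
  by (induction l) (auto simp: mono_eval_simps one_closed closed w_closed)

lemma mono_eval_append:
  "fst ` set l \<subseteq> P \<Longrightarrow> fst ` set m \<subseteq> P \<Longrightarrow>
     mono_eval A w (l @ m) = mono_eval A w l \<otimes> mono_eval A w m"
  by (induction l)
    (auto simp: mono_eval_simps l_one mono_eval_closed mult_assoc w_closed adj_closed)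

lemma mono_eval_adj:
  "fst ` set l \<subseteq> P \<Longrightarrow> adj A (mono_eval A w l) = mono_eval A w (rev (map (apsnd Not) l))"
proof (induction l)
  case (Cons ps l)
  obtain p s where ps: "ps = (p, s)" by (cases ps)
  have fst: "fst ` set (rev (map (apsnd Not) l)) \<subseteq> P" using Cons.prems by auto
  have "mono_eval A w (rev (map (apsnd Not) (ps # l))) =
      mono_eval A w (rev (map (apsnd Not) l)) \<otimes> mono_eval A w [(p, \<not> s)]"
    using Cons.prems fst by (simp add: ps mono_eval_append)
  then show ?case
    using Cons ps w_closed by (simp add: mono_eval_simps adj_mult mono_eval_closed closed adj_adj r_one)
qed (simp add: mono_eval_simps)

lemma poly_eval_closed: "ps \<in> star_polys P \<Longrightarrow> poly_eval A w ps \<in> carrier A"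
  by (induction ps) (auto simp: poly_eval_simps star_polys_simps mono_eval_closed closed)

lemma poly_eval_append:
  "\<lbrakk>ps \<in> star_polys P; qs \<in> star_polys P\<rbrakk> \<Longrightarrow>
     poly_eval A w (ps @ qs) = poly_eval A w ps \<oplus> poly_eval A w qs"
  by (induction ps)
    (auto simp: poly_eval_simps star_polys_simps mono_eval_closed poly_eval_closed closed a_assoc)

lemma poly_eval_smult:
  "ps \<in> star_polys P \<Longrightarrow> \<exists>qs\<in>star_polys P. poly_eval A w qs = d \<odot> poly_eval A w ps"
proof (induction ps)
  case Nil
  then show ?case by (intro bexI[of _ "[]"]) (auto simp: star_polys_simps poly_eval_simps)
next
  case (Cons cl ps)
  obtain c l where cl: "cl = (c, l)" by (cases cl)
  with Cons obtain qs where "qs \<in> star_polys P" "poly_eval A w qs = d \<odot> poly_eval A w ps"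
    by (auto simp: star_polys_simps)
  then show ?case using Cons.prems
    by (intro bexI[of _ "(d * c, l) # qs"])
      (auto simp: cl star_polys_simps poly_eval_simps smult_r_distr smult_assoc mono_eval_closed
        poly_eval_closed closed)
qed

lemma poly_eval_adj:
  "ps \<in> star_polys P \<Longrightarrow> \<exists>qs\<in>star_polys P. poly_eval A w qs = adj A (poly_eval A w ps)"
proof (induction ps)
  case Nil
  then show ?case by (intro bexI[of _ "[]"]) (auto simp: star_polys_simps poly_eval_simps)
next
  case (Cons cl ps)
  obtain c l where cl: "cl = (c, l)" by (cases cl)
  with Cons obtain qs where "qs \<in> star_polys P" "poly_eval A w qs = adj A (poly_eval A w ps)"
    by (auto simp: star_polys_simps)
  moreover have "fst ` set (rev (map (apsnd Not) l)) \<subseteq> P"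
    using Cons.prems by (auto simp: cl star_polys_simps)
  ultimately show ?case using Cons.prems
    by (intro bexI[of _ "(cnj c, rev (map (apsnd Not) l)) # qs"])
      (simp_all add: cl star_polys_simps poly_eval_simps adj_add adj_smult mono_eval_adj
        mono_eval_closed poly_eval_closed closed)
qed

text \<open>A polynomial is a list of scaled monomials, so multiplying by one scaled monomial means
  prefixing its letters to every entry. Only the value is tracked, hence the existential
  form.\<close>

lemma poly_eval_mono_mult:
  assumes l: "fst ` set l \<subseteq> P"
  shows "qs \<in> star_polys P \<Longrightarrow>
    \<exists>rs\<in>star_polys P. poly_eval A w rs = (c \<odot> mono_eval A w l) \<otimes> poly_eval A w qs"
proof (induction qs)
  case Nil
  then show ?case
    using l by (intro bexI[of _ "[]"]) (auto simp: star_polys_simps poly_eval_simps closed mono_eval_closed)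
next
  case (Cons dm qs)
  obtain d m where dm: "dm = (d, m)" by (cases dm)
  with Cons obtain rs where
    "rs \<in> star_polys P" "poly_eval A w rs = (c \<odot> mono_eval A w l) \<otimes> poly_eval A w qs"
    by (auto simp: star_polys_simps)
  then show ?case using Cons.prems l
    by (intro bexI[of _ "(d * c, l @ m) # rs"])
      (auto simp: dm star_polys_simps poly_eval_simps r_distr smult_assoc mono_eval_closed
        mono_eval_append smult_mult_l smult_mult_r poly_eval_closed closed)
qed

lemma poly_eval_mult:
  "\<lbrakk>ps \<in> star_polys P; qs \<in> star_polys P\<rbrakk> \<Longrightarrow>
    \<exists>rs\<in>star_polys P. poly_eval A w rs = poly_eval A w ps \<otimes> poly_eval A w qs"
proof (induction ps)
  case Nil
  then show ?case
    by (intro bexI[of _ "[]"]) (auto simp: star_polys_simps poly_eval_simps poly_eval_closed)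
next
  case (Cons cl ps)
  obtain c l where cl: "cl = (c, l)" by (cases cl)
  have l: "fst ` set l \<subseteq> P" "ps \<in> star_polys P" using Cons.prems by (auto simp: cl star_polys_simps)
  obtain rs where
    "rs \<in> star_polys P" "poly_eval A w rs = poly_eval A w ps \<otimes> poly_eval A w qs"
    using Cons l by auto
  moreover obtain rs' where
    "rs' \<in> star_polys P" "poly_eval A w rs' = (c \<odot> mono_eval A w l) \<otimes> poly_eval A w qs"
    using poly_eval_mono_mult[OF l(1) Cons.prems(2)] by blast
  ultimately show ?case using Cons.prems l
    by (intro bexI[of _ "rs' @ rs"])
      (simp_all add: cl star_polys_simps poly_eval_append poly_eval_simps l_distr
        mono_eval_closed poly_eval_closed closed)
qed

text \<open>The values of *-polynomials are closed under all the operations, so their sequential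
  closure is a C*-subalgebra and contains the generated one.\<close>

lemma generated_limit_of_star_polys:
  assumes "x \<in> carrier (cstar_generated A (insert \<one> (w ` P)))"
  shows "\<exists>s. (\<forall>n. s n \<in> star_polys P) \<and> cstar_lim A (\<lambda>n. poly_eval A w (s n)) x"
proof -
  let ?Q = "poly_eval A w ` star_polys P"
  let ?C = "{x. \<exists>X. (\<forall>n. X n \<in> ?Q) \<and> cstar_lim A X x}"
  have QI: "y \<in> ?Q" if "\<exists>qs\<in>star_polys P. poly_eval A w qs = y" for y
    using that by blast
  have "cstar_subalgebra A ?C"
  proof (rule closure_subalgebra)
    show "\<zero> \<in> ?Q" using star_polys_simps(1) poly_eval_simps(1) by force
    show "x \<oplus> y \<in> ?Q" if xy: "x \<in> ?Q" "y \<in> ?Q" for x y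
    proof -
      obtain ps qs where "ps \<in> star_polys P" "x = poly_eval A w ps" "qs \<in> star_polys P" "y = poly_eval A w qs"
        using xy by auto
      then show ?thesis by (intro image_eqI[of _ _ "ps @ qs"]) (simp_all add: poly_eval_append star_polys_simps)
    qed
    show "c \<odot> x \<in> ?Q" if "x \<in> ?Q" for c x using that by (elim imageE) (simp add: QI poly_eval_smult)
    show "adj A x \<in> ?Q" if "x \<in> ?Q" for x using that by (elim imageE) (simp add: QI poly_eval_adj)
    show "x \<otimes> y \<in> ?Q" if "x \<in> ?Q" "y \<in> ?Q" for x y using that by (elim imageE) (simp add: QI poly_eval_mult)
  qed (use poly_eval_closed in auto)
  moreover have "insert \<one> (w ` P) \<subseteq> ?C"
  proof -
    have "x \<in> ?C" if x: "x \<in> ?Q" for x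
    proof -
      have "x \<in> carrier A" using x poly_eval_closed by auto
      from cstar_lim_const[OF this] show ?thesis using x by (intro CollectI exI[of _ "\<lambda>_. x"]) simp
    qed
    moreover have "\<one> \<in> ?Q"
      by (intro image_eqI[of _ _ "[(1, [])]"])
        (simp_all add: poly_eval_simps mono_eval_simps star_polys_simps smult_one one_closed)
    moreover have "w p \<in> ?Q" if "p \<in> P" for p
      using that w_closed[OF that]
      by (intro image_eqI[of _ _ "[(1, [(p, False)])]"])
        (simp_all add: poly_eval_simps mono_eval_simps star_polys_simps smult_one r_one)
    ultimately show ?thesis by blast
  qed
  ultimately have "x \<in> ?C" using cstar_generated_minimal assms by blast
  then obtain X where X: "\<forall>n. X n \<in> ?Q" "cstar_lim A X x" by blast
  then have "\<forall>n. \<exists>s. s \<in> star_polys P \<and> X n = poly_eval A w s" by blast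
  from choice[OF this] obtain s where s: "\<And>n. s n \<in> star_polys P" "\<And>n. X n = poly_eval A w (s n)"
    by blast
  then have "X = (\<lambda>n. poly_eval A w (s n))" by auto
  then show ?thesis using X(2) s(1) by blast
qed

text \<open>A sequence of polynomials determines its limit, so choosing one sequence for each
  element is injective. This is what makes the type \<open>'g univ\<close> large enough for every
  generated algebra.\<close>

lemma inj_on_generated_univ:
  obtains f :: "'a \<Rightarrow> 'g univ" where "inj_on f (carrier (cstar_generated A (insert \<one> (w ` P))))"
proof -
  define f where "f x = (SOME s. (\<forall>n. s n \<in> star_polys P) \<and> cstar_lim A (\<lambda>n. poly_eval A w (s n)) x)" for x
  have f: "cstar_lim A (\<lambda>n. poly_eval A w (f x n)) x"
    if "x \<in> carrier (cstar_generated A (insert \<one> (w ` P)))" for x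
    using someI_ex[OF generated_limit_of_star_polys[OF that]] by (simp add: f_def)
  have "inj_on f (carrier (cstar_generated A (insert \<one> (w ` P))))"
    using f cstar_lim_unique by (intro inj_onI) metis
  then show ?thesis using that by blast
qed

end

end


section \<open>Universal C*-algebras\<close>

text \<open>The uniform bound is what makes a generator a bounded family, that is, an element of the
  product.\<close>

locale contractive_relations =
  fixes P :: "'g set" and \<Phi> :: "'g univ cstar_struct \<Rightarrow> ('g \<Rightarrow> 'g univ) \<Rightarrow> bool"
  assumes contr: "\<lbrakk>unital_cstar_algebra B; w \<in> P \<rightarrow> carrier B; \<Phi> B w; p \<in> P\<rbrakk> \<Longrightarrow>
    nrm B (w p) \<le> 1"

context contractive_relations
begin

abbreviation "I \<equiv> univ_index P \<Phi>"
abbreviation "M \<equiv> cstar_product I fst"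
abbreviation "U \<equiv> univ_cstar P \<Phi>"

lemma univ_index_unital: "i \<in> I \<Longrightarrow> unital_cstar_algebra (fst i)"
  by (auto simp: univ_index_def)

lemma univ_index_cstar: "i \<in> I \<Longrightarrow> cstar_algebra (fst i)"
  using univ_index_unital unital_cstar_algebra.axioms by blast

interpretation M: unital_cstar_algebra M
  by (rule unital_cstar_algebra_product) (rule univ_index_unital)

lemma univ_gen_eval: "i \<in> I \<Longrightarrow> univ_gen P \<Phi> p i = snd i p"
  by (cases i) (simp add: univ_gen_def)

lemma univ_gens_subset: "insert \<one>\<^bsub>M\<^esub> (univ_gen P \<Phi> ` P) \<subseteq> carrier M"
proof -
  have "univ_gen P \<Phi> p \<in> carrier M" if "p \<in> P" for p
  proof (rule cstar_productI[OF univ_index_cstar])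
    show "univ_gen P \<Phi> p \<in> extensional I" by (simp add: univ_gen_def)
    show "univ_gen P \<Phi> p i \<in> carrier (fst i)" if "i \<in> I" for i
      using that \<open>p \<in> P\<close> by (auto simp: univ_gen_eval univ_index_def)
    show "nrm (fst i) (univ_gen P \<Phi> p i) \<le> 1" if "i \<in> I" for i
      using that \<open>p \<in> P\<close> contr by (auto simp: univ_gen_eval univ_index_def)
  qed
  then show ?thesis using M.one_closed by blast
qed

lemma univ_cstar_eq: "U = cstar_generated M (insert \<one>\<^bsub>M\<^esub> (univ_gen P \<Phi> ` P))"
  by (simp add: univ_cstar_def Let_def)

lemma univ_cstar_unital: "unital_cstar_algebra U"
  unfolding univ_cstar_eq
  by (rule M.unital_cstar_algebra_generated[OF univ_gens_subset])
    (use M.cstar_generated_superset in blast)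

lemma univ_gen_closed: "p \<in> P \<Longrightarrow> univ_gen P \<Phi> p \<in> carrier U"
  using M.cstar_generated_superset[of "insert \<one>\<^bsub>M\<^esub> (univ_gen P \<Phi> ` P)"]
  by (simp add: univ_cstar_eq image_subset_iff)

lemma univ_cstar_subset: "carrier U \<subseteq> carrier M"
  unfolding univ_cstar_eq by (rule M.cstar_generated_subset[OF univ_gens_subset])

lemma star_hom_eval: "i \<in> I \<Longrightarrow> star_hom U (fst i) (\<lambda>x. x i)"
  using cstar_productD(1)[OF univ_index_cstar subsetD[OF univ_cstar_subset]]
  by (simp add: star_hom_def univ_cstar_eq)

lemma univ_one_eval: "i \<in> I \<Longrightarrow> \<one>\<^bsub>U\<^esub> i = \<one>\<^bsub>fst i\<^esub>"
  and univ_zero_eval: "i \<in> I \<Longrightarrow> \<zero>\<^bsub>U\<^esub> i = \<zero>\<^bsub>fst i\<^esub>"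
  by (simp_all add: univ_cstar_eq)

lemma univ_cstar_extensional: "x \<in> carrier U \<Longrightarrow> x \<in> extensional I"
  by (rule cstar_productD(2)[OF univ_index_cstar subsetD[OF univ_cstar_subset]])

lemma univ_cstar_eqI:
  "\<lbrakk>x \<in> carrier U; y \<in> carrier U; \<And>i. i \<in> I \<Longrightarrow> x i = y i\<rbrakk> \<Longrightarrow> x = y"
  by (rule extensionalityI[OF univ_cstar_extensional univ_cstar_extensional])

lemma univ_hom_eq:
  assumes B: "cstar_algebra B" and h: "star_hom U B h" and k: "star_hom U B k"
    and eq: "h \<one>\<^bsub>U\<^esub> = k \<one>\<^bsub>U\<^esub>" "\<And>p. p \<in> P \<Longrightarrow> h (univ_gen P \<Phi> p) = k (univ_gen P \<Phi> p)"
    and x: "x \<in> carrier U"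
  shows "h x = k x"
proof (rule M.star_hom_eq_on_generated[OF univ_gens_subset B])
  show "contractive (cstar_generated M (insert \<one>\<^bsub>M\<^esub> (univ_gen P \<Phi> ` P))) B h"
    "contractive (cstar_generated M (insert \<one>\<^bsub>M\<^esub> (univ_gen P \<Phi> ` P))) B k"
    using star_hom_contractive[OF univ_cstar_unital B] h k by (simp_all add: univ_cstar_eq)
  show "\<And>x. x \<in> insert \<one>\<^bsub>M\<^esub> (univ_gen P \<Phi> ` P) \<Longrightarrow> h x = k x"
    using eq by (auto simp: univ_cstar_eq)
qed (use h k x in \<open>simp_all add: univ_cstar_eq\<close>)

text \<open>The transported pair is itself an index, so the homomorphism is the projection to that
  coordinate followed by the inverse of the transport.\<close>

lemma univ_hom_exists:
  assumes D: "unital_cstar_algebra D" "w \<in> P \<rightarrow> carrier D" and f: "inj_on f (carrier D)"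
    and \<Phi>: "\<Phi> (transport f D) (f \<circ> w)"
  obtains h where "star_hom U D h" "h \<one>\<^bsub>U\<^esub> = \<one>\<^bsub>D\<^esub>" "\<And>p. p \<in> P \<Longrightarrow> h (univ_gen P \<Phi> p) = w p"
proof -
  interpret D: unital_cstar_algebra D by fact
  note T = transport_simps[OF D.cstar_algebra_axioms f]
  let ?i = "(transport f D, f \<circ> w)"
  have i: "?i \<in> I"
    using \<Phi> unital_cstar_algebra_transport[OF D(1) f] D(2) by (auto simp: univ_index_def T)
  let ?h = "inv_into (carrier D) f \<circ> (\<lambda>x. x ?i)"
  have "star_hom U D ?h"
    using star_hom_comp[OF star_hom_eval[OF i]] star_hom_transport_inv[OF D.cstar_algebra_axioms f]
    by simp
  moreover have "?h \<one>\<^bsub>U\<^esub> = \<one>\<^bsub>D\<^esub>"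
    using univ_one_eval[OF i] D.one_closed by (simp add: T inv_into_f_f[OF f])
  moreover have "?h (univ_gen P \<Phi> p) = w p" if "p \<in> P" for p
    using funcset_mem[OF D(2) that] univ_gen_eval[OF i] by (simp add: inv_into_f_f[OF f])
  ultimately show ?thesis using that by blast
qed

end


section \<open>Words in homomorphic images, quotients by kernels\<close>

lemma words_simps [simp]:
  "[] \<in> words P" "p # q # \<alpha> \<in> words P \<longleftrightarrow> p \<in> P \<and> q \<in> P \<and> \<alpha> \<in> words P" "[p] \<notin> words P"
  by (auto simp: words_def)

lemma words_induct [consumes 1, case_names Nil Cons]:
  assumes "\<alpha> \<in> words P" "Q []" "\<And>p q \<alpha>. \<lbrakk>p \<in> P; q \<in> P; \<alpha> \<in> words P; Q \<alpha>\<rbrakk> \<Longrightarrow> Q (p # q # \<alpha>)"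
  shows "Q \<alpha>"
  using assms(1)
  by (induction \<alpha> rule: induct_list012) (use assms(2,3) in auto)

lemma (in unital_cstar_algebra) word_op_closed:
  assumes "w \<in> P \<rightarrow> carrier A" "\<alpha> \<in> words P"
  shows "word_op A w \<alpha> \<in> carrier A"
  using assms(2) by (induction rule: words_induct) (use assms(1) in \<open>auto simp: one_closed closed Pi_iff\<close>)

lemma (in unital_cstar_algebra) word_op_append:
  assumes "w \<in> P \<rightarrow> carrier A" "\<alpha> \<in> words P" "\<beta> \<in> words P"
  shows "word_op A w (\<alpha> @ \<beta>) = word_op A w \<alpha> \<otimes> word_op A w \<beta>"
  using assms(2)
proof (induction rule: words_induct)
  case (Cons p q \<alpha>)
  then show ?case using assms(1,3) word_op_closed[OF assms(1)]
    by (simp add: Pi_iff mult_assoc closed)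
qed (simp add: l_one word_op_closed[OF assms(1,3)])

lemma word_op_hom:
  assumes A: "unital_cstar_algebra A" and h: "star_hom A B h" "h \<one>\<^bsub>A\<^esub> = \<one>\<^bsub>B\<^esub>"
    and w: "w \<in> P \<rightarrow> carrier A" "\<And>p. p \<in> P \<Longrightarrow> w' p = h (w p)" and "\<alpha> \<in> words P"
  shows "word_op B w' \<alpha> = h (word_op A w \<alpha>)"
proof -
  interpret A: unital_cstar_algebra A by fact
  show ?thesis using assms(6)
  proof (induction rule: words_induct)
    case (Cons p q \<alpha>)
    have c: "w p \<in> carrier A" "w q \<in> carrier A" using Cons w(1) by auto
    show ?case
      using Cons c A.word_op_closed[OF w(1)] by (simp add: w(2) star_homD[OF h(1)] A.closed)
  qed (simp add: h(2))
qed

lemma some_list_of_finite: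
  assumes "finite F"
  shows "set (SOME \<beta>s. set \<beta>s = F \<and> distinct \<beta>s) = F"
  using someI_ex[OF finite_distinct_list[OF assms]] by blast

lemma neutral_words_words: "\<alpha> \<in> neutral_words G P \<Longrightarrow> \<alpha> \<in> words P"
  by (simp add: neutral_words_def)

text \<open>The enumeration chosen in \<open>diff_prod\<close> depends on the set alone, so the
  factors appear in the same order in both algebras and one can argue list by list.\<close>

lemma diff_prod_hom:
  assumes A: "unital_cstar_algebra A" and B: "cstar_algebra B" and h: "star_hom A B h" "h \<one>\<^bsub>A\<^esub> = \<one>\<^bsub>B\<^esub>"
    and w: "w \<in> P \<rightarrow> carrier A" "\<And>p. p \<in> P \<Longrightarrow> w' p = h (w p)"
    and \<alpha>: "\<alpha> \<in> words P" and F: "finite F" "F \<subseteq> words P"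
  shows "diff_prod A w \<alpha> F \<in> carrier A" "diff_prod B w' \<alpha> F = h (diff_prod A w \<alpha> F)"
proof -
  interpret A: unital_cstar_algebra A by fact
  let ?d = "\<lambda>B w \<beta>s. foldr (\<lambda>\<beta> x. (word_op B w \<alpha> \<ominus>\<^bsub>B\<^esub> word_op B w \<beta>) \<otimes>\<^bsub>B\<^esub> x) \<beta>s \<one>\<^bsub>B\<^esub>"
  note wc = A.word_op_closed[OF w(1)]
  have c: "?d A w \<beta>s \<in> carrier A" if "set \<beta>s \<subseteq> words P" for \<beta>s
    using that by (induction \<beta>s) (auto simp: A.one_closed A.mult_closed A.minus_closed wc \<alpha>)
  have e: "?d B w' \<beta>s = h (?d A w \<beta>s)" if "set \<beta>s \<subseteq> words P" for \<beta>s
    using that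
  proof (induction \<beta>s)
    case (Cons \<beta> \<beta>s)
    then show ?case
      using c[of \<beta>s] \<alpha> wc
      by (simp add: star_homD(4)[OF h(1)] word_op_hom[OF A h w]
          star_hom_minus[OF A.cstar_algebra_axioms B h(1)])
  qed (simp add: h(2))
  show "diff_prod A w \<alpha> F \<in> carrier A"
    using c[of "SOME \<beta>s. set \<beta>s = F \<and> distinct \<beta>s"] some_list_of_finite[OF F(1)] F(2) wc[OF \<alpha>]
    by (simp add: diff_prod_def)
  show "diff_prod B w' \<alpha> F = h (diff_prod A w \<alpha> F)"
    using e[of "SOME \<beta>s. set \<beta>s = F \<and> distinct \<beta>s"] some_list_of_finite[OF F(1)] F(2)
      word_op_hom[OF A h w \<alpha>]
    by (simp add: diff_prod_def)
qed

text \<open>The cosets of the kernel are the fibres of h, so the image of a coset is a singleton and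
  \<open>the_elem\<close> reads off its value. The operations on cosets are unions over
  representatives; on each of them h takes a single value.\<close>

lemma cstar_quotient_kernel:
  assumes A: "cstar_algebra A" and C: "cstar_algebra C" and h: "star_hom A C h"
    and J: "J = {x \<in> carrier A. h x = \<zero>\<^bsub>C\<^esub>}"
  defines "\<iota> \<equiv> \<lambda>U. the_elem (h ` U)"
  shows "star_hom (cstar_quotient A J) C \<iota>"
    and "inj_on \<iota> (carrier (cstar_quotient A J))"
    and "\<And>x. x \<in> carrier A \<Longrightarrow> \<iota> (J +>\<^bsub>A\<^esub> x) = h x"
proof -
  interpret A: cstar_algebra A by fact
  interpret C: cstar_algebra C by fact
  note hD = star_homD[OF h]
  have coset: "J +>\<^bsub>A\<^esub> x = {u \<in> carrier A. h u = h x}" if x: "x \<in> carrier A" for x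
  proof (intro equalityI subsetI)
    fix u assume "u \<in> J +>\<^bsub>A\<^esub> x"
    then obtain j where "j \<in> carrier A" "h j = \<zero>\<^bsub>C\<^esub>" "u = j \<oplus>\<^bsub>A\<^esub> x"
      by (auto simp: a_r_coset_def' J)
    then show "u \<in> {u \<in> carrier A. h u = h x}" using x hD by simp
  next
    fix u assume "u \<in> {u \<in> carrier A. h u = h x}"
    then have u: "u \<in> carrier A" "h u = h x" by auto
    have "u \<ominus>\<^bsub>A\<^esub> x \<in> J" using u x hD(1) by (simp add: J star_hom_minus[OF A C h])
    moreover have "u = (u \<ominus>\<^bsub>A\<^esub> x) \<oplus>\<^bsub>A\<^esub> x" using u x by (simp add: a_minus_def A.a_assoc A.l_neg)
    ultimately show "u \<in> J +>\<^bsub>A\<^esub> x" unfolding a_r_coset_def' by blast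
  qed
  have \<iota>I: "\<iota> U = c" if "\<And>u. u \<in> U \<Longrightarrow> h u = c" "U \<noteq> {}" for U c
  proof -
    have "h ` U = {c}" using that by blast
    then show ?thesis by (simp add: \<iota>_def)
  qed
  show 3: "\<iota> (J +>\<^bsub>A\<^esub> x) = h x" if "x \<in> carrier A" for x
    by (rule \<iota>I) (use coset[OF that] that in auto)
  have carr: "carrier (cstar_quotient A J) = {J +>\<^bsub>A\<^esub> x | x. x \<in> carrier A}"
    by (auto simp: cstar_quotient_def A_RCOSETS_def')
  then have carrE: "\<exists>x. x \<in> carrier A \<and> U = J +>\<^bsub>A\<^esub> x" if "U \<in> carrier (cstar_quotient A J)" for U
    using that by blast
  show "inj_on \<iota> (carrier (cstar_quotient A J))"
  proof (rule inj_onI)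
    fix U V assume "U \<in> carrier (cstar_quotient A J)" "V \<in> carrier (cstar_quotient A J)" "\<iota> U = \<iota> V"
    then obtain x y where "x \<in> carrier A" "y \<in> carrier A" "U = J +>\<^bsub>A\<^esub> x" "V = J +>\<^bsub>A\<^esub> y"
      using carrE by metis
    then show "U = V" using 3 coset \<open>\<iota> U = \<iota> V\<close> by simp
  qed
  have add: "\<iota> (U \<oplus>\<^bsub>cstar_quotient A J\<^esub> V) = \<iota> U \<oplus>\<^bsub>C\<^esub> \<iota> V"
    and mult: "\<iota> (U \<otimes>\<^bsub>cstar_quotient A J\<^esub> V) = \<iota> U \<otimes>\<^bsub>C\<^esub> \<iota> V"
    if UV: "U \<in> carrier (cstar_quotient A J)" "V \<in> carrier (cstar_quotient A J)" for U V
  proof -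
    obtain x y where xy: "x \<in> carrier A" "y \<in> carrier A" "U = J +>\<^bsub>A\<^esub> x" "V = J +>\<^bsub>A\<^esub> y"
      using UV carrE by metis
    have ne: "x \<in> U" "y \<in> V" using coset xy by auto
    have U: "u \<in> carrier A \<and> h u = h x" if "u \<in> U" for u using that coset xy by auto
    have V: "v \<in> carrier A \<and> h v = h y" if "v \<in> V" for v using that coset xy by auto
    have S: "U \<oplus>\<^bsub>cstar_quotient A J\<^esub> V = (\<Union>u\<in>U. \<Union>v\<in>V. {u \<oplus>\<^bsub>A\<^esub> v})"
      by (simp add: cstar_quotient_def set_add_def set_mult_def)
    have "\<iota> (U \<oplus>\<^bsub>cstar_quotient A J\<^esub> V) = h x \<oplus>\<^bsub>C\<^esub> h y"
    proof (rule \<iota>I)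
      show "h z = h x \<oplus>\<^bsub>C\<^esub> h y" if z: "z \<in> U \<oplus>\<^bsub>cstar_quotient A J\<^esub> V" for z
      proof -
        obtain u v where uv: "u \<in> U" "v \<in> V" "z = u \<oplus>\<^bsub>A\<^esub> v" using z unfolding S by blast
        have "h z = h u \<oplus>\<^bsub>C\<^esub> h v" using hD(2) U[OF uv(1)] V[OF uv(2)] uv(3) by blast
        then show ?thesis by (simp only: conjunct2[OF U[OF uv(1)]] conjunct2[OF V[OF uv(2)]])
      qed
      show "U \<oplus>\<^bsub>cstar_quotient A J\<^esub> V \<noteq> {}" unfolding S using ne by blast
    qed
    then show "\<iota> (U \<oplus>\<^bsub>cstar_quotient A J\<^esub> V) = \<iota> U \<oplus>\<^bsub>C\<^esub> \<iota> V" using 3 xy by simp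
    have W: "U \<otimes>\<^bsub>cstar_quotient A J\<^esub> V = (\<Union>u\<in>U. \<Union>v\<in>V. J +>\<^bsub>A\<^esub> (u \<otimes>\<^bsub>A\<^esub> v))"
      by (simp add: cstar_quotient_def rcoset_mult_def)
    have "\<iota> (U \<otimes>\<^bsub>cstar_quotient A J\<^esub> V) = h x \<otimes>\<^bsub>C\<^esub> h y"
    proof (rule \<iota>I)
      show "h z = h x \<otimes>\<^bsub>C\<^esub> h y" if z: "z \<in> U \<otimes>\<^bsub>cstar_quotient A J\<^esub> V" for z
      proof -
        obtain u v where uv: "u \<in> U" "v \<in> V" "z \<in> J +>\<^bsub>A\<^esub> (u \<otimes>\<^bsub>A\<^esub> v)"
          using z unfolding W by blast
        have c: "u \<in> carrier A" "v \<in> carrier A" using U[OF uv(1)] V[OF uv(2)] by blast+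
        have "h z = h (u \<otimes>\<^bsub>A\<^esub> v)" using uv(3) coset[OF A.mult_closed[OF c]] by blast
        also have "\<dots> = h u \<otimes>\<^bsub>C\<^esub> h v" by (rule hD(4)[OF c])
        finally show ?thesis by (simp only: conjunct2[OF U[OF uv(1)]] conjunct2[OF V[OF uv(2)]])
      qed
      have "x \<otimes>\<^bsub>A\<^esub> y \<in> J +>\<^bsub>A\<^esub> (x \<otimes>\<^bsub>A\<^esub> y)" using coset xy A.mult_closed by simp
      then show "U \<otimes>\<^bsub>cstar_quotient A J\<^esub> V \<noteq> {}" unfolding W using ne by blast
    qed
    then show "\<iota> (U \<otimes>\<^bsub>cstar_quotient A J\<^esub> V) = \<iota> U \<otimes>\<^bsub>C\<^esub> \<iota> V" using 3 xy by simp
  qed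
  have smult: "\<iota> (c \<odot>\<^bsub>cstar_quotient A J\<^esub> U) = c \<odot>\<^bsub>C\<^esub> \<iota> U"
    and adj: "\<iota> (adj (cstar_quotient A J) U) = adj C (\<iota> U)"
    and into: "\<iota> U \<in> carrier C"
    if U: "U \<in> carrier (cstar_quotient A J)" for U c
  proof -
    obtain x where x: "x \<in> carrier A" "U = J +>\<^bsub>A\<^esub> x" using U carrE by metis
    have ne: "x \<in> U" using coset x by auto
    have u: "u \<in> carrier A \<and> h u = h x" if "u \<in> U" for u using that coset x by auto
    have W: "c \<odot>\<^bsub>cstar_quotient A J\<^esub> U = (\<Union>u\<in>U. J +>\<^bsub>A\<^esub> (c \<odot>\<^bsub>A\<^esub> u))"
      by (simp add: cstar_quotient_def)
    have "\<iota> (c \<odot>\<^bsub>cstar_quotient A J\<^esub> U) = c \<odot>\<^bsub>C\<^esub> h x"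
    proof (rule \<iota>I)
      show "h z = c \<odot>\<^bsub>C\<^esub> h x" if z: "z \<in> c \<odot>\<^bsub>cstar_quotient A J\<^esub> U" for z
      proof -
        obtain v where v: "v \<in> U" "z \<in> J +>\<^bsub>A\<^esub> (c \<odot>\<^bsub>A\<^esub> v)" using z unfolding W by blast
        have vc: "v \<in> carrier A" using u[OF v(1)] by blast
        have "h z = h (c \<odot>\<^bsub>A\<^esub> v)" using v(2) coset[OF A.smult_closed[OF vc]] by blast
        also have "\<dots> = c \<odot>\<^bsub>C\<^esub> h v" by (rule hD(3)[OF vc])
        finally show ?thesis by (simp only: conjunct2[OF u[OF v(1)]])
      qed
      have "c \<odot>\<^bsub>A\<^esub> x \<in> J +>\<^bsub>A\<^esub> (c \<odot>\<^bsub>A\<^esub> x)" using coset x A.smult_closed by simp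
      then show "c \<odot>\<^bsub>cstar_quotient A J\<^esub> U \<noteq> {}" unfolding W using ne by blast
    qed
    then show "\<iota> (c \<odot>\<^bsub>cstar_quotient A J\<^esub> U) = c \<odot>\<^bsub>C\<^esub> \<iota> U" using 3 x by simp
    have "\<iota> (adj (cstar_quotient A J) U) = adj C (h x)"
    proof (rule \<iota>I)
      have S: "adj (cstar_quotient A J) U = adj A ` U" by (simp add: cstar_quotient_def)
      show "h z = adj C (h x)" if z: "z \<in> adj (cstar_quotient A J) U" for z
      proof -
        obtain v where v: "v \<in> U" "z = adj A v" using z unfolding S by blast
        have "h z = adj C (h v)" using hD(5) u[OF v(1)] v(2) by blast
        then show ?thesis by (simp only: conjunct2[OF u[OF v(1)]])
      qed
      show "adj (cstar_quotient A J) U \<noteq> {}" unfolding S using ne by blast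
    qed
    then show "\<iota> (adj (cstar_quotient A J) U) = adj C (\<iota> U)" using 3 x by simp
    show "\<iota> U \<in> carrier C" using 3 x hD(1) by simp
  qed
  show "star_hom (cstar_quotient A J) C \<iota>"
    using add mult smult adj into by (simp add: star_hom_def)
qed

section \<open>Bounded operators on square-summable functions\<close>

text \<open>Infinite sums are controlled through their finite sections, for which the inequalities
  of Minkowski and Cauchy-Schwarz are at hand.\<close>

abbreviation fin_norm :: "('i \<Rightarrow> complex) \<Rightarrow> 'i set \<Rightarrow> real" where
  "fin_norm f Y \<equiv> L2_set (\<lambda>x. cmod (f x)) Y"

lemma fin_norm_le_iff: "0 \<le> C \<Longrightarrow> fin_norm f Y \<le> C \<longleftrightarrow> (\<Sum>x\<in>Y. (cmod (f x))\<^sup>2) \<le> C\<^sup>2"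
  unfolding L2_set_def by (metis abs_of_nonneg real_sqrt_abs real_sqrt_le_iff)

lemma
  assumes off: "\<And>x. x \<notin> I \<Longrightarrow> f x = 0" and le: "\<And>Y. finite Y \<Longrightarrow> fin_norm f Y \<le> C"
  shows l2I: "f \<in> l2 I" and l2_norm_leI: "l2_norm f \<le> C"
proof -
  have C: "0 \<le> C" using le[of "{}"] by simp
  have b: "(\<Sum>x\<in>Y. (cmod (f x))\<^sup>2) \<le> C\<^sup>2" if "finite Y" for Y
    using le[OF that] C by (simp add: fin_norm_le_iff)
  then have s: "(\<lambda>x. (cmod (f x))\<^sup>2) summable_on UNIV"
    by (intro nonneg_bdd_above_summable_on bdd_aboveI[of _ "C\<^sup>2"]) auto
  then show "f \<in> l2 I" using off by (simp add: l2_def)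
  have "(\<Sum>\<^sub>\<infinity>x. (cmod (f x))\<^sup>2) \<le> C\<^sup>2"
    by (rule infsum_le_finite_sums[OF s]) (use b in auto)
  then show "l2_norm f \<le> C" using C by (simp add: l2_norm_def real_le_lsqrt)
qed

lemma l2_off: "f \<in> l2 I \<Longrightarrow> x \<notin> I \<Longrightarrow> f x = 0"
  by (simp add: l2_def)

lemma l2_norm_nonneg [simp]: "0 \<le> l2_norm f"
  by (simp add: l2_norm_def infsum_nonneg)

lemma fin_norm_le_l2_norm:
  assumes "f \<in> l2 I" "finite Y"
  shows "fin_norm f Y \<le> l2_norm f"
  unfolding L2_set_def l2_norm_def
  by (rule real_sqrt_le_mono, rule finite_sum_le_infsum) (use assms in \<open>auto simp: l2_def\<close>)

lemma cmod_le_l2_norm: "f \<in> l2 I \<Longrightarrow> cmod (f x) \<le> l2_norm f"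
  using fin_norm_le_l2_norm[of f I "{x}"] by simp

lemma l2_mono: "f \<in> l2 J \<Longrightarrow> J \<subseteq> I \<Longrightarrow> f \<in> l2 I"
  by (auto simp: l2_def)

lemma l2_zero [simp]: "(\<lambda>_. 0) \<in> l2 I" and l2_norm_zero [simp]: "l2_norm (\<lambda>_. 0) = 0"
  by (simp_all add: l2_def l2_norm_def)

lemma l2_norm_eq_0: "f \<in> l2 I \<Longrightarrow> l2_norm f = 0 \<Longrightarrow> f = (\<lambda>_. 0)"
  using cmod_le_l2_norm[of f I] by fastforce

lemma
  assumes f: "f \<in> l2 I" and g: "g \<in> l2 I"
  shows l2_add: "(\<lambda>x. f x + g x) \<in> l2 I"
    and l2_norm_triangle: "l2_norm (\<lambda>x. f x + g x) \<le> l2_norm f + l2_norm g"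
proof -
  have "fin_norm (\<lambda>x. f x + g x) Y \<le> l2_norm f + l2_norm g" if "finite Y" for Y
  proof -
    have "fin_norm (\<lambda>x. f x + g x) Y \<le> L2_set (\<lambda>x. cmod (f x) + cmod (g x)) Y"
      by (rule L2_set_mono) (auto simp: norm_triangle_ineq)
    also have "\<dots> \<le> fin_norm f Y + fin_norm g Y" by (rule L2_set_triangle_ineq)
    also have "\<dots> \<le> l2_norm f + l2_norm g"
      using fin_norm_le_l2_norm[OF f that] fin_norm_le_l2_norm[OF g that] by simp
    finally show ?thesis .
  qed
  then show "(\<lambda>x. f x + g x) \<in> l2 I" "l2_norm (\<lambda>x. f x + g x) \<le> l2_norm f + l2_norm g"
    using l2_off[OF f] l2_off[OF g]
    by (auto intro!: l2I[of I _ "l2_norm f + l2_norm g"] l2_norm_leI[of I])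
qed

lemma l2_norm_scale: "l2_norm (\<lambda>x. c * f x) = cmod c * l2_norm f"
  by (simp add: l2_norm_def norm_mult power_mult_distrib infsum_cmult_right' real_sqrt_mult)

lemma l2_scale:
  assumes "f \<in> l2 I"
  shows "(\<lambda>x. c * f x) \<in> l2 I"
  using assms by (auto simp: l2_def norm_mult power_mult_distrib intro: summable_on_cmult_right)

lemma l2_diff:
  assumes "f \<in> l2 I" "g \<in> l2 I"
  shows "(\<lambda>x. f x - g x) \<in> l2 I"
  using l2_add[OF assms(1) l2_scale[OF assms(2), of "-1"]] by simp

lemma
  assumes f: "f \<in> l2 I" and g: "g \<in> l2 I"
  shows l2_inner_summable: "(\<lambda>x. cnj (f x) * g x) summable_on UNIV"
    and l2_cauchy_schwarz: "cmod (l2_inner f g) \<le> l2_norm f * l2_norm g"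
proof -
  have b: "(\<Sum>x\<in>Y. cmod (cnj (f x) * g x)) \<le> l2_norm f * l2_norm g" if "finite Y" for Y
  proof -
    have "(\<Sum>x\<in>Y. cmod (cnj (f x) * g x)) = (\<Sum>x\<in>Y. \<bar>cmod (f x)\<bar> * \<bar>cmod (g x)\<bar>)"
      by (simp add: norm_mult)
    also have "\<dots> \<le> fin_norm f Y * fin_norm g Y" by (rule L2_set_mult_ineq)
    also have "\<dots> \<le> l2_norm f * l2_norm g"
      using fin_norm_le_l2_norm[OF f that] fin_norm_le_l2_norm[OF g that]
      by (intro mult_mono) auto
    finally show ?thesis .
  qed
  then have s: "(\<lambda>x. cmod (cnj (f x) * g x)) summable_on UNIV"
    by (intro nonneg_bdd_above_summable_on bdd_aboveI[of _ "l2_norm f * l2_norm g"]) auto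
  then show "(\<lambda>x. cnj (f x) * g x) summable_on UNIV" by (rule abs_summable_summable)
  have "cmod (l2_inner f g) \<le> (\<Sum>\<^sub>\<infinity>x. cmod (cnj (f x) * g x))"
    unfolding l2_inner_def by (rule norm_infsum_bound[OF s])
  also have "\<dots> \<le> l2_norm f * l2_norm g"
    by (rule infsum_le_finite_sums[OF s]) (use b in auto)
  finally show "cmod (l2_inner f g) \<le> l2_norm f * l2_norm g" .
qed

lemma l2_inner_cnj: "cnj (l2_inner f g) = l2_inner g f"
  by (simp add: l2_inner_def mult.commute flip: infsum_cnj)

lemma l2_inner_scale_right: "l2_inner f (\<lambda>x. c * g x) = c * l2_inner f g"
proof -
  have "l2_inner f (\<lambda>x. c * g x) = (\<Sum>\<^sub>\<infinity>x. c * (cnj (f x) * g x))"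
    unfolding l2_inner_def by (rule arg_cong[of _ _ "\<lambda>h. infsum h UNIV"]) (auto simp: mult_ac)
  then show ?thesis by (simp add: l2_inner_def infsum_cmult_right')
qed

lemma l2_inner_add_right:
  assumes "f \<in> l2 I" "g \<in> l2 I" "h \<in> l2 I"
  shows "l2_inner f (\<lambda>x. g x + h x) = l2_inner f g + l2_inner f h"
  using infsum_add[OF l2_inner_summable[OF assms(1,2)] l2_inner_summable[OF assms(1,3)]]
  by (simp add: l2_inner_def distrib_left)

lemma l2_inner_scale_left: "l2_inner (\<lambda>x. c * f x) g = cnj c * l2_inner f g"
  using l2_inner_scale_right[of g c f] by (metis complex_cnj_mult l2_inner_cnj)

lemma l2_inner_add_left:
  assumes "f \<in> l2 I" "g \<in> l2 I" "h \<in> l2 I"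
  shows "l2_inner (\<lambda>x. f x + g x) h = l2_inner f h + l2_inner g h"
  using l2_inner_add_right[OF assms(3,1,2)] by (metis complex_cnj_add l2_inner_cnj)

lemma l2_inner_self:
  assumes "f \<in> l2 I"
  shows "l2_inner f f = complex_of_real ((l2_norm f)\<^sup>2)"
proof -
  have s: "(\<lambda>x. (cmod (f x))\<^sup>2) summable_on UNIV" using assms by (simp add: l2_def)
  have "l2_inner f f = (\<Sum>\<^sub>\<infinity>x. complex_of_real ((cmod (f x))\<^sup>2))"
    unfolding l2_inner_def
    by (rule arg_cong[of _ _ "\<lambda>h. infsum h UNIV"], rule ext)
      (simp only: complex_norm_square mult.commute)
  also have "\<dots> = complex_of_real (\<Sum>\<^sub>\<infinity>x. (cmod (f x))\<^sup>2)" by (rule infsumI[OF has_sum_bounded_linear[OF bounded_linear_of_real has_sum_infsum[OF s]]])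
  also have "(\<Sum>\<^sub>\<infinity>x. (cmod (f x))\<^sup>2) = (l2_norm f)\<^sup>2"
    by (simp add: l2_norm_def infsum_nonneg)
  finally show ?thesis .
qed

definition ket :: "'i \<Rightarrow> 'i \<Rightarrow> complex" where
  "ket y = (\<lambda>x. if x = y then 1 else 0)"

lemma
  assumes "finite Y" "Y \<subseteq> I"
  shows l2_finite_support: "(\<lambda>x. if x \<in> Y then f x else 0) \<in> l2 I"
    and l2_norm_finite_support: "l2_norm (\<lambda>x. if x \<in> Y then f x else 0) \<le> fin_norm f Y"
proof -
  have "fin_norm (\<lambda>x. if x \<in> Y then f x else 0) Z \<le> fin_norm f Y" if "finite Z" for Z
  proof -
    have "(\<Sum>x\<in>Z. (cmod (if x \<in> Y then f x else 0))\<^sup>2) = (\<Sum>x\<in>Z \<inter> Y. (cmod (f x))\<^sup>2)"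
      using that by (intro sum.mono_neutral_cong_right) auto
    also have "\<dots> \<le> (\<Sum>x\<in>Y. (cmod (f x))\<^sup>2)"
      using assms by (intro sum_mono2) auto
    finally show ?thesis by (simp add: L2_set_def)
  qed
  then show "(\<lambda>x. if x \<in> Y then f x else 0) \<in> l2 I"
    "l2_norm (\<lambda>x. if x \<in> Y then f x else 0) \<le> fin_norm f Y"
    using assms by (auto intro!: l2I[of I _ "fin_norm f Y"] l2_norm_leI[of I])
qed

lemma ket_l2: "y \<in> I \<Longrightarrow> ket y \<in> l2 I"
  using l2_finite_support[of "{y}" I "\<lambda>_. 1"] by (simp add: ket_def)

lemma l2_norm_ket [simp]: "l2_norm (ket y) = 1"
proof -
  have "(\<Sum>\<^sub>\<infinity>x. (cmod (ket y x))\<^sup>2) = (\<Sum>\<^sub>\<infinity>x\<in>{y}. (cmod (ket y x))\<^sup>2)"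
    by (rule infsum_cong_neutral) (auto simp: ket_def)
  then show ?thesis by (simp add: l2_norm_def ket_def)
qed

lemma l2_inner_ket: "l2_inner (ket y) g = g y"
proof -
  have "(\<Sum>\<^sub>\<infinity>x. cnj (ket y x) * g x) = (\<Sum>\<^sub>\<infinity>x\<in>{y}. cnj (ket y x) * g x)"
    by (rule infsum_cong_neutral) (auto simp: ket_def)
  then show ?thesis by (simp add: l2_inner_def ket_def)
qed

section \<open>Bounded operators and their norms\<close>

lemma l2_ops_carrier:
  "T \<in> carrier (l2_ops I) \<longleftrightarrow> T \<in> l2 I \<rightarrow>\<^sub>E l2 I \<and>
     (\<forall>f\<in>l2 I. \<forall>g\<in>l2 I. T (\<lambda>x. f x + g x) = (\<lambda>x. T f x + T g x)) \<and>
     (\<forall>c. \<forall>f\<in>l2 I. T (\<lambda>x. c * f x) = (\<lambda>x. c * T f x)) \<and>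
     (\<exists>C. \<forall>f\<in>l2 I. l2_norm (T f) \<le> C * l2_norm f)"
  by (simp add: l2_ops_def Let_def)

lemma l2_opsD:
  assumes "T \<in> carrier (l2_ops I)"
  shows "f \<in> l2 I \<Longrightarrow> T f \<in> l2 I"
    and "\<lbrakk>f \<in> l2 I; g \<in> l2 I\<rbrakk> \<Longrightarrow> T (\<lambda>x. f x + g x) = (\<lambda>x. T f x + T g x)"
    and "f \<in> l2 I \<Longrightarrow> T (\<lambda>x. c * f x) = (\<lambda>x. c * T f x)"
    and "\<exists>C. \<forall>f\<in>l2 I. l2_norm (T f) \<le> C * l2_norm f"
    and "T \<in> extensional (l2 I)"
  using assms by (auto simp: l2_ops_carrier PiE_def)

lemma l2_opsI:
  assumes "\<And>f. f \<in> l2 I \<Longrightarrow> T f \<in> l2 I" "T \<in> extensional (l2 I)"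
    and "\<And>f g. \<lbrakk>f \<in> l2 I; g \<in> l2 I\<rbrakk> \<Longrightarrow> T (\<lambda>x. f x + g x) = (\<lambda>x. T f x + T g x)"
    and "\<And>c f. f \<in> l2 I \<Longrightarrow> T (\<lambda>x. c * f x) = (\<lambda>x. c * T f x)"
    and "\<And>f. f \<in> l2 I \<Longrightarrow> l2_norm (T f) \<le> C * l2_norm f"
  shows "T \<in> carrier (l2_ops I)"
  unfolding l2_ops_carrier using assms by (auto simp: PiE_def intro!: exI[of _ C])

lemma l2_ops_diff:
  assumes "T \<in> carrier (l2_ops I)" "f \<in> l2 I" "g \<in> l2 I"
  shows "T (\<lambda>x. f x - g x) = (\<lambda>x. T f x - T g x)"
  using l2_opsD(2)[OF assms(1,2) l2_scale[OF assms(3), of "-1"]] l2_opsD(3)[OF assms(1,3), of "-1"]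
  by simp

lemma l2_ops_eqI:
  assumes "S \<in> extensional (l2 I)" "T \<in> extensional (l2 I)"
    and "\<And>f. f \<in> l2 I \<Longrightarrow> S f = T f"
  shows "S = T"
  using assms by (rule extensionalityI)

lemma l2_ops_simps:
  "mult (l2_ops I) S T = (\<lambda>f\<in>l2 I. S (T f))"
  "one (l2_ops I) = (\<lambda>f\<in>l2 I. f)"
  "zero (l2_ops I) = (\<lambda>f\<in>l2 I. \<lambda>x. 0)"
  "add (l2_ops I) S T = (\<lambda>f\<in>l2 I. \<lambda>x. S f x + T f x)"
  "smult (l2_ops I) c T = (\<lambda>f\<in>l2 I. \<lambda>x. c * T f x)"
  "nrm (l2_ops I) = op_norm_on I"
  by (simp_all add: l2_ops_def Let_def)

lemma adj_l2_ops:
  "adj (l2_ops I) T = (THE S. S \<in> carrier (l2_ops I) \<and>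
     (\<forall>f\<in>l2 I. \<forall>g\<in>l2 I. l2_inner (T f) g = l2_inner f (S g)))"
  by (simp add: l2_ops_def Let_def)

lemma op_norm_le:
  assumes "0 \<le> C" "\<And>f. f \<in> l2 J \<Longrightarrow> l2_norm (T f) \<le> C * l2_norm f"
  shows "op_norm_on J T \<le> C"
  unfolding op_norm_on_def
proof (rule cSup_least)
  have "(\<lambda>_. 0) \<in> l2 J \<and> l2_norm (\<lambda>_::'a. 0) \<le> 1" by simp
  then show "{l2_norm (T f) |f. f \<in> l2 J \<and> l2_norm f \<le> 1} \<noteq> {}" by blast
  fix r assume "r \<in> {l2_norm (T f) |f. f \<in> l2 J \<and> l2_norm f \<le> 1}"
  then obtain f where f: "f \<in> l2 J" "l2_norm f \<le> 1" "r = l2_norm (T f)" by blast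
  have "l2_norm (T f) \<le> C * 1"
    using assms(2)[OF f(1)] mult_left_mono[OF f(2) assms(1)] by linarith
  then show "r \<le> C" using f(3) by simp
qed

context
  fixes T :: "('i \<Rightarrow> complex) \<Rightarrow> ('i \<Rightarrow> complex)" and I J
  assumes T: "T \<in> carrier (l2_ops I)" and J: "J \<subseteq> I"
begin

text \<open>The set J may be smaller than I because \<open>D_red_o\<close> measures an operator on
  functions supported in \<open>Delta\<close>.\<close>

lemma op_norm_ge1:
  assumes "f \<in> l2 J" "l2_norm f \<le> 1"
  shows "l2_norm (T f) \<le> op_norm_on J T"
  unfolding op_norm_on_def
proof (rule cSup_upper)
  show "l2_norm (T f) \<in> {l2_norm (T f) |f. f \<in> l2 J \<and> l2_norm f \<le> 1}" using assms by blast
  obtain C where C: "\<And>f. f \<in> l2 I \<Longrightarrow> l2_norm (T f) \<le> C * l2_norm f" using l2_opsD(4)[OF T] by blast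
  show "bdd_above {l2_norm (T f) |f. f \<in> l2 J \<and> l2_norm f \<le> 1}"
  proof (rule bdd_aboveI)
    fix r assume "r \<in> {l2_norm (T f) |f. f \<in> l2 J \<and> l2_norm f \<le> 1}"
    then obtain g where g: "g \<in> l2 J" "l2_norm g \<le> 1" "r = l2_norm (T g)" by blast
    have "r \<le> C * l2_norm g" using C[OF l2_mono[OF g(1) J]] g(3) by simp
    also have "\<dots> \<le> \<bar>C\<bar> * 1" using g(2) by (intro mult_mono) auto
    finally show "r \<le> \<bar>C\<bar>" by simp
  qed
qed

lemma op_norm_nonneg: "0 \<le> op_norm_on J T"
  using order_trans[OF l2_norm_nonneg op_norm_ge1[of "\<lambda>_. 0"]] by simp

lemma op_norm_bound:
  assumes f: "f \<in> l2 J"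
  shows "l2_norm (T f) \<le> op_norm_on J T * l2_norm f"
proof (cases "l2_norm f = 0")
  case True
  have fI: "f \<in> l2 I" using f J by (rule l2_mono)
  obtain C where C: "\<And>f. f \<in> l2 I \<Longrightarrow> l2_norm (T f) \<le> C * l2_norm f" using l2_opsD(4)[OF T] by blast
  have "l2_norm (T f) = 0" using C[OF fI] True l2_norm_nonneg[of "T f"] by simp
  then show ?thesis using True by simp
next
  case False
  then have pos: "l2_norm f > 0" using l2_norm_nonneg[of f] by linarith
  let ?c = "complex_of_real (1 / l2_norm f)"
  have n: "cmod ?c = 1 / l2_norm f" using pos by (simp add: norm_divide)
  have "l2_norm (T (\<lambda>x. ?c * f x)) \<le> op_norm_on J T"
    using pos n by (intro op_norm_ge1 l2_scale f) (simp add: l2_norm_scale del: of_real_divide)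
  moreover have "T (\<lambda>x. ?c * f x) = (\<lambda>x. ?c * T f x)" using l2_opsD(3)[OF T l2_mono[OF f J]] .
  ultimately have "1 / l2_norm f * l2_norm (T f) \<le> op_norm_on J T"
    using n by (simp add: l2_norm_scale del: of_real_divide)
  then show ?thesis using pos by (simp add: field_simps)
qed

end

lemma l2_ops_closed:
  shows "\<lbrakk>S \<in> carrier (l2_ops I); T \<in> carrier (l2_ops I)\<rbrakk> \<Longrightarrow> S \<otimes>\<^bsub>l2_ops I\<^esub> T \<in> carrier (l2_ops I)"
    and "\<lbrakk>S \<in> carrier (l2_ops I); T \<in> carrier (l2_ops I)\<rbrakk> \<Longrightarrow> S \<oplus>\<^bsub>l2_ops I\<^esub> T \<in> carrier (l2_ops I)"
    and "T \<in> carrier (l2_ops I) \<Longrightarrow> c \<odot>\<^bsub>l2_ops I\<^esub> T \<in> carrier (l2_ops I)"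
    and "\<zero>\<^bsub>l2_ops I\<^esub> \<in> carrier (l2_ops I)"
    and "\<one>\<^bsub>l2_ops I\<^esub> \<in> carrier (l2_ops I)"
proof -
  assume S: "S \<in> carrier (l2_ops I)" and T: "T \<in> carrier (l2_ops I)"
  note SD = l2_opsD[OF S] and TD = l2_opsD[OF T]
  note bS = op_norm_bound[OF S order_refl] and bT = op_norm_bound[OF T order_refl]
  show "S \<otimes>\<^bsub>l2_ops I\<^esub> T \<in> carrier (l2_ops I)"
  proof (rule l2_opsI[where C = "op_norm_on I S * op_norm_on I T"])
    fix f assume f: "f \<in> l2 I"
    have "l2_norm (S (T f)) \<le> op_norm_on I S * (op_norm_on I T * l2_norm f)"
      using order_trans[OF bS[OF TD(1)[OF f]] mult_left_mono[OF bT[OF f] op_norm_nonneg[OF S order_refl]]] .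
    then show "l2_norm ((S \<otimes>\<^bsub>l2_ops I\<^esub> T) f) \<le> op_norm_on I S * op_norm_on I T * l2_norm f"
      using f by (simp add: l2_ops_simps mult.assoc)
  qed (simp_all add: l2_ops_simps SD TD l2_add l2_scale)
  show "S \<oplus>\<^bsub>l2_ops I\<^esub> T \<in> carrier (l2_ops I)"
  proof (rule l2_opsI[where C = "op_norm_on I S + op_norm_on I T"])
    fix f assume f: "f \<in> l2 I"
    show "l2_norm ((S \<oplus>\<^bsub>l2_ops I\<^esub> T) f) \<le> (op_norm_on I S + op_norm_on I T) * l2_norm f"
      using f l2_norm_triangle[OF SD(1)[OF f] TD(1)[OF f]] bS[OF f] bT[OF f]
      by (simp add: l2_ops_simps distrib_right)
  qed (simp_all add: l2_ops_simps SD TD l2_add l2_scale algebra_simps)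
next
  assume T: "T \<in> carrier (l2_ops I)"
  note TD = l2_opsD[OF T]
  show "c \<odot>\<^bsub>l2_ops I\<^esub> T \<in> carrier (l2_ops I)"
  proof (rule l2_opsI[where C = "cmod c * op_norm_on I T"])
    fix f assume f: "f \<in> l2 I"
    show "l2_norm ((c \<odot>\<^bsub>l2_ops I\<^esub> T) f) \<le> cmod c * op_norm_on I T * l2_norm f"
      using f mult_left_mono[OF op_norm_bound[OF T order_refl f], of "cmod c"]
      by (simp add: l2_ops_simps l2_norm_scale mult.assoc)
  qed (simp_all add: l2_ops_simps TD l2_add l2_scale algebra_simps)
next
  show "\<zero>\<^bsub>l2_ops I\<^esub> \<in> carrier (l2_ops I)" "\<one>\<^bsub>l2_ops I\<^esub> \<in> carrier (l2_ops I)"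
    by (rule l2_opsI[where C = 1]; simp add: l2_ops_simps l2_add l2_scale)+
qed

section \<open>Adjoints of bounded operators\<close>

lemma eventually_finite_finite_subsets_at_top: "eventually finite (finite_subsets_at_top A)"
  by (rule eventually_finite_subsets_at_top_weakI) simp

lemma l2_tail_small:
  assumes f: "f \<in> l2 I" and e: "e > 0"
  shows "eventually (\<lambda>Y. l2_norm (\<lambda>x. f x - (if x \<in> Y then f x else 0)) \<le> e) (finite_subsets_at_top UNIV)"
proof -
  let ?s = "\<lambda>x. (cmod (f x))\<^sup>2"
  have s: "?s summable_on UNIV" using f by (simp add: l2_def)
  have "(sum ?s \<longlongrightarrow> infsum ?s UNIV) (finite_subsets_at_top UNIV)"
    using has_sum_infsum[OF s] by (simp add: has_sum_def)
  then have "eventually (\<lambda>Y. infsum ?s UNIV - e\<^sup>2 < sum ?s Y) (finite_subsets_at_top UNIV)"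
    by (rule order_tendstoD(1)) (use e in simp)
  with eventually_finite_finite_subsets_at_top show ?thesis
  proof eventually_elim
    case (elim Y)
    show ?case
    proof (rule l2_norm_leI[of I])
      fix Z :: "'a set" assume Z: "finite Z"
      have "(\<Sum>x\<in>Z. (cmod (f x - (if x \<in> Y then f x else 0)))\<^sup>2) = sum ?s (Z - Y)"
        using Z by (intro sum.mono_neutral_cong_right) auto
      moreover have "sum ?s (Z - Y) + sum ?s Y = sum ?s (Z \<union> Y)"
        using Z elim by (subst sum.union_disjoint[symmetric]) (auto simp: Un_Diff_cancel2)
      moreover have "sum ?s (Z \<union> Y) \<le> infsum ?s UNIV"
        using Z elim by (intro finite_sum_le_infsum[OF s]) auto
      ultimately have "(\<Sum>x\<in>Z. (cmod (f x - (if x \<in> Y then f x else 0)))\<^sup>2) \<le> e\<^sup>2"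
        using elim by linarith
      then show "fin_norm (\<lambda>x. f x - (if x \<in> Y then f x else 0)) Z \<le> e"
        using e by (simp add: fin_norm_le_iff)
    qed (use l2_off[OF f] in auto)
  qed
qed

lemma l2_ops_inner_finite:
  assumes T: "T \<in> carrier (l2_ops I)" and g: "g \<in> l2 I" and "finite Y" "Y \<subseteq> I"
  shows "l2_inner (T (\<lambda>x. if x \<in> Y then c x else 0)) g = (\<Sum>y\<in>Y. cnj (c y) * l2_inner (T (ket y)) g)"
  using assms(3,4)
proof (induction Y)
  case empty
  have "T (\<lambda>x. 0 * (0::complex)) = (\<lambda>x. 0 * T (\<lambda>_. 0) x)" by (rule l2_opsD(3)[OF T]) simp
  then show ?case by (simp add: l2_inner_def)
next
  case (insert y Y)
  let ?h = "\<lambda>x. if x \<in> Y then c x else 0"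
  have h: "?h \<in> l2 I" using insert by (intro l2_finite_support) auto
  have k: "ket y \<in> l2 I" using insert by (intro ket_l2) auto
  have "(\<lambda>x. if x \<in> insert y Y then c x else 0) = (\<lambda>x. ?h x + c y * ket y x)"
    using insert by (auto simp: ket_def)
  then have "T (\<lambda>x. if x \<in> insert y Y then c x else 0) = (\<lambda>x. T ?h x + c y * T (ket y) x)"
    using l2_opsD(2)[OF T h l2_scale[OF k]] l2_opsD(3)[OF T k] by simp
  then have "l2_inner (T (\<lambda>x. if x \<in> insert y Y then c x else 0)) g =
      l2_inner (T ?h) g + cnj (c y) * l2_inner (T (ket y)) g"
    using l2_inner_add_left[OF l2_opsD(1)[OF T h] l2_scale[OF l2_opsD(1)[OF T k]] g]
    by (simp add: l2_inner_scale_left)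
  then show ?case using insert by simp
qed

text \<open>The adjoint is written down by its matrix coefficients, as the function sending y to the
  inner product of T(delta_y) with g. Finite sections show that it is square summable and that it
  satisfies the adjoint identity.\<close>

lemma l2_ops_adjoint_exists:
  assumes T: "T \<in> carrier (l2_ops I)"
  obtains S where "S \<in> carrier (l2_ops I)"
    "\<And>f g. \<lbrakk>f \<in> l2 I; g \<in> l2 I\<rbrakk> \<Longrightarrow> l2_inner (T f) g = l2_inner f (S g)"
    "op_norm_on I S \<le> op_norm_on I T"
proof -
  note TD = l2_opsD[OF T] and bT = op_norm_bound[OF T order_refl] and nT = op_norm_nonneg[OF T order_refl]
  let ?N = "op_norm_on I T"
  define s where "s g = (\<lambda>y. if y \<in> I then l2_inner (T (ket y)) g else 0)" for g
  \<comment> \<open>For the section h of s(g) to Y, the square of its norm is the inner product of T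
    h with g, hence at most \<open>?N\<close> times the norms of h and g. One factor, the norm of h,
    cancels.\<close>
  have fin: "fin_norm (s g) Y \<le> ?N * l2_norm g" if g: "g \<in> l2 I" and Y: "finite Y" for g Y
  proof -
    let ?Y = "Y \<inter> I"
    let ?h = "\<lambda>x. if x \<in> ?Y then s g x else 0"
    have h: "?h \<in> l2 I" using Y by (intro l2_finite_support) auto
    have eq: "fin_norm (s g) Y = fin_norm (s g) ?Y"
      unfolding L2_set_def using Y
      by (intro arg_cong[of _ _ sqrt] sum.mono_neutral_cong_right) (auto simp: s_def)
    have "l2_inner (T ?h) g = (\<Sum>y\<in>?Y. cnj (s g y) * s g y)"
      using l2_ops_inner_finite[OF T g, of ?Y "s g"] Y by (simp add: s_def)
    also have "\<dots> = complex_of_real (\<Sum>y\<in>?Y. (cmod (s g y))\<^sup>2)"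
      unfolding of_real_sum by (rule sum.cong[OF refl]) (simp only: complex_norm_square mult.commute)
    also have "\<dots> = complex_of_real ((fin_norm (s g) ?Y)\<^sup>2)"
      by (simp add: L2_set_def sum_nonneg)
    finally have "(fin_norm (s g) ?Y)\<^sup>2 = cmod (l2_inner (T ?h) g)"
      by (simp add: norm_power)
    also have "\<dots> \<le> l2_norm (T ?h) * l2_norm g"
      by (rule l2_cauchy_schwarz[OF TD(1)[OF h] g])
    also have "\<dots> \<le> (?N * l2_norm ?h) * l2_norm g"
      by (intro mult_right_mono bT h) simp
    also have "\<dots> \<le> (?N * fin_norm (s g) ?Y) * l2_norm g"
      using Y nT by (intro mult_right_mono mult_left_mono l2_norm_finite_support[of _ I]) auto
    finally have "fin_norm (s g) ?Y * fin_norm (s g) ?Y \<le> (?N * l2_norm g) * fin_norm (s g) ?Y"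
      by (simp add: power2_eq_square mult_ac)
    then have "fin_norm (s g) ?Y \<le> ?N * l2_norm g"
    proof (cases "fin_norm (s g) ?Y = 0")
      case False
      then have "fin_norm (s g) ?Y > 0" using L2_set_nonneg[of _ ?Y] by (simp add: less_le)
      then show ?thesis using \<open>_ \<le> (?N * l2_norm g) * _\<close> by (simp only: mult_le_cancel_right)
    qed (use nT in simp)
    then show ?thesis using eq by simp
  qed
  have off: "s g y = 0" if "y \<notin> I" for g y using that by (simp add: s_def)
  have sl2: "s g \<in> l2 I" if "g \<in> l2 I" for g by (rule l2I[OF off fin[OF that]])
  have sn: "l2_norm (s g) \<le> ?N * l2_norm g" if "g \<in> l2 I" for g
    by (rule l2_norm_leI[OF off fin[OF that]])
  define S where "S = (\<lambda>g\<in>l2 I. s g)"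
  have k: "T (ket y) \<in> l2 I" if "y \<in> I" for y by (rule TD(1)[OF ket_l2[OF that]])
  have S: "S \<in> carrier (l2_ops I)"
  proof (rule l2_opsI[where C = ?N])
    show "S (\<lambda>x. f x + g x) = (\<lambda>x. S f x + S g x)" if "f \<in> l2 I" "g \<in> l2 I" for f g
      using that l2_inner_add_right[OF k] by (auto simp: S_def l2_add s_def)
    show "S (\<lambda>x. c * f x) = (\<lambda>x. c * S f x)" if "f \<in> l2 I" for c f
      using that by (auto simp: S_def l2_scale s_def l2_inner_scale_right)
  qed (simp_all add: S_def sl2 sn)
  moreover have "l2_inner (T f) g = l2_inner f (S g)" if f: "f \<in> l2 I" and g: "g \<in> l2 I" for f g
  proof -
    let ?F = "finite_subsets_at_top (UNIV :: 'a set)"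
    let ?u = "\<lambda>Y. \<Sum>x\<in>Y. cnj (f x) * s g x"
    have "((\<lambda>x. cnj (f x) * s g x) has_sum l2_inner f (s g)) UNIV"
      unfolding l2_inner_def by (rule has_sum_infsum[OF l2_inner_summable[OF f sl2[OF g]]])
    then have lim1: "(?u \<longlongrightarrow> l2_inner f (s g)) ?F" by (simp add: has_sum_def)
    have lim2: "(?u \<longlongrightarrow> l2_inner (T f) g) ?F"
    proof (rule tendstoI)
      fix e :: real assume e: "e > 0"
      \<comment> \<open>The tolerance d is chosen so that a d < e; the summand 1 in its denominator
        covers a = 0.\<close>
      define a where "a = ?N * l2_norm g"
      define d where "d = e / (2 * (a + 1))"
      have a: "a \<ge> 0" using nT by (simp add: a_def)
      have d: "d > 0" using e a by (simp add: d_def)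
      have "(a + 1) * d = e / 2" unfolding d_def using a by (auto simp: divide_simps)
      then have "a * d < e" using d e by (simp add: distrib_right)
      then have "?N * d * l2_norm g < e" by (simp add: a_def mult_ac)
      show "eventually (\<lambda>Y. dist (?u Y) (l2_inner (T f) g) < e) ?F"
        using l2_tail_small[OF f d] eventually_finite_finite_subsets_at_top
      proof eventually_elim
        case (elim Y)
        let ?fY = "\<lambda>x. if x \<in> Y \<inter> I then f x else 0"
        have fY: "?fY \<in> l2 I" using elim by (intro l2_finite_support) auto
        have "(\<lambda>x. f x - ?fY x) = (\<lambda>x. f x - (if x \<in> Y then f x else 0))"
          using l2_off[OF f] by auto
        then have le: "l2_norm (\<lambda>x. f x - ?fY x) \<le> d" using elim(1) by (simp only:)
        have "?u Y = (\<Sum>x\<in>Y \<inter> I. cnj (f x) * l2_inner (T (ket x)) g)"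
          using elim by (intro sum.mono_neutral_cong_right) (auto simp: s_def)
        also have "\<dots> = l2_inner (T ?fY) g"
          using l2_ops_inner_finite[OF T g, of "Y \<inter> I" f] elim by simp
        finally have u: "?u Y = l2_inner (T ?fY) g" .
        have "l2_inner (T f) g - l2_inner (T ?fY) g = l2_inner (\<lambda>x. T f x + (-1) * T ?fY x) g"
          using l2_inner_add_left[OF TD(1)[OF f] l2_scale[OF TD(1)[OF fY], of "-1"] g]
            l2_inner_scale_left[of "-1" "T ?fY" g] by simp
        also have "\<dots> = l2_inner (T (\<lambda>x. f x - ?fY x)) g"
          using l2_ops_diff[OF T f fY] by simp
        finally have "dist (?u Y) (l2_inner (T f) g) = cmod (l2_inner (T (\<lambda>x. f x - ?fY x)) g)"
          unfolding u by (simp add: dist_norm norm_minus_commute)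
        also have "\<dots> \<le> l2_norm (T (\<lambda>x. f x - ?fY x)) * l2_norm g"
          by (rule l2_cauchy_schwarz[OF TD(1)[OF l2_diff[OF f fY]] g])
        also have "\<dots> \<le> (?N * l2_norm (\<lambda>x. f x - ?fY x)) * l2_norm g"
          by (intro mult_right_mono bT l2_diff f fY) simp
        also have "\<dots> \<le> (?N * d) * l2_norm g"
          by (intro mult_right_mono mult_left_mono le nT) simp
        also have "\<dots> < e" by fact
        finally show ?case .
      qed
    qed
    show ?thesis using tendsto_unique[OF _ lim1 lim2] g by (simp add: S_def)
  qed
  moreover have "op_norm_on I S \<le> ?N"
    by (rule op_norm_le[OF nT]) (simp add: S_def sn)
  ultimately show ?thesis using that by blast
qed

lemma l2_ops_adjoint_unique:
  assumes S: "S \<in> carrier (l2_ops I)" "S' \<in> carrier (l2_ops I)"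
    and eq: "\<And>f g. \<lbrakk>f \<in> l2 I; g \<in> l2 I\<rbrakk> \<Longrightarrow> l2_inner f (S g) = l2_inner f (S' g)"
  shows "S = S'"
proof (rule l2_ops_eqI[OF l2_opsD(5)[OF S(1)] l2_opsD(5)[OF S(2)]], rule ext)
  fix g x assume g: "g \<in> l2 I"
  show "S g x = S' g x"
  proof (cases "x \<in> I")
    case True
    then show ?thesis using eq[OF ket_l2 g, of x] by (simp add: l2_inner_ket)
  next
    case False
    then show ?thesis using l2_off l2_opsD(1)[OF _ g] S by metis
  qed
qed

text \<open>The adjoint is a definite description; uniqueness allows it to be computed by exhibiting
  a candidate.\<close>

lemma adj_l2_opsI:
  assumes "S \<in> carrier (l2_ops I)"
    and "\<And>f g. \<lbrakk>f \<in> l2 I; g \<in> l2 I\<rbrakk> \<Longrightarrow> l2_inner (T f) g = l2_inner f (S g)"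
  shows "adj (l2_ops I) T = S"
  unfolding adj_l2_ops
proof (rule the_equality)
  fix S' assume "S' \<in> carrier (l2_ops I) \<and> (\<forall>f\<in>l2 I. \<forall>g\<in>l2 I. l2_inner (T f) g = l2_inner f (S' g))"
  then show "S' = S" using assms l2_ops_adjoint_unique[of S' I S] by metis
qed (use assms in simp)

lemma adj_l2_opsD:
  assumes "T \<in> carrier (l2_ops I)"
  shows "adj (l2_ops I) T \<in> carrier (l2_ops I)"
    and "\<lbrakk>f \<in> l2 I; g \<in> l2 I\<rbrakk> \<Longrightarrow> l2_inner (T f) g = l2_inner f (adj (l2_ops I) T g)"
    and "op_norm_on I (adj (l2_ops I) T) \<le> op_norm_on I T"
proof -
  obtain S where S: "S \<in> carrier (l2_ops I)"
    "\<And>f g. \<lbrakk>f \<in> l2 I; g \<in> l2 I\<rbrakk> \<Longrightarrow> l2_inner (T f) g = l2_inner f (S g)"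
    "op_norm_on I S \<le> op_norm_on I T"
    using l2_ops_adjoint_exists[OF assms] by blast
  have "adj (l2_ops I) T = S" by (rule adj_l2_opsI[OF S(1,2)])
  then show "adj (l2_ops I) T \<in> carrier (l2_ops I)"
    "\<lbrakk>f \<in> l2 I; g \<in> l2 I\<rbrakk> \<Longrightarrow> l2_inner (T f) g = l2_inner f (adj (l2_ops I) T g)"
    "op_norm_on I (adj (l2_ops I) T) \<le> op_norm_on I T"
    using S by simp_all
qed

lemma adj_l2_opsD':
  assumes "T \<in> carrier (l2_ops I)" "f \<in> l2 I" "g \<in> l2 I"
  shows "l2_inner (adj (l2_ops I) T f) g = l2_inner f (T g)"
  using adj_l2_opsD(2)[OF assms(1,3,2)] by (metis l2_inner_cnj)

lemma op_norm_mult_le: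
  assumes S: "S \<in> carrier (l2_ops I)" and T: "T \<in> carrier (l2_ops I)"
  shows "op_norm_on I (S \<otimes>\<^bsub>l2_ops I\<^esub> T) \<le> op_norm_on I S * op_norm_on I T"
proof (rule op_norm_le)
  fix f assume f: "f \<in> l2 I"
  have "l2_norm (S (T f)) \<le> op_norm_on I S * (op_norm_on I T * l2_norm f)"
    using order_trans[OF op_norm_bound[OF S order_refl l2_opsD(1)[OF T f]]
        mult_left_mono[OF op_norm_bound[OF T order_refl f] op_norm_nonneg[OF S order_refl]]] .
  then show "l2_norm ((S \<otimes>\<^bsub>l2_ops I\<^esub> T) f) \<le> op_norm_on I S * op_norm_on I T * l2_norm f"
    using f by (simp add: l2_ops_simps mult.assoc)
qed (use op_norm_nonneg[OF S order_refl] op_norm_nonneg[OF T order_refl] in simp)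

lemma op_norm_smult_le:
  assumes T: "T \<in> carrier (l2_ops I)"
  shows "op_norm_on I (c \<odot>\<^bsub>l2_ops I\<^esub> T) \<le> cmod c * op_norm_on I T"
proof (rule op_norm_le)
  fix f assume f: "f \<in> l2 I"
  show "l2_norm ((c \<odot>\<^bsub>l2_ops I\<^esub> T) f) \<le> cmod c * op_norm_on I T * l2_norm f"
    using f mult_left_mono[OF op_norm_bound[OF T order_refl f], of "cmod c"]
    by (simp add: l2_ops_simps l2_norm_scale mult.assoc)
qed (use op_norm_nonneg[OF T order_refl] in simp)

lemma op_norm_eq_0:
  assumes T: "T \<in> carrier (l2_ops I)"
  shows "op_norm_on I T = 0 \<longleftrightarrow> T = \<zero>\<^bsub>l2_ops I\<^esub>"
proof
  assume "op_norm_on I T = 0"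
  then have "l2_norm (T f) = 0" if "f \<in> l2 I" for f
    using op_norm_bound[OF T order_refl that] l2_norm_nonneg[of "T f"] by simp
  then have "T f = (\<lambda>_. 0)" if "f \<in> l2 I" for f
    using l2_norm_eq_0[OF l2_opsD(1)[OF T that]] that by blast
  then show "T = \<zero>\<^bsub>l2_ops I\<^esub>"
    by (intro l2_ops_eqI[OF l2_opsD(5)[OF T]]) (simp_all add: l2_ops_simps)
next
  assume z: "T = \<zero>\<^bsub>l2_ops I\<^esub>"
  have "op_norm_on I T \<le> 0" by (rule op_norm_le) (simp_all add: z l2_ops_simps)
  then show "op_norm_on I T = 0" using op_norm_nonneg[OF T order_refl] by simp
qed

text \<open>The limit is first taken at each function and each point. On a finite set the Cauchy
  estimate survives the limit in n, and since the bound does not depend on the set it becomes an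
  estimate in norm.\<close>

lemma l2_ops_complete:
  assumes X: "\<And>n. X n \<in> carrier (l2_ops I)"
    and cauchy: "\<And>e. e > 0 \<Longrightarrow> \<exists>N. \<forall>m\<ge>N. \<forall>n\<ge>N.
      op_norm_on I (X m \<oplus>\<^bsub>l2_ops I\<^esub> (-1) \<odot>\<^bsub>l2_ops I\<^esub> X n) < e"
  shows "\<exists>T\<in>carrier (l2_ops I). (\<lambda>n::nat. op_norm_on I (X n \<oplus>\<^bsub>l2_ops I\<^esub> (-1) \<odot>\<^bsub>l2_ops I\<^esub> T)) \<longlonglongrightarrow> 0"
proof -
  note XD = l2_opsD[OF X]
  have diff: "l2_norm (\<lambda>x. X m f x - X n f x) \<le>
      op_norm_on I (X m \<oplus>\<^bsub>l2_ops I\<^esub> (-1) \<odot>\<^bsub>l2_ops I\<^esub> X n) * l2_norm f" if f: "f \<in> l2 I" for m n f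
    using op_norm_bound[OF l2_ops_closed(2)[OF X l2_ops_closed(3)[OF X]] order_refl f, of m "-1" n] f
    by (simp add: l2_ops_simps)
  have "convergent (\<lambda>n. X n f x)" if f: "f \<in> l2 I" for f x
  proof (rule Cauchy_convergent, rule CauchyI)
    fix e :: real assume e: "e > 0"
    have pos: "l2_norm f + 1 > 0" using l2_norm_nonneg[of f] by linarith
    obtain N where N: "\<And>m n. \<lbrakk>m \<ge> N; n \<ge> N\<rbrakk> \<Longrightarrow>
        op_norm_on I (X m \<oplus>\<^bsub>l2_ops I\<^esub> (-1) \<odot>\<^bsub>l2_ops I\<^esub> X n) < e / (l2_norm f + 1)"
      using cauchy[of "e / (l2_norm f + 1)"] e pos by (meson divide_pos_pos)
    have "norm (X m f x - X n f x) < e" if "m \<ge> N" "n \<ge> N" for m n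
    proof -
      have "norm (X m f x - X n f x) \<le> l2_norm (\<lambda>x. X m f x - X n f x)"
        using cmod_le_l2_norm[OF l2_diff[OF XD(1)[OF f] XD(1)[OF f]]] .
      also have "\<dots> \<le> e / (l2_norm f + 1) * l2_norm f"
        using order_trans[OF diff[OF f] mult_right_mono[OF less_imp_le[OF N[OF that]] l2_norm_nonneg]] .
      also have "\<dots> < e" using e pos by (simp add: field_simps)
      finally show ?thesis .
    qed
    then show "\<exists>M. \<forall>m\<ge>M. \<forall>n\<ge>M. norm (X m f x - X n f x) < e" by blast
  qed
  then have "\<forall>f x. \<exists>l. f \<in> l2 I \<longrightarrow> (\<lambda>n. X n f x) \<longlonglongrightarrow> l" by (auto simp: convergent_def)
  then obtain L where L: "\<And>f x. f \<in> l2 I \<Longrightarrow> (\<lambda>n. X n f x) \<longlonglongrightarrow> L f x" by metis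
  have fin: "fin_norm (\<lambda>x. X m f x - L f x) Y \<le> e * l2_norm f"
    if f: "f \<in> l2 I" and Y: "finite Y"
      and N: "\<And>m n. \<lbrakk>m \<ge> N; n \<ge> N\<rbrakk> \<Longrightarrow> op_norm_on I (X m \<oplus>\<^bsub>l2_ops I\<^esub> (-1) \<odot>\<^bsub>l2_ops I\<^esub> X n) < e"
      and m: "m \<ge> N" for m f Y e N
  proof -
    have "(\<lambda>n. fin_norm (\<lambda>x. X m f x - X n f x) Y) \<longlonglongrightarrow> fin_norm (\<lambda>x. X m f x - L f x) Y"
      unfolding L2_set_def by (intro tendsto_intros L f)
    moreover have "eventually (\<lambda>n. fin_norm (\<lambda>x. X m f x - X n f x) Y \<le> e * l2_norm f) sequentially"
      using eventually_ge_at_top[of N]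
    proof eventually_elim
      case (elim n)
      have "fin_norm (\<lambda>x. X m f x - X n f x) Y \<le> l2_norm (\<lambda>x. X m f x - X n f x)"
        by (rule fin_norm_le_l2_norm[OF l2_diff[OF XD(1)[OF f] XD(1)[OF f]] Y])
      also have "\<dots> \<le> e * l2_norm f"
        using order_trans[OF diff[OF f] mult_right_mono[OF less_imp_le[OF N[OF m elim]] l2_norm_nonneg]] .
      finally show ?case .
    qed
    ultimately show ?thesis by (intro tendsto_upperbound[of _ _ sequentially]) auto
  qed
  have off: "L f x = 0" if f: "f \<in> l2 I" and x: "x \<notin> I" for f x
  proof -
    have "(\<lambda>n. X n f x) = (\<lambda>n. 0)" using l2_off[OF XD(1)[OF f] x] by simp
    then show ?thesis using L[OF f, of x] LIMSEQ_unique[OF _ tendsto_const] by metis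
  qed
  have near: "\<exists>N. \<forall>m\<ge>N. \<forall>f\<in>l2 I. (\<lambda>x. X m f x - L f x) \<in> l2 I \<and>
      l2_norm (\<lambda>x. X m f x - L f x) \<le> e * l2_norm f" if e: "e > 0" for e
  proof -
    obtain N where N: "\<And>m n. \<lbrakk>m \<ge> N; n \<ge> N\<rbrakk> \<Longrightarrow>
        op_norm_on I (X m \<oplus>\<^bsub>l2_ops I\<^esub> (-1) \<odot>\<^bsub>l2_ops I\<^esub> X n) < e" using cauchy[OF e] by blast
    have "(\<lambda>x. X m f x - L f x) \<in> l2 I \<and> l2_norm (\<lambda>x. X m f x - L f x) \<le> e * l2_norm f"
      if m: "m \<ge> N" and f: "f \<in> l2 I" for m f
      using fin[OF f _ N m] off[OF f] l2_off[OF XD(1)[OF f]]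
      by (intro conjI l2I[where C = "e * l2_norm f"] l2_norm_leI[of I]) auto
    then show ?thesis by blast
  qed
  obtain N1 where N1: "\<And>f. f \<in> l2 I \<Longrightarrow> (\<lambda>x. X N1 f x - L f x) \<in> l2 I"
    "\<And>f. f \<in> l2 I \<Longrightarrow> l2_norm (\<lambda>x. X N1 f x - L f x) \<le> l2_norm f"
    using near[of 1] by force
  \<comment> \<open>Writing L f as a term of the sequence minus a square-summable error shows that L
    f is square summable and bounds its norm.\<close>
  have LX: "L f = (\<lambda>x. X N1 f x + (-1) * (X N1 f x - L f x))" for f by simp
  have Ll2: "L f \<in> l2 I" if f: "f \<in> l2 I" for f
    by (subst LX) (intro l2_add l2_scale XD(1) N1 f)
  have Ln: "l2_norm (L f) \<le> (op_norm_on I (X N1) + 1) * l2_norm f" if f: "f \<in> l2 I" for f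
  proof -
    have "l2_norm (L f) \<le> l2_norm (X N1 f) + l2_norm (\<lambda>x. (-1) * (X N1 f x - L f x))"
      by (subst LX) (rule l2_norm_triangle[OF XD(1)[OF f] l2_scale[OF N1(1)[OF f]]])
    then show ?thesis
      using op_norm_bound[OF X order_refl f, of N1] N1(2)[OF f]
      by (simp only: l2_norm_scale) (simp add: distrib_right)
  qed
  define T where "T = (\<lambda>f\<in>l2 I. L f)"
  have T: "T \<in> carrier (l2_ops I)"
  proof (rule l2_opsI[where C = "op_norm_on I (X N1) + 1"])
    show "T (\<lambda>x. f x + g x) = (\<lambda>x. T f x + T g x)" if fg: "f \<in> l2 I" "g \<in> l2 I" for f g
    proof
      fix x
      have "(\<lambda>n. X n f x + X n g x) \<longlonglongrightarrow> L (\<lambda>x. f x + g x) x"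
        using L[OF l2_add[OF fg], of x] XD(2)[OF fg] by simp
      then have "L (\<lambda>x. f x + g x) x = L f x + L g x"
        by (rule LIMSEQ_unique) (intro tendsto_add L fg)
      then show "T (\<lambda>x. f x + g x) x = T f x + T g x" using fg l2_add[OF fg] by (simp add: T_def)
    qed
    show "T (\<lambda>x. c * f x) = (\<lambda>x. c * T f x)" if f: "f \<in> l2 I" for c f
    proof
      fix x
      have "(\<lambda>n. c * X n f x) \<longlonglongrightarrow> L (\<lambda>x. c * f x) x"
        using L[OF l2_scale[OF f], of c x] XD(3)[OF f] by simp
      then have "L (\<lambda>x. c * f x) x = c * L f x"
        by (rule LIMSEQ_unique) (intro tendsto_mult_left L f)
      then show "T (\<lambda>x. c * f x) x = c * T f x" using f l2_scale[OF f] by (simp add: T_def)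
    qed
  qed (simp_all add: T_def Ll2 Ln)
  have "(\<lambda>n. op_norm_on I (X n \<oplus>\<^bsub>l2_ops I\<^esub> (-1) \<odot>\<^bsub>l2_ops I\<^esub> T)) \<longlonglongrightarrow> 0"
  proof (rule LIMSEQ_I)
    fix r :: real assume r: "r > 0"
    then obtain N where N: "\<And>m f. \<lbrakk>m \<ge> N; f \<in> l2 I\<rbrakk> \<Longrightarrow> l2_norm (\<lambda>x. X m f x - L f x) \<le> r / 2 * l2_norm f"
      using near[of "r / 2"] by (auto simp del: times_divide_eq_left)
    have "norm (op_norm_on I (X m \<oplus>\<^bsub>l2_ops I\<^esub> (-1) \<odot>\<^bsub>l2_ops I\<^esub> T) - 0) < r" if m: "m \<ge> N" for m
    proof -
      have "op_norm_on I (X m \<oplus>\<^bsub>l2_ops I\<^esub> (-1) \<odot>\<^bsub>l2_ops I\<^esub> T) \<le> r / 2"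
        using r N[OF m] by (intro op_norm_le) (auto simp: l2_ops_simps T_def)
      then show ?thesis
        using r op_norm_nonneg[OF l2_ops_closed(2)[OF X l2_ops_closed(3)[OF T]] order_refl] by simp
    qed
    then show "\<exists>no. \<forall>n\<ge>no. norm (op_norm_on I (X n \<oplus>\<^bsub>l2_ops I\<^esub> (-1) \<odot>\<^bsub>l2_ops I\<^esub> T) - 0) < r"
      by blast
  qed
  then show ?thesis using T by blast
qed

theorem cstar_algebra_l2_ops: "cstar_algebra (l2_ops I)"
proof -
  let ?A = "l2_ops I"
  note D = l2_opsD and c = l2_ops_closed and aD = adj_l2_opsD and aD' = adj_l2_opsD'
  have N: "nrm ?A = op_norm_on I" by (simp add: l2_ops_simps)
  have eq: "S = T" if "S \<in> carrier ?A" "T \<in> carrier ?A" "\<And>f. f \<in> l2 I \<Longrightarrow> S f = T f" for S T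
    using l2_ops_eqI[OF D(5)[OF that(1)] D(5)[OF that(2)] that(3)] .
  have adj_norm: "op_norm_on I (adj ?A T) \<le> op_norm_on I T" if "T \<in> carrier ?A" for T by (rule aD(3)[OF that])
  note ev = l2_ops_simps
  show ?thesis
  proof (rule cstar_algebraI, goal_cases)
    case (18 T)
    show ?case by (rule adj_l2_opsI[OF 18]) (rule aD'[OF 18])
  next
    case (19 S T)
    show ?case
    proof (rule adj_l2_opsI)
      fix f g assume fg: "f \<in> l2 I" "g \<in> l2 I"
      show "l2_inner ((S \<oplus>\<^bsub>?A\<^esub> T) f) g = l2_inner f ((adj ?A S \<oplus>\<^bsub>?A\<^esub> adj ?A T) g)"
        using fg 19 by (simp add: ev l2_inner_add_left[OF D(1)[OF 19(1)] D(1)[OF 19(2)]]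
            l2_inner_add_right[OF _ D(1)[OF aD(1)] D(1)[OF aD(1)]] aD(2))
    qed (rule c(2)[OF aD(1)[OF 19(1)] aD(1)[OF 19(2)]])
  next
    case (20 T a)
    show ?case
    proof (rule adj_l2_opsI)
      fix f g assume fg: "f \<in> l2 I" "g \<in> l2 I"
      show "l2_inner ((a \<odot>\<^bsub>?A\<^esub> T) f) g = l2_inner f ((cnj a \<odot>\<^bsub>?A\<^esub> adj ?A T) g)"
        using fg 20 by (simp add: ev l2_inner_scale_left l2_inner_scale_right aD(2))
    qed (rule c(3)[OF aD(1)[OF 20]])
  next
    case (21 S T)
    show ?case
    proof (rule adj_l2_opsI)
      fix f g assume fg: "f \<in> l2 I" "g \<in> l2 I"
      show "l2_inner ((S \<otimes>\<^bsub>?A\<^esub> T) f) g = l2_inner f ((adj ?A T \<otimes>\<^bsub>?A\<^esub> adj ?A S) g)"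
        using fg aD(2)[OF 21(1) D(1)[OF 21(2) fg(1)] fg(2)]
          aD(2)[OF 21(2) fg(1) D(1)[OF aD(1)[OF 21(1)] fg(2)]] by (simp add: ev)
    qed (rule c(1)[OF aD(1)[OF 21(2)] aD(1)[OF 21(1)]])
  next
    case (22 T)
    then show ?case using op_norm_nonneg[OF _ order_refl] by (simp add: N)
  next
    case (23 T)
    then show ?case using op_norm_eq_0 by (simp add: N)
  next
    case (24 S T)
    show ?case unfolding N
    proof (rule op_norm_le)
      fix f assume f: "f \<in> l2 I"
      show "l2_norm ((S \<oplus>\<^bsub>?A\<^esub> T) f) \<le> (op_norm_on I S + op_norm_on I T) * l2_norm f"
        using f l2_norm_triangle[OF D(1)[OF 24(1) f] D(1)[OF 24(2) f]]
          op_norm_bound[OF 24(1) order_refl f] op_norm_bound[OF 24(2) order_refl f]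
        by (simp add: ev distrib_right)
    qed (use op_norm_nonneg[OF 24(1) order_refl] op_norm_nonneg[OF 24(2) order_refl] in simp)
  next
    case (25 T a)
    show ?case
    proof (cases "a = 0")
      case True
      have "a \<odot>\<^bsub>?A\<^esub> T = \<zero>\<^bsub>?A\<^esub>" by (simp add: ev True)
      then show ?thesis using op_norm_eq_0[OF c(4)] True by (simp add: N)
    next
      case False
      have "(1 / a) \<odot>\<^bsub>?A\<^esub> (a \<odot>\<^bsub>?A\<^esub> T) = T"
        using False by (intro eq c 25) (simp add: ev)
      then have "op_norm_on I T \<le> cmod (1 / a) * op_norm_on I (a \<odot>\<^bsub>?A\<^esub> T)"
        using op_norm_smult_le[OF c(3)[OF 25], of "1 / a" a] by metis
      then show ?thesis using op_norm_smult_le[OF 25, of a] False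
        by (simp add: N norm_divide field_simps)
    qed
  next
    case (26 S T)
    then show ?case by (simp add: N op_norm_mult_le)
  next
    case (27 T)
    let ?S = "adj ?A T \<otimes>\<^bsub>?A\<^esub> T"
    have S: "?S \<in> carrier ?A" by (rule c(1)[OF aD(1)[OF 27] 27])
    have "op_norm_on I ?S \<le> op_norm_on I (adj ?A T) * op_norm_on I T"
      by (rule op_norm_mult_le[OF aD(1)[OF 27] 27])
    also have "\<dots> \<le> (op_norm_on I T)\<^sup>2"
      using mult_right_mono[OF adj_norm[OF 27] op_norm_nonneg[OF 27 order_refl]]
      by (simp add: power2_eq_square)
    finally have le: "op_norm_on I ?S \<le> (op_norm_on I T)\<^sup>2" .
    \<comment> \<open>The square of the norm of T f is the inner product of f with
      \<open>?S f\<close>, to which Cauchy-Schwarz applies.\<close>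
    have "op_norm_on I T \<le> sqrt (op_norm_on I ?S)"
    proof (rule op_norm_le)
      fix f assume f: "f \<in> l2 I"
      have "complex_of_real ((l2_norm (T f))\<^sup>2) = l2_inner f (?S f)"
        using aD(2)[OF 27 f D(1)[OF 27 f]] f by (simp add: ev l2_inner_self[OF D(1)[OF 27 f]])
      then have "(l2_norm (T f))\<^sup>2 = cmod (l2_inner f (?S f))"
        by (metis norm_of_real abs_of_nonneg zero_le_power2)
      also have "\<dots> \<le> l2_norm f * l2_norm (?S f)" by (rule l2_cauchy_schwarz[OF f D(1)[OF S f]])
      also have "\<dots> \<le> l2_norm f * (op_norm_on I ?S * l2_norm f)"
        by (intro mult_left_mono op_norm_bound[OF S order_refl f]) simp
      also have "\<dots> = (sqrt (op_norm_on I ?S) * l2_norm f)\<^sup>2"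
        using op_norm_nonneg[OF S order_refl] by (simp add: power_mult_distrib power2_eq_square)
      finally show "l2_norm (T f) \<le> sqrt (op_norm_on I ?S) * l2_norm f"
        by (rule power2_le_imp_le) (simp add: op_norm_nonneg[OF S order_refl])
    qed (simp add: op_norm_nonneg[OF S order_refl])
    then have "(op_norm_on I T)\<^sup>2 \<le> op_norm_on I ?S"
      using power_mono[of "op_norm_on I T" "sqrt (op_norm_on I ?S)" 2] op_norm_nonneg[OF 27 order_refl]
        op_norm_nonneg[OF S order_refl] by simp
    then show ?case using le by (simp add: N)
  next
    case (28 X)
    then show ?case unfolding N by (rule l2_ops_complete)
  next
    case (5 T)
    then show ?case by (intro eq c) (simp_all add: ev)
  next
    case (10 T)
    then show ?case by (intro eq c) (simp_all add: ev)
  next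
    case (12 R S T)
    then show ?case by (intro eq c) (simp_all add: ev D(1))
  next
    case (13 R S T)
    then show ?case by (intro eq c) (simp_all add: ev D(1))
  next
    case (14 R S T)
    then show ?case by (intro eq c) (simp_all add: ev D(1,2))
  next
    case (15 S T a)
    then show ?case by (intro eq c) (simp_all add: ev D(1))
  next
    case (16 S T a)
    then show ?case by (intro eq c) (simp_all add: ev D(1,3))
  next
    case (17 T)
    then show ?case by (rule aD(1))
  next
    case (1 S T)
    then show ?case by (rule c(2))
  next
    case 2
    show ?case by (rule c(4))
  next
    case (6 T a)
    then show ?case by (rule c(3))
  next
    case (11 S T)
    then show ?case by (rule c(1))
  qed (simp_all add: ev algebra_simps cong: restrict_cong)
qed

theorem unital_cstar_algebra_l2_ops: "unital_cstar_algebra (l2_ops I)"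
proof -
  have "\<one>\<^bsub>l2_ops I\<^esub> \<otimes>\<^bsub>l2_ops I\<^esub> T = T" "T \<otimes>\<^bsub>l2_ops I\<^esub> \<one>\<^bsub>l2_ops I\<^esub> = T" if T: "T \<in> carrier (l2_ops I)" for T
    using l2_opsD(1,5)[OF T]
    by (auto intro!: l2_ops_eqI[of _ I] simp: l2_ops_simps)
  then show ?thesis
    using cstar_algebra_l2_ops[of I] l2_ops_closed(5)[of I]
    by (simp add: unital_cstar_algebra_def unital_cstar_algebra_axioms_def)
qed

section \<open>Multiplication operators\<close>

lemma
  assumes b: "\<And>x. x \<in> I \<Longrightarrow> cmod (\<phi> x) \<le> C" "0 \<le> C" and f: "f \<in> l2 I"
  shows l2_mult: "(\<lambda>x. \<phi> x * f x) \<in> l2 I"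
    and l2_norm_mult_le: "l2_norm (\<lambda>x. \<phi> x * f x) \<le> C * l2_norm f"
proof -
  have "fin_norm (\<lambda>x. \<phi> x * f x) Y \<le> C * l2_norm f" if "finite Y" for Y
  proof -
    have "cmod (\<phi> x * f x) \<le> C * cmod (f x)" for x
      using b l2_off[OF f, of x] by (cases "x \<in> I") (auto simp: norm_mult mult_right_mono)
    then have "fin_norm (\<lambda>x. \<phi> x * f x) Y \<le> L2_set (\<lambda>x. C * cmod (f x)) Y"
      by (intro L2_set_mono) auto
    also have "\<dots> = C * fin_norm f Y" using b by (simp add: L2_set_right_distrib)
    also have "\<dots> \<le> C * l2_norm f" by (intro mult_left_mono fin_norm_le_l2_norm[OF f that] b)
    finally show ?thesis .
  qed
  then show "(\<lambda>x. \<phi> x * f x) \<in> l2 I" "l2_norm (\<lambda>x. \<phi> x * f x) \<le> C * l2_norm f"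
    using l2_off[OF f] by (auto intro!: l2I[of I _ "C * l2_norm f"] l2_norm_leI[of I])
qed

lemma mult_op_closed:
  assumes b: "\<And>x. x \<in> I \<Longrightarrow> cmod (\<phi> x) \<le> C" "0 \<le> C"
  shows "mult_op I \<phi> \<in> carrier (l2_ops I)"
  by (rule l2_opsI[where C = C])
    (simp_all add: mult_op_def l2_mult[OF b] l2_norm_mult_le[OF b] l2_add l2_scale distrib_left mult.left_commute)

lemma mult_op_cong: "(\<And>x. x \<in> I \<Longrightarrow> \<phi> x = \<psi> x) \<Longrightarrow> mult_op I \<phi> = mult_op I \<psi>"
  unfolding mult_op_def
proof (rule restrict_ext, rule ext)
  fix f x assume "\<And>x. x \<in> I \<Longrightarrow> \<phi> x = \<psi> x" "f \<in> l2 I"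
  then show "\<phi> x * f x = \<psi> x * f x" using l2_off[of f I x] by (cases "x \<in> I") auto
qed

lemma mult_op_add: "mult_op I \<phi> \<oplus>\<^bsub>l2_ops I\<^esub> mult_op I \<psi> = mult_op I (\<lambda>x. \<phi> x + \<psi> x)"
  by (simp add: l2_ops_simps mult_op_def distrib_right cong: restrict_cong)

lemma mult_op_smult: "c \<odot>\<^bsub>l2_ops I\<^esub> mult_op I \<phi> = mult_op I (\<lambda>x. c * \<phi> x)"
  by (simp add: l2_ops_simps mult_op_def mult.assoc cong: restrict_cong)

lemma mult_op_mult:
  assumes b: "\<And>x. x \<in> I \<Longrightarrow> cmod (\<psi> x) \<le> C" "0 \<le> C"
  shows "mult_op I \<phi> \<otimes>\<^bsub>l2_ops I\<^esub> mult_op I \<psi> = mult_op I (\<lambda>x. \<phi> x * \<psi> x)"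
  by (simp add: l2_ops_simps mult_op_def l2_mult[OF b] mult.assoc cong: restrict_cong)

lemma mult_op_zero: "mult_op I (\<lambda>_. 0) = \<zero>\<^bsub>l2_ops I\<^esub>"
  by (simp add: l2_ops_simps mult_op_def)

lemma adj_mult_op:
  assumes b: "\<And>x. x \<in> I \<Longrightarrow> cmod (\<phi> x) \<le> C" "0 \<le> C"
  shows "adj (l2_ops I) (mult_op I \<phi>) = mult_op I (\<lambda>x. cnj (\<phi> x))"
proof (rule adj_l2_opsI)
  show "mult_op I (\<lambda>x. cnj (\<phi> x)) \<in> carrier (l2_ops I)"
    using b by (intro mult_op_closed[where C = C]) simp_all
  show "l2_inner (mult_op I \<phi> f) g = l2_inner f (mult_op I (\<lambda>x. cnj (\<phi> x)) g)"
    if "f \<in> l2 I" "g \<in> l2 I" for f g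
    using that by (simp add: mult_op_def l2_inner_def mult_ac)
qed

text \<open>The diagonal matrix coefficient at x. It recovers the function of a multiplication
  operator, so elements of D_r can be treated as functions on P.\<close>

definition symbol :: "(('i \<Rightarrow> complex) \<Rightarrow> ('i \<Rightarrow> complex)) \<Rightarrow> 'i \<Rightarrow> complex" where
  "symbol T x = T (ket x) x"

definition diagonal_ops :: "'i set \<Rightarrow> (('i \<Rightarrow> complex) \<Rightarrow> ('i \<Rightarrow> complex)) set" where
  "diagonal_ops I = {T \<in> carrier (l2_ops I). T = mult_op I (symbol T)}"

lemma symbol_mult_op: "x \<in> I \<Longrightarrow> symbol (mult_op I \<phi>) x = \<phi> x"
  by (simp add: symbol_def mult_op_def ket_l2) (simp add: ket_def)

lemma cmod_symbol_le:
  assumes "T \<in> carrier (l2_ops I)" "J \<subseteq> I" "x \<in> J"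
  shows "cmod (symbol T x) \<le> op_norm_on J T"
proof -
  have k: "ket x \<in> l2 J" by (rule ket_l2[OF assms(3)])
  have "cmod (symbol T x) \<le> l2_norm (T (ket x))"
    unfolding symbol_def using cmod_le_l2_norm[OF l2_opsD(1)[OF assms(1) l2_mono[OF k assms(2)]]] .
  also have "\<dots> \<le> op_norm_on J T" using op_norm_bound[OF assms(1,2) k] by simp
  finally show ?thesis .
qed

lemma diagonal_opsI:
  assumes "\<And>x. x \<in> I \<Longrightarrow> cmod (\<phi> x) \<le> C" "0 \<le> C"
  shows "mult_op I \<phi> \<in> diagonal_ops I"
  using mult_op_closed[OF assms] symbol_mult_op[of _ I \<phi>]
  by (auto simp: diagonal_ops_def intro: mult_op_cong)

lemma diagonal_opsD:
  assumes "T \<in> diagonal_ops I"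
  shows "T \<in> carrier (l2_ops I)" "T = mult_op I (symbol T)"
    "x \<in> I \<Longrightarrow> cmod (symbol T x) \<le> op_norm_on I T" "0 \<le> op_norm_on I T"
  using assms cmod_symbol_le[of T I I x] op_norm_nonneg[of T I I] by (auto simp: diagonal_ops_def)

lemma diagonal_opsE:
  assumes "T \<in> diagonal_ops I"
  obtains \<phi> C where "T = mult_op I \<phi>" "\<And>x. x \<in> I \<Longrightarrow> cmod (\<phi> x) \<le> C" "0 \<le> C"
  using diagonal_opsD[OF assms] that by blast

lemma op_norm_diagonal_le:
  assumes "T \<in> diagonal_ops I" "J \<subseteq> I" "0 \<le> C" "\<And>x. x \<in> J \<Longrightarrow> cmod (symbol T x) \<le> C"
  shows "op_norm_on J T \<le> C"
proof (rule op_norm_le[OF assms(3)])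
  fix f assume f: "f \<in> l2 J"
  have "T f = mult_op I (symbol T) f" using arg_cong[OF diagonal_opsD(2)[OF assms(1)]] .
  then have "T f = (\<lambda>x. symbol T x * f x)"
    using l2_mono[OF f assms(2)] by (simp add: mult_op_def)
  then show "l2_norm (T f) \<le> C * l2_norm f" using l2_norm_mult_le[OF assms(4,3) f] by simp
qed

lemma symbol_l2_ops:
  assumes S: "S \<in> diagonal_ops I" and T: "T \<in> diagonal_ops I" and x: "x \<in> I"
  shows "symbol (S \<oplus>\<^bsub>l2_ops I\<^esub> T) x = symbol S x + symbol T x"
    "symbol (c \<odot>\<^bsub>l2_ops I\<^esub> S) x = c * symbol S x"
    "symbol (S \<otimes>\<^bsub>l2_ops I\<^esub> T) x = symbol S x * symbol T x"
    "symbol (adj (l2_ops I) S) x = cnj (symbol S x)"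
proof -
  obtain \<phi> C where S': "S = mult_op I \<phi>" "\<And>x. x \<in> I \<Longrightarrow> cmod (\<phi> x) \<le> C" "0 \<le> C"
    using diagonal_opsE[OF S] by blast
  obtain \<psi> D where T': "T = mult_op I \<psi>" "\<And>x. x \<in> I \<Longrightarrow> cmod (\<psi> x) \<le> D" "0 \<le> D"
    using diagonal_opsE[OF T] by blast
  show "symbol (S \<oplus>\<^bsub>l2_ops I\<^esub> T) x = symbol S x + symbol T x"
    "symbol (c \<odot>\<^bsub>l2_ops I\<^esub> S) x = c * symbol S x"
    "symbol (S \<otimes>\<^bsub>l2_ops I\<^esub> T) x = symbol S x * symbol T x"
    "symbol (adj (l2_ops I) S) x = cnj (symbol S x)"
    unfolding S'(1) T'(1)
    by (simp_all add: mult_op_add mult_op_smult mult_op_mult[OF T'(2,3)] adj_mult_op[OF S'(2,3)]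
        symbol_mult_op[OF x])
qed

text \<open>Being diagonal is the pointwise identity \<open>T f x = T (ket x) x * f x\<close>, and
  convergence in norm implies convergence at every function and point; so it survives
  limits.\<close>

lemma cstar_subalgebra_diagonal: "cstar_subalgebra (l2_ops I) (diagonal_ops I)"
proof -
  interpret A: unital_cstar_algebra "l2_ops I" by (rule unital_cstar_algebra_l2_ops)
  have "closed_subspace (l2_ops I) (diagonal_ops I)"
  proof (rule A.closed_subspaceI)
    show "diagonal_ops I \<subseteq> carrier (l2_ops I)" by (auto simp: diagonal_ops_def)
    show "\<zero>\<^bsub>l2_ops I\<^esub> \<in> diagonal_ops I"
      using diagonal_opsI[of I "\<lambda>_. 0" 0] by (simp add: mult_op_zero)
    show "S \<oplus>\<^bsub>l2_ops I\<^esub> T \<in> diagonal_ops I" if ST: "S \<in> diagonal_ops I" "T \<in> diagonal_ops I" for S T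
    proof -
      obtain \<phi> C where S: "S = mult_op I \<phi>" "\<And>x. x \<in> I \<Longrightarrow> cmod (\<phi> x) \<le> C" "0 \<le> C"
        using diagonal_opsE[OF ST(1)] by blast
      obtain \<psi> D where T: "T = mult_op I \<psi>" "\<And>x. x \<in> I \<Longrightarrow> cmod (\<psi> x) \<le> D" "0 \<le> D"
        using diagonal_opsE[OF ST(2)] by blast
      show ?thesis unfolding S(1) T(1) mult_op_add
      proof (rule diagonal_opsI[where C = "C + D"])
        show "cmod (\<phi> x + \<psi> x) \<le> C + D" if "x \<in> I" for x
          using norm_triangle_ineq[of "\<phi> x" "\<psi> x"] S(2)[OF that] T(2)[OF that] by linarith
      qed (use S(3) T(3) in simp)
    qed
    show "c \<odot>\<^bsub>l2_ops I\<^esub> S \<in> diagonal_ops I" if S': "S \<in> diagonal_ops I" for c S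
    proof -
      obtain \<phi> C where S: "S = mult_op I \<phi>" "\<And>x. x \<in> I \<Longrightarrow> cmod (\<phi> x) \<le> C" "0 \<le> C"
        using diagonal_opsE[OF S'] by blast
      show ?thesis unfolding S(1) mult_op_smult
        by (rule diagonal_opsI[where C = "cmod c * C"])
          (use S(2,3) in \<open>simp_all add: norm_mult mult_left_mono\<close>)
    qed
    fix X T assume X: "cstar_lim (l2_ops I) X T" "\<And>n. X n \<in> diagonal_ops I"
    have T: "T \<in> carrier (l2_ops I)" by (rule A.cstar_limD(2)[OF X(1)])
    have ptw: "(\<lambda>n. X n f x) \<longlonglongrightarrow> T f x" if f: "f \<in> l2 I" for f x
    proof (rule LIM_zero_cancel, rule Lim_null_comparison)
      show "(\<lambda>n. nrm (l2_ops I) (X n \<ominus>\<^bsub>l2_ops I\<^esub> T) * l2_norm f) \<longlonglongrightarrow> 0"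
        using tendsto_mult_right[OF A.cstar_limD(3)[OF X(1)], of "l2_norm f"] by simp
      have Xn: "X n \<ominus>\<^bsub>l2_ops I\<^esub> T \<in> carrier (l2_ops I)" for n
        using A.cstar_limD(1)[OF X(1)] T by (rule A.minus_closed)
      have "norm (X n f x - T f x) \<le> nrm (l2_ops I) (X n \<ominus>\<^bsub>l2_ops I\<^esub> T) * l2_norm f" for n
        using order_trans[OF cmod_le_l2_norm[OF l2_opsD(1)[OF Xn f]] op_norm_bound[OF Xn order_refl f], of n x] f T
        by (simp add: A.minus_smult) (simp add: l2_ops_simps)
      then show "\<forall>\<^sub>F n in sequentially. norm (X n f x - T f x) \<le> nrm (l2_ops I) (X n \<ominus>\<^bsub>l2_ops I\<^esub> T) * l2_norm f"
        by simp
    qed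
    have "T f = mult_op I (symbol T) f" if f: "f \<in> l2 I" for f
    proof
      fix x
      show "T f x = mult_op I (symbol T) f x"
      proof (cases "x \<in> I")
        case True
        have "X n f x = X n (ket x) x * f x" for n
        proof -
          obtain \<phi> C where "X n = mult_op I \<phi>" using diagonal_opsE[OF X(2)[of n]] by blast
          then show ?thesis
            using f ket_l2[OF True] by (simp add: mult_op_def) (simp add: ket_def)
        qed
        then have "(\<lambda>n. X n f x) \<longlonglongrightarrow> T (ket x) x * f x"
          using ptw[OF ket_l2[OF True], of x] by (simp add: tendsto_mult_right)
        then show ?thesis using LIMSEQ_unique[OF ptw[OF f, of x]] f by (simp add: mult_op_def symbol_def)
      next
        case False
        then show ?thesis using l2_off[OF f] l2_off[OF l2_opsD(1)[OF T f]] f by (simp add: mult_op_def)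
      qed
    qed
    then have "T = mult_op I (symbol T)"
      using l2_opsD(5)[OF T] by (intro l2_ops_eqI) (auto simp: mult_op_def)
    then show "T \<in> diagonal_ops I" using T by (simp add: diagonal_ops_def)
  qed
  moreover have "S \<otimes>\<^bsub>l2_ops I\<^esub> T \<in> diagonal_ops I" if ST: "S \<in> diagonal_ops I" "T \<in> diagonal_ops I" for S T
  proof -
    obtain \<phi> C where S: "S = mult_op I \<phi>" "\<And>x. x \<in> I \<Longrightarrow> cmod (\<phi> x) \<le> C" "0 \<le> C"
      using diagonal_opsE[OF ST(1)] by blast
    obtain \<psi> D where T: "T = mult_op I \<psi>" "\<And>x. x \<in> I \<Longrightarrow> cmod (\<psi> x) \<le> D" "0 \<le> D"
      using diagonal_opsE[OF ST(2)] by blast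
    have "mult_op I (\<lambda>x. \<phi> x * \<psi> x) \<in> diagonal_ops I"
      by (rule diagonal_opsI[where C = "C * D"])
        (use S(2,3) T(2,3) in \<open>simp_all add: norm_mult mult_mono\<close>)
    then show ?thesis by (simp add: S(1) T(1) mult_op_mult[OF T(2,3)])
  qed
  moreover have "adj (l2_ops I) S \<in> diagonal_ops I" if S': "S \<in> diagonal_ops I" for S
  proof -
    obtain \<phi> C where S: "S = mult_op I \<phi>" "\<And>x. x \<in> I \<Longrightarrow> cmod (\<phi> x) \<le> C" "0 \<le> C"
      using diagonal_opsE[OF S'] by blast
    have "mult_op I (\<lambda>x. cnj (\<phi> x)) \<in> diagonal_ops I"
      by (rule diagonal_opsI[where C = C]) (use S(2,3) in simp_all)
    then show ?thesis by (simp add: S(1) adj_mult_op[OF S(2,3)])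
  qed
  ultimately show ?thesis by (simp add: cstar_subalgebra_def)
qed

section \<open>Words and constructible ideals\<close>

lemma words_append: "\<alpha> \<in> words P \<Longrightarrow> \<beta> \<in> words P \<Longrightarrow> \<alpha> @ \<beta> \<in> words P"
  and words_rev: "\<alpha> \<in> words P \<Longrightarrow> rev \<alpha> \<in> words P"
  and words_drop: "\<alpha> \<in> words P \<Longrightarrow> drop (2 * m) \<alpha> \<in> words P"
  by (auto simp: words_def dest: in_set_dropD)

text \<open>For \<open>X = P\<close> this is \<open>K(\<alpha>)\<close>. For a general \<open>X\<close> with \<open>P X \<subseteq> X\<close> it is the support of the
  projection given by \<open>\<alpha>\<close> in the representation of \<open>P\<close> by shifts on \<open>\<ell>\<^sup>2(X)\<close>.\<close>

definition word_domain :: "('g, 'm) monoid_scheme \<Rightarrow> 'g set \<Rightarrow> 'g list \<Rightarrow> 'g set" where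
  "word_domain G X \<alpha> =
     {x \<in> carrier G. \<forall>m\<le>length \<alpha> div 2. word_elt G (drop (2 * m) \<alpha>) \<otimes>\<^bsub>G\<^esub> x \<in> X}"

locale monoid_in_group = group G + P: submonoid P G for G (structure) and P
begin

lemma P_carrier: "p \<in> P \<Longrightarrow> p \<in> carrier G"
  by (rule P.mem_carrier)

lemma lcoset_iff:
  assumes "g \<in> carrier G" "X \<subseteq> carrier G"
  shows "x \<in> g <# X \<longleftrightarrow> x \<in> carrier G \<and> inv g \<otimes> x \<in> X"
proof
  assume "x \<in> g <# X"
  then obtain h where "h \<in> X" "x = g \<otimes> h" by (auto simp: l_coset_def)
  moreover have "h \<in> carrier G" using \<open>h \<in> X\<close> assms(2) by blast
  ultimately show "x \<in> carrier G \<and> inv g \<otimes> x \<in> X"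
    using assms(1) by (simp add: m_assoc[symmetric])
next
  assume x: "x \<in> carrier G \<and> inv g \<otimes> x \<in> X"
  then have "x = g \<otimes> (inv g \<otimes> x)" using assms(1) by (simp add: m_assoc[symmetric])
  then show "x \<in> g <# X" using x by (auto simp: l_coset_def)
qed

lemma word_elt_closed: "\<alpha> \<in> words P \<Longrightarrow> word_elt G \<alpha> \<in> carrier G"
  by (induction rule: words_induct) (simp_all add: P_carrier)

lemma word_elt_append:
  "\<lbrakk>\<alpha> \<in> words P; \<beta> \<in> words P\<rbrakk> \<Longrightarrow> word_elt G (\<alpha> @ \<beta>) = word_elt G \<alpha> \<otimes> word_elt G \<beta>"
  by (induction rule: words_induct) (simp_all add: P_carrier word_elt_closed m_assoc)

lemma word_elt_rev: "\<alpha> \<in> words P \<Longrightarrow> word_elt G (rev \<alpha>) = inv (word_elt G \<alpha>)"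
proof (induction rule: words_induct)
  case (Cons p q \<alpha>)
  have "word_elt G (rev (p # q # \<alpha>)) = word_elt G (rev \<alpha>) \<otimes> word_elt G [q, p]"
    using Cons word_elt_append[of "rev \<alpha>" "[q, p]"] by (simp add: words_rev)
  then show ?case
    using Cons by (simp add: P_carrier word_elt_closed inv_mult_group m_assoc)
qed simp

text \<open>Reversal inverts the value of an even word, so lying in the translate of P by a reversed
  suffix means being moved into P by the suffix. In this form K is the domain of a composite of
  partial translations.\<close>

lemma K_eq_word_domain: "\<alpha> \<in> words P \<Longrightarrow> K G P \<alpha> = word_domain G P \<alpha>"
  using P.subset words_drop[of \<alpha> P]
  by (auto simp: K_def word_domain_def lcoset_iff word_elt_closed words_rev word_elt_rev)

lemma neutral_wordsD:
  "\<alpha> \<in> neutral_words G P \<Longrightarrow> \<alpha> \<in> words P" "\<alpha> \<in> neutral_words G P \<Longrightarrow> word_elt G \<alpha> = \<one>"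
  by (simp_all add: neutral_words_def)

lemma neutral_words_append:
  "\<lbrakk>\<alpha> \<in> neutral_words G P; \<beta> \<in> neutral_words G P\<rbrakk> \<Longrightarrow> \<alpha> @ \<beta> \<in> neutral_words G P"
  by (simp add: neutral_words_def words_append word_elt_append)

lemma neutral_words_rev: "\<alpha> \<in> neutral_words G P \<Longrightarrow> rev \<alpha> \<in> neutral_words G P"
  by (simp add: neutral_words_def words_rev word_elt_rev)

lemma neutral_words_Nil: "[] \<in> neutral_words G P"
  by (simp add: neutral_words_def)

lemma word_domain_Nil: "X \<subseteq> carrier G \<Longrightarrow> word_domain G X [] = X"
  by (auto simp: word_domain_def)

lemma word_domain_Cons:
  "word_domain G X (p # q # \<alpha>) = {x \<in> word_domain G X \<alpha>. word_elt G (p # q # \<alpha>) \<otimes> x \<in> X}"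
proof -
  \<comment> \<open>Index 0 is the whole word; index m + 1 drops the first two letters and then
    gives index m of the rest.\<close>
  have all: "(\<forall>m\<le>Suc n. R m) \<longleftrightarrow> R 0 \<and> (\<forall>m\<le>n. R (Suc m))" for R and n :: nat
    using less_Suc_eq_0_disj le_eq_less_or_eq by (metis Suc_le_mono le0 not0_implies_Suc)
  show ?thesis
    unfolding word_domain_def
    by (auto simp: all simp del: word_elt.simps(3))
qed

lemma word_domain_carrier: "x \<in> word_domain G X \<alpha> \<Longrightarrow> x \<in> carrier G"
  by (simp add: word_domain_def)

lemma word_domain_elt: "x \<in> word_domain G X \<alpha> \<Longrightarrow> word_elt G \<alpha> \<otimes> x \<in> X"
  by (auto simp: word_domain_def dest: spec[of _ 0])

lemma word_domain_subset:
  assumes "X \<subseteq> carrier G" "\<alpha> \<in> words P"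
  shows "word_domain G X \<alpha> \<subseteq> X"
  using assms(2) by (induction rule: words_induct) (use assms(1) in \<open>auto simp: word_domain_Nil word_domain_Cons\<close>)

text \<open>Composition of partial maps: the right factor \<beta> acts first, and its image must lie
  in the domain of \<alpha>.\<close>

lemma word_domain_append:
  assumes X: "X \<subseteq> carrier G" and \<beta>: "\<beta> \<in> words P"
  shows "\<alpha> \<in> words P \<Longrightarrow>
    word_domain G X (\<alpha> @ \<beta>) = {x \<in> word_domain G X \<beta>. word_elt G \<beta> \<otimes> x \<in> word_domain G X \<alpha>}"
proof (induction rule: words_induct)
  case Nil
  then show ?case using word_domain_elt by (auto simp: word_domain_Nil[OF X])
next
  case (Cons p q \<alpha>)
  have "word_elt G (p # q # (\<alpha> @ \<beta>)) \<otimes> x = word_elt G (p # q # \<alpha>) \<otimes> (word_elt G \<beta> \<otimes> x)"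
    if "x \<in> carrier G" for x
    using Cons that \<beta> by (simp add: word_elt_append word_elt_closed P_carrier m_assoc)
  then show ?case
    using Cons word_domain_carrier[of _ X \<beta>]
    by (auto simp: word_domain_Cons simp del: word_elt.simps(3))
qed

lemma word_domain_append_neutral:
  assumes "X \<subseteq> carrier G" "\<alpha> \<in> words P" "\<beta> \<in> neutral_words G P"
  shows "word_domain G X (\<alpha> @ \<beta>) = word_domain G X \<alpha> \<inter> word_domain G X \<beta>"
  using word_domain_append[OF assms(1) _ assms(2), of \<beta>] neutral_wordsD[OF assms(3)]
    word_domain_carrier[of _ X] by auto

text \<open>The reversed word undoes the partial translation step by step, so it is defined wherever
  the original one arrives.\<close>

lemma word_domain_rev:
  assumes X: "X \<subseteq> carrier G"
  shows "\<alpha> \<in> words P \<Longrightarrow> x \<in> word_domain G X \<alpha> \<Longrightarrow> word_elt G \<alpha> \<otimes> x \<in> word_domain G X (rev \<alpha>)"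
proof (induction arbitrary: x rule: words_induct)
  case Nil
  then show ?case using word_domain_carrier by simp
next
  case (Cons p q \<alpha>)
  let ?y = "word_elt G (p # q # \<alpha>) \<otimes> x"
  have x: "x \<in> word_domain G X \<alpha>" "?y \<in> X" using Cons.prems by (auto simp: word_domain_Cons)
  have xc: "x \<in> carrier G" by (rule word_domain_carrier[OF x(1)])
  have "word_elt G [q, p] \<otimes> ?y = (inv q \<otimes> (p \<otimes> (inv p \<otimes> (q \<otimes> (word_elt G \<alpha> \<otimes> x)))))"
    using Cons.hyps xc by (simp add: m_assoc P_carrier word_elt_closed)
  also have "\<dots> = word_elt G \<alpha> \<otimes> x"
    using Cons.hyps xc by (simp add: P_carrier word_elt_closed inv_solve_left m_assoc[symmetric])
  finally have e: "word_elt G [q, p] \<otimes> ?y = word_elt G \<alpha> \<otimes> x" .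
  have yc: "?y \<in> carrier G" using x(2) X by blast
  have "?y \<in> word_domain G X [q, p]"
    using x e word_domain_elt[OF x(1)] yc
    by (simp add: word_domain_Cons word_domain_Nil[OF X] del: word_elt.simps(3))
  moreover have "word_elt G [q, p] \<otimes> ?y \<in> word_domain G X (rev \<alpha>)"
    unfolding e by (rule Cons.IH[OF x(1)])
  ultimately have "?y \<in> word_domain G X (rev \<alpha> @ [q, p])"
    using word_domain_append[OF X, of "[q, p]" "rev \<alpha>"] Cons.hyps by (simp add: words_rev del: word_elt.simps(3))
  then show ?case by simp
qed

text \<open>Going along \<alpha> and back is the identity on the domain of \<alpha>. Hence every
  constructible ideal already comes from a neutral word.\<close>

lemma neutral_word_same_domain:
  assumes "X \<subseteq> carrier G" "\<alpha> \<in> words P"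
  shows "rev \<alpha> @ \<alpha> \<in> neutral_words G P" "word_domain G X (rev \<alpha> @ \<alpha>) = word_domain G X \<alpha>"
  using assms word_domain_append[OF assms(1,2), of "rev \<alpha>"] word_domain_rev[OF assms]
  by (auto simp: neutral_words_def words_append words_rev word_elt_append word_elt_rev word_elt_closed)

lemma constructible_neutral: "constructible G P = K G P ` neutral_words G P"
proof -
  have "K G P \<alpha> \<in> K G P ` neutral_words G P" if "\<alpha> \<in> words P" for \<alpha>
    using neutral_word_same_domain[OF P.subset that] that
    by (intro image_eqI[of _ _ "rev \<alpha> @ \<alpha>"]) (simp_all add: K_eq_word_domain neutral_wordsD)
  then show ?thesis by (auto simp: constructible_def neutral_wordsD)
qed

lemma K_neutral: "\<alpha> \<in> neutral_words G P \<Longrightarrow> K G P \<alpha> = word_domain G P \<alpha>"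
  by (simp add: K_eq_word_domain neutral_wordsD)

lemma K_append:
  "\<lbrakk>\<alpha> \<in> neutral_words G P; \<beta> \<in> neutral_words G P\<rbrakk> \<Longrightarrow> K G P (\<alpha> @ \<beta>) = K G P \<alpha> \<inter> K G P \<beta>"
  by (simp add: K_neutral neutral_words_append word_domain_append_neutral[OF P.subset] neutral_wordsD(1))

lemma K_subset: "\<alpha> \<in> neutral_words G P \<Longrightarrow> K G P \<alpha> \<subseteq> P"
  by (simp add: K_neutral word_domain_subset[OF P.subset] neutral_wordsD(1))

lemma K_Nil: "K G P [] = P"
  by (simp add: K_neutral neutral_words_Nil word_domain_Nil[OF P.subset])

lemma K_right_ideal:
  assumes "\<alpha> \<in> neutral_words G P" "x \<in> K G P \<alpha>" "p \<in> P"
  shows "x \<otimes> p \<in> K G P \<alpha>"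
proof -
  have \<alpha>: "\<alpha> \<in> words P" by (rule neutral_wordsD(1)[OF assms(1)])
  have x: "x \<in> carrier G" "\<And>m. m \<le> length \<alpha> div 2 \<Longrightarrow> word_elt G (drop (2 * m) \<alpha>) \<otimes> x \<in> P"
    using assms(2) by (auto simp: K_neutral[OF assms(1)] word_domain_def)
  have "word_elt G (drop (2 * m) \<alpha>) \<otimes> (x \<otimes> p) \<in> P" if "m \<le> length \<alpha> div 2" for m
    using P.m_closed[OF x(2)[OF that] assms(3)] x(1) P_carrier[OF assms(3)]
      word_elt_closed[OF words_drop[OF \<alpha>]] by (simp add: m_assoc)
  then show ?thesis
    using x(1) P_carrier[OF assms(3)] by (simp add: K_neutral[OF assms(1)] word_domain_def)
qed

text \<open>A translate hP is closed under right multiplication by P, so it contains pP as soon as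
  it contains p. This reduces the conditions on ideals to conditions on elements.\<close>

lemma Delta_iff:
  assumes F: "F \<subseteq> carrier G"
  shows "p \<in> Delta G P F \<longleftrightarrow>
    p \<in> P \<and> (\<forall>h\<in>F. (\<forall>r\<in>P. inv h \<otimes> (p \<otimes> r) \<notin> P) \<or> inv h \<otimes> p \<in> P)"
proof -
  have "(p <# P) \<inter> (h <# P) = {} \<longleftrightarrow> (\<forall>r\<in>P. inv h \<otimes> (p \<otimes> r) \<notin> P)"
    and "(p <# P) \<inter> (h <# P) = p <# P \<longleftrightarrow> inv h \<otimes> p \<in> P"
    if p: "p \<in> P" and h: "h \<in> F" for h
  proof -
    have hc: "h \<in> carrier G" and pc: "p \<in> carrier G" using F h P_carrier[OF p] by auto
    have pP: "p <# P = (\<lambda>r. p \<otimes> r) ` P" by (auto simp: l_coset_def)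
    have hP: "p \<otimes> r \<in> h <# P \<longleftrightarrow> inv h \<otimes> (p \<otimes> r) \<in> P" if "r \<in> P" for r
      using lcoset_iff[OF hc P.subset] pc P_carrier[OF that] by simp
    show "(p <# P) \<inter> (h <# P) = {} \<longleftrightarrow> (\<forall>r\<in>P. inv h \<otimes> (p \<otimes> r) \<notin> P)"
      unfolding pP using hP by blast
    have "(p <# P) \<inter> (h <# P) = p <# P \<longleftrightarrow> (\<forall>r\<in>P. inv h \<otimes> (p \<otimes> r) \<in> P)"
      unfolding pP using hP by blast
    also have "\<dots> \<longleftrightarrow> inv h \<otimes> p \<in> P"
    proof
      assume "\<forall>r\<in>P. inv h \<otimes> (p \<otimes> r) \<in> P"
      then have "inv h \<otimes> (p \<otimes> \<one>) \<in> P" using P.one_closed by blast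
      then show "inv h \<otimes> p \<in> P" using pc by simp
    next
      assume hp: "inv h \<otimes> p \<in> P"
      show "\<forall>r\<in>P. inv h \<otimes> (p \<otimes> r) \<in> P"
        using P.m_closed[OF hp] hc pc P_carrier by (simp add: m_assoc[symmetric])
    qed
    finally show "(p <# P) \<inter> (h <# P) = p <# P \<longleftrightarrow> inv h \<otimes> p \<in> P" .
  qed
  then show ?thesis unfolding Delta_def by auto
qed

lemma Delta_subset: "Delta G P F \<subseteq> P"
  by (auto simp: Delta_def)

lemma Delta_mono: "F \<subseteq> F' \<Longrightarrow> Delta G P F' \<subseteq> Delta G P F"
  by (auto simp: Delta_def)

text \<open>The elements of F are decided one at a time. If pP meets gP, move on to some pr in gP;
  earlier decisions persist because the ideal of pr lies in that of p.\<close>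

lemma Delta_nonempty:
  assumes "finite F" "F \<subseteq> carrier G"
  shows "Delta G P F \<noteq> {}"
  using assms
proof (induction F)
  case empty
  have "\<one> \<in> Delta G P {}" by (simp add: Delta_def P.one_closed)
  then show ?case by blast
next
  case (insert g F)
  then obtain p where p: "p \<in> P" "\<And>h. h \<in> F \<Longrightarrow> (\<forall>r\<in>P. inv h \<otimes> (p \<otimes> r) \<notin> P) \<or> inv h \<otimes> p \<in> P"
    using Delta_iff[of F] by auto
  show ?case
  proof (cases "\<forall>r\<in>P. inv g \<otimes> (p \<otimes> r) \<notin> P")
    case True
    then have "p \<in> Delta G P (insert g F)" using p insert.prems by (subst Delta_iff) auto
    then show ?thesis by blast
  next
    case False
    then obtain r where r: "r \<in> P" "inv g \<otimes> (p \<otimes> r) \<in> P" by blast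
    have "(\<forall>s\<in>P. inv h \<otimes> (p \<otimes> r \<otimes> s) \<notin> P) \<or> inv h \<otimes> (p \<otimes> r) \<in> P" if h: "h \<in> F" for h
      using p(2)[OF h]
    proof
      assume "\<forall>r\<in>P. inv h \<otimes> (p \<otimes> r) \<notin> P"
      then show ?thesis using r(1) p(1) P.m_closed by (simp add: m_assoc P_carrier)
    next
      assume "inv h \<otimes> p \<in> P"
      moreover have "h \<in> carrier G" using h insert.prems by blast
      ultimately show ?thesis
        using P.m_closed[OF _ r(1)] r(1) p(1) by (simp add: m_assoc[symmetric] P_carrier)
    qed
    then have "p \<otimes> r \<in> Delta G P (insert g F)"
      using p(1) r insert.prems by (subst Delta_iff) (auto simp: P.m_closed)
    then show ?thesis by blast
  qed
qed

text \<open>The inverse of g^{-1}h is h^{-1}g, so the conditions on q at the translated set are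
  those on gq at F. Membership of gq in P has to be supplied separately.\<close>

lemma Delta_translate:
  assumes F: "F \<subseteq> carrier G" and g: "g \<in> carrier G" and q: "q \<in> Delta G P ((\<lambda>h. inv g \<otimes> h) ` F)"
    and gq: "g \<otimes> q \<in> P"
  shows "g \<otimes> q \<in> Delta G P F"
proof -
  have F': "(\<lambda>h. inv g \<otimes> h) ` F \<subseteq> carrier G" using F g by auto
  have qP: "q \<in> P" and qF: "\<And>h. h \<in> F \<Longrightarrow>
      (\<forall>r\<in>P. inv (inv g \<otimes> h) \<otimes> (q \<otimes> r) \<notin> P) \<or> inv (inv g \<otimes> h) \<otimes> q \<in> P"
    using q unfolding Delta_iff[OF F'] by auto
  have "inv (inv g \<otimes> h) \<otimes> x = inv h \<otimes> (g \<otimes> x)" if "h \<in> F" "x \<in> carrier G" for h x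
    using that F g by (simp add: inv_mult_group subset_iff m_assoc)
  then have "(\<forall>r\<in>P. inv h \<otimes> (g \<otimes> q \<otimes> r) \<notin> P) \<or> inv h \<otimes> (g \<otimes> q) \<in> P" if "h \<in> F" for h
    using qF[OF that] that qP g by (simp add: P_carrier m_assoc)
  then show ?thesis using gq by (simp add: Delta_iff[OF F])
qed

lemma Delta_decides_word:
  assumes "\<alpha> \<in> neutral_words G P"
  obtains F where "finite F" "F \<subseteq> carrier G"
    "\<And>q. q \<in> Delta G P F \<Longrightarrow> q \<in> K G P \<alpha> \<or> (\<forall>r\<in>P. q \<otimes> r \<notin> K G P \<alpha>)"
proof -
  let ?w = "\<lambda>m. word_elt G (drop (2 * m) \<alpha>)"
  have wc: "?w m \<in> carrier G" for m using word_elt_closed words_drop neutral_wordsD(1) assms by blast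
  \<comment> \<open>K(\<alpha>) is the intersection of the translates of P by exactly these
    elements, so deciding each translate decides K(\<alpha>).\<close>
  define F where "F = (\<lambda>m. inv (?w m)) ` {..length \<alpha> div 2}"
  have F: "F \<subseteq> carrier G" using wc by (auto simp: F_def)
  have "q \<in> K G P \<alpha> \<or> (\<forall>r\<in>P. q \<otimes> r \<notin> K G P \<alpha>)" if "q \<in> Delta G P F" for q
  proof -
    have q: "q \<in> P" "\<And>m. m \<le> length \<alpha> div 2 \<Longrightarrow> (\<forall>r\<in>P. ?w m \<otimes> (q \<otimes> r) \<notin> P) \<or> ?w m \<otimes> q \<in> P"
      using that wc unfolding Delta_iff[OF F] by (auto simp: F_def)
    show ?thesis
    proof (cases "\<forall>m\<le>length \<alpha> div 2. ?w m \<otimes> q \<in> P")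
      case True
      then have "q \<in> K G P \<alpha>" using q(1) by (simp add: K_neutral[OF assms] word_domain_def P_carrier)
      then show ?thesis ..
    next
      case False
      then obtain m where m: "m \<le> length \<alpha> div 2" "?w m \<otimes> q \<notin> P" by blast
      then have "\<forall>r\<in>P. ?w m \<otimes> (q \<otimes> r) \<notin> P" using q(2) by blast
      then show ?thesis using m(1) by (auto simp: K_neutral[OF assms] word_domain_def)
    qed
  qed
  then show ?thesis using that[of F] F by (simp add: F_def)
qed

end

section \<open>Representations by shifts\<close>

lemma
  assumes f: "f \<in> l2 I" and h: "inj_on h D" "D \<subseteq> J"
  shows l2_reindex: "(\<lambda>x. if x \<in> D then f (h x) else 0) \<in> l2 J"
    and l2_norm_reindex: "l2_norm (\<lambda>x. if x \<in> D then f (h x) else 0) \<le> l2_norm f"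
proof -
  have fin: "fin_norm (\<lambda>x. if x \<in> D then f (h x) else 0) Y \<le> l2_norm f" if Y: "finite Y" for Y
  proof -
    have "(\<Sum>x\<in>Y. (cmod (if x \<in> D then f (h x) else 0))\<^sup>2) = (\<Sum>x\<in>Y \<inter> D. (cmod (f (h x)))\<^sup>2)"
      using Y by (intro sum.mono_neutral_cong_right) auto
    also have "\<dots> = (\<Sum>x\<in>h ` (Y \<inter> D). (cmod (f x))\<^sup>2)"
      using h(1) by (subst sum.reindex) (auto intro: inj_on_subset)
    finally have "fin_norm (\<lambda>x. if x \<in> D then f (h x) else 0) Y = fin_norm f (h ` (Y \<inter> D))"
      by (simp add: L2_set_def)
    then show ?thesis using fin_norm_le_l2_norm[OF f] Y by simp
  qed
  have off: "(if x \<in> D then f (h x) else 0) = 0" if "x \<notin> J" for x using that h(2) by auto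
  show "(\<lambda>x. if x \<in> D then f (h x) else 0) \<in> l2 J"
    by (rule l2I[OF off fin])
  show "l2_norm (\<lambda>x. if x \<in> D then f (h x) else 0) \<le> l2_norm f"
    by (rule l2_norm_leI[OF off fin])
qed

text \<open>The left regular representation is the case X = P. The general form serves the set of
  the ultrafilter, which contains P and may be larger.\<close>

definition shift :: "('g, 'm) monoid_scheme \<Rightarrow> 'g set \<Rightarrow> 'g \<Rightarrow> ('g \<Rightarrow> complex) \<Rightarrow> ('g \<Rightarrow> complex)" where
  "shift G X p = (\<lambda>f\<in>l2 X. \<lambda>x. if x \<in> p <#\<^bsub>G\<^esub> X then f (inv\<^bsub>G\<^esub> p \<otimes>\<^bsub>G\<^esub> x) else 0)"

lemma shift_apply:
  "f \<in> l2 X \<Longrightarrow> shift G X p f x = (if x \<in> p <#\<^bsub>G\<^esub> X then f (inv\<^bsub>G\<^esub> p \<otimes>\<^bsub>G\<^esub> x) else 0)"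
  by (simp add: shift_def)

lemma left_reg_shift: "left_reg G P = shift G P"
  by (simp add: fun_eq_iff left_reg_def shift_def)

locale invariant_subset = monoid_in_group +
  fixes X
  assumes X_carrier: "X \<subseteq> carrier G" and X_invariant: "\<lbrakk>p \<in> P; x \<in> X\<rbrakk> \<Longrightarrow> p \<otimes> x \<in> X"
begin

lemma lcoset_subset: "p \<in> P \<Longrightarrow> p <# X \<subseteq> X"
  by (auto simp: l_coset_def X_invariant)

lemma X_mem_carrier: "x \<in> X \<Longrightarrow> x \<in> carrier G"
  using X_carrier by blast

abbreviation "back p \<equiv> (\<lambda>f\<in>l2 X. \<lambda>x. if x \<in> X then f (p \<otimes> x) else 0)"

lemma shift_closed:
  assumes p: "p \<in> P"
  shows "shift G X p \<in> carrier (l2_ops X)"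
proof -
  have inj: "inj_on (\<lambda>x. inv p \<otimes> x) (p <# X)"
    by (rule inj_onI)
      (use p X_carrier lcoset_iff[of p X] in \<open>auto simp: P_carrier\<close>)
  show ?thesis
  proof (rule l2_opsI[where C = 1])
    fix f assume f: "f \<in> l2 X"
    show "shift G X p f \<in> l2 X" "l2_norm (shift G X p f) \<le> 1 * l2_norm f"
      using l2_reindex[OF f inj lcoset_subset[OF p]] l2_norm_reindex[OF f inj lcoset_subset[OF p]] f
      by (simp_all add: shift_def)
  qed (auto simp: shift_def l2_add l2_scale)
qed

lemma back_closed:
  assumes p: "p \<in> P"
  shows "back p \<in> carrier (l2_ops X)"
proof -
  have inj: "inj_on (\<lambda>x. p \<otimes> x) X"
    by (rule inj_onI) (use p in \<open>auto simp: P_carrier X_mem_carrier\<close>)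
  show ?thesis
  proof (rule l2_opsI[where C = 1])
    fix f assume f: "f \<in> l2 X"
    show "back p f \<in> l2 X" "l2_norm (back p f) \<le> 1 * l2_norm f"
      using l2_reindex[OF f inj order_refl] l2_norm_reindex[OF f inj order_refl] f
      by simp_all
  qed (auto simp: l2_add l2_scale)
qed

lemma adj_shift:
  assumes p: "p \<in> P"
  shows "adj (l2_ops X) (shift G X p) = back p"
proof (rule adj_l2_opsI[OF back_closed[OF p]])
  fix f g assume fg: "f \<in> l2 X" "g \<in> l2 X"
  have pc: "p \<in> carrier G" by (rule P_carrier[OF p])
  have bij: "bij_betw (\<lambda>y. p \<otimes> y) X (p <# X)"
    unfolding bij_betw_def l_coset_def
    using pc X_mem_carrier by (auto intro!: inj_onI)
  have "l2_inner (shift G X p f) g = (\<Sum>\<^sub>\<infinity>x\<in>p <# X. cnj (f (inv p \<otimes> x)) * g x)"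
    unfolding l2_inner_def using fg by (intro infsum_cong_neutral) (auto simp: shift_def)
  also have "\<dots> = (\<Sum>\<^sub>\<infinity>y\<in>X. cnj (f (inv p \<otimes> (p \<otimes> y))) * g (p \<otimes> y))"
    by (rule infsum_reindex_bij_betw[OF bij, symmetric])
  also have "\<dots> = (\<Sum>\<^sub>\<infinity>y\<in>X. cnj (f y) * g (p \<otimes> y))"
    using pc X_mem_carrier by (intro infsum_cong) (simp add: m_assoc[symmetric])
  also have "\<dots> = l2_inner f (back p g)"
    unfolding l2_inner_def using fg by (intro infsum_cong_neutral) auto
  finally show "l2_inner (shift G X p f) g = l2_inner f (back p g)" .
qed

lemma shift_funcset: "shift G X \<in> P \<rightarrow> carrier (l2_ops X)"
  using shift_closed by blast

text \<open>A word acts as the partial translation by its value, with \<open>word_domain\<close> as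
  domain. The first letters of the word act last, matching the recursion of the domain.\<close>

lemma word_op_shift:
  assumes "\<alpha> \<in> words P" "f \<in> l2 X"
  shows "word_op (l2_ops X) (shift G X) \<alpha> f =
    (\<lambda>x. if x \<in> carrier G \<and> inv (word_elt G \<alpha>) \<otimes> x \<in> word_domain G X \<alpha>
         then f (inv (word_elt G \<alpha>) \<otimes> x) else 0)"
  using assms(1)
proof (induction rule: words_induct)
  case Nil
  then show ?case
    using assms(2) l2_off[OF assms(2)] X_carrier
    by (auto simp: l2_ops_simps word_domain_Nil[OF X_carrier] fun_eq_iff)
next
  case (Cons p q \<alpha>)
  interpret A: unital_cstar_algebra "l2_ops X" by (rule unital_cstar_algebra_l2_ops)
  let ?W = "word_op (l2_ops X) (shift G X) \<alpha>" and ?w = "word_elt G \<alpha>"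
    and ?w' = "word_elt G (p # q # \<alpha>)"
  have Wf: "?W f \<in> l2 X"
    using A.word_op_closed[OF shift_funcset Cons(3)] assms(2) by (rule l2_opsD(1))
  have sWf: "shift G X q (?W f) \<in> l2 X" by (rule l2_opsD(1)[OF shift_closed[OF Cons(2)] Wf])
  have pc: "p \<in> carrier G" and qc: "q \<in> carrier G" and wc: "?w \<in> carrier G"
    using Cons P_carrier word_elt_closed by auto
  have "word_op (l2_ops X) (shift G X) (p # q # \<alpha>) f = back p (shift G X q (?W f))"
    using assms(2) Wf sWf by (simp add: l2_ops_simps adj_shift[OF Cons(1)])
  also have "\<dots> = (\<lambda>x. if x \<in> carrier G \<and> inv ?w' \<otimes> x \<in> word_domain G X (p # q # \<alpha>)
      then f (inv ?w' \<otimes> x) else 0)"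
  proof
    fix x
    show "back p (shift G X q (?W f)) x = (if x \<in> carrier G \<and> inv ?w' \<otimes> x \<in> word_domain G X (p # q # \<alpha>)
      then f (inv ?w' \<otimes> x) else 0)"
    proof (cases "x \<in> carrier G")
      case False
      then show ?thesis using sWf X_carrier by auto
    next
      case True
      let ?z = "inv q \<otimes> (p \<otimes> x)"
      have z: "?z \<in> carrier G" using True pc qc by simp
      have cancel: "a \<otimes> (inv a \<otimes> b) = b" if "a \<in> carrier G" "b \<in> carrier G" for a b
        using that by (simp add: m_assoc[symmetric])
      have y: "inv ?w' \<otimes> x = inv ?w \<otimes> ?z"
        using True pc qc wc by (simp add: inv_mult_group m_assoc)
      have e1: "?w' \<otimes> (inv ?w' \<otimes> x) = x"
        using cancel[OF word_elt_closed[of "p # q # \<alpha>"] True] Cons by simp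
      have e2: "?w \<otimes> (inv ?w \<otimes> ?z) = ?z" by (rule cancel[OF wc z])
      \<comment> \<open>The shift by q asks for \<open>?z\<close> to lie in X. This is automatic on
        the support of the remaining word, since \<open>?z\<close> is reached by that word.\<close>
      have zX: "inv ?w \<otimes> ?z \<in> word_domain G X \<alpha> \<Longrightarrow> ?z \<in> X" using word_domain_elt e2 by metis
      have c: "inv ?w' \<otimes> x \<in> word_domain G X (p # q # \<alpha>) \<longleftrightarrow> inv ?w \<otimes> ?z \<in> word_domain G X \<alpha> \<and> x \<in> X"
        unfolding word_domain_Cons using e1 y by (simp del: word_elt.simps(3))
      have "back p (shift G X q (?W f)) x = (if x \<in> X \<and> ?z \<in> X then ?W f ?z else 0)"
        using sWf Wf lcoset_iff[OF qc X_carrier] True pc by (simp add: shift_def)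
      also have "\<dots> = (if inv ?w \<otimes> ?z \<in> word_domain G X \<alpha> \<and> x \<in> X then f (inv ?w \<otimes> ?z) else 0)"
        using zX z unfolding Cons(4) by auto
      finally show ?thesis using c y True by (simp del: word_elt.simps(3))
    qed
  qed
  finally show ?case .
qed

lemma word_op_shift_neutral:
  assumes "\<alpha> \<in> neutral_words G P"
  shows "word_op (l2_ops X) (shift G X) \<alpha> = mult_op X (indicator (word_domain G X \<alpha>))"
proof (rule l2_ops_eqI)
  interpret A: unital_cstar_algebra "l2_ops X" by (rule unital_cstar_algebra_l2_ops)
  note \<alpha> = neutral_wordsD[OF assms]
  show "word_op (l2_ops X) (shift G X) \<alpha> \<in> extensional (l2 X)"
    by (rule l2_opsD(5)[OF A.word_op_closed[OF shift_funcset \<alpha>(1)]])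
  show "word_op (l2_ops X) (shift G X) \<alpha> f = mult_op X (indicator (word_domain G X \<alpha>)) f" if "f \<in> l2 X" for f
    unfolding word_op_shift[OF \<alpha>(1) that] using that word_domain_carrier[of _ X \<alpha>] \<alpha>(2)
    by (auto simp: mult_op_def indicator_def fun_eq_iff)
qed (simp add: mult_op_def)

lemma isometric_rep_shift: "isometric_rep G P (l2_ops X) (shift G X)"
proof -
  have one: "shift G X \<one> = \<one>\<^bsub>l2_ops X\<^esub>"
  proof (rule l2_ops_eqI)
    show "shift G X \<one> f = \<one>\<^bsub>l2_ops X\<^esub> f" if "f \<in> l2 X" for f
      using that l2_off[OF that] X_carrier lcoset_iff[OF one_closed X_carrier]
      by (auto simp: shift_def l2_ops_simps fun_eq_iff)
  qed (simp_all add: shift_def l2_ops_simps)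
  have isom: "adj (l2_ops X) (shift G X p) \<otimes>\<^bsub>l2_ops X\<^esub> shift G X p = \<one>\<^bsub>l2_ops X\<^esub>" if p: "p \<in> P" for p
  proof (rule l2_ops_eqI)
    fix f assume f: "f \<in> l2 X"
    have sf: "shift G X p f \<in> l2 X" by (rule l2_opsD(1)[OF shift_closed[OF p] f])
    have "p \<otimes> x \<in> p <# X" if "x \<in> X" for x using that by (auto simp: l_coset_def)
    moreover have "inv p \<otimes> (p \<otimes> x) = x" if "x \<in> X" for x
      using X_mem_carrier[OF that] P_carrier[OF p] by (simp add: m_assoc[symmetric])
    ultimately have "(\<lambda>x. if x \<in> X then shift G X p f (p \<otimes> x) else 0) = f"
      using l2_off[OF f] by (auto simp: shift_apply[OF f])
    then show "(adj (l2_ops X) (shift G X p) \<otimes>\<^bsub>l2_ops X\<^esub> shift G X p) f = \<one>\<^bsub>l2_ops X\<^esub> f"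
      using f sf by (simp add: l2_ops_simps adj_shift[OF p])
  qed (simp_all add: l2_ops_simps)
  have mult: "shift G X (p \<otimes> q) = shift G X p \<otimes>\<^bsub>l2_ops X\<^esub> shift G X q" if p: "p \<in> P" and q: "q \<in> P" for p q
  proof (rule l2_ops_eqI)
    fix f assume f: "f \<in> l2 X"
    have sf: "shift G X q f \<in> l2 X" by (rule l2_opsD(1)[OF shift_closed[OF q] f])
    have pc: "p \<in> carrier G" and qc: "q \<in> carrier G" using p q P_carrier by auto
    show "shift G X (p \<otimes> q) f = (shift G X p \<otimes>\<^bsub>l2_ops X\<^esub> shift G X q) f"
    proof
      fix x
      show "shift G X (p \<otimes> q) f x = (shift G X p \<otimes>\<^bsub>l2_ops X\<^esub> shift G X q) f x"
      proof (cases "x \<in> carrier G")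
        case True
        have e: "inv (p \<otimes> q) \<otimes> x = inv q \<otimes> (inv p \<otimes> x)"
          using pc qc True by (simp add: inv_mult_group m_assoc)
        \<comment> \<open>The composite also requires the intermediate point to lie in X; invariance
          of X under q provides it.\<close>
        have "inv p \<otimes> x \<in> X" if "inv q \<otimes> (inv p \<otimes> x) \<in> X"
        proof -
          have "inv p \<otimes> x = q \<otimes> (inv q \<otimes> (inv p \<otimes> x))" using pc qc True by (simp add: m_assoc[symmetric])
          then show ?thesis using X_invariant[OF q that] by simp
        qed
        then show ?thesis
          using f sf True pc qc e lcoset_iff[OF _ X_carrier] by (auto simp: shift_apply l2_ops_simps)
      next
        case False
        then show ?thesis
          using f sf pc qc lcoset_iff[OF _ X_carrier] by (simp add: shift_apply l2_ops_simps)
      qed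
    qed
  qed (simp_all add: shift_def l2_ops_simps)
  show ?thesis unfolding isometric_rep_def using one isom mult shift_closed by blast
qed

end

section \<open>The diagonal algebra of the regular representation\<close>

lemma (in monoid_in_group) invariant_subset_P: "invariant_subset G P P"
  by unfold_locales (use P.subset P.m_closed in auto)

context monoid_in_group
begin

interpretation R: invariant_subset G P P by (rule invariant_subset_P)

abbreviation "diag_gen \<equiv> word_op (l2_ops P) (left_reg G P)"

lemma diag_gen: "\<alpha> \<in> neutral_words G P \<Longrightarrow> diag_gen \<alpha> = mult_op P (indicator (K G P \<alpha>))"
  by (simp add: left_reg_shift R.word_op_shift_neutral K_neutral)

text \<open>Indicators of constructible ideals are values of neutral words, which turns products in
  D_r into concatenations.\<close>

lemma D_red_eq: "D_red G P = (l2_ops P)\<lparr>carrier := closed_span (l2_ops P) (diag_gen ` neutral_words G P)\<rparr>"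
  unfolding D_red_def constructible_neutral image_image by (simp add: diag_gen cong: image_cong)

lemma mult_op_indicator_closed: "mult_op I (indicator S) \<in> carrier (l2_ops I)"
  by (rule mult_op_closed[where C = 1]) (auto simp: indicator_def)

lemma diag_gen_closed: "diag_gen ` neutral_words G P \<subseteq> carrier (l2_ops P)"
  using diag_gen mult_op_indicator_closed by auto

lemma cstar_subalgebra_D_red: "cstar_subalgebra (l2_ops P) (carrier (D_red G P))"
proof -
  interpret A: unital_cstar_algebra "l2_ops P" by (rule unital_cstar_algebra_l2_ops)
  have "cstar_subalgebra (l2_ops P) (closed_span (l2_ops P) (diag_gen ` neutral_words G P))"
  proof (rule A.closed_span_subalgebra[OF diag_gen_closed])
    show "x \<otimes>\<^bsub>l2_ops P\<^esub> y \<in> diag_gen ` neutral_words G P"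
      if xy: "x \<in> diag_gen ` neutral_words G P" "y \<in> diag_gen ` neutral_words G P" for x y
    proof -
      obtain \<alpha> \<beta> where ab: "\<alpha> \<in> neutral_words G P" "\<beta> \<in> neutral_words G P" "x = diag_gen \<alpha>" "y = diag_gen \<beta>"
        using xy by blast
      then have "x \<otimes>\<^bsub>l2_ops P\<^esub> y = diag_gen (\<alpha> @ \<beta>)"
        using A.word_op_append[OF R.shift_funcset] neutral_wordsD(1) by (simp add: left_reg_shift)
      then show ?thesis using neutral_words_append[OF ab(1,2)] by simp
    qed
    show "adj (l2_ops P) x \<in> diag_gen ` neutral_words G P" if x: "x \<in> diag_gen ` neutral_words G P" for x
    proof -
      obtain \<alpha> where \<alpha>: "\<alpha> \<in> neutral_words G P" "x = diag_gen \<alpha>" using x by blast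
      have "adj (l2_ops P) x = mult_op P (\<lambda>y. cnj (indicator (K G P \<alpha>) y))"
        unfolding \<alpha>(2) diag_gen[OF \<alpha>(1)] by (rule adj_mult_op[where C = 1]) (auto simp: indicator_def)
      also have "\<dots> = diag_gen \<alpha>" unfolding diag_gen[OF \<alpha>(1)] by (rule mult_op_cong) (auto simp: indicator_def)
      finally show ?thesis using \<alpha>(1) by blast
    qed
  qed
  then show ?thesis by (simp add: D_red_eq)
qed

lemma D_red_carrier_update: "D_red G P = (l2_ops P)\<lparr>carrier := carrier (D_red G P)\<rparr>"
  by (simp add: D_red_eq)

lemma diag_gen_D_red: "\<alpha> \<in> neutral_words G P \<Longrightarrow> diag_gen \<alpha> \<in> carrier (D_red G P)"
  using cstar_algebra.closed_span_superset[OF cstar_algebra_l2_ops, of "diag_gen ` neutral_words G P"]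
  by (auto simp: D_red_eq)

lemma unital_D_red: "unital_cstar_algebra (D_red G P)"
  by (subst D_red_carrier_update,
      rule unital_cstar_algebra.unital_cstar_algebra_subalgebra[OF unital_cstar_algebra_l2_ops cstar_subalgebra_D_red])
    (use diag_gen_D_red[OF neutral_words_Nil] in simp)

lemma D_red_simps [simp]:
  "mult (D_red G P) = mult (l2_ops P)" "one (D_red G P) = one (l2_ops P)"
  "add (D_red G P) = add (l2_ops P)" "zero (D_red G P) = zero (l2_ops P)"
  "smult (D_red G P) = smult (l2_ops P)" "adj (D_red G P) = adj (l2_ops P)"
  "nrm (D_red G P) = nrm (l2_ops P)"
  by (simp_all add: D_red_def)

lemma D_red_diagonal: "carrier (D_red G P) \<subseteq> diagonal_ops P"
proof -
  have "diag_gen ` neutral_words G P \<subseteq> diagonal_ops P"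
  proof
    fix T assume "T \<in> diag_gen ` neutral_words G P"
    then obtain \<alpha> where "T = mult_op P (indicator (K G P \<alpha>))" using diag_gen by auto
    then show "T \<in> diagonal_ops P"
      using diagonal_opsI[of P "indicator (K G P \<alpha>)" 1] by (auto simp: indicator_def)
  qed
  then show ?thesis
    using cstar_algebra.closed_span_minimal[OF cstar_algebra_l2_ops
        cstar_algebra.cstar_subalgebraD(1)[OF cstar_algebra_l2_ops cstar_subalgebra_diagonal]]
    by (simp add: D_red_eq)
qed

lemma D_red_l2_ops: "carrier (D_red G P) \<subseteq> carrier (l2_ops P)"
  using D_red_diagonal by (auto simp: diagonal_ops_def)

lemma minus_D_red:
  "\<lbrakk>x \<in> carrier (D_red G P); y \<in> carrier (D_red G P)\<rbrakk> \<Longrightarrow> x \<ominus>\<^bsub>D_red G P\<^esub> y = x \<ominus>\<^bsub>l2_ops P\<^esub> y"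
  using cstar_algebra.minus_subalgebra[OF cstar_algebra_l2_ops cstar_subalgebra_D_red]
  by (simp flip: D_red_carrier_update)

lemma symbol_diag_gen:
  "\<lbrakk>\<alpha> \<in> neutral_words G P; x \<in> P\<rbrakk> \<Longrightarrow> symbol (diag_gen \<alpha>) x = indicator (K G P \<alpha>) x"
  by (simp add: diag_gen symbol_mult_op)

text \<open>The symbol is additive and multiplicative on diagonal operators, so the product of
  differences can be evaluated point by point.\<close>

lemma foldr_diag_gen:
  assumes \<alpha>: "\<alpha> \<in> neutral_words G P" and "set \<beta>s \<subseteq> neutral_words G P"
    and sub: "\<And>\<beta>. \<beta> \<in> set \<beta>s \<Longrightarrow> K G P \<beta> \<subseteq> K G P \<alpha>"
  defines "d \<equiv> foldr (\<lambda>\<beta> x. (diag_gen \<alpha> \<ominus>\<^bsub>l2_ops P\<^esub> diag_gen \<beta>) \<otimes>\<^bsub>l2_ops P\<^esub> x) \<beta>s \<one>\<^bsub>l2_ops P\<^esub>"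
  shows "d \<in> carrier (D_red G P) \<and>
    (\<forall>x\<in>P. symbol d x = (\<Prod>\<beta>\<leftarrow>\<beta>s. indicator (K G P \<alpha>) x - indicator (K G P \<beta>) x))"
  using assms(2,3) unfolding d_def
proof (induction \<beta>s)
  case Nil
  interpret D: unital_cstar_algebra "D_red G P" by (rule unital_D_red)
  have k: "ket x x = 1" for x :: 'a by (simp add: ket_def)
  have "symbol \<one>\<^bsub>l2_ops P\<^esub> x = 1" if "x \<in> P" for x
    using that by (simp add: symbol_def l2_ops_simps ket_l2 k)
  then show ?case using D.one_closed by simp
next
  case (Cons \<beta> \<beta>s)
  interpret D: unital_cstar_algebra "D_red G P" by (rule unital_D_red)
  interpret A: unital_cstar_algebra "l2_ops P" by (rule unital_cstar_algebra_l2_ops)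
  let ?d = "foldr (\<lambda>\<beta> x. (diag_gen \<alpha> \<ominus>\<^bsub>l2_ops P\<^esub> diag_gen \<beta>) \<otimes>\<^bsub>l2_ops P\<^esub> x) \<beta>s \<one>\<^bsub>l2_ops P\<^esub>"
  have IH: "?d \<in> carrier (D_red G P)"
    "\<And>x. x \<in> P \<Longrightarrow> symbol ?d x = (\<Prod>\<beta>\<leftarrow>\<beta>s. indicator (K G P \<alpha>) x - indicator (K G P \<beta>) x)"
    using Cons by auto
  have \<beta>: "\<beta> \<in> neutral_words G P" using Cons.prems by simp
  note c = diag_gen_D_red[OF \<alpha>] diag_gen_D_red[OF \<beta>]
  let ?e = "diag_gen \<alpha> \<ominus>\<^bsub>l2_ops P\<^esub> diag_gen \<beta>"
  have e: "?e \<in> carrier (D_red G P)"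
    using D.minus_closed[OF c] by (simp add: minus_D_red[OF c])
  have me: "(-1) \<odot>\<^bsub>l2_ops P\<^esub> diag_gen \<beta> \<in> carrier (D_red G P)" using D.smult_closed[OF c(2), of "-1"] by simp
  have "symbol ?e x = indicator (K G P \<alpha>) x - indicator (K G P \<beta>) x" if x: "x \<in> P" for x
  proof -
    have "?e = diag_gen \<alpha> \<oplus>\<^bsub>l2_ops P\<^esub> (-1) \<odot>\<^bsub>l2_ops P\<^esub> diag_gen \<beta>"
      using c D_red_l2_ops by (intro A.minus_smult) auto
    then show ?thesis
      using symbol_l2_ops(1)[OF subsetD[OF D_red_diagonal c(1)] subsetD[OF D_red_diagonal me] x]
        symbol_l2_ops(2)[OF subsetD[OF D_red_diagonal c(2)] subsetD[OF D_red_diagonal c(2)] x, of "-1"]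
      by (simp add: symbol_diag_gen \<alpha> \<beta> x)
  qed
  then show ?case
    using D.mult_closed[OF e IH(1)] IH(2)
      symbol_l2_ops(3)[OF subsetD[OF D_red_diagonal e] subsetD[OF D_red_diagonal IH(1)]]
    by simp
qed

text \<open>(T2)-(T4) concern neutral words only and hold for indicator functions in D_r; a
  homomorphism from D_r that sends words to words carries them over. This applies to the regular
  representation and to every strongly covariant family.\<close>

lemma diagonal_rep_toeplitz:
  assumes B: "cstar_algebra B" and one: "w \<one> = \<one>\<^bsub>B\<^esub>"
    and \<pi>: "star_hom (D_red G P) B \<pi>" "\<And>\<alpha>. \<alpha> \<in> neutral_words G P \<Longrightarrow> \<pi> (diag_gen \<alpha>) = word_op B w \<alpha>"
  shows "toeplitz_family G P B w"
proof -
  interpret B: cstar_algebra B by fact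
  interpret D: unital_cstar_algebra "D_red G P" by (rule unital_D_red)
  have z: "\<pi> \<zero>\<^bsub>l2_ops P\<^esub> = \<zero>\<^bsub>B\<^esub>"
    using star_hom_zero[OF D.cstar_algebra_axioms B \<pi>(1)] by simp
  have zero: "word_op B w \<alpha> = \<zero>\<^bsub>B\<^esub>" if "\<alpha> \<in> neutral_words G P" "K G P \<alpha> = {}" for \<alpha>
  proof -
    have "diag_gen \<alpha> = mult_op P (\<lambda>_. 0)"
      unfolding diag_gen[OF that(1)] that(2) by (rule mult_op_cong) simp
    then show ?thesis using \<pi>(2)[OF that(1)] z by (simp add: mult_op_zero)
  qed
  have eq: "word_op B w \<alpha> = word_op B w \<beta>"
    if "\<alpha> \<in> neutral_words G P" "\<beta> \<in> neutral_words G P" "K G P \<alpha> = K G P \<beta>" for \<alpha> \<beta>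
    using \<pi>(2)[OF that(1)] \<pi>(2)[OF that(2)] that by (simp add: diag_gen)
  have prod: "diff_prod B w \<alpha> F = \<zero>\<^bsub>B\<^esub>"
    if \<alpha>: "\<alpha> \<in> neutral_words G P" and F: "finite F" "F \<subseteq> neutral_words G P"
      and K: "K G P \<alpha> = (\<Union>\<beta>\<in>F. K G P \<beta>)" for \<alpha> F
  proof (cases "F = {}")
    case True
    then show ?thesis using zero[OF \<alpha>] K by (simp add: diff_prod_def)
  next
    case False
    define \<beta>s where "\<beta>s = (SOME \<beta>s. set \<beta>s = F \<and> distinct \<beta>s)"
    have \<beta>s: "set \<beta>s = F" using some_list_of_finite[OF F(1)] by (simp add: \<beta>s_def)
    let ?d = "\<lambda>\<beta>s. foldr (\<lambda>\<beta> x. (diag_gen \<alpha> \<ominus>\<^bsub>l2_ops P\<^esub> diag_gen \<beta>) \<otimes>\<^bsub>l2_ops P\<^esub> x) \<beta>s \<one>\<^bsub>l2_ops P\<^esub>"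
    have d: "?d \<beta>s \<in> carrier (D_red G P)"
      "\<And>x. x \<in> P \<Longrightarrow> symbol (?d \<beta>s) x = (\<Prod>\<beta>\<leftarrow>\<beta>s. indicator (K G P \<alpha>) x - indicator (K G P \<beta>) x)"
      if "set \<beta>s \<subseteq> F" for \<beta>s
      using foldr_diag_gen[OF \<alpha>, of \<beta>s] that F K by blast+
    have "(\<Prod>\<beta>\<leftarrow>\<beta>s. indicator (K G P \<alpha>) x - indicator (K G P \<beta>) x) = (0 :: complex)" for x
    proof -
      \<comment> \<open>At every point some factor vanishes: inside K(\<alpha>) one whose ideal
        contains the point, outside K(\<alpha>) any factor. The latter requires F to be nonempty,
        whence the case split.\<close>
      have "\<exists>\<beta>\<in>F. (indicator (K G P \<alpha>) x :: complex) = indicator (K G P \<beta>) x"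
        using K False by (cases "x \<in> K G P \<alpha>") (auto simp: indicator_def)
      then show ?thesis using \<beta>s by (auto simp: prod_list_zero_iff)
    qed
    then have "?d \<beta>s = mult_op P (\<lambda>_. 0)"
      using diagonal_opsD(2)[OF subsetD[OF D_red_diagonal d(1)[of \<beta>s]]] d(2)[of \<beta>s] \<beta>s
        mult_op_cong[of P "symbol (?d \<beta>s)" "\<lambda>_. 0"] by simp
    then have "\<pi> (?d \<beta>s) = \<zero>\<^bsub>B\<^esub>" using z by (simp add: mult_op_zero)
    moreover have "\<pi> (?d \<beta>s') = foldr (\<lambda>\<beta> x. (word_op B w \<alpha> \<ominus>\<^bsub>B\<^esub> word_op B w \<beta>) \<otimes>\<^bsub>B\<^esub> x) \<beta>s' \<one>\<^bsub>B\<^esub>"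
      if "set \<beta>s' \<subseteq> F" for \<beta>s'
      using that
    proof (induction \<beta>s')
      case Nil
      then show ?case using \<pi>(2)[OF neutral_words_Nil] by simp
    next
      case (Cons \<beta> \<beta>s')
      then have \<beta>: "\<beta> \<in> neutral_words G P" using F by auto
      note c = diag_gen_D_red[OF \<alpha>] diag_gen_D_red[OF \<beta>]
      have e: "diag_gen \<alpha> \<ominus>\<^bsub>l2_ops P\<^esub> diag_gen \<beta> \<in> carrier (D_red G P)"
        using D.minus_closed[OF c] by (simp add: minus_D_red[OF c])
      have "\<pi> (diag_gen \<alpha> \<ominus>\<^bsub>l2_ops P\<^esub> diag_gen \<beta>) = word_op B w \<alpha> \<ominus>\<^bsub>B\<^esub> word_op B w \<beta>"
        using star_hom_minus[OF D.cstar_algebra_axioms B \<pi>(1) c]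
        by (simp add: minus_D_red[OF c] \<pi>(2) \<alpha> \<beta>)
      then show ?case
        using star_homD(4)[OF \<pi>(1) e d(1)[of \<beta>s']] Cons by simp
    qed
    ultimately show ?thesis using False \<beta>s by (simp add: diff_prod_def \<beta>s_def)
  qed
  show ?thesis unfolding toeplitz_family_def using one zero eq prod by blast
qed

end

section \<open>A strongly covariant representation\<close>

text \<open>Zorn's lemma for proper filters, ordered by refinement: the infimum of a chain stays
  proper because the chain is directed.\<close>

lemma ultrafilter_exists:
  fixes F :: "'a filter"
  assumes "F \<noteq> bot"
  obtains U where "U \<le> F" "U \<noteq> bot" "\<And>Q. eventually Q U \<or> eventually (\<lambda>x. \<not> Q x) U"
proof -
  let ?A = "{U. U \<le> F \<and> U \<noteq> bot}"
  have "\<exists>m\<in>?A. \<forall>a\<in>?A. a \<le> m \<longrightarrow> a = m"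
  proof (rule predicate_Zorn)
    show "partial_order_on ?A (relation_of (\<lambda>x y. y \<le> x) ?A)"
      by (rule partial_order_on_relation_ofI) auto
    fix C assume C: "C \<in> Chains (relation_of (\<lambda>x y. y \<le> x) ?A)"
    then have CA: "a \<le> F" "a \<noteq> bot" if "a \<in> C" for a
      using that by (auto simp: Chains_def relation_of_def)
    have chain: "a \<le> b \<or> b \<le> a" if "a \<in> C" "b \<in> C" for a b
      using C that by (auto simp: Chains_def relation_of_def)
    show "\<exists>u\<in>?A. \<forall>a\<in>C. u \<le> a"
    proof (cases "C = {}")
      case True
      then show ?thesis using assms by (intro bexI[of _ F]) auto
    next
      case False
      have base: "\<exists>x\<in>C. x \<le> inf a b" if "a \<in> C" "b \<in> C" for a b
        using chain[OF that]
      proof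
        assume "a \<le> b"
        then show ?thesis using that(1) by (intro bexI[of _ a]) auto
      next
        assume "b \<le> a"
        then show ?thesis using that(2) by (intro bexI[of _ b]) auto
      qed
      have "eventually (\<lambda>_. False) (Inf C) \<longleftrightarrow> (\<exists>b\<in>C. eventually (\<lambda>_. False) b)"
        by (rule eventually_Inf_base[OF False base])
      then have "Inf C \<noteq> bot" using CA(2) by (auto simp flip: trivial_limit_def)
      moreover obtain c where "c \<in> C" using False by blast
      then have "Inf C \<le> F" using CA(1) by (meson Inf_lower order_trans)
      ultimately show ?thesis by (intro bexI[of _ "Inf C"]) (auto intro: Inf_lower)
    qed
  qed
  then obtain m where m: "m \<le> F" "m \<noteq> bot" and max: "\<And>a. \<lbrakk>a \<le> F; a \<noteq> bot; a \<le> m\<rbrakk> \<Longrightarrow> a = m"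
    by blast
  have "eventually Q m" if Q: "\<not> eventually (\<lambda>x. \<not> Q x) m" for Q
  proof -
    \<comment> \<open>If the complement of Q is not eventual, then adding Q keeps the filter proper;
      by maximality nothing was added.\<close>
    let ?V = "inf m (principal {x. Q x})"
    have "?V \<noteq> bot" using Q by (simp add: trivial_limit_def eventually_inf_principal)
    moreover have "?V \<le> F" using m(1) by (rule le_infI1)
    ultimately have "?V = m" by (intro max) simp_all
    then have "m \<le> principal {x. Q x}" by (metis inf.cobounded2)
    then show "eventually Q m" by (auto simp: le_principal)
  qed
  then show ?thesis using that[OF m] by blast
qed

text \<open>Compactness of a disc gives a cluster point, and along an ultrafilter a cluster point is
  a limit.\<close>

lemma ultrafilter_bounded_tendsto:
  fixes f :: "'a \<Rightarrow> complex"
  assumes U: "U \<noteq> bot" "\<And>Q. eventually Q U \<or> eventually (\<lambda>x. \<not> Q x) U"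
    and ev: "eventually (\<lambda>x. cmod (f x) \<le> C) U"
  shows "\<exists>l. (f \<longlongrightarrow> l) U"
proof -
  have "filtermap f U \<noteq> bot" using U(1) by (simp add: filtermap_bot_iff)
  moreover have "eventually (\<lambda>y. y \<in> cball 0 C) (filtermap f U)"
    using ev by (simp add: eventually_filtermap)
  ultimately obtain l where l: "inf (nhds l) (filtermap f U) \<noteq> bot"
    using compact_cball[of "0 :: complex" C] unfolding compact_filter by blast
  have "(f \<longlongrightarrow> l) U"
  proof (rule topological_tendstoI)
    fix S assume S: "open S" "l \<in> S"
    show "eventually (\<lambda>x. f x \<in> S) U"
    proof (rule ccontr)
      assume "\<not> eventually (\<lambda>x. f x \<in> S) U"
      then have "eventually (\<lambda>y. y \<notin> S) (filtermap f U)"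
        using U(2)[of "\<lambda>x. f x \<in> S"] by (simp add: eventually_filtermap)
      moreover have "eventually (\<lambda>y. y \<in> S) (nhds l)" using S by (rule eventually_nhds_in_open)
      ultimately have "eventually (\<lambda>_. False) (inf (nhds l) (filtermap f U))"
        unfolding eventually_inf by (intro exI[of _ "\<lambda>y. y \<in> S"] exI[of _ "\<lambda>y. y \<notin> S"]) auto
      then show False using l by (simp add: trivial_limit_def)
    qed
  qed
  then show ?thesis ..
qed

section \<open>The ideal of D_r in terms of symbols\<close>

context monoid_in_group
begin

text \<open>The norm of a diagonal operator on functions supported in \<open>Delta\<close> is
  bounded by its symbol there, and \<open>Delta\<close> shrinks as F grows; so smallness at one F
  gives smallness from that F on.\<close>

lemma D_red_oI:
  assumes b: "b \<in> carrier (D_red G P)"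
    and small: "\<And>e. e > 0 \<Longrightarrow> \<exists>F. finite F \<and> F \<subseteq> carrier G \<and> (\<forall>q\<in>Delta G P F. cmod (symbol b q) \<le> e)"
  shows "b \<in> D_red_o G P"
proof -
  have bd: "b \<in> diagonal_ops P" using b D_red_diagonal by blast
  have "((\<lambda>F. op_norm_on (Delta G P F) b) \<longlongrightarrow> 0) (finite_subsets_at_top (carrier G))"
  proof (rule tendstoI)
    fix e :: real assume e: "e > 0"
    then obtain F where F: "finite F" "F \<subseteq> carrier G" "\<And>q. q \<in> Delta G P F \<Longrightarrow> cmod (symbol b q) \<le> e / 2"
      using small[of "e / 2"] by auto
    have "dist (op_norm_on (Delta G P F') b) 0 < e" if "F \<subseteq> F'" for F'
    proof -
      have "op_norm_on (Delta G P F') b \<le> e / 2"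
        using F(3) Delta_mono[OF that] e by (intro op_norm_diagonal_le[OF bd Delta_subset]) auto
      moreover have "0 \<le> op_norm_on (Delta G P F') b"
        by (rule op_norm_nonneg[OF diagonal_opsD(1)[OF bd] Delta_subset])
      ultimately show ?thesis using e by simp
    qed
    then show "eventually (\<lambda>F. dist (op_norm_on (Delta G P F) b) 0 < e) (finite_subsets_at_top (carrier G))"
      using F(1,2) unfolding eventually_finite_subsets_at_top by blast
  qed
  then show ?thesis using b by (simp add: D_red_o_def)
qed

lemma D_red_oD:
  assumes b: "b \<in> D_red_o G P" and e: "e > 0"
  obtains F where "finite F" "F \<subseteq> carrier G" "\<And>q. q \<in> Delta G P F \<Longrightarrow> cmod (symbol b q) < e"
proof -
  have bc: "b \<in> carrier (l2_ops P)" using b D_red_l2_ops by (auto simp: D_red_o_def)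
  have "eventually (\<lambda>F. op_norm_on (Delta G P F) b < e) (finite_subsets_at_top (carrier G))"
    using b e by (intro order_tendstoD(2)[of _ 0]) (auto simp: D_red_o_def)
  then obtain F where F: "finite F" "F \<subseteq> carrier G" "op_norm_on (Delta G P F) b < e"
    unfolding eventually_finite_subsets_at_top by blast
  have "cmod (symbol b q) < e" if "q \<in> Delta G P F" for q
    using cmod_symbol_le[OF bc Delta_subset that] F(3) by linarith
  then show ?thesis using that F by blast
qed

end

locale boundary_ultrafilter = monoid_in_group +
  fixes U
  assumes nontrivial: "U \<noteq> bot" and ultra: "\<And>Q. eventually Q U \<or> eventually (\<lambda>x. \<not> Q x) U"
    and ev_Delta: "\<lbrakk>finite F; F \<subseteq> carrier G\<rbrakk> \<Longrightarrow> eventually (\<lambda>q. q \<in> Delta G P F) U"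
begin

lemma ev_P: "eventually (\<lambda>q. q \<in> P) U"
  by (rule eventually_mono[OF ev_Delta[of "{}"]]) (use Delta_subset in auto)

definition X where "X = {g \<in> carrier G. eventually (\<lambda>q. g \<otimes> q \<in> P) U}"

sublocale S: invariant_subset G P X
proof unfold_locales
  show "X \<subseteq> carrier G" by (auto simp: X_def)
  fix p g assume p: "p \<in> P" and g: "g \<in> X"
  then have gc: "g \<in> carrier G" by (simp add: X_def)
  have "eventually (\<lambda>q. g \<otimes> q \<in> P) U" using g by (simp add: X_def)
  then have "eventually (\<lambda>q. p \<otimes> g \<otimes> q \<in> P) U"
    using ev_P
  proof eventually_elim
    case (elim q)
    then have "p \<otimes> (g \<otimes> q) \<in> P" using P.m_closed p by blast
    then show ?case using p gc elim by (simp add: m_assoc P_carrier)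
  qed
  then show "p \<otimes> g \<in> X" using gc p by (simp add: X_def P_carrier)
qed

lemma X_ev: "g \<in> X \<Longrightarrow> eventually (\<lambda>q. g \<otimes> q \<in> P) U" and X_carrier: "g \<in> X \<Longrightarrow> g \<in> carrier G"
  by (simp_all add: X_def)

lemma one_in_X: "\<one> \<in> X"
proof -
  have "eventually (\<lambda>q. \<one> \<otimes> q \<in> P) U" using ev_P by eventually_elim (simp add: P_carrier)
  then show ?thesis by (simp add: X_def)
qed

text \<open>If g fails one of the finitely many suffix conditions, the ultrafilter turns failure to
  be eventually in P into being eventually outside P. This is what gives an equivalence instead of
  one implication.\<close>

lemma ev_word_domain:
  assumes \<alpha>: "\<alpha> \<in> neutral_words G P" and g: "g \<in> X"
  shows "eventually (\<lambda>q. g \<otimes> q \<in> K G P \<alpha> \<longleftrightarrow> g \<in> word_domain G X \<alpha>) U"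
proof -
  let ?w = "\<lambda>m. word_elt G (drop (2 * m) \<alpha>)"
  have wc: "?w m \<in> carrier G" for m using word_elt_closed words_drop neutral_wordsD(1) \<alpha> by blast
  have gc: "g \<in> carrier G" by (rule X_carrier[OF g])
  have a: "?w m \<otimes> (g \<otimes> q) = ?w m \<otimes> g \<otimes> q" if "q \<in> P" for m q
    using wc gc that by (simp add: m_assoc P_carrier)
  show ?thesis
  proof (cases "g \<in> word_domain G X \<alpha>")
    case True
    then have "\<forall>m\<in>{..length \<alpha> div 2}. eventually (\<lambda>q. ?w m \<otimes> g \<otimes> q \<in> P) U"
      by (auto simp: word_domain_def X_def)
    then have "eventually (\<lambda>q. \<forall>m\<in>{..length \<alpha> div 2}. ?w m \<otimes> g \<otimes> q \<in> P) U"
      by (intro eventually_ball_finite) auto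
    then show ?thesis using ev_P
    proof eventually_elim
      case (elim q)
      then show ?case using True gc a
        by (simp add: K_neutral[OF \<alpha>] word_domain_def P_carrier)
    qed
  next
    case False
    then obtain m where m: "m \<le> length \<alpha> div 2" "?w m \<otimes> g \<notin> X"
      using gc by (auto simp: word_domain_def)
    then have "\<not> eventually (\<lambda>q. ?w m \<otimes> g \<otimes> q \<in> P) U" using wc gc by (simp add: X_def)
    then have "eventually (\<lambda>q. ?w m \<otimes> g \<otimes> q \<notin> P) U" using ultra by blast
    then show ?thesis using ev_P
    proof eventually_elim
      case (elim q)
      then have "g \<otimes> q \<notin> K G P \<alpha>" using m(1) a[of q m]
        by (auto simp: K_neutral[OF \<alpha>] word_domain_def)
      then show ?case using False by simp
    qed
  qed
qed

definition limit_symbol where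
  "limit_symbol T g = Lim U (\<lambda>q. symbol T (g \<otimes> q))"

lemma limit_symbol_tendsto:
  assumes T: "T \<in> diagonal_ops P" and g: "g \<in> X"
  shows "((\<lambda>q. symbol T (g \<otimes> q)) \<longlongrightarrow> limit_symbol T g) U"
    and "cmod (limit_symbol T g) \<le> op_norm_on P T"
proof -
  have ev: "eventually (\<lambda>q. cmod (symbol T (g \<otimes> q)) \<le> op_norm_on P T) U"
    using X_ev[OF g] by eventually_elim (rule diagonal_opsD(3)[OF T])
  obtain l where l: "((\<lambda>q. symbol T (g \<otimes> q)) \<longlongrightarrow> l) U"
    using ultrafilter_bounded_tendsto[OF nontrivial ultra ev] by blast
  then show lim: "((\<lambda>q. symbol T (g \<otimes> q)) \<longlongrightarrow> limit_symbol T g) U"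
    using tendsto_Lim[OF nontrivial l] by (simp add: limit_symbol_def)
  show "cmod (limit_symbol T g) \<le> op_norm_on P T"
    by (rule tendsto_upperbound[OF tendsto_norm[OF lim] ev nontrivial])
qed

lemma limit_symbolI:
  assumes "((\<lambda>q. f q) \<longlongrightarrow> l) U" "eventually (\<lambda>q. f q = symbol T (g \<otimes> q)) U"
  shows "limit_symbol T g = l"
  unfolding limit_symbol_def by (rule tendsto_Lim[OF nontrivial Lim_transform_eventually[OF assms]])

definition boundary_rep where
  "boundary_rep T = mult_op X (limit_symbol T)"

lemma star_hom_boundary_rep: "star_hom (D_red G P) (l2_ops X) boundary_rep"
proof -
  note D = D_red_diagonal[THEN subsetD]
  note lim = limit_symbol_tendsto
  have ev: "eventually (\<lambda>q. R (g \<otimes> q)) U" if "g \<in> X" "\<And>x. x \<in> P \<Longrightarrow> R x" for g R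
    using X_ev[OF that(1)] by eventually_elim (rule that(2))
  have closed: "boundary_rep T \<in> carrier (l2_ops X)" if "T \<in> diagonal_ops P" for T
    unfolding boundary_rep_def
    by (rule mult_op_closed[where C = "op_norm_on P T"]) (use that lim(2) diagonal_opsD(4) in auto)
  have add: "boundary_rep (S \<oplus>\<^bsub>l2_ops P\<^esub> T) = boundary_rep S \<oplus>\<^bsub>l2_ops X\<^esub> boundary_rep T"
    if ST: "S \<in> diagonal_ops P" "T \<in> diagonal_ops P" for S T
  proof -
    have "limit_symbol (S \<oplus>\<^bsub>l2_ops P\<^esub> T) g = limit_symbol S g + limit_symbol T g" if g: "g \<in> X" for g
      by (rule limit_symbolI[OF tendsto_add[OF lim(1)[OF ST(1) g] lim(1)[OF ST(2) g]] ev[OF g]])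
        (simp add: symbol_l2_ops(1)[OF ST])
    then show ?thesis unfolding boundary_rep_def mult_op_add by (rule mult_op_cong)
  qed
  have smult: "boundary_rep (c \<odot>\<^bsub>l2_ops P\<^esub> T) = c \<odot>\<^bsub>l2_ops X\<^esub> boundary_rep T"
    if T: "T \<in> diagonal_ops P" for c T
  proof -
    have "limit_symbol (c \<odot>\<^bsub>l2_ops P\<^esub> T) g = c * limit_symbol T g" if g: "g \<in> X" for g
      by (rule limit_symbolI[OF tendsto_mult_left[OF lim(1)[OF T g], of c] ev[OF g]])
        (simp add: symbol_l2_ops(2)[OF T T])
    then show ?thesis unfolding boundary_rep_def mult_op_smult by (rule mult_op_cong)
  qed
  have mult: "boundary_rep (S \<otimes>\<^bsub>l2_ops P\<^esub> T) = boundary_rep S \<otimes>\<^bsub>l2_ops X\<^esub> boundary_rep T"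
    if ST: "S \<in> diagonal_ops P" "T \<in> diagonal_ops P" for S T
  proof -
    have "limit_symbol (S \<otimes>\<^bsub>l2_ops P\<^esub> T) g = limit_symbol S g * limit_symbol T g" if g: "g \<in> X" for g
      by (rule limit_symbolI[OF tendsto_mult[OF lim(1)[OF ST(1) g] lim(1)[OF ST(2) g]] ev[OF g]])
        (simp add: symbol_l2_ops(3)[OF ST])
    then have "boundary_rep (S \<otimes>\<^bsub>l2_ops P\<^esub> T) = mult_op X (\<lambda>g. limit_symbol S g * limit_symbol T g)"
      unfolding boundary_rep_def by (rule mult_op_cong)
    then show ?thesis
      unfolding boundary_rep_def
      using mult_op_mult[where \<phi> = "limit_symbol S", OF lim(2)[OF ST(2)] diagonal_opsD(4)[OF ST(2)]] by simp
  qed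
  have adj: "boundary_rep (adj (l2_ops P) T) = adj (l2_ops X) (boundary_rep T)"
    if T: "T \<in> diagonal_ops P" for T
  proof -
    have "limit_symbol (adj (l2_ops P) T) g = cnj (limit_symbol T g)" if g: "g \<in> X" for g
      by (rule limit_symbolI[OF tendsto_cnj[OF lim(1)[OF T g]] ev[OF g]])
        (simp add: symbol_l2_ops(4)[OF T T])
    then have "boundary_rep (adj (l2_ops P) T) = mult_op X (\<lambda>g. cnj (limit_symbol T g))"
      unfolding boundary_rep_def by (rule mult_op_cong)
    then show ?thesis
      unfolding boundary_rep_def using adj_mult_op[where I = X and \<phi> = "limit_symbol T", OF lim(2)[OF T] diagonal_opsD(4)[OF T]] by simp
  qed
  show ?thesis unfolding star_hom_def using closed add smult mult adj D by simp
qed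

lemma boundary_rep_diag_gen:
  assumes \<alpha>: "\<alpha> \<in> neutral_words G P"
  shows "boundary_rep (diag_gen \<alpha>) = word_op (l2_ops X) (shift G X) \<alpha>"
proof -
  have "limit_symbol (diag_gen \<alpha>) g = indicator (word_domain G X \<alpha>) g" if g: "g \<in> X" for g
  proof (rule limit_symbolI[OF tendsto_const])
    show "eventually (\<lambda>q. indicator (word_domain G X \<alpha>) g = symbol (diag_gen \<alpha>) (g \<otimes> q)) U"
      using ev_word_domain[OF \<alpha> g] X_ev[OF g]
      by eventually_elim (simp add: symbol_diag_gen[OF \<alpha>] indicator_def)
  qed
  then show ?thesis
    unfolding boundary_rep_def S.word_op_shift_neutral[OF \<alpha>] by (rule mult_op_cong)
qed

lemma boundary_rep_D_red_o:
  assumes b: "b \<in> D_red_o G P"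
  shows "boundary_rep b = \<zero>\<^bsub>l2_ops X\<^esub>"
proof -
  have "limit_symbol b g = 0" if g: "g \<in> X" for g
  proof (rule limit_symbolI[of "\<lambda>q. symbol b (g \<otimes> q)"])
    show "((\<lambda>q. symbol b (g \<otimes> q)) \<longlongrightarrow> 0) U"
    proof (rule tendstoI)
      fix e :: real assume "e > 0"
      then obtain F where F: "finite F" "F \<subseteq> carrier G" "\<And>q. q \<in> Delta G P F \<Longrightarrow> cmod (symbol b q) < e"
        using D_red_oD[OF b] by blast
      have gc: "g \<in> carrier G" by (rule X_carrier[OF g])
      \<comment> \<open>F is translated back by g, so that almost all points gq land in
        \<open>Delta G P F\<close>.\<close>
      have "eventually (\<lambda>q. q \<in> Delta G P ((\<lambda>h. inv g \<otimes> h) ` F)) U"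
        using F gc by (intro ev_Delta) auto
      then show "eventually (\<lambda>q. dist (symbol b (g \<otimes> q)) 0 < e) U"
        using X_ev[OF g]
      proof eventually_elim
        case (elim q)
        then have "g \<otimes> q \<in> Delta G P F" by (intro Delta_translate[OF F(2) gc])
        then show ?case using F(3) by simp
      qed
    qed
  qed simp
  then have "boundary_rep b = mult_op X (\<lambda>_. 0)"
    unfolding boundary_rep_def by (rule mult_op_cong)
  then show ?thesis by (simp add: mult_op_zero)
qed

lemma strongly_covariant_shift: "strongly_covariant G P (l2_ops X) (shift G X)"
  unfolding strongly_covariant_def
  using S.isometric_rep_shift star_hom_boundary_rep boundary_rep_diag_gen boundary_rep_D_red_o by blast

end

text \<open>The sets \<open>Delta G P F\<close> are nonempty and shrink as F grows, so they form the
  base of a proper filter, which any ultrafilter finer than it extends.\<close>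

lemma (in monoid_in_group) boundary_ultrafilter_exists: "\<exists>U. boundary_ultrafilter G P U"
proof -
  let ?B = "{F. finite F \<and> F \<subseteq> carrier G}"
  let ?F = "INF F\<in>?B. principal (Delta G P F)"
  have "\<exists>F\<in>?B. principal (Delta G P F) \<le> inf (principal (Delta G P a)) (principal (Delta G P b))"
    if "a \<in> ?B" "b \<in> ?B" for a b
    using that Delta_mono[of a "a \<union> b"] Delta_mono[of b "a \<union> b"]
    by (intro bexI[of _ "a \<union> b"]) auto
  then have "eventually (\<lambda>_. False) ?F \<longleftrightarrow> (\<exists>F\<in>?B. eventually (\<lambda>_. False) (principal (Delta G P F)))"
    by (intro eventually_INF_base) auto
  then have "?F \<noteq> bot"
    using Delta_nonempty by (auto simp: trivial_limit_def eventually_principal)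
  then obtain U where U: "U \<le> ?F" "U \<noteq> bot" "\<And>Q. eventually Q U \<or> eventually (\<lambda>x. \<not> Q x) U"
    using ultrafilter_exists by blast
  have "eventually (\<lambda>q. q \<in> Delta G P F) U" if "finite F" "F \<subseteq> carrier G" for F
  proof -
    have "?F \<le> principal (Delta G P F)" using that by (intro INF_lower) simp
    then have "U \<le> principal (Delta G P F)" using U(1) by (rule order_trans[rotated])
    then show ?thesis by (simp add: le_principal)
  qed
  then have "boundary_ultrafilter G P U"
    using U(2,3) by unfold_locales auto
  then show ?thesis ..
qed

section \<open>Universal families and the canonical homomorphisms\<close>

lemma word_op_carrier_update: "word_op (A\<lparr>carrier := S\<rparr>) w = word_op A w"
proof
  show "word_op (A\<lparr>carrier := S\<rparr>) w \<alpha> = word_op A w \<alpha>" for \<alpha>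
    by (induction \<alpha> rule: induct_list012) simp_all
qed

lemma word_op_generated: "word_op (cstar_generated A X) w = word_op A w"
  unfolding cstar_generated_def by (rule word_op_carrier_update)

lemma toeplitz_familyD:
  assumes "toeplitz_family G P B w"
  shows "w \<one>\<^bsub>G\<^esub> = \<one>\<^bsub>B\<^esub>"
    and "\<lbrakk>\<alpha> \<in> neutral_words G P; K G P \<alpha> = {}\<rbrakk> \<Longrightarrow> word_op B w \<alpha> = \<zero>\<^bsub>B\<^esub>"
    and "\<lbrakk>\<alpha> \<in> neutral_words G P; \<beta> \<in> neutral_words G P; K G P \<alpha> = K G P \<beta>\<rbrakk> \<Longrightarrow>
      word_op B w \<alpha> = word_op B w \<beta>"
    and "\<lbrakk>\<alpha> \<in> neutral_words G P; finite F; F \<subseteq> neutral_words G P; K G P \<alpha> = (\<Union>\<beta>\<in>F. K G P \<beta>)\<rbrakk> \<Longrightarrow>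
      diff_prod B w \<alpha> F = \<zero>\<^bsub>B\<^esub>"
proof -
  note c = assms[unfolded toeplitz_family_def]
  show "w \<one>\<^bsub>G\<^esub> = \<one>\<^bsub>B\<^esub>" by (rule conjunct1[OF c])
  show "word_op B w \<alpha> = \<zero>\<^bsub>B\<^esub>" if "\<alpha> \<in> neutral_words G P" "K G P \<alpha> = {}"
    by (rule c[THEN conjunct2, THEN conjunct1, THEN bspec, THEN mp, OF that])
  show "word_op B w \<alpha> = word_op B w \<beta>"
    if "\<alpha> \<in> neutral_words G P" "\<beta> \<in> neutral_words G P" "K G P \<alpha> = K G P \<beta>"
    by (rule c[THEN conjunct2, THEN conjunct2, THEN conjunct1, THEN bspec, THEN bspec, THEN mp, OF that])
  show "diff_prod B w \<alpha> F = \<zero>\<^bsub>B\<^esub>"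
    if "\<alpha> \<in> neutral_words G P" "finite F" "F \<subseteq> neutral_words G P" "K G P \<alpha> = (\<Union>\<beta>\<in>F. K G P \<beta>)"
    by (rule c[THEN conjunct2, THEN conjunct2, THEN conjunct2, THEN bspec, THEN spec, THEN mp, OF that(1)])
      (intro conjI that)
qed

text \<open>Each relation is an equation between elements of A, so an injective homomorphism
  reflects it. Relations checked among all operators thus descend to the generated subalgebra and to
  its transported copy.\<close>

lemma toeplitz_family_reflect:
  assumes A: "unital_cstar_algebra A" and B: "cstar_algebra B" and h: "star_hom A B h" "h \<one>\<^bsub>A\<^esub> = \<one>\<^bsub>B\<^esub>"
    and inj: "inj_on h (carrier A)" and w: "w \<in> P \<rightarrow> carrier A" "\<one>\<^bsub>G\<^esub> \<in> P"
    and w': "\<And>p. p \<in> P \<Longrightarrow> w' p = h (w p)" and T: "toeplitz_family G P B w'"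
  shows "toeplitz_family G P A w"
proof -
  interpret A: unital_cstar_algebra A by fact
  have z: "h \<zero>\<^bsub>A\<^esub> = \<zero>\<^bsub>B\<^esub>" by (rule star_hom_zero[OF A.cstar_algebra_axioms B h(1)])
  have wo: "word_op B w' \<alpha> = h (word_op A w \<alpha>)" if "\<alpha> \<in> neutral_words G P" for \<alpha>
    by (rule word_op_hom[OF A h w(1) w' neutral_words_words[OF that]])
  note c = A.word_op_closed[OF w(1) neutral_words_words]
  have dp1: "diff_prod A w \<alpha> F \<in> carrier A" if "\<alpha> \<in> neutral_words G P" "finite F" "F \<subseteq> words P" for \<alpha> F
    by (rule diff_prod_hom(1)[OF A B h w(1) w' neutral_words_words[OF that(1)] that(2,3)])
  have dp2: "diff_prod B w' \<alpha> F = h (diff_prod A w \<alpha> F)"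
    if "\<alpha> \<in> neutral_words G P" "finite F" "F \<subseteq> words P" for \<alpha> F
    by (rule diff_prod_hom(2)[OF A B h w(1) w' neutral_words_words[OF that(1)] that(2,3)])
  have nw: "neutral_words G P \<subseteq> words P" by (auto simp: neutral_words_def)
  have "w \<one>\<^bsub>G\<^esub> = \<one>\<^bsub>A\<^esub>"
  proof (rule inj_onD[OF inj _ funcset_mem[OF w] A.one_closed])
    show "h (w \<one>\<^bsub>G\<^esub>) = h \<one>\<^bsub>A\<^esub>" using toeplitz_familyD(1)[OF T] h(2) w'[OF w(2)] by simp
  qed
  moreover have "word_op A w \<alpha> = \<zero>\<^bsub>A\<^esub>" if "\<alpha> \<in> neutral_words G P" "K G P \<alpha> = {}" for \<alpha>
    by (rule inj_onD[OF inj _ c[OF that(1)] A.zero_closed])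
      (use toeplitz_familyD(2)[OF T that] wo[OF that(1)] z in simp)
  moreover have "word_op A w \<alpha> = word_op A w \<beta>"
    if "\<alpha> \<in> neutral_words G P" "\<beta> \<in> neutral_words G P" "K G P \<alpha> = K G P \<beta>" for \<alpha> \<beta>
  proof (rule inj_onD[OF inj _ c[OF that(1)] c[OF that(2)]])
    have "word_op B w' \<alpha> = word_op B w' \<beta>" by (rule toeplitz_familyD(3)[OF T that])
    then show "h (word_op A w \<alpha>) = h (word_op A w \<beta>)" by (simp only: wo[OF that(1)] wo[OF that(2)])
  qed
  moreover have "diff_prod A w \<alpha> F = \<zero>\<^bsub>A\<^esub>"
    if \<alpha>: "\<alpha> \<in> neutral_words G P" and F: "finite F" "F \<subseteq> neutral_words G P" and K: "K G P \<alpha> = (\<Union>\<beta>\<in>F. K G P \<beta>)" for \<alpha> F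
  proof (rule inj_onD[OF inj _ dp1[OF \<alpha> F(1) subset_trans[OF F(2) nw]] A.zero_closed])
    have "diff_prod B w' \<alpha> F = \<zero>\<^bsub>B\<^esub>" by (rule toeplitz_familyD(4)[OF T \<alpha> F K])
    then show "h (diff_prod A w \<alpha> F) = h \<zero>\<^bsub>A\<^esub>" using dp2[OF \<alpha> F(1) subset_trans[OF F(2) nw]] z by simp
  qed
  ultimately show ?thesis unfolding toeplitz_family_def by blast
qed

text \<open>Strong covariance asserts that some homomorphism from D_r into the algebra exists, so it
  is pushed forward along h by composition.\<close>

lemma strongly_covariant_hom:
  assumes A: "unital_cstar_algebra A" and B: "cstar_algebra B" and h: "star_hom A B h" "h \<one>\<^bsub>A\<^esub> = \<one>\<^bsub>B\<^esub>"
    and S: "strongly_covariant G P A w"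
  shows "strongly_covariant G P B (h \<circ> w)"
proof -
  interpret A: unital_cstar_algebra A by fact
  note hD = star_homD[OF h(1)]
  have iso: "isometric_rep G P A w" using S by (simp add: strongly_covariant_def)
  then have w: "w \<in> P \<rightarrow> carrier A" by (simp add: isometric_rep_def)
  obtain \<pi> where \<pi>: "star_hom (D_red G P) A \<pi>"
    "\<And>\<alpha>. \<alpha> \<in> neutral_words G P \<Longrightarrow> \<pi> (word_op (l2_ops P) (left_reg G P) \<alpha>) = word_op A w \<alpha>"
    "\<And>b. b \<in> D_red_o G P \<Longrightarrow> \<pi> b = \<zero>\<^bsub>A\<^esub>"
    using S unfolding strongly_covariant_def by blast
  have "isometric_rep G P B (h \<circ> w)"
    unfolding isometric_rep_def
  proof (intro conjI ballI)
    show "(h \<circ> w) \<one>\<^bsub>G\<^esub> = \<one>\<^bsub>B\<^esub>" using iso h(2) by (simp add: isometric_rep_def)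
    fix p assume p: "p \<in> P"
    have wp: "w p \<in> carrier A" "adj A (w p) \<otimes>\<^bsub>A\<^esub> w p = \<one>\<^bsub>A\<^esub>"
      using iso p by (auto simp: isometric_rep_def)
    show "(h \<circ> w) p \<in> carrier B" using hD(1) wp by simp
    show "adj B ((h \<circ> w) p) \<otimes>\<^bsub>B\<^esub> (h \<circ> w) p = \<one>\<^bsub>B\<^esub>"
      using hD(4)[OF A.adj_closed[OF wp(1)] wp(1)] hD(5)[OF wp(1)] wp(2) h(2) by simp
    fix q assume q: "q \<in> P"
    then have "w q \<in> carrier A" using w by blast
    moreover have "w (p \<otimes>\<^bsub>G\<^esub> q) = w p \<otimes>\<^bsub>A\<^esub> w q" using iso p q by (simp add: isometric_rep_def)
    ultimately show "(h \<circ> w) (p \<otimes>\<^bsub>G\<^esub> q) = (h \<circ> w) p \<otimes>\<^bsub>B\<^esub> (h \<circ> w) q" using hD(4) wp by simp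
  qed
  moreover have "star_hom (D_red G P) B (h \<circ> \<pi>)" by (rule star_hom_comp[OF \<pi>(1) h(1)])
  moreover have "(h \<circ> \<pi>) (word_op (l2_ops P) (left_reg G P) \<alpha>) = word_op B (h \<circ> w) \<alpha>"
    if "\<alpha> \<in> neutral_words G P" for \<alpha>
    using \<pi>(2)[OF that] word_op_hom[where w' = "h \<circ> w", OF A h w comp_apply, OF neutral_words_words[OF that]]
    by simp
  moreover have "(h \<circ> \<pi>) b = \<zero>\<^bsub>B\<^esub>" if "b \<in> D_red_o G P" for b
    using \<pi>(3)[OF that] star_hom_zero[OF A.cstar_algebra_axioms B h(1)] by simp
  ultimately show ?thesis unfolding strongly_covariant_def by blast
qed

lemma strongly_covariantE:
  assumes "strongly_covariant G P B w"
  obtains \<pi> where "star_hom (D_red G P) B \<pi>"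
    "\<And>\<alpha>. \<alpha> \<in> neutral_words G P \<Longrightarrow> \<pi> (word_op (l2_ops P) (left_reg G P) \<alpha>) = word_op B w \<alpha>"
    "\<And>b. b \<in> D_red_o G P \<Longrightarrow> \<pi> b = \<zero>\<^bsub>B\<^esub>"
  using assms unfolding strongly_covariant_def by blast

lemma star_hom_inclusion: "S \<subseteq> carrier A \<Longrightarrow> star_hom (A\<lparr>carrier := S\<rparr>) A (\<lambda>x. x)"
  by (auto simp: star_hom_def)

lemma star_hom_restrict_codomain:
  assumes "star_hom A B h" "h ` carrier A \<subseteq> S"
  shows "star_hom A (B\<lparr>carrier := S\<rparr>) h"
  using assms by (auto simp: star_hom_def)

lemma star_hom_restrict_domain:
  assumes "star_hom A B h" "S \<subseteq> carrier A"
  shows "star_hom (A\<lparr>carrier := S\<rparr>) B h"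
  using assms unfolding star_hom_def by (auto simp: subset_iff)

lemma star_hom_extensional:
  assumes "cstar_algebra A" "star_hom A B h"
  shows "star_hom A B (restrict h (carrier A))"
proof -
  interpret cstar_algebra A by fact
  show ?thesis using assms(2) by (simp add: star_hom_def closed Pi_iff)
qed

section \<open>Relations among words in the universal Toeplitz algebra\<close>

context monoid_in_group
begin

interpretation R: invariant_subset G P P by (rule invariant_subset_P)

abbreviation "TU \<equiv> T_univ G P"
abbreviation "CU \<equiv> Cov G P"
abbreviation "t \<equiv> t_gen G P"
abbreviation "d \<equiv> word_op TU t"

text \<open>The word whose operator is t_p^* t_p. Its ideal is that of the empty word, so (T3) makes
  every generator an isometry.\<close>

lemma isometry_word:
  assumes "p \<in> P"
  shows "[p, p] \<in> neutral_words G P" "K G P [p, p] = P"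
proof -
  show n: "[p, p] \<in> neutral_words G P" using assms by (simp add: neutral_words_def P_carrier)
  have "word_elt G [p, p] \<otimes> x = x" if "x \<in> P" for x using assms that by (simp add: P_carrier)
  then show "K G P [p, p] = P"
    by (auto simp: K_neutral[OF n] word_domain_Cons word_domain_Nil[OF P.subset] simp del: word_elt.simps(3))
qed

text \<open>Words start with an adjoint letter and end with a plain one; padding by the identity on
  both sides makes the range projection t_p t_p^* a word.\<close>

lemma range_word:
  assumes p: "p \<in> P"
  shows "[\<one>, p, p, \<one>] \<in> neutral_words G P" "K G P [\<one>, p, p, \<one>] = p <# P"
proof -
  have pc: "p \<in> carrier G" by (rule P_carrier[OF p])
  show n: "[\<one>, p, p, \<one>] \<in> neutral_words G P" using p pc P.one_closed by (simp add: neutral_words_def)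
  have e1: "word_elt G [p, \<one>] \<otimes> x = inv p \<otimes> x" and e2: "word_elt G [\<one>, p, p, \<one>] \<otimes> x = x"
    if "x \<in> P" for x
    using pc P_carrier[OF that] by simp_all
  have "K G P [\<one>, p, p, \<one>] = {x \<in> P. inv p \<otimes> x \<in> P}"
  proof (rule Set.set_eqI)
    show "x \<in> K G P [\<one>, p, p, \<one>] \<longleftrightarrow> x \<in> {x \<in> P. inv p \<otimes> x \<in> P}" for x
      by (cases "x \<in> P")
        (simp_all add: K_neutral[OF n] word_domain_Cons word_domain_Nil[OF P.subset] e1 e2 del: word_elt.simps(3))
  qed
  also have "\<dots> = p <# P"
  proof (rule Set.set_eqI)
    show "x \<in> {x \<in> P. inv p \<otimes> x \<in> P} \<longleftrightarrow> x \<in> p <# P" for x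
      using lcoset_iff[OF pc P.subset, of x] subsetD[OF R.lcoset_subset[OF p], of x] P_carrier[of x]
      by blast
  qed
  finally show "K G P [\<one>, p, p, \<one>] = p <# P" .
qed

lemma toeplitz_isometry:
  assumes "unital_cstar_algebra B" "w \<in> P \<rightarrow> carrier B" "toeplitz_family G P B w" "p \<in> P"
  shows "adj B (w p) \<otimes>\<^bsub>B\<^esub> w p = \<one>\<^bsub>B\<^esub>"
proof -
  interpret B: unital_cstar_algebra B by fact
  have wp: "w p \<in> carrier B" using assms(2,4) by blast
  have "word_op B w [p, p] = word_op B w []"
    using isometry_word[OF assms(4)]
    by (intro toeplitz_familyD(3)[OF assms(3)]) (simp_all add: neutral_words_Nil K_Nil)
  then show ?thesis using wp by (simp add: B.r_one B.closed)
qed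

sublocale T: contractive_relations P "toeplitz_family G P"
proof
  fix B w p
  assume a: "unital_cstar_algebra B" "w \<in> P \<rightarrow> carrier B" "toeplitz_family G P B w" "p \<in> P"
  then have "w p \<in> carrier B" by blast
  then show "nrm B (w p) \<le> 1"
    by (rule unital_cstar_algebra.nrm_isometry_le_1[OF a(1) _ toeplitz_isometry[OF a]])
qed

sublocale C: contractive_relations P "strongly_covariant G P"
proof
  fix B w p
  assume a: "unital_cstar_algebra B" "w \<in> P \<rightarrow> carrier B" "strongly_covariant G P B w" "p \<in> P"
  then show "nrm B (w p) \<le> 1"
    by (intro unital_cstar_algebra.nrm_isometry_le_1[OF a(1)])
      (auto simp: strongly_covariant_def isometric_rep_def)
qed

lemma unital_TU: "unital_cstar_algebra TU"
  unfolding T_univ_def by (rule T.univ_cstar_unital)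

lemma unital_CU: "unital_cstar_algebra CU"
  unfolding Cov_def by (rule C.univ_cstar_unital)

interpretation TU: unital_cstar_algebra TU by (rule unital_TU)
interpretation CU: unital_cstar_algebra CU by (rule unital_CU)

lemma t_funcset: "t \<in> P \<rightarrow> carrier TU"
  unfolding t_gen_def T_univ_def using T.univ_gen_closed by blast

lemma t_closed: "p \<in> P \<Longrightarrow> t p \<in> carrier TU"
  using t_funcset by blast

lemma d_closed: "\<alpha> \<in> neutral_words G P \<Longrightarrow> d \<alpha> \<in> carrier TU"
  by (rule TU.word_op_closed[OF t_funcset neutral_wordsD(1)])

lemma strongly_covariant_toeplitz:
  assumes "unital_cstar_algebra B" "strongly_covariant G P B w"
  shows "toeplitz_family G P B w"
proof -
  interpret B: unital_cstar_algebra B by fact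
  obtain \<pi> where \<pi>: "star_hom (D_red G P) B \<pi>"
    "\<And>\<alpha>. \<alpha> \<in> neutral_words G P \<Longrightarrow> \<pi> (diag_gen \<alpha>) = word_op B w \<alpha>"
    "\<And>b. b \<in> D_red_o G P \<Longrightarrow> \<pi> b = \<zero>\<^bsub>B\<^esub>"
    by (rule strongly_covariantE[OF assms(2)], rule that; assumption)
  have "w \<one> = \<one>\<^bsub>B\<^esub>" using assms(2) by (simp add: strongly_covariant_def isometric_rep_def)
  then show ?thesis by (rule diagonal_rep_toeplitz[OF B.cstar_algebra_axioms _ \<pi>(1,2)])
qed

lemma d_eval: "\<alpha> \<in> words P \<Longrightarrow> i \<in> T.I \<Longrightarrow> d \<alpha> i = word_op (fst i) (snd i) \<alpha>"
  by (rule word_op_hom[OF unital_TU T.star_hom_eval[folded T_univ_def] T.univ_one_eval[folded T_univ_def]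
        t_funcset, symmetric])
    (simp_all add: t_gen_def T.univ_gen_eval)

text \<open>Every coordinate of the universal algebra is a Toeplitz family, and elements are equal
  if they agree in all coordinates; so the relations hold in the universal algebra itself.\<close>

lemma d_eq:
  assumes "\<alpha> \<in> neutral_words G P" "\<beta> \<in> neutral_words G P" "K G P \<alpha> = K G P \<beta>"
  shows "d \<alpha> = d \<beta>"
proof (rule T.univ_cstar_eqI[folded T_univ_def])
  show "d \<alpha> i = d \<beta> i" if i: "i \<in> T.I" for i
  proof -
    have "toeplitz_family G P (fst i) (snd i)" using i by (auto simp: univ_index_def)
    then have "word_op (fst i) (snd i) \<alpha> = word_op (fst i) (snd i) \<beta>"
      using assms by (intro toeplitz_familyD(3))
    then show ?thesis using d_eval[OF neutral_wordsD(1) i] assms by simp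
  qed
qed (use d_closed assms in auto)

lemma d_zero:
  assumes "\<alpha> \<in> neutral_words G P" "K G P \<alpha> = {}"
  shows "d \<alpha> = \<zero>\<^bsub>TU\<^esub>"
proof (rule T.univ_cstar_eqI[folded T_univ_def])
  show "d \<alpha> i = \<zero>\<^bsub>TU\<^esub> i" if i: "i \<in> T.I" for i
  proof -
    have "toeplitz_family G P (fst i) (snd i)" using i by (auto simp: univ_index_def)
    then have "word_op (fst i) (snd i) \<alpha> = \<zero>\<^bsub>fst i\<^esub>"
      using assms by (intro toeplitz_familyD(2))
    then show ?thesis
      using d_eval[OF neutral_wordsD(1)[OF assms(1)] i] T.univ_zero_eval[OF i, folded T_univ_def] by simp
  qed
qed (use d_closed assms in auto)

lemma t_one: "t \<one> = \<one>\<^bsub>TU\<^esub>"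
proof (rule T.univ_cstar_eqI[folded T_univ_def])
  show "t \<one> i = \<one>\<^bsub>TU\<^esub> i" if i: "i \<in> T.I" for i
  proof -
    have "toeplitz_family G P (fst i) (snd i)" using i by (auto simp: univ_index_def)
    then show ?thesis
      using T.univ_gen_eval[OF i, of \<one>] T.univ_one_eval[OF i]
      by (simp add: toeplitz_familyD(1) t_gen_def T_univ_def)
  qed
qed (simp_all add: t_closed P.one_closed TU.one_closed)

lemma d_append:
  "\<lbrakk>\<alpha> \<in> neutral_words G P; \<beta> \<in> neutral_words G P\<rbrakk> \<Longrightarrow> d (\<alpha> @ \<beta>) = d \<alpha> \<otimes>\<^bsub>TU\<^esub> d \<beta>"
  by (rule TU.word_op_append[OF t_funcset]) (simp_all add: neutral_wordsD)

lemma t_isometry: "p \<in> P \<Longrightarrow> adj TU (t p) \<otimes>\<^bsub>TU\<^esub> t p = \<one>\<^bsub>TU\<^esub>"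
  using d_eq[OF isometry_word(1) neutral_words_Nil] isometry_word(2) K_Nil t_closed
  by (simp add: TU.r_one TU.closed)

lemma d_range_word: "p \<in> P \<Longrightarrow> d [\<one>, p, p, \<one>] = t p \<otimes>\<^bsub>TU\<^esub> adj TU (t p)"
  using t_closed[of p] by (simp add: t_one TU.l_one TU.r_one TU.one_closed TU.closed)

lemma t_range: "p \<in> P \<Longrightarrow> (t p \<otimes>\<^bsub>TU\<^esub> adj TU (t p)) \<otimes>\<^bsub>TU\<^esub> t p = t p"
  using t_closed[of p] by (simp add: TU.mult_assoc TU.closed t_isometry TU.r_one)

text \<open>In front of t_p its range projection may be inserted. This replaces \<alpha> by a word
  with ideal \<open>K G P \<alpha> \<inter> (p <# P)\<close>, to which (T2) or (T3) applies.\<close>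

lemma d_mult_t_aux:
  assumes \<alpha>: "\<alpha> \<in> neutral_words G P" and p: "p \<in> P"
  shows "d \<alpha> \<otimes>\<^bsub>TU\<^esub> t p = d (\<alpha> @ [\<one>, p, p, \<one>]) \<otimes>\<^bsub>TU\<^esub> t p"
    and "K G P (\<alpha> @ [\<one>, p, p, \<one>]) = K G P \<alpha> \<inter> (p <# P)"
    and "\<alpha> @ [\<one>, p, p, \<one>] \<in> neutral_words G P"
proof -
  note r = range_word[OF p]
  have "d \<alpha> \<otimes>\<^bsub>TU\<^esub> t p = d \<alpha> \<otimes>\<^bsub>TU\<^esub> ((t p \<otimes>\<^bsub>TU\<^esub> adj TU (t p)) \<otimes>\<^bsub>TU\<^esub> t p)" by (simp add: t_range p)
  also have "\<dots> = d (\<alpha> @ [\<one>, p, p, \<one>]) \<otimes>\<^bsub>TU\<^esub> t p"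
    unfolding d_append[OF \<alpha> r(1)] d_range_word[OF p]
    using t_closed[OF p] d_closed[OF \<alpha>] by (simp add: TU.mult_assoc TU.closed)
  finally show "d \<alpha> \<otimes>\<^bsub>TU\<^esub> t p = d (\<alpha> @ [\<one>, p, p, \<one>]) \<otimes>\<^bsub>TU\<^esub> t p" .
  show "K G P (\<alpha> @ [\<one>, p, p, \<one>]) = K G P \<alpha> \<inter> (p <# P)" using K_append[OF \<alpha> r(1)] r(2) by simp
  show "\<alpha> @ [\<one>, p, p, \<one>] \<in> neutral_words G P" by (rule neutral_words_append[OF \<alpha> r(1)])
qed

lemma d_mult_t:
  assumes \<alpha>: "\<alpha> \<in> neutral_words G P" and p: "p \<in> K G P \<alpha>"
  shows "d \<alpha> \<otimes>\<^bsub>TU\<^esub> t p = t p"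
proof -
  have pP: "p \<in> P" using K_subset[OF \<alpha>] p by blast
  have "p <# P \<subseteq> K G P \<alpha>" using K_right_ideal[OF \<alpha> p] by (auto simp: l_coset_def)
  then have "d (\<alpha> @ [\<one>, p, p, \<one>]) = d [\<one>, p, p, \<one>]"
    using d_mult_t_aux(2,3)[OF \<alpha> pP] range_word[OF pP] by (intro d_eq) auto
  then show ?thesis using d_mult_t_aux(1)[OF \<alpha> pP] d_range_word[OF pP] t_range[OF pP] by simp
qed

lemma d_mult_t_zero:
  assumes \<alpha>: "\<alpha> \<in> neutral_words G P" and p: "p \<in> P" "(p <# P) \<inter> K G P \<alpha> = {}"
  shows "d \<alpha> \<otimes>\<^bsub>TU\<^esub> t p = \<zero>\<^bsub>TU\<^esub>"
proof -
  have "d (\<alpha> @ [\<one>, p, p, \<one>]) = \<zero>\<^bsub>TU\<^esub>"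
    using d_mult_t_aux(2,3)[OF \<alpha> p(1)] p(2) by (intro d_zero) auto
  then show ?thesis using d_mult_t_aux(1)[OF \<alpha> p(1)] t_closed[OF p(1)] by simp
qed

lemma hom_zero_of_one:
  assumes B: "cstar_algebra B" and A: "unital_cstar_algebra A" and \<rho>: "star_hom A B \<rho>"
    and z: "\<rho> \<one>\<^bsub>A\<^esub> = \<zero>\<^bsub>B\<^esub>" and x: "x \<in> carrier A"
  shows "\<rho> x = \<zero>\<^bsub>B\<^esub>"
proof -
  interpret A: unital_cstar_algebra A by fact
  interpret B: cstar_algebra B by fact
  have "\<rho> x = \<rho> \<one>\<^bsub>A\<^esub> \<otimes>\<^bsub>B\<^esub> \<rho> x"
    using star_homD(4)[OF \<rho> A.one_closed x] by (simp add: A.l_one x)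
  then show ?thesis using z star_homD(1)[OF \<rho> x] by simp
qed

text \<open>A point \<open>p\<close> of \<open>K(\<alpha>)\<close> whose ideal avoids all the \<open>K(\<beta>)\<close> makes \<open>t\<^sub>p\<close> a fixed vector
  of the product, so that the isometry \<open>t\<^sub>p\<close> is annihilated.\<close>

lemma rho_diff_prod_zero:
  assumes B: "cstar_algebra B" and \<rho>: "star_hom TU B \<rho>" and \<alpha>: "\<alpha> \<in> neutral_words G P"
    and A: "finite A" "A \<subseteq> neutral_words G P" "\<And>\<beta>. \<beta> \<in> A \<Longrightarrow> K G P \<beta> \<subseteq> K G P \<alpha>"
    and nf: "\<not> foundation_set G P (K G P ` A) (K G P \<alpha>)"
    and z: "\<rho> (diff_prod TU t \<alpha> A) = \<zero>\<^bsub>B\<^esub>" and x: "x \<in> carrier TU"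
  shows "\<rho> x = \<zero>\<^bsub>B\<^esub>"
proof -
  interpret B: cstar_algebra B by fact
  have c: "K G P \<alpha> \<in> constructible G P" "K G P ` A \<subseteq> constructible G P"
    using \<alpha> A(2) by (auto simp: constructible_neutral)
  have "\<exists>p\<in>K G P \<alpha>. (p <# P) \<inter> \<Union>(K G P ` A) = {}"
  proof (rule ccontr)
    assume "\<not> (\<exists>p\<in>K G P \<alpha>. (p <# P) \<inter> \<Union>(K G P ` A) = {})"
    then have "foundation_set G P (K G P ` A) (K G P \<alpha>)"
      unfolding foundation_set_def using c A(1,3) by (intro conjI) auto
    with nf show False ..
  qed
  then obtain p where p: "p \<in> K G P \<alpha>" "(p <# P) \<inter> \<Union>(K G P ` A) = {}" by blast
  have pP: "p \<in> P" using K_subset[OF \<alpha>] p by blast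
  have tp: "t p \<in> carrier TU" by (rule t_closed[OF pP])
  let ?e = "foldr (\<lambda>\<beta> x. (d \<alpha> \<ominus>\<^bsub>TU\<^esub> d \<beta>) \<otimes>\<^bsub>TU\<^esub> x)"
  \<comment> \<open>Each factor fixes t_p, because the word \<alpha> fixes it and the word \<beta>
    annihilates it; so every product over a list does.\<close>
  have fix_t: "?e \<beta>s \<one>\<^bsub>TU\<^esub> \<in> carrier TU \<and> ?e \<beta>s \<one>\<^bsub>TU\<^esub> \<otimes>\<^bsub>TU\<^esub> t p = t p" if "set \<beta>s \<subseteq> A" for \<beta>s
    using that
  proof (induction \<beta>s)
    case Nil
    then show ?case using tp by (simp add: TU.one_closed TU.l_one)
  next
    case (Cons \<beta> \<beta>s)
    have \<beta>: "\<beta> \<in> neutral_words G P" "(p <# P) \<inter> K G P \<beta> = {}" using Cons.prems A(2) p(2) by auto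
    have c: "d \<alpha> \<in> carrier TU" "d \<beta> \<in> carrier TU" using d_closed \<alpha> \<beta> by auto
    have f: "(d \<alpha> \<ominus>\<^bsub>TU\<^esub> d \<beta>) \<otimes>\<^bsub>TU\<^esub> t p = t p"
      using c tp by (simp add: TU.minus_mult d_mult_t[OF \<alpha> p(1)] d_mult_t_zero[OF \<beta>(1) pP \<beta>(2)])
    have IH: "?e \<beta>s \<one>\<^bsub>TU\<^esub> \<in> carrier TU" "?e \<beta>s \<one>\<^bsub>TU\<^esub> \<otimes>\<^bsub>TU\<^esub> t p = t p" using Cons by auto
    then show ?case using c tp f by (simp add: TU.mult_assoc TU.closed TU.minus_closed)
  qed
  have D: "diff_prod TU t \<alpha> A \<in> carrier TU \<and> diff_prod TU t \<alpha> A \<otimes>\<^bsub>TU\<^esub> t p = t p"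
  proof (cases "A = {}")
    case True
    then show ?thesis using d_closed[OF \<alpha>] d_mult_t[OF \<alpha> p(1)] by (simp add: diff_prod_def)
  next
    case False
    then show ?thesis using fix_t some_list_of_finite[OF A(1)] by (simp add: diff_prod_def)
  qed
  have "\<rho> (t p) = \<rho> (diff_prod TU t \<alpha> A) \<otimes>\<^bsub>B\<^esub> \<rho> (t p)" using star_homD(4)[OF \<rho>, of "diff_prod TU t \<alpha> A" "t p"] D tp by simp
  then have tz: "\<rho> (t p) = \<zero>\<^bsub>B\<^esub>" using z star_homD(1)[OF \<rho> tp] by simp
  have "\<rho> \<one>\<^bsub>TU\<^esub> = \<rho> (adj TU (t p)) \<otimes>\<^bsub>B\<^esub> \<rho> (t p)"
    using star_homD(4)[OF \<rho> TU.adj_closed[OF tp] tp] t_isometry[OF pP] by simp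
  then have "\<rho> \<one>\<^bsub>TU\<^esub> = \<zero>\<^bsub>B\<^esub>" using tz star_homD(1)[OF \<rho> TU.adj_closed[OF tp]] by simp
  then show ?thesis using hom_zero_of_one[OF B unital_TU \<rho> _ x] by blast
qed

section \<open>The canonical map to the regular representation\<close>

lemma left_reg_one: "left_reg G P \<one> = \<one>\<^bsub>l2_ops P\<^esub>"
  using R.isometric_rep_shift by (simp add: isometric_rep_def left_reg_shift)

lemma left_reg_funcset: "left_reg G P \<in> P \<rightarrow> carrier (l2_ops P)"
  using R.shift_funcset by (simp add: left_reg_shift)

interpretation L: unital_cstar_algebra "l2_ops P" by (rule unital_cstar_algebra_l2_ops)

lemma T_red_eq: "T_red G P = cstar_generated (l2_ops P) (insert \<one>\<^bsub>l2_ops P\<^esub> (left_reg G P ` P))"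
proof -
  have "\<one>\<^bsub>l2_ops P\<^esub> \<in> left_reg G P ` P" using left_reg_one P.one_closed by (metis image_eqI)
  then show ?thesis by (simp add: T_red_def insert_absorb)
qed

lemma T_red_gens: "insert \<one>\<^bsub>l2_ops P\<^esub> (left_reg G P ` P) \<subseteq> carrier (l2_ops P)"
  using left_reg_funcset L.one_closed by blast

lemma unital_T_red: "unital_cstar_algebra (T_red G P)"
  unfolding T_red_eq
  by (rule L.unital_cstar_algebra_generated[OF T_red_gens subsetD[OF L.cstar_generated_superset insertI1]])

lemma left_reg_T_red: "left_reg G P \<in> P \<rightarrow> carrier (T_red G P)"
  using L.cstar_generated_superset[of "insert \<one>\<^bsub>l2_ops P\<^esub> (left_reg G P ` P)"]
  by (simp add: T_red_eq image_subset_iff)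

lemma T_red_subset: "carrier (T_red G P) \<subseteq> carrier (l2_ops P)"
  unfolding T_red_eq by (rule L.cstar_generated_subset[OF T_red_gens])

lemma T_red_inclusion: "star_hom (T_red G P) (l2_ops P) (\<lambda>x. x)"
  using star_hom_inclusion[OF T_red_subset] by (simp add: T_red_def flip: L.cstar_generated_eq)

lemma toeplitz_left_reg: "toeplitz_family G P (l2_ops P) (left_reg G P)"
proof (rule diagonal_rep_toeplitz[where w = "left_reg G P", OF L.cstar_algebra_axioms left_reg_one])
  show "star_hom (D_red G P) (l2_ops P) (\<lambda>x. x)"
    using star_hom_inclusion[OF D_red_l2_ops] by (simp flip: D_red_carrier_update)
qed simp

lemma T_red_one: "\<one>\<^bsub>T_red G P\<^esub> = \<one>\<^bsub>l2_ops P\<^esub>"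
  by (simp add: T_red_def)

lemma toeplitz_T_red: "toeplitz_family G P (T_red G P) (left_reg G P)"
  by (rule toeplitz_family_reflect[where h = "\<lambda>x. x" and w' = "left_reg G P",
        OF unital_T_red L.cstar_algebra_axioms T_red_inclusion])
    (simp_all add: left_reg_T_red toeplitz_left_reg P.one_closed T_red_one)

text \<open>Existence comes from an injective copy of the reduced algebra serving as a coordinate,
  uniqueness from contractivity. Preservation of the unit is not part of the description; it follows
  from the value at t_e.\<close>

lemma lambda_plus_props:
  shows "star_hom TU (T_red G P) (lambda_plus G P)"
    and "\<And>p. p \<in> P \<Longrightarrow> lambda_plus G P (t p) = left_reg G P p"
proof -
  let ?D = "T_red G P"
  interpret D: unital_cstar_algebra ?D by (rule unital_T_red)
  obtain f :: "(('a \<Rightarrow> complex) \<Rightarrow> ('a \<Rightarrow> complex)) \<Rightarrow> 'a univ" where f: "inj_on f (carrier ?D)"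
    by (rule L.inj_on_generated_univ[OF left_reg_funcset, folded T_red_eq], rule that; assumption)
  let ?f' = "inv_into (carrier ?D) f"
  note tr = transport_simps[OF D.cstar_algebra_axioms f]
  have tf: "toeplitz_family G P (transport f ?D) (f \<circ> left_reg G P)"
  proof (rule toeplitz_family_reflect[OF unital_cstar_algebra_transport[OF unital_T_red f] D.cstar_algebra_axioms
        star_hom_transport_inv[OF D.cstar_algebra_axioms f]])
    show "?f' \<one>\<^bsub>transport f ?D\<^esub> = \<one>\<^bsub>?D\<^esub>" by (simp add: tr inv_into_f_f[OF f] D.one_closed)
    show "inj_on ?f' (carrier (transport f ?D))" unfolding tr by (rule inj_on_inv_into) simp
    show "f \<circ> left_reg G P \<in> P \<rightarrow> carrier (transport f ?D)" using left_reg_T_red by (auto simp: tr)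
    show "left_reg G P p = ?f' ((f \<circ> left_reg G P) p)" if "p \<in> P" for p
      using funcset_mem[OF left_reg_T_red that] by (simp add: inv_into_f_f[OF f])
  qed (rule P.one_closed, rule toeplitz_T_red)
  obtain h where h: "star_hom TU ?D h" "h \<one>\<^bsub>TU\<^esub> = \<one>\<^bsub>?D\<^esub>" "\<And>p. p \<in> P \<Longrightarrow> h (t p) = left_reg G P p"
    by (rule T.univ_hom_exists[OF unital_T_red left_reg_T_red f tf, folded T_univ_def t_gen_def], rule that; assumption)
  let ?h = "restrict h (carrier TU)"
  let ?Q = "\<lambda>h. h \<in> extensional (carrier TU) \<and> star_hom TU ?D h \<and> (\<forall>p\<in>P. h (t p) = left_reg G P p)"
  have ex: "?Q ?h"
    using h star_hom_extensional[OF TU.cstar_algebra_axioms h(1)] t_closed by simp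
  have uniq: "k = ?h" if k: "?Q k" for k
  proof (rule extensionalityI)
    show "k x = ?h x" if x: "x \<in> carrier TU" for x
    proof (rule T.univ_hom_eq[OF D.cstar_algebra_axioms, folded T_univ_def t_gen_def])
      show "k (t p) = ?h (t p)" if "p \<in> P" for p
      proof -
        have "k (t p) = left_reg G P p" using k that by blast
        moreover have "?h (t p) = left_reg G P p" using ex that by blast
        ultimately show ?thesis by (rule trans[OF _ sym])
      qed
      from this[OF P.one_closed] show "k \<one>\<^bsub>TU\<^esub> = ?h \<one>\<^bsub>TU\<^esub>" by (simp only: t_one)
    qed (use k ex x in blast)+
  qed (use k ex in auto)
  have "lambda_plus G P = ?h"
    unfolding lambda_plus_def by (rule the_equality[where P = ?Q and a = ?h, OF ex uniq])
  then have "?Q (lambda_plus G P)" by (rule ssubst[where P = ?Q]) (rule ex)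
  then show "star_hom TU (T_red G P) (lambda_plus G P)" "\<And>p. p \<in> P \<Longrightarrow> lambda_plus G P (t p) = left_reg G P p"
    by blast+
qed

abbreviation "lam \<equiv> lambda_plus G P"

lemma lam_hom: "star_hom TU (l2_ops P) lam"
  using star_hom_comp[OF lambda_plus_props(1) T_red_inclusion] by (simp add: comp_def)

lemma lam_contractive: "contractive TU (l2_ops P) lam"
  by (rule star_hom_contractive[OF unital_TU L.cstar_algebra_axioms lam_hom])

lemma lam_one: "lam \<one>\<^bsub>TU\<^esub> = \<one>\<^bsub>l2_ops P\<^esub>"
  using lambda_plus_props(2)[OF P.one_closed] left_reg_one t_one by simp

lemma lam_d: "\<alpha> \<in> neutral_words G P \<Longrightarrow> lam (d \<alpha>) = diag_gen \<alpha>"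
  by (rule word_op_hom[OF unital_TU lam_hom lam_one t_funcset, symmetric])
    (simp_all add: lambda_plus_props(2) neutral_wordsD)

section \<open>The diagonal subalgebra of the universal algebra\<close>

lemma D_univ_carrier: "carrier (D_univ G P) = closed_span TU (d ` neutral_words G P)"
  by (simp add: D_univ_def)

lemma d_image: "d ` neutral_words G P \<subseteq> carrier TU"
  using d_closed by blast

lemma cstar_subalgebra_D_univ: "cstar_subalgebra TU (carrier (D_univ G P))"
  unfolding D_univ_carrier
proof (rule TU.closed_span_subalgebra[OF d_image])
  show "x \<otimes>\<^bsub>TU\<^esub> y \<in> d ` neutral_words G P" if xy: "x \<in> d ` neutral_words G P" "y \<in> d ` neutral_words G P" for x y
  proof -
    obtain \<alpha> \<beta> where ab: "\<alpha> \<in> neutral_words G P" "\<beta> \<in> neutral_words G P" "x = d \<alpha>" "y = d \<beta>" using xy by blast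
    then have "x \<otimes>\<^bsub>TU\<^esub> y = d (\<alpha> @ \<beta>)" by (simp add: d_append)
    then show ?thesis using neutral_words_append[OF ab(1,2)] by simp
  qed
  \<comment> \<open>The adjoint reverses the factors and exchanges plain and adjoint letters, so the
    reversed word again has its letters in the correct roles.\<close>
  have adj_word: "adj TU (d \<alpha>) = d (rev \<alpha>)" if "\<alpha> \<in> words P" for \<alpha>
    using that
  proof (induction rule: words_induct)
    case (Cons p q \<alpha>)
    note c = t_closed[OF Cons(1)] t_closed[OF Cons(2)] TU.word_op_closed[OF t_funcset Cons(3)]
      TU.word_op_closed[OF t_funcset words_rev[OF Cons(3)]]
    have "d (rev \<alpha> @ [q, p]) = d (rev \<alpha>) \<otimes>\<^bsub>TU\<^esub> d [q, p]"
      using Cons by (intro TU.word_op_append[OF t_funcset]) (simp_all add: words_rev)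
    then show ?case
      using Cons c by (simp add: TU.adj_mult TU.adj_adj TU.closed TU.r_one)
  qed simp
  show "adj TU x \<in> d ` neutral_words G P" if x: "x \<in> d ` neutral_words G P" for x
  proof -
    obtain \<alpha> where \<alpha>: "\<alpha> \<in> neutral_words G P" "x = d \<alpha>" using x by blast
    show ?thesis
      unfolding \<alpha>(2) adj_word[OF neutral_wordsD(1)[OF \<alpha>(1)]] by (rule imageI[OF neutral_words_rev[OF \<alpha>(1)]])
  qed
qed

lemma D_univ_eq: "D_univ G P = TU\<lparr>carrier := carrier (D_univ G P)\<rparr>"
  by (simp add: D_univ_def)

lemma d_D_univ: "\<alpha> \<in> neutral_words G P \<Longrightarrow> d \<alpha> \<in> carrier (D_univ G P)"
  unfolding D_univ_carrier by (rule subsetD[OF TU.closed_span_superset imageI])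

lemma D_univ_subset: "carrier (D_univ G P) \<subseteq> carrier TU"
  by (rule TU.closed_subspaceD(1)[OF TU.cstar_subalgebraD(1)[OF cstar_subalgebra_D_univ]])

lemma unital_D_univ: "unital_cstar_algebra (D_univ G P)"
  by (subst D_univ_eq, rule TU.unital_cstar_algebra_subalgebra[OF cstar_subalgebra_D_univ])
    (use d_D_univ[OF neutral_words_Nil] in simp)

lemma D_red_closed_subspace: "closed_subspace (l2_ops P) (carrier (D_red G P))"
  by (rule L.cstar_subalgebraD(1)[OF cstar_subalgebra_D_red])

lemma lam_D_univ: "x \<in> carrier (D_univ G P) \<Longrightarrow> lam x \<in> carrier (D_red G P)"
proof -
  assume x: "x \<in> carrier (D_univ G P)"
  have "closed_span TU (d ` neutral_words G P) \<subseteq> {x \<in> carrier TU. lam x \<in> carrier (D_red G P)}"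
    by (rule TU.closed_span_minimal[OF closed_subspace_vimage[OF TU.cstar_algebra_axioms
            L.cstar_algebra_axioms lam_hom lam_contractive D_red_closed_subspace]])
      (use d_closed lam_d diag_gen_D_red in auto)
  then show ?thesis using x by (auto simp: D_univ_carrier)
qed

end

context monoid_in_group
begin

interpretation TU: unital_cstar_algebra TU by (rule unital_TU)
interpretation CU: unital_cstar_algebra CU by (rule unital_CU)
interpretation L: unital_cstar_algebra "l2_ops P" by (rule unital_cstar_algebra_l2_ops)

section \<open>The quotient map onto the covariance algebra\<close>

lemma index_subset: "C.I \<subseteq> T.I"
  using strongly_covariant_toeplitz by (auto simp: univ_index_def)

lemma restriction_hom: "star_hom T.M C.M (\<lambda>x. restrict x C.I)"
  and restriction_contractive: "contractive T.M C.M (\<lambda>x. restrict x C.I)"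
proof -
  have Td: "x i \<in> carrier (fst i)" if "x \<in> carrier T.M" "i \<in> T.I" for x i
    by (rule cstar_productD(1)[OF T.univ_index_cstar that])
  have ge: "nrm (fst i) (x i) \<le> nrm T.M x" if "x \<in> carrier T.M" "i \<in> C.I" for x i
    by (rule nrm_cstar_product_ge[OF T.univ_index_cstar that(1) subsetD[OF index_subset that(2)]])
  have "restrict x C.I \<in> carrier C.M" if "x \<in> carrier T.M" for x
    by (rule cstar_productI[OF C.univ_index_cstar])
      (use that ge[OF that] Td[OF that] index_subset in auto)
  moreover have "restrict (\<lambda>i\<in>T.I. R i) C.I = (\<lambda>i\<in>C.I. R i)" for R :: "'a univ_index \<Rightarrow> 'a univ"
    using index_subset by (auto simp: restrict_def fun_eq_iff)
  ultimately show "star_hom T.M C.M (\<lambda>x. restrict x C.I)"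
    by (simp add: star_hom_def cong: restrict_cong)
  have "nrm C.M (restrict x C.I) \<le> nrm T.M x" if "x \<in> carrier T.M" for x
    by (rule nrm_cstar_product_le[OF C.univ_index_cstar])
      (use ge[OF that] nrm_cstar_product_nonneg[OF T.univ_index_cstar that] in auto)
  then show "contractive T.M C.M (\<lambda>x. restrict x C.I)" by (simp add: contractive_def)
qed

lemma restriction_gen: "restrict (univ_gen P (toeplitz_family G P) p) C.I = univ_gen P (strongly_covariant G P) p"
proof (rule extensionalityI)
  fix i assume i: "i \<in> C.I"
  then show "restrict (univ_gen P (toeplitz_family G P) p) C.I i = univ_gen P (strongly_covariant G P) p i"
    using T.univ_gen_eval[OF subsetD[OF index_subset i]] C.univ_gen_eval[OF i] by simp
qed (auto simp: univ_gen_def)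

text \<open>Restricting coordinates is a contractive homomorphism of the whole products and sends
  generators to generators, hence it maps one generated algebra into the other.\<close>

lemma restriction_univ: "star_hom TU CU (\<lambda>x. restrict x C.I)"
proof -
  have one: "restrict \<one>\<^bsub>T.M\<^esub> C.I = \<one>\<^bsub>C.M\<^esub>"
    using index_subset by (auto simp: restrict_def fun_eq_iff)
  have TM: "cstar_algebra T.M" by (rule cstar_algebra_product[OF T.univ_index_cstar])
  have CM: "cstar_algebra C.M" by (rule cstar_algebra_product[OF C.univ_index_cstar])
  have "(\<lambda>x. restrict x C.I) ` insert \<one>\<^bsub>T.M\<^esub> (univ_gen P (toeplitz_family G P) ` P) =
      insert \<one>\<^bsub>C.M\<^esub> (univ_gen P (strongly_covariant G P) ` P)"
    by (simp only: image_insert image_image one restriction_gen)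
  then have "(\<lambda>x. restrict x C.I) ` carrier TU \<subseteq> carrier CU"
    unfolding T_univ_def Cov_def T.univ_cstar_eq C.univ_cstar_eq
    by (intro star_hom_image_generated[OF TM CM restriction_hom restriction_contractive
          T.univ_gens_subset C.univ_gens_subset])
      (simp only: cstar_algebra.cstar_generated_superset[OF CM])
  then show ?thesis
    using star_hom_restrict_codomain[OF star_hom_restrict_domain[OF restriction_hom T.univ_cstar_subset], of "carrier CU"]
    by (simp add: T_univ_def Cov_def T.univ_cstar_eq C.univ_cstar_eq flip: cstar_algebra.cstar_generated_eq[OF TM] cstar_algebra.cstar_generated_eq[OF CM])
qed

lemma j_one: "j_gen G P \<one> = \<one>\<^bsub>CU\<^esub>"
proof (rule C.univ_cstar_eqI[folded Cov_def])
  show "j_gen G P \<one> i = \<one>\<^bsub>CU\<^esub> i" if i: "i \<in> C.I" for i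
  proof -
    have "isometric_rep G P (fst i) (snd i)" using i by (auto simp: univ_index_def strongly_covariant_def)
    then show ?thesis
      using C.univ_gen_eval[OF i, of \<one>] C.univ_one_eval[OF i]
      by (simp add: isometric_rep_def j_gen_def Cov_def)
  qed
  show "j_gen G P \<one> \<in> carrier CU" unfolding j_gen_def Cov_def by (rule C.univ_gen_closed[OF P.one_closed])
qed (rule CU.one_closed)

abbreviation "q \<equiv> q_univ G P"

lemma q_eq:
  assumes "x \<in> carrier TU"
  shows "q x = restrict x C.I"
    and "star_hom TU CU q"
proof -
  let ?h = "restrict (\<lambda>x. restrict x C.I) (carrier TU)"
  let ?Q = "\<lambda>h. h \<in> extensional (carrier TU) \<and> star_hom TU CU h \<and> (\<forall>p\<in>P. h (t p) = j_gen G P p)"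
  have hom: "star_hom TU CU ?h" by (rule star_hom_extensional[OF TU.cstar_algebra_axioms restriction_univ])
  have gen: "?h (t p) = j_gen G P p" if "p \<in> P" for p
    using t_closed[OF that] by (simp add: t_gen_def j_gen_def restriction_gen)
  have ex: "?Q ?h" using hom gen by simp
  have uniq: "k = ?h" if k: "?Q k" for k
  proof (rule extensionalityI)
    have kh: "star_hom TU CU k" "\<And>p. p \<in> P \<Longrightarrow> k (t p) = j_gen G P p" using k by auto
    show "k x = ?h x" if x: "x \<in> carrier TU" for x
    proof (rule T.univ_hom_eq[where h = k and k = ?h and x = x, OF CU.cstar_algebra_axioms, folded T_univ_def t_gen_def])
      show eq: "k (t p) = ?h (t p)" if "p \<in> P" for p by (simp only: kh(2)[OF that] gen[OF that])
      from this[OF P.one_closed] show "k \<one>\<^bsub>TU\<^esub> = ?h \<one>\<^bsub>TU\<^esub>" by (simp only: t_one)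
    qed (rule kh(1), rule hom, rule x)
  qed (use k in auto)
  have "q = ?h" unfolding q_univ_def by (rule the_equality[where P = ?Q and a = ?h, OF ex uniq])
  then show "q x = restrict x C.I" "star_hom TU CU q" using assms hom by simp_all
qed

lemma q_hom: "star_hom TU CU q"
  by (rule q_eq(2)[OF TU.one_closed])

lemma q_one: "q \<one>\<^bsub>TU\<^esub> = \<one>\<^bsub>CU\<^esub>"
proof -
  have "q (t \<one>) = j_gen G P \<one>"
    using q_eq(1)[OF t_closed[OF P.one_closed]] by (simp add: t_gen_def j_gen_def restriction_gen)
  then show ?thesis by (simp add: t_one j_one)
qed

text \<open>At a strongly covariant coordinate, evaluation and the composite of \<open>lam\<close>
  with the homomorphism on D_r agree on words, hence on all of D_u. The second one kills x.\<close>

lemma q_vanishes: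
  assumes x: "x \<in> carrier (D_univ G P)" and xo: "lam x \<in> D_red_o G P"
  shows "q x = \<zero>\<^bsub>CU\<^esub>"
proof (rule C.univ_cstar_eqI[folded Cov_def])
  have xT: "x \<in> carrier TU" by (rule subsetD[OF D_univ_subset x])
  show "q x \<in> carrier CU" by (rule star_homD(1)[OF q_hom xT])
  fix i assume i: "i \<in> C.I"
  have iT: "i \<in> T.I" by (rule subsetD[OF index_subset i])
  have Bu: "unital_cstar_algebra (fst i)" by (rule C.univ_index_unital[OF i])
  have B: "cstar_algebra (fst i)" by (rule C.univ_index_cstar[OF i])
  have sc: "strongly_covariant G P (fst i) (snd i)" using i by (auto simp: univ_index_def)
  obtain \<pi> where \<pi>: "star_hom (D_red G P) (fst i) \<pi>"
    "\<And>\<alpha>. \<alpha> \<in> neutral_words G P \<Longrightarrow> \<pi> (diag_gen \<alpha>) = word_op (fst i) (snd i) \<alpha>"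
    "\<And>b. b \<in> D_red_o G P \<Longrightarrow> \<pi> b = \<zero>\<^bsub>fst i\<^esub>"
    by (rule strongly_covariantE[OF sc], rule that; assumption)
  interpret Du: unital_cstar_algebra "D_univ G P" by (rule unital_D_univ)
  have lamD: "star_hom (D_univ G P) (D_red G P) lam"
  proof -
    have "lam ` carrier (D_univ G P) \<subseteq> carrier (D_red G P)" using lam_D_univ by blast
    then have "star_hom (TU\<lparr>carrier := carrier (D_univ G P)\<rparr>) ((l2_ops P)\<lparr>carrier := carrier (D_red G P)\<rparr>) lam"
      by (intro star_hom_restrict_codomain star_hom_restrict_domain lam_hom D_univ_subset) simp
    then show ?thesis by (simp flip: D_univ_eq D_red_carrier_update)
  qed
  have h: "star_hom (D_univ G P) (fst i) (\<pi> \<circ> lam)" by (rule star_hom_comp[OF lamD \<pi>(1)])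
  have k: "star_hom (D_univ G P) (fst i) (\<lambda>x. x i)"
    using star_hom_restrict_domain[OF T.star_hom_eval[OF iT, folded T_univ_def] D_univ_subset]
    by (simp flip: D_univ_eq)
  let ?E = "{x \<in> carrier (D_univ G P). (\<pi> \<circ> lam) x = x i}"
  have "cstar_subalgebra (D_univ G P) ?E"
    by (rule cstar_subalgebra_equalizer[OF Du.cstar_algebra_axioms B h
          star_hom_contractive[OF unital_D_univ B h] k star_hom_contractive[OF unital_D_univ B k]])
  then have "cstar_subalgebra (TU\<lparr>carrier := carrier (D_univ G P)\<rparr>) ?E" by (simp flip: D_univ_eq)
  then have "closed_subspace TU ?E"
    by (rule TU.cstar_subalgebraD(1)[OF TU.cstar_subalgebra_subalgebra[OF cstar_subalgebra_D_univ]])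
  moreover have "word_op TU t ` neutral_words G P \<subseteq> ?E"
    using d_D_univ d_eval[OF neutral_wordsD(1) iT] lam_d \<pi>(2) by auto
  ultimately have "carrier (D_univ G P) \<subseteq> ?E" unfolding D_univ_carrier by (rule TU.closed_span_minimal)
  then have "x i = \<pi> (lam x)" using x by auto
  then have "x i = \<zero>\<^bsub>fst i\<^esub>" using \<pi>(3)[OF xo] by simp
  then show "q x i = \<zero>\<^bsub>CU\<^esub> i"
    using q_eq(1)[OF xT] i C.univ_zero_eval[OF i] by (simp add: Cov_def)
qed (rule CU.zero_closed)

text \<open>The shifts on the square-summable functions on X are strongly covariant, and the delta
  function at e separates the unit from zero. Before they supply an index, they must be seen inside
  the algebra they generate and moved to the index type.\<close>

lemma Cov_nontrivial: "\<one>\<^bsub>CU\<^esub> \<noteq> \<zero>\<^bsub>CU\<^esub>"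
proof -
  obtain U where "boundary_ultrafilter G P U" using boundary_ultrafilter_exists by blast
  then interpret bu: boundary_ultrafilter G P U .
  let ?A = "l2_ops bu.X" and ?w = "shift G bu.X"
  interpret A: unital_cstar_algebra ?A by (rule unital_cstar_algebra_l2_ops)
  let ?S = "insert \<one>\<^bsub>?A\<^esub> (?w ` P)"
  let ?D = "cstar_generated ?A ?S"
  have S: "?S \<subseteq> carrier ?A" using bu.S.shift_funcset A.one_closed by (simp add: image_subset_iff_funcset)
  have subD: "cstar_subalgebra ?A (carrier ?D)" by (rule A.cstar_generated_subalgebra[OF S])
  have D: "unital_cstar_algebra ?D"
    by (rule A.unital_cstar_algebra_generated[OF S subsetD[OF A.cstar_generated_superset insertI1]])
  interpret D: unital_cstar_algebra ?D by (rule D)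
  have wD: "?w \<in> P \<rightarrow> carrier ?D"
    using A.cstar_generated_superset[of ?S] by (simp add: image_subset_iff)
  obtain \<pi> where \<pi>: "star_hom (D_red G P) ?A \<pi>"
    "\<And>\<alpha>. \<alpha> \<in> neutral_words G P \<Longrightarrow> \<pi> (diag_gen \<alpha>) = word_op ?A ?w \<alpha>"
    "\<And>b. b \<in> D_red_o G P \<Longrightarrow> \<pi> b = \<zero>\<^bsub>?A\<^esub>"
    by (rule strongly_covariantE[OF bu.strongly_covariant_shift], rule that; assumption)
  interpret Dr: unital_cstar_algebra "D_red G P" by (rule unital_D_red)
  have wordD: "word_op ?A ?w \<alpha> \<in> carrier ?D" if "\<alpha> \<in> neutral_words G P" for \<alpha>
    using D.word_op_closed[OF wD neutral_wordsD(1)[OF that]] by (simp add: word_op_generated)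
  \<comment> \<open>The homomorphism on D_r must take values in the generated algebra. The preimage
    of that algebra is a closed subspace containing the words, hence everything.\<close>
  let ?V = "{b \<in> carrier (D_red G P). \<pi> b \<in> carrier ?D}"
  have "closed_subspace (D_red G P) ?V"
    by (rule closed_subspace_vimage[OF Dr.cstar_algebra_axioms A.cstar_algebra_axioms \<pi>(1)
          star_hom_contractive[OF unital_D_red A.cstar_algebra_axioms \<pi>(1)] A.cstar_subalgebraD(1)[OF subD]])
  then have "closed_subspace ((l2_ops P)\<lparr>carrier := carrier (D_red G P)\<rparr>) ?V" by (simp flip: D_red_carrier_update)
  then have "closed_subspace (l2_ops P) ?V" by (rule L.closed_subspace_subalgebra[OF cstar_subalgebra_D_red])
  moreover have "diag_gen ` neutral_words G P \<subseteq> ?V" using diag_gen_D_red \<pi>(2) wordD by auto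
  ultimately have "closed_span (l2_ops P) (diag_gen ` neutral_words G P) \<subseteq> ?V"
    by (rule L.closed_span_minimal)
  then have "carrier (D_red G P) \<subseteq> ?V" by (simp add: D_red_eq)
  then have img: "\<pi> ` carrier (D_red G P) \<subseteq> carrier ?D" by auto
  have "star_hom (D_red G P) (?A\<lparr>carrier := carrier ?D\<rparr>) \<pi>"
    by (rule star_hom_restrict_codomain[OF \<pi>(1) img])
  then have \<pi>D: "star_hom (D_red G P) ?D \<pi>" by (simp flip: A.cstar_generated_eq)
  have "isometric_rep G P ?D ?w"
    using bu.S.isometric_rep_shift funcset_mem[OF wD] by (simp add: isometric_rep_def)
  moreover have "\<forall>\<alpha>\<in>neutral_words G P. \<pi> (diag_gen \<alpha>) = word_op ?D ?w \<alpha>"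
    using \<pi>(2) by (simp add: word_op_generated)
  moreover have "\<forall>b\<in>D_red_o G P. \<pi> b = \<zero>\<^bsub>?D\<^esub>" using \<pi>(3) by simp
  ultimately have sc: "strongly_covariant G P ?D ?w" unfolding strongly_covariant_def using \<pi>D by blast
  obtain f :: "(('a \<Rightarrow> complex) \<Rightarrow> ('a \<Rightarrow> complex)) \<Rightarrow> 'a univ" where f: "inj_on f (carrier ?D)"
    by (rule A.inj_on_generated_univ[OF bu.S.shift_funcset], rule that; assumption)
  note tr = transport_simps[OF D.cstar_algebra_axioms f]
  have "strongly_covariant G P (transport f ?D) (f \<circ> ?w)"
    by (rule strongly_covariant_hom[OF D cstar_algebra_transport[OF D.cstar_algebra_axioms f]
          star_hom_transport[OF D.cstar_algebra_axioms f] _ sc]) (simp add: tr)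
  then have i: "(transport f ?D, f \<circ> ?w) \<in> C.I"
    using unital_cstar_algebra_transport[OF D f] wD by (auto simp: univ_index_def tr Pi_iff)
  have "\<one>\<^bsub>?A\<^esub> (ket \<one>) \<noteq> \<zero>\<^bsub>?A\<^esub> (ket \<one>)"
  proof -
    have "\<one>\<^bsub>?A\<^esub> (ket \<one>) \<one> = 1" "\<zero>\<^bsub>?A\<^esub> (ket \<one>) \<one> = 0"
      using ket_l2[OF bu.one_in_X] by (simp_all add: l2_ops_simps) (simp add: ket_def)
    then show ?thesis by (metis zero_neq_one)
  qed
  then have "\<one>\<^bsub>?D\<^esub> \<noteq> \<zero>\<^bsub>?D\<^esub>" by auto
  then have "f \<one>\<^bsub>?D\<^esub> \<noteq> f \<zero>\<^bsub>?D\<^esub>" using inj_onD[OF f _ D.one_closed D.zero_closed] by blast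
  then have "\<one>\<^bsub>CU\<^esub> (transport f ?D, f \<circ> ?w) \<noteq> \<zero>\<^bsub>CU\<^esub> (transport f ?D, f \<circ> ?w)"
    using C.univ_one_eval[OF i] C.univ_zero_eval[OF i] by (simp add: Cov_def tr)
  then show ?thesis by auto
qed

section \<open>Compressions by the generators\<close>

text \<open>The error made when the compression \<open>t\<^sub>p\<^sup>* x t\<^sub>p\<close> is replaced by the value at \<open>p\<close> of the
  function \<open>\<lambda>\<^sup>+(x)\<close>. For a fixed \<open>x\<close> in \<open>D\<^sub>u\<close> it is small on some \<open>\<Delta>\<^sub>F\<close>.\<close>

definition compression_error :: "'a \<Rightarrow> 'a univ_elem \<Rightarrow> 'a univ_elem" where
  "compression_error p x =
     ((adj TU (t p) \<otimes>\<^bsub>TU\<^esub> x) \<otimes>\<^bsub>TU\<^esub> t p) \<ominus>\<^bsub>TU\<^esub> (symbol (lam x) p \<odot>\<^bsub>TU\<^esub> \<one>\<^bsub>TU\<^esub>)"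

lemma symbol_lam:
  assumes x: "x \<in> carrier (D_univ G P)" and y: "y \<in> carrier (D_univ G P)" and p: "p \<in> P"
  shows "symbol (lam (x \<oplus>\<^bsub>TU\<^esub> y)) p = symbol (lam x) p + symbol (lam y) p"
    and "symbol (lam (c \<odot>\<^bsub>TU\<^esub> x)) p = c * symbol (lam x) p"
    and "cmod (symbol (lam x) p) \<le> nrm TU x"
proof -
  note xT = subsetD[OF D_univ_subset x] and yT = subsetD[OF D_univ_subset y]
  note lx = subsetD[OF D_red_diagonal lam_D_univ[OF x]] and ly = subsetD[OF D_red_diagonal lam_D_univ[OF y]]
  show "symbol (lam (x \<oplus>\<^bsub>TU\<^esub> y)) p = symbol (lam x) p + symbol (lam y) p"
    unfolding star_homD(2)[OF lam_hom xT yT] by (rule symbol_l2_ops(1)[OF lx ly p])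
  show "symbol (lam (c \<odot>\<^bsub>TU\<^esub> x)) p = c * symbol (lam x) p"
    unfolding star_homD(3)[OF lam_hom xT] by (rule symbol_l2_ops(2)[OF lx lx p])
  have "cmod (symbol (lam x) p) \<le> op_norm_on P (lam x)" by (rule diagonal_opsD(3)[OF lx p])
  also have "\<dots> \<le> nrm TU x" using lam_contractive xT by (simp add: contractive_def l2_ops_simps)
  finally show "cmod (symbol (lam x) p) \<le> nrm TU x" .
qed

lemma compression_error_closed:
  "\<lbrakk>x \<in> carrier (D_univ G P); p \<in> P\<rbrakk> \<Longrightarrow> compression_error p x \<in> carrier TU"
  unfolding compression_error_def using D_univ_subset t_closed
  by (intro TU.minus_closed TU.closed TU.one_closed) auto

lemma compression_error_add:
  assumes x: "x \<in> carrier (D_univ G P)" and y: "y \<in> carrier (D_univ G P)" and p: "p \<in> P"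
  shows "compression_error p (x \<oplus>\<^bsub>TU\<^esub> y) = compression_error p x \<oplus>\<^bsub>TU\<^esub> compression_error p y"
  using subsetD[OF D_univ_subset x] subsetD[OF D_univ_subset y] t_closed[OF p]
  by (simp add: compression_error_def symbol_lam(1)[OF x y p] TU.r_distr TU.l_distr TU.smult_l_distr
      TU.add_minus_add TU.closed TU.one_closed)

lemma compression_error_smult:
  assumes x: "x \<in> carrier (D_univ G P)" and p: "p \<in> P"
  shows "compression_error p (c \<odot>\<^bsub>TU\<^esub> x) = c \<odot>\<^bsub>TU\<^esub> compression_error p x"
  using subsetD[OF D_univ_subset x] t_closed[OF p]
  by (simp add: compression_error_def symbol_lam(2)[OF x x p] TU.smult_mult_l TU.smult_mult_r
      TU.smult_assoc TU.smult_minus TU.closed TU.one_closed)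

text \<open>Compression by an isometry and the scalar value each cost at most the norm of x.
  Independence of p is what lets the error estimate pass to limits.\<close>

lemma nrm_compression_error:
  assumes x: "x \<in> carrier (D_univ G P)" and p: "p \<in> P"
  shows "nrm TU (compression_error p x) \<le> 2 * nrm TU x"
proof -
  note xT = subsetD[OF D_univ_subset x] and tp = t_closed[OF p]
  have t1: "nrm TU (t p) \<le> 1" by (rule TU.nrm_isometry_le_1[OF tp t_isometry[OF p]])
  have o1: "nrm TU \<one>\<^bsub>TU\<^esub> \<le> 1" by (rule TU.nrm_isometry_le_1[OF TU.one_closed]) (simp add: TU.l_one TU.one_closed)
  let ?c = "(adj TU (t p) \<otimes>\<^bsub>TU\<^esub> x) \<otimes>\<^bsub>TU\<^esub> t p" and ?s = "symbol (lam x) p \<odot>\<^bsub>TU\<^esub> \<one>\<^bsub>TU\<^esub>"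
  have c: "?c \<in> carrier TU" "?s \<in> carrier TU" using xT tp by (auto intro!: TU.closed TU.one_closed)
  have "nrm TU ?c \<le> nrm TU (adj TU (t p) \<otimes>\<^bsub>TU\<^esub> x) * nrm TU (t p)"
    by (intro TU.nrm_mult TU.closed xT tp)
  also have "\<dots> \<le> (nrm TU (t p) * nrm TU x) * nrm TU (t p)"
    using TU.nrm_mult[OF TU.adj_closed[OF tp] xT] TU.nrm_nonneg[OF tp] tp by (intro mult_right_mono) auto
  also have "\<dots> \<le> (1 * nrm TU x) * 1"
    using t1 TU.nrm_nonneg[OF tp] TU.nrm_nonneg[OF xT] by (intro mult_mono) auto
  finally have 1: "nrm TU ?c \<le> nrm TU x" by simp
  have "nrm TU ?s = cmod (symbol (lam x) p) * nrm TU \<one>\<^bsub>TU\<^esub>" by (rule TU.nrm_smult[OF TU.one_closed])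
  also have "\<dots> \<le> nrm TU x * 1"
    using symbol_lam(3)[OF x x p] o1 TU.nrm_nonneg[OF xT] TU.nrm_nonneg[OF TU.one_closed] by (intro mult_mono) auto
  finally have 2: "nrm TU ?s \<le> nrm TU x" by simp
  have "nrm TU (compression_error p x) \<le> nrm TU ?c + nrm TU ?s"
    unfolding compression_error_def using TU.nrm_triangle[OF c(1) TU.a_inv_closed[OF c(2)]] c(2)
    by (simp add: a_minus_def)
  then show ?thesis using 1 2 by simp
qed

text \<open>For p in K(\<alpha>) the compression is t_p^* t_p = 1; if pP misses K(\<alpha>) it is 0.
  Both are the value of the indicator, and on a suitable \<open>Delta\<close> there is no third
  case.\<close>

lemma compression_error_word:
  assumes \<alpha>: "\<alpha> \<in> neutral_words G P"
  obtains F where "finite F" "F \<subseteq> carrier G" "\<And>p. p \<in> Delta G P F \<Longrightarrow> compression_error p (word_op TU t \<alpha>) = \<zero>\<^bsub>TU\<^esub>"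
proof -
  obtain F where F: "finite F" "F \<subseteq> carrier G"
    "\<And>p. p \<in> Delta G P F \<Longrightarrow> p \<in> K G P \<alpha> \<or> (\<forall>r\<in>P. p \<otimes> r \<notin> K G P \<alpha>)"
    by (rule Delta_decides_word[OF \<alpha>], rule that; assumption)
  have "compression_error p (word_op TU t \<alpha>) = \<zero>\<^bsub>TU\<^esub>" if p: "p \<in> Delta G P F" for p
  proof -
    have pP: "p \<in> P" by (rule subsetD[OF Delta_subset p])
    note tp = t_closed[OF pP] and dc = d_closed[OF \<alpha>]
    have sym: "symbol (lam (word_op TU t \<alpha>)) p = indicator (K G P \<alpha>) p"
      by (simp add: lam_d[OF \<alpha>] symbol_diag_gen[OF \<alpha> pP])
    have assoc: "(adj TU (t p) \<otimes>\<^bsub>TU\<^esub> word_op TU t \<alpha>) \<otimes>\<^bsub>TU\<^esub> t p = adj TU (t p) \<otimes>\<^bsub>TU\<^esub> (word_op TU t \<alpha> \<otimes>\<^bsub>TU\<^esub> t p)"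
      by (rule TU.mult_assoc[OF TU.adj_closed[OF tp] dc tp])
    show ?thesis
    proof (cases "p \<in> K G P \<alpha>")
      case True
      then show ?thesis
        by (simp add: compression_error_def assoc d_mult_t[OF \<alpha> True] t_isometry[OF pP] sym
            TU.smult_one TU.one_closed)
    next
      case False
      then have "(p <# P) \<inter> K G P \<alpha> = {}" using F(3)[OF p] by (auto simp: l_coset_def)
      from d_mult_t_zero[OF \<alpha> pP this] show ?thesis
        using False tp by (simp add: compression_error_def assoc sym TU.one_closed TU.closed)
    qed
  qed
  then show ?thesis using that F by blast
qed

text \<open>The elements with this property form a closed subspace containing all words. Sums use
  the union of two finite sets, limits the uniform bound on the error.\<close>

lemma compression_error_small:
  assumes x: "x \<in> carrier (D_univ G P)" and e: "e > 0"
  shows "\<exists>F. finite F \<and> F \<subseteq> carrier G \<and> (\<forall>p\<in>Delta G P F. nrm TU (compression_error p x) < e)"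
proof -
  let ?R = "\<lambda>x e. \<exists>F. finite F \<and> F \<subseteq> carrier G \<and> (\<forall>p\<in>Delta G P F. nrm TU (compression_error p x) < e)"
  let ?S = "{x \<in> carrier (D_univ G P). \<forall>e>0. ?R x e}"
  note D = TU.closed_subspaceD[OF TU.cstar_subalgebraD(1)[OF cstar_subalgebra_D_univ]]
  have word: "word_op TU t \<alpha> \<in> ?S" if \<alpha>: "\<alpha> \<in> neutral_words G P" for \<alpha>
  proof -
    obtain F where "finite F" "F \<subseteq> carrier G" "\<And>p. p \<in> Delta G P F \<Longrightarrow> compression_error p (word_op TU t \<alpha>) = \<zero>\<^bsub>TU\<^esub>"
      by (rule compression_error_word[OF \<alpha>], rule that; assumption)
    then have "?R (word_op TU t \<alpha>) e" if "e > 0" for e using that by (intro exI[of _ F]) simp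
    then show ?thesis using d_D_univ[OF \<alpha>] by simp
  qed
  have smult: "c \<odot>\<^bsub>TU\<^esub> x \<in> ?S" if x: "x \<in> ?S" for c x
  proof -
    have xD: "x \<in> carrier (D_univ G P)" and xR: "\<And>e. e > 0 \<Longrightarrow> ?R x e" using x by auto
    have "?R (c \<odot>\<^bsub>TU\<^esub> x) e" if e: "e > 0" for e
    proof -
      \<comment> \<open>The summand 1 keeps the divisor positive when c = 0.\<close>
      have pos: "cmod c + 1 > 0" using norm_ge_zero[of c] by linarith
      obtain F where F: "finite F" "F \<subseteq> carrier G" "\<And>p. p \<in> Delta G P F \<Longrightarrow> nrm TU (compression_error p x) < e / (cmod c + 1)"
        using xR[OF divide_pos_pos[OF e pos]] by blast
      have "nrm TU (compression_error p (c \<odot>\<^bsub>TU\<^esub> x)) < e" if p: "p \<in> Delta G P F" for p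
      proof -
        have pP: "p \<in> P" by (rule subsetD[OF Delta_subset p])
        have n: "0 \<le> nrm TU (compression_error p x)" by (rule TU.nrm_nonneg[OF compression_error_closed[OF xD pP]])
        have "nrm TU (compression_error p (c \<odot>\<^bsub>TU\<^esub> x)) = cmod c * nrm TU (compression_error p x)"
          unfolding compression_error_smult[OF xD pP] by (rule TU.nrm_smult[OF compression_error_closed[OF xD pP]])
        also have "\<dots> \<le> (cmod c + 1) * nrm TU (compression_error p x)" using n by (simp add: distrib_right)
        also have "\<dots> < e" using F(3)[OF p] pos by (simp add: pos_less_divide_eq mult.commute)
        finally show ?thesis .
      qed
      then show ?thesis using F by blast
    qed
    then show ?thesis using D(4)[OF xD] by simp
  qed
  have add: "x \<oplus>\<^bsub>TU\<^esub> y \<in> ?S" if xy: "x \<in> ?S" "y \<in> ?S" for x y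
  proof -
    have xD: "x \<in> carrier (D_univ G P)" and xR: "\<And>e. e > 0 \<Longrightarrow> ?R x e" using xy(1) by auto
    have yD: "y \<in> carrier (D_univ G P)" and yR: "\<And>e. e > 0 \<Longrightarrow> ?R y e" using xy(2) by auto
    have "?R (x \<oplus>\<^bsub>TU\<^esub> y) e" if e: "e > 0" for e
    proof -
      obtain F where F: "finite F" "F \<subseteq> carrier G" "\<And>p. p \<in> Delta G P F \<Longrightarrow> nrm TU (compression_error p x) < e / 2"
        using xR[OF half_gt_zero[OF e]] by blast
      obtain F' where F': "finite F'" "F' \<subseteq> carrier G" "\<And>p. p \<in> Delta G P F' \<Longrightarrow> nrm TU (compression_error p y) < e / 2"
        using yR[OF half_gt_zero[OF e]] by blast
      have "nrm TU (compression_error p (x \<oplus>\<^bsub>TU\<^esub> y)) < e" if p: "p \<in> Delta G P (F \<union> F')" for p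
      proof -
        have pP: "p \<in> P" by (rule subsetD[OF Delta_subset p])
        have "nrm TU (compression_error p (x \<oplus>\<^bsub>TU\<^esub> y)) \<le> nrm TU (compression_error p x) + nrm TU (compression_error p y)"
          unfolding compression_error_add[OF xD yD pP]
          by (rule TU.nrm_triangle[OF compression_error_closed[OF xD pP] compression_error_closed[OF yD pP]])
        then show ?thesis
          using F(3)[OF subsetD[OF Delta_mono p]] F'(3)[OF subsetD[OF Delta_mono p]] by force
      qed
      then show ?thesis using F F' by (intro exI[of _ "F \<union> F'"]) simp
    qed
    then show ?thesis using D(3)[OF xD yD] by simp
  qed
  have "closed_subspace TU ?S"
  proof (rule TU.closed_subspaceI)
    show "?S \<subseteq> carrier TU" using D(1) by auto
    \<comment> \<open>Zero is reached as a multiple of the unit, which is the empty word.\<close>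
    have "0 \<odot>\<^bsub>TU\<^esub> \<one>\<^bsub>TU\<^esub> \<in> ?S" using smult[OF word[OF neutral_words_Nil], of 0] by simp
    then show "\<zero>\<^bsub>TU\<^esub> \<in> ?S" by (simp only: TU.zero_smult[OF TU.one_closed])
  next
    fix X x assume X: "cstar_lim TU X x" "\<And>n. X n \<in> ?S"
    have XD: "X n \<in> carrier (D_univ G P)" and XR: "\<And>e. e > 0 \<Longrightarrow> ?R (X n) e" for n using X(2)[of n] by auto
    have xD: "x \<in> carrier (D_univ G P)" by (rule D(5)[OF X(1) XD])
    have "?R x e" if e: "e > 0" for e
    proof -
      \<comment> \<open>The difference contributes at most twice e/4, the approximant less than
        e/2.\<close>
      have "eventually (\<lambda>n. nrm TU (X n \<ominus>\<^bsub>TU\<^esub> x) < e / 4) sequentially"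
        by (rule order_tendstoD(2)[OF TU.cstar_limD(3)[OF X(1)]]) (use e in simp)
      then obtain n where n: "nrm TU (X n \<ominus>\<^bsub>TU\<^esub> x) < e / 4" unfolding eventually_sequentially by blast
      obtain F where F: "finite F" "F \<subseteq> carrier G" "\<And>p. p \<in> Delta G P F \<Longrightarrow> nrm TU (compression_error p (X n)) < e / 2"
        using XR[OF half_gt_zero[OF e], of n] by blast
      have XT: "X n \<in> carrier TU" and xT: "x \<in> carrier TU" using subsetD[OF D_univ_subset] XD xD by auto
      have yD: "x \<ominus>\<^bsub>TU\<^esub> X n \<in> carrier (D_univ G P)"
        by (rule TU.closed_subspace_minus[OF TU.cstar_subalgebraD(1)[OF cstar_subalgebra_D_univ] xD XD])
      have eq: "X n \<oplus>\<^bsub>TU\<^esub> (x \<ominus>\<^bsub>TU\<^esub> X n) = x"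
        using XT xT by (simp add: a_minus_def TU.a_lcomm TU.r_neg)
      have "nrm TU (compression_error p x) < e" if p: "p \<in> Delta G P F" for p
      proof -
        have pP: "p \<in> P" by (rule subsetD[OF Delta_subset p])
        have "compression_error p x = compression_error p (X n) \<oplus>\<^bsub>TU\<^esub> compression_error p (x \<ominus>\<^bsub>TU\<^esub> X n)"
          using compression_error_add[OF XD[of n] yD pP] by (simp only: eq)
        then have "nrm TU (compression_error p x) \<le> nrm TU (compression_error p (X n)) + nrm TU (compression_error p (x \<ominus>\<^bsub>TU\<^esub> X n))"
          using TU.nrm_triangle[OF compression_error_closed[OF XD pP] compression_error_closed[OF yD pP]] by (simp only:)
        also have "\<dots> < e / 2 + 2 * (e / 4)"
          using F(3)[OF p] nrm_compression_error[OF yD pP] n TU.nrm_minus_commute[OF XT xT] by linarith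
        finally show ?thesis by simp
      qed
      then show ?thesis using F by blast
    qed
    then show "x \<in> ?S" using xD by simp
  qed (rule add, assumption, assumption, rule smult, assumption)
  moreover have "word_op TU t ` neutral_words G P \<subseteq> ?S" by (rule image_subsetI[OF word])
  ultimately have "carrier (D_univ G P) \<subseteq> ?S" unfolding D_univ_carrier by (rule TU.closed_span_minimal)
  then have "x \<in> ?S" using x by (rule subsetD)
  then show ?thesis using e by simp
qed

section \<open>Kernels on the diagonal and faithfulness\<close>

lemma rho_zero_of_diagonal_kernel:
  assumes B: "cstar_algebra B" and \<rho>: "star_hom TU B \<rho>"
    and x: "x \<in> carrier (D_univ G P)" "lam x \<notin> D_red_o G P" and z: "\<rho> x = \<zero>\<^bsub>B\<^esub>"
    and y: "y \<in> carrier TU"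
  shows "\<rho> y = \<zero>\<^bsub>B\<^esub>"
proof -
  interpret B: cstar_algebra B by fact
  note \<rho>D = star_homD[OF \<rho>]
  have xT: "x \<in> carrier TU" by (rule subsetD[OF D_univ_subset x(1)])
  have "\<not> (\<forall>e>0. \<exists>F. finite F \<and> F \<subseteq> carrier G \<and> (\<forall>p\<in>Delta G P F. cmod (symbol (lam x) p) \<le> e))"
    using D_red_oI[OF lam_D_univ[OF x(1)]] x(2) by blast
  then obtain e where e: "e > 0"
    "\<not> (\<exists>F. finite F \<and> F \<subseteq> carrier G \<and> (\<forall>p\<in>Delta G P F. cmod (symbol (lam x) p) \<le> e))"
    by (auto simp only: not_all not_imp)
  \<comment> \<open>The error is kept below e/2 while some p in the same \<open>Delta\<close> has a
    value above e in modulus; the quotient 1/2 will bound the norm of the image of the unit.\<close>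
  obtain F where F: "finite F" "F \<subseteq> carrier G" "\<And>p. p \<in> Delta G P F \<Longrightarrow> nrm TU (compression_error p x) < e / 2"
    using compression_error_small[OF x(1) half_gt_zero[OF e(1)]] by blast
  have "\<not> (\<forall>p\<in>Delta G P F. cmod (symbol (lam x) p) \<le> e)"
  proof
    assume "\<forall>p\<in>Delta G P F. cmod (symbol (lam x) p) \<le> e"
    with F(1,2) have "\<exists>F. finite F \<and> F \<subseteq> carrier G \<and> (\<forall>p\<in>Delta G P F. cmod (symbol (lam x) p) \<le> e)"
      by (intro exI[of _ F] conjI)
    with e(2) show False ..
  qed
  then obtain p where p: "p \<in> Delta G P F" "cmod (symbol (lam x) p) > e"
    by (auto simp: not_le)
  have pP: "p \<in> P" by (rule subsetD[OF Delta_subset p(1)])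
  note tp = t_closed[OF pP]
  let ?s = "symbol (lam x) p" and ?one = "\<rho> \<one>\<^bsub>TU\<^esub>"
  have one: "?one \<in> carrier B" by (rule \<rho>D(1)[OF TU.one_closed])
  have c: "(adj TU (t p) \<otimes>\<^bsub>TU\<^esub> x) \<otimes>\<^bsub>TU\<^esub> t p \<in> carrier TU" "?s \<odot>\<^bsub>TU\<^esub> \<one>\<^bsub>TU\<^esub> \<in> carrier TU"
    by (intro TU.closed tp xT TU.one_closed)+
  have "\<rho> ((adj TU (t p) \<otimes>\<^bsub>TU\<^esub> x) \<otimes>\<^bsub>TU\<^esub> t p) = (\<rho> (adj TU (t p)) \<otimes>\<^bsub>B\<^esub> \<rho> x) \<otimes>\<^bsub>B\<^esub> \<rho> (t p)"
    using \<rho>D(4)[OF TU.mult_closed[OF TU.adj_closed[OF tp] xT] tp] \<rho>D(4)[OF TU.adj_closed[OF tp] xT] by simp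
  also have "\<dots> = \<zero>\<^bsub>B\<^esub>" using z \<rho>D(1)[OF TU.adj_closed[OF tp]] \<rho>D(1)[OF tp] by simp
  \<comment> \<open>The compression of x is killed along with x, so only the scalar multiple of the
    image of the unit remains.\<close>
  finally have "\<rho> (compression_error p x) = \<zero>\<^bsub>B\<^esub> \<ominus>\<^bsub>B\<^esub> (?s \<odot>\<^bsub>B\<^esub> ?one)"
    unfolding compression_error_def star_hom_minus[OF TU.cstar_algebra_axioms B \<rho> c] \<rho>D(3)[OF TU.one_closed]
    by simp
  then have "nrm B (\<rho> (compression_error p x)) = cmod ?s * nrm B ?one"
    using one B.nrm_minus_commute[OF B.zero_closed B.smult_closed[OF one, of ?s]]
    by (simp add: B.nrm_smult B.smult_closed)
  moreover have "nrm B (\<rho> (compression_error p x)) \<le> nrm TU (compression_error p x)"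
    using star_hom_contractive[OF unital_TU B \<rho>] compression_error_closed[OF x(1) pP] by (simp add: contractive_def)
  ultimately have "cmod ?s * nrm B ?one < e / 2" using F(3)[OF p(1)] by linarith
  moreover have "e * nrm B ?one \<le> cmod ?s * nrm B ?one"
    using p(2) B.nrm_nonneg[OF one] by (intro mult_right_mono) auto
  ultimately have "e * nrm B ?one < e * (1 / 2)" by linarith
  then have small: "nrm B ?one < 1 / 2" using e(1) by (simp only: mult_less_cancel_left_pos)
  have "adj B ?one \<otimes>\<^bsub>B\<^esub> ?one = ?one"
    using \<rho>D(4)[OF TU.one_closed TU.one_closed] \<rho>D(5)[OF TU.one_closed] by (simp add: TU.l_one TU.one_closed)
  \<comment> \<open>A norm equal to its own square is 0 or 1, and 1 is excluded by the bound
    1/2.\<close>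
  then have "nrm B ?one = nrm B ?one * nrm B ?one"
    using B.cstar_identity[OF one] by (simp add: power2_eq_square)
  then have "nrm B ?one = 0" using small by auto
  then have "?one = \<zero>\<^bsub>B\<^esub>" using B.nrm_eq_0[OF one] by simp
  then show ?thesis by (rule hom_zero_of_one[OF B unital_TU \<rho> _ y])
qed

text \<open>The map q is itself a representation of the universal algebra; if it killed an x outside
  the ideal it would kill the unit, contrary to the covariance algebra being nonzero.\<close>

lemma q_kernel:
  assumes x: "x \<in> carrier (D_univ G P)"
  shows "q x = \<zero>\<^bsub>CU\<^esub> \<longleftrightarrow> lam x \<in> D_red_o G P"
proof
  assume z: "q x = \<zero>\<^bsub>CU\<^esub>"
  show "lam x \<in> D_red_o G P"
  proof (rule ccontr)
    assume "lam x \<notin> D_red_o G P"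
    then have "q \<one>\<^bsub>TU\<^esub> = \<zero>\<^bsub>CU\<^esub>"
      by (rule rho_zero_of_diagonal_kernel[OF CU.cstar_algebra_axioms q_hom x _ z TU.one_closed])
    then show False using q_one Cov_nontrivial by simp
  qed
qed (rule q_vanishes[OF x])

lemma D_univ_o_eq: "D_univ_o G P = {x \<in> carrier (D_univ G P). q x = \<zero>\<^bsub>CU\<^esub>}"
  using q_kernel by (auto simp: D_univ_o_def)

lemma quotient_embedding:
  "\<exists>\<iota>. star_hom (cstar_quotient (D_univ G P) (D_univ_o G P)) CU \<iota> \<and>
     inj_on \<iota> (carrier (cstar_quotient (D_univ G P) (D_univ_o G P))) \<and>
     (\<forall>x\<in>carrier (D_univ G P). \<iota> (D_univ_o G P +>\<^bsub>D_univ G P\<^esub> x) = q x)"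
proof -
  interpret Du: unital_cstar_algebra "D_univ G P" by (rule unital_D_univ)
  have "star_hom (D_univ G P) CU q"
    using star_hom_restrict_domain[OF q_hom D_univ_subset] by (simp flip: D_univ_eq)
  note k = cstar_quotient_kernel[OF Du.cstar_algebra_axioms CU.cstar_algebra_axioms this D_univ_o_eq]
  show ?thesis
    by (intro exI[of _ "\<lambda>U. the_elem (q ` U)"] conjI ballI k)
qed

lemma faithful_iff_nonzero:
  assumes B: "cstar_algebra B" and \<sigma>: "star_hom CU B \<sigma>"
  shows "inj_on \<sigma> (q ` carrier (D_univ G P)) \<longleftrightarrow> (\<exists>x\<in>carrier CU. \<sigma> x \<noteq> \<zero>\<^bsub>B\<^esub>)"
proof
  \<comment> \<open>The image of D_u contains the unit and zero, which are distinct, so an injective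
    \<sigma> cannot send the unit to zero.\<close>
  assume inj: "inj_on \<sigma> (q ` carrier (D_univ G P))"
  interpret Du: unital_cstar_algebra "D_univ G P" by (rule unital_D_univ)
  have "q \<one>\<^bsub>TU\<^esub> \<in> q ` carrier (D_univ G P)" using d_D_univ[OF neutral_words_Nil] by simp
  moreover have "q \<zero>\<^bsub>TU\<^esub> \<in> q ` carrier (D_univ G P)"
    using Du.zero_closed by (intro imageI) (simp add: D_univ_def)
  moreover have "q \<one>\<^bsub>TU\<^esub> \<noteq> q \<zero>\<^bsub>TU\<^esub>"
    using q_one star_hom_zero[OF TU.cstar_algebra_axioms CU.cstar_algebra_axioms q_hom] Cov_nontrivial by simp
  ultimately have "\<sigma> (q \<one>\<^bsub>TU\<^esub>) \<noteq> \<sigma> (q \<zero>\<^bsub>TU\<^esub>)" using inj by (auto dest: inj_onD)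
  then have "\<sigma> \<one>\<^bsub>CU\<^esub> \<noteq> \<zero>\<^bsub>B\<^esub>"
    using q_one star_hom_zero[OF TU.cstar_algebra_axioms CU.cstar_algebra_axioms q_hom]
      star_hom_zero[OF CU.cstar_algebra_axioms B \<sigma>] by simp
  then show "\<exists>x\<in>carrier CU. \<sigma> x \<noteq> \<zero>\<^bsub>B\<^esub>" using CU.one_closed by blast
next
  assume "\<exists>x\<in>carrier CU. \<sigma> x \<noteq> \<zero>\<^bsub>B\<^esub>"
  \<comment> \<open>A homomorphism that kills the unit is zero, so a nonzero \<sigma> keeps
    it.\<close>
  then have \<sigma>1: "\<sigma> \<one>\<^bsub>CU\<^esub> \<noteq> \<zero>\<^bsub>B\<^esub>" using hom_zero_of_one[OF B unital_CU \<sigma>] by blast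
  interpret B: cstar_algebra B by fact
  have \<rho>: "star_hom TU B (\<sigma> \<circ> q)" by (rule star_hom_comp[OF q_hom \<sigma>])
  show "inj_on \<sigma> (q ` carrier (D_univ G P))"
  proof (rule inj_onI)
    fix a b assume "a \<in> q ` carrier (D_univ G P)" "b \<in> q ` carrier (D_univ G P)" and eq: "\<sigma> a = \<sigma> b"
    then obtain x y where xy: "x \<in> carrier (D_univ G P)" "y \<in> carrier (D_univ G P)" "a = q x" "b = q y" by blast
    have xT: "x \<in> carrier TU" and yT: "y \<in> carrier TU" using subsetD[OF D_univ_subset] xy by auto
    \<comment> \<open>Injectivity is tested on the difference of preimages, which again lies in D_u:
      if \<sigma> kills its image, it lies in the ideal, and then q already kills it.\<close>
    let ?z = "x \<ominus>\<^bsub>TU\<^esub> y"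
    have zD: "?z \<in> carrier (D_univ G P)"
      by (rule TU.closed_subspace_minus[OF TU.cstar_subalgebraD(1)[OF cstar_subalgebra_D_univ] xy(1,2)])
    have "(\<sigma> \<circ> q) ?z = (\<sigma> \<circ> q) x \<ominus>\<^bsub>B\<^esub> (\<sigma> \<circ> q) y"
      by (rule star_hom_minus[OF TU.cstar_algebra_axioms B \<rho> xT yT])
    also have "\<dots> = \<zero>\<^bsub>B\<^esub>" using eq xy star_homD(1)[OF \<rho> yT] by simp
    finally have z: "(\<sigma> \<circ> q) ?z = \<zero>\<^bsub>B\<^esub>" .
    have "lam ?z \<in> D_red_o G P"
    proof (rule ccontr)
      assume "lam ?z \<notin> D_red_o G P"
      then have "(\<sigma> \<circ> q) \<one>\<^bsub>TU\<^esub> = \<zero>\<^bsub>B\<^esub>"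
        by (rule rho_zero_of_diagonal_kernel[OF B \<rho> zD _ z TU.one_closed])
      then show False using \<sigma>1 q_one by simp
    qed
    then have "q ?z = \<zero>\<^bsub>CU\<^esub>" by (rule q_vanishes[OF zD])
    then have "q x \<ominus>\<^bsub>CU\<^esub> q y = \<zero>\<^bsub>CU\<^esub>"
      using star_hom_minus[OF TU.cstar_algebra_axioms CU.cstar_algebra_axioms q_hom xT yT] by simp
    then show "a = b"
      using CU.minus_eq_0_iff[OF star_homD(1)[OF q_hom xT] star_homD(1)[OF q_hom yT]] xy by simp
  qed
qed

end

theorem proposition6p9:
  fixes G :: "('g, 'm) monoid_scheme" and P :: "'g set" and B :: "('b, 'n) cstar_struct_scheme"
  assumes "group G" and "submonoid P G" and "cstar_algebra B"
  shows
    "(\<forall>\<rho> \<alpha> A.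
        star_hom (T_univ G P) B \<rho> \<and>
        \<alpha> \<in> neutral_words G P \<and>
        finite A \<and> A \<subseteq> neutral_words G P \<and>
        (\<forall>\<beta>\<in>A. K G P \<beta> \<subseteq> K G P \<alpha>) \<and>
        \<not> foundation_set G P (K G P ` A) (K G P \<alpha>) \<and>
        \<rho> (diff_prod (T_univ G P) (t_gen G P) \<alpha> A) = \<zero>\<^bsub>B\<^esub>
        \<longrightarrow> (\<forall>x\<in>carrier (T_univ G P). \<rho> x = \<zero>\<^bsub>B\<^esub>)) \<and>
     (\<exists>\<iota>. star_hom (cstar_quotient (D_univ G P) (D_univ_o G P)) (Cov G P) \<iota> \<and>
        inj_on \<iota> (carrier (cstar_quotient (D_univ G P) (D_univ_o G P))) \<and>
        (\<forall>x\<in>carrier (D_univ G P). \<iota> (D_univ_o G P +>\<^bsub>D_univ G P\<^esub> x) = q_univ G P x)) \<and>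
     (\<forall>\<sigma>. star_hom (Cov G P) B \<sigma> \<longrightarrow>
        (inj_on \<sigma> (q_univ G P ` carrier (D_univ G P)) \<longleftrightarrow>
         (\<exists>x\<in>carrier (Cov G P). \<sigma> x \<noteq> \<zero>\<^bsub>B\<^esub>)))"
proof -
  interpret monoid_in_group G P
    using assms(1,2) by (simp add: monoid_in_group_def)
  show ?thesis
  proof (intro conjI allI impI ballI)
    fix \<rho> \<alpha> A x
    assume "star_hom TU B \<rho> \<and> \<alpha> \<in> neutral_words G P \<and> finite A \<and> A \<subseteq> neutral_words G P \<and>
        (\<forall>\<beta>\<in>A. K G P \<beta> \<subseteq> K G P \<alpha>) \<and> \<not> foundation_set G P (K G P ` A) (K G P \<alpha>) \<and>
        \<rho> (diff_prod TU (t_gen G P) \<alpha> A) = \<zero>\<^bsub>B\<^esub>"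
      and x: "x \<in> carrier TU"
    then show "\<rho> x = \<zero>\<^bsub>B\<^esub>"
      by (elim conjE) (rule rho_diff_prod_zero[OF assms(3)]; blast)
  qed (rule quotient_embedding, rule faithful_iff_nonzero[OF assms(3)])
qed

end
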